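(* Let $k\geq 0$, $d\geq k+2$ and $s\geq 1$ be integers. Let $P_1,\dots,P_s$ be generic points of $\mathbb{P}^2$ and set $$X=(k+1)P_1\cup\dots\cup(k+1)P_s,\qquad T=(k+2)P_1\cup\dots\cup(k+2)P_s,\qquad \deg(Y)=s\left(\binom{k+2}{2}+2\right).$$ The secant variety $\sigma_s(O_{k,2,d})$ is defective if and only if one of the following holds: (i) $h^1(\mathcal{I}_X(d))>\max\left\{0,\ \deg(Y)-\binom{d+2}{2}\right\}$, or (ii) $h^0(\mathcal{I}_T(d))>\max\left\{0,\ \binom{d+2}{2}-\deg(Y)\right\}$.
   Context: We work over an algebraically closed field $\kappa$ of characteristic $0$. For a point $P\in\mathbb{P}^n$, $mP$ denotes the fat point of multiplicity $m$ at $P$, i.e. the scheme defined by $I_P^m$. For a closed subscheme $A\subset \mathbb{P}^n$, $\mathcal{I}_A$ is its ideal sheaf and $h^i(\mathcal{I}_A(d))=\dim_\kappa H^i(\mathbb{P}^n,\mathcal{I}_A(d))$. $V_{n,d}\subset\mathbb{P}^N$, $N=\binom{n+d}{n}-1$, is the $d$-uple Veronese embedding of $\mathbb{P}^n$. For a variety $V\subset\mathbb{P}^N$ and a smooth point $P\in V$, the $k$-th osculating space $O_{k,V,P}$ is the linear span of the scheme $(k+1)P\cap V$ (the $k$-th infinitesimal neighbourhood of $P$ in $V$). The $k$-th osculating variety of $V$ is the closure of $\bigcup_{P\in U}O_{k,V,P}$, where $U\subset V$ is the dense set of smooth points at which $O_{k,V,P}$ has maximal dimension. $O_{k,n,d}$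 denotes the $k$-th osculating variety of $V_{n,d}$. For a closed irreducible projective variety $W\subseteq\mathbb{P}^N$, $\sigma_s(W)$ is the closure of the union of all linear spaces spanned by $s$ points of $W$. $\sigma_s(O_{k,n,d})$ is called defective if $\dim\sigma_s(O_{k,n,d})<\min\left\{N,\ s\left(n+\binom{k+n}{n}-1\right)+s-1\right\}$. Here $\deg(Y)$ is the degree of a generic union $Y=Z_1\cup\dots\cup Z_s\subset \mathbb{P}^2$ of zero-dimensional schemes, each $Z_i$ supported at $P_i$ and of degree $\binom{k+2}{2}+2$; only this number enters the statement. *)

theory Defs
  imports
    "HOL-Computational_Algebra.Computational_Algebra"
    "HOL-Library.Poly_Mapping"
    "HOL-Library.Function_Algebras"
    "HOL-Library.FuncSet"
    "HOL-Library.Extended_Nat"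
begin

section \<open>Polynomials in a set of variables\<close>

type_synonym ('i, 'a) mpoly = "('i \<Rightarrow>\<^sub>0 nat) \<Rightarrow>\<^sub>0 'a"

definition polys :: "'i set \<Rightarrow> ('i, 'a::field) mpoly set" where
  "polys I = {p. \<forall>m\<in>Poly_Mapping.keys p. Poly_Mapping.keys m \<subseteq> I}"

definition mdeg :: "('i \<Rightarrow>\<^sub>0 nat) \<Rightarrow> nat" where
  "mdeg m = (\<Sum>i\<in>Poly_Mapping.keys m. Poly_Mapping.lookup m i)"

definition homogeneous :: "nat \<Rightarrow> ('i, 'a::field) mpoly \<Rightarrow> bool" where
  "homogeneous e p \<longleftrightarrow> (\<forall>m\<in>Poly_Mapping.keys p. mdeg m = e)"

definition monom_eval :: "('i \<Rightarrow>\<^sub>0 nat) \<Rightarrow> ('i \<Rightarrow> 'a::field) \<Rightarrow> 'a" where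
  "monom_eval m v = (\<Prod>i\<in>Poly_Mapping.keys m. v i ^ Poly_Mapping.lookup m i)"

definition mpoly_eval :: "('i, 'a::field) mpoly \<Rightarrow> ('i \<Rightarrow> 'a) \<Rightarrow> 'a" where
  "mpoly_eval p v = (\<Sum>m\<in>Poly_Mapping.keys p. Poly_Mapping.lookup p m * monom_eval m v)"

definition mpoly_var :: "'i \<Rightarrow> ('i, 'a::field) mpoly" where
  "mpoly_var i = Poly_Mapping.single (Poly_Mapping.single i 1) 1"

text \<open>In the exponent below the subtraction truncates only where the coefficient is zero.\<close>

definition mpoly_deriv :: "'i \<Rightarrow> ('i, 'a::field) mpoly \<Rightarrow> ('i, 'a) mpoly" where
  "mpoly_deriv i p = (\<Sum>m\<in>Poly_Mapping.keys p.
     Poly_Mapping.single (m - Poly_Mapping.single i 1)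
       (of_nat (Poly_Mapping.lookup m i) * Poly_Mapping.lookup p m))"

definition gen_ideal :: "'i set \<Rightarrow> ('i, 'a::field) mpoly set \<Rightarrow> ('i, 'a) mpoly set" where
  "gen_ideal I G =
     {(\<Sum>g\<in>A. r g * g) | A r. finite A \<and> A \<subseteq> G \<and> (\<forall>g\<in>A. r g \<in> polys I)}"

definition ideal_power :: "'i set \<Rightarrow> ('i, 'a::field) mpoly set \<Rightarrow> nat \<Rightarrow> ('i, 'a) mpoly set" where
  "ideal_power I J m = gen_ideal I {(\<Prod>j<m. f j) | f. \<forall>j<m. f j \<in> J}"

definition saturation :: "'i set \<Rightarrow> ('i, 'a::field) mpoly set \<Rightarrow> ('i, 'a) mpoly set" where
  "saturation I J = {f \<in> polys I. \<exists>m. \<forall>i\<in>I. mpoly_var i ^ m * f \<in> J}"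


section \<open>Projective space and its Zariski topology\<close>

text \<open>
  For a finite index set \<open>I\<close>, the space \<open>\<kappa>\<^sup>I\<close> consists of the functions that are zero
  outside \<open>I\<close>. A point of the projective space with homogeneous coordinates indexed
  by \<open>I\<close> is the set of all its (nonzero) coordinate vectors.
\<close>

definition vscale :: "'a::field \<Rightarrow> ('i \<Rightarrow> 'a) \<Rightarrow> 'i \<Rightarrow> 'a" where
  "vscale c v = (\<lambda>i. c * v i)"

interpretation vec: vector_space vscale
  by unfold_locales (auto simp: vscale_def fun_eq_iff algebra_simps)

definition coord_space :: "'i set \<Rightarrow> ('i \<Rightarrow> 'a::field) set" where
  "coord_space I = {v. \<forall>i. i \<notin> I \<longrightarrow> v i = 0}"

type_synonym ('i, 'a) ppoint = "('i \<Rightarrow> 'a) set"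

definition ppoint_of :: "('i \<Rightarrow> 'a::field) \<Rightarrow> ('i, 'a) ppoint" where
  "ppoint_of v = {vscale c v | c. c \<noteq> 0}"

definition projectivization :: "('i \<Rightarrow> 'a::field) set \<Rightarrow> ('i, 'a) ppoint set" where
  "projectivization W = {ppoint_of v | v. v \<in> W \<and> v \<noteq> 0}"

definition proj_space :: "'i set \<Rightarrow> ('i, 'a::field) ppoint set" where
  "proj_space I = projectivization (coord_space I)"

definition zero_locus :: "'i set \<Rightarrow> ('i, 'a::field) mpoly set \<Rightarrow> ('i, 'a) ppoint set" where
  "zero_locus I F = {P \<in> proj_space I. \<forall>f\<in>F. \<forall>v\<in>P. mpoly_eval f v = 0}"

definition zariski_closed :: "'i set \<Rightarrow> ('i, 'a::field) ppoint set \<Rightarrow> bool" where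
  "zariski_closed I Z \<longleftrightarrow>
     (\<exists>F \<subseteq> polys I. (\<forall>f\<in>F. \<exists>e. homogeneous e f) \<and> Z = zero_locus I F)"

definition zariski_closure :: "'i set \<Rightarrow> ('i, 'a::field) ppoint set \<Rightarrow> ('i, 'a) ppoint set" where
  "zariski_closure I A = \<Inter>{Z. zariski_closed I Z \<and> A \<subseteq> Z}"

definition irreducible_closed :: "'i set \<Rightarrow> ('i, 'a::field) ppoint set \<Rightarrow> bool" where
  "irreducible_closed I Z \<longleftrightarrow> zariski_closed I Z \<and> Z \<noteq> {} \<and>
     (\<forall>A B. zariski_closed I A \<longrightarrow> zariski_closed I B \<longrightarrow> Z \<subseteq> A \<union> B \<longrightarrow> Z \<subseteq> A \<or> Z \<subseteq> B)"

text \<open>Krull dimension of a closed subset (with value 0 for the empty set).\<close>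

definition zariski_dim :: "'i set \<Rightarrow> ('i, 'a::field) ppoint set \<Rightarrow> enat" where
  "zariski_dim I X = Sup {enat l | l.
     \<exists>Z. (\<forall>j\<le>l. irreducible_closed I (Z j) \<and> Z j \<subseteq> X) \<and> (\<forall>j<l. Z j \<subset> Z (Suc j))}"

text \<open>
  The field being infinite, a polynomial vanishing on all coordinate vectors of a point has all
  its homogeneous components vanishing there, so this is the homogeneous ideal of \<open>A\<close>.
\<close>

definition vanishing_ideal :: "'i set \<Rightarrow> ('i, 'a::field) ppoint set \<Rightarrow> ('i, 'a) mpoly set" where
  "vanishing_ideal I A = {f \<in> polys I. \<forall>P\<in>A. \<forall>v\<in>P. mpoly_eval f v = 0}"


section \<open>Generic tuples of points\<close>

definition point_tuples :: "nat \<Rightarrow> nat \<Rightarrow> (nat \<Rightarrow> (nat, 'a::field) ppoint) set" where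
  "point_tuples n s = {..<s} \<rightarrow>\<^sub>E proj_space {..n}"

definition multihomogeneous :: "nat \<Rightarrow> nat \<Rightarrow> (nat \<times> nat, 'a::field) mpoly \<Rightarrow> bool" where
  "multihomogeneous n s f \<longleftrightarrow> (\<forall>j<s. \<exists>e. \<forall>m\<in>Poly_Mapping.keys f.
     (\<Sum>i\<le>n. Poly_Mapping.lookup m (j, i)) = e)"

definition multi_zariski_closed ::
    "nat \<Rightarrow> nat \<Rightarrow> (nat \<Rightarrow> (nat, 'a::field) ppoint) set \<Rightarrow> bool" where
  "multi_zariski_closed n s Z \<longleftrightarrow>
     (\<exists>F \<subseteq> polys ({..<s} \<times> {..n}). (\<forall>f\<in>F. multihomogeneous n s f) \<and>
        Z = {P \<in> point_tuples n s. \<forall>f\<in>F. \<forall>v. (\<forall>j<s. v j \<in> P j) \<longrightarrow>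
               mpoly_eval f (\<lambda>(j, i). v j i) = 0})"

text \<open>
  \<open>Q\<close> holds for generic \<open>P\<^sub>1, \<dots>, P\<^sub>s\<close>: it holds on a nonempty Zariski open subset of
  \<open>(\<P>\<^sup>n)\<^sup>s\<close>, which is dense because \<open>(\<P>\<^sup>n)\<^sup>s\<close> is irreducible.
\<close>

definition for_generic_points ::
    "nat \<Rightarrow> nat \<Rightarrow> ((nat \<Rightarrow> (nat, 'a::field) ppoint) \<Rightarrow> bool) \<Rightarrow> bool" where
  "for_generic_points n s Q \<longleftrightarrow>
     (\<exists>Z. multi_zariski_closed n s Z \<and> Z \<noteq> point_tuples n s \<and>
          (\<forall>P \<in> point_tuples n s - Z. Q P))"


section \<open>Osculating varieties and secant varieties\<close>

text \<open>
  Linear span of the subscheme of projective space defined by the homogeneous ideal \<open>J\<close>, as a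
  linear subspace of \<open>\<kappa>\<^sup>I\<close>: the intersection of all hyperplanes containing the scheme. A
  hyperplane contains the scheme iff its equation is in the saturation of \<open>J\<close>.
\<close>

definition scheme_span :: "'i set \<Rightarrow> ('i, 'a::field) mpoly set \<Rightarrow> ('i \<Rightarrow> 'a) set" where
  "scheme_span I J = {v \<in> coord_space I.
     \<forall>l \<in> saturation I J. homogeneous 1 l \<longrightarrow> mpoly_eval l v = 0}"

definition osculating_space ::
    "'i set \<Rightarrow> nat \<Rightarrow> ('i, 'a::field) ppoint set \<Rightarrow> ('i, 'a) ppoint \<Rightarrow> ('i \<Rightarrow> 'a) set" where
  "osculating_space I k V P = scheme_span I
     (gen_ideal I (ideal_power I (vanishing_ideal I {P}) (k + 1) \<union> vanishing_ideal I V))"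

text \<open>The affine cone over the embedded projective tangent space; \<open>V\<close> is assumed irreducible
  in \<open>smooth_points\<close>, so its local dimension is constant.\<close>

definition tangent_space ::
    "'i set \<Rightarrow> ('i, 'a::field) ppoint set \<Rightarrow> ('i, 'a) ppoint \<Rightarrow> ('i \<Rightarrow> 'a) set" where
  "tangent_space I V P = {w \<in> coord_space I. \<forall>f \<in> vanishing_ideal I V. \<forall>v\<in>P.
     (\<Sum>i\<in>I. mpoly_eval (mpoly_deriv i f) v * w i) = 0}"

definition smooth_points :: "'i set \<Rightarrow> ('i, 'a::field) ppoint set \<Rightarrow> ('i, 'a) ppoint set" where
  "smooth_points I V = {P \<in> V. enat (vec.dim (tangent_space I V P)) = zariski_dim I V + 1}"

definition osculating_variety ::
    "'i set \<Rightarrow> nat \<Rightarrow> ('i, 'a::field) ppoint set \<Rightarrow> ('i, 'a) ppoint set" where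
  "osculating_variety I k V =
     (let U = {P \<in> smooth_points I V. \<forall>Q \<in> smooth_points I V.
                 vec.dim (osculating_space I k V Q) \<le> vec.dim (osculating_space I k V P)}
      in zariski_closure I (\<Union>P\<in>U. projectivization (osculating_space I k V P)))"

definition secant_variety ::
    "'i set \<Rightarrow> nat \<Rightarrow> ('i, 'a::field) ppoint set \<Rightarrow> ('i, 'a) ppoint set" where
  "secant_variety I s W =
     zariski_closure I (\<Union>Q \<in> {..<s} \<rightarrow>\<^sub>E W. projectivization (vec.span (\<Union>j<s. Q j)))"

text \<open>The homogeneous coordinates of the ambient space of the \<open>d\<close>-uple embedding of \<open>\<P>\<^sup>n\<close> are
  indexed by the exponents of the monomials of degree \<open>d\<close> in \<open>x\<^sub>0, \<dots>, x\<^sub>n\<close>.\<close>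

definition exponents :: "nat \<Rightarrow> nat \<Rightarrow> (nat \<Rightarrow>\<^sub>0 nat) set" where
  "exponents n d = {m. Poly_Mapping.keys m \<subseteq> {..n} \<and> mdeg m = d}"

definition veronese_map :: "nat \<Rightarrow> nat \<Rightarrow> (nat \<Rightarrow> 'a::field) \<Rightarrow> (nat \<Rightarrow>\<^sub>0 nat) \<Rightarrow> 'a" where
  "veronese_map n d v = (\<lambda>m. if m \<in> exponents n d then monom_eval m v else 0)"

definition veronese_variety :: "nat \<Rightarrow> nat \<Rightarrow> (nat \<Rightarrow>\<^sub>0 nat, 'a::field) ppoint set" where
  "veronese_variety n d = {ppoint_of (veronese_map n d v) | v. v \<in> coord_space {..n} \<and> v \<noteq> 0}"

definition veronese_osculating_variety ::
    "nat \<Rightarrow> nat \<Rightarrow> nat \<Rightarrow> (nat \<Rightarrow>\<^sub>0 nat, 'a::field) ppoint set" where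
  "veronese_osculating_variety k n d =
     osculating_variety (exponents n d) k (veronese_variety n d)"

text \<open>Defectivity of \<open>\<sigma>\<^sub>s(O\<^sub>k\<^sub>,\<^sub>n\<^sub>,\<^sub>d)\<close> over the field \<open>'a\<close>; the natural number subtractions do
  not truncate when \<open>s \<ge> 1\<close>.\<close>

definition secant_defective :: "'a::field itself \<Rightarrow> nat \<Rightarrow> nat \<Rightarrow> nat \<Rightarrow> nat \<Rightarrow> bool" where
  "secant_defective (_ :: 'a itself) s k n d \<longleftrightarrow>
     zariski_dim (exponents n d)
       (secant_variety (exponents n d) s
          (veronese_osculating_variety k n d :: (nat \<Rightarrow>\<^sub>0 nat, 'a) ppoint set))
     < enat (min (((n + d) choose n) - 1) (s * (n + ((k + n) choose n) - 1) + s - 1))"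


section \<open>Cohomology of ideal sheaves\<close>

text \<open>Union of the fat points \<open>mP\<^sub>0, \<dots>, mP\<^bsub>s-1\<^esub>\<close> in \<open>\<P>\<^sup>n\<close>.\<close>

definition fat_points_ideal ::
    "nat \<Rightarrow> nat \<Rightarrow> nat \<Rightarrow> (nat \<Rightarrow> (nat, 'a::field) ppoint) \<Rightarrow> (nat, 'a) mpoly set" where
  "fat_points_ideal n m s P = (\<Inter>j<s. ideal_power {..n} (vanishing_ideal {..n} {P j}) m)"

text \<open>
  \<open>H\<^sup>p(\<P>\<^sup>n, \<I>(d))\<close>, where \<open>\<I>\<close> is the sheaf associated with the homogeneous ideal \<open>J\<close>, is
  the Cech cohomology for the standard affine open cover \<open>x\<^sub>i \<noteq> 0\<close>. The sections of \<open>\<I>(d)\<close> over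
  the intersection of the charts in \<open>\<sigma>\<close> are the fractions of degree \<open>d\<close> in the localization
  of \<open>J\<close> at the product of the variables \<open>x\<^sub>i\<close> with \<open>i\<close> in \<open>\<sigma>\<close>, realized as Laurent polynomials.
\<close>

type_synonym 'a laurent = "(nat \<Rightarrow>\<^sub>0 int) \<Rightarrow>\<^sub>0 'a"

definition laurent_of :: "(nat, 'a::field) mpoly \<Rightarrow> 'a laurent" where
  "laurent_of f = (\<Sum>m\<in>Poly_Mapping.keys f.
     Poly_Mapping.single (Poly_Mapping.map int m) (Poly_Mapping.lookup f m))"

definition inv_vars_power :: "nat set \<Rightarrow> nat \<Rightarrow> 'a::field laurent" where
  "inv_vars_power \<sigma> m = Poly_Mapping.single (\<Sum>i\<in>\<sigma>. Poly_Mapping.single i (- int m)) 1"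

definition sheaf_sections :: "(nat, 'a::field) mpoly set \<Rightarrow> nat \<Rightarrow> nat set \<Rightarrow> 'a laurent set" where
  "sheaf_sections J d \<sigma> =
     {laurent_of f * inv_vars_power \<sigma> m | f m. f \<in> J \<and> homogeneous (d + m * card \<sigma>) f}"

text \<open>A cochain of degree \<open>p\<close> assigns a section to each \<open>{i\<^sub>0 < \<dots> < i\<^sub>p} \<subseteq> {0, \<dots>, n}\<close>.\<close>

type_synonym 'a cochain = "nat set \<Rightarrow> 'a laurent"

definition cochain_scale :: "'a::field \<Rightarrow> 'a cochain \<Rightarrow> 'a cochain" where
  "cochain_scale c f = (\<lambda>\<sigma>. Poly_Mapping.single 0 c * f \<sigma>)"

interpretation cochain: vector_space cochain_scale
  by unfold_locales
    (auto simp: cochain_scale_def fun_eq_iff algebra_simps single_add mult_single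
          simp flip: mult.assoc)

definition cech_cochains :: "nat \<Rightarrow> (nat, 'a::field) mpoly set \<Rightarrow> nat \<Rightarrow> nat \<Rightarrow> 'a cochain set" where
  "cech_cochains n J d p = {c. \<forall>\<sigma>.
     if \<sigma> \<subseteq> {..n} \<and> card \<sigma> = p + 1 then c \<sigma> \<in> sheaf_sections J d \<sigma> else c \<sigma> = 0}"

definition cech_differential :: "nat \<Rightarrow> nat \<Rightarrow> 'a::field cochain \<Rightarrow> 'a cochain" where
  "cech_differential n p c = (\<lambda>\<sigma>. if \<sigma> \<subseteq> {..n} \<and> card \<sigma> = p + 2
     then (\<Sum>i\<in>\<sigma>. (- 1) ^ card {j\<in>\<sigma>. j < i} * c (\<sigma> - {i})) else 0)"

definition cech_cocycles :: "nat \<Rightarrow> (nat, 'a::field) mpoly set \<Rightarrow> nat \<Rightarrow> nat \<Rightarrow> 'a cochain set" where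
  "cech_cocycles n J d p = {c \<in> cech_cochains n J d p. cech_differential n p c = 0}"

definition cech_coboundaries ::
    "nat \<Rightarrow> (nat, 'a::field) mpoly set \<Rightarrow> nat \<Rightarrow> nat \<Rightarrow> 'a cochain set" where
  "cech_coboundaries n J d p =
     (case p of 0 \<Rightarrow> {0} | Suc q \<Rightarrow> cech_differential n q ` cech_cochains n J d q)"

text \<open>
  The vector space dimension of cocycles modulo coboundaries: the least number of cocycles that
  span the quotient. The quotient is finite-dimensional (Serre), although its two constituents
  are not.
\<close>

definition cohomology_dim :: "nat \<Rightarrow> (nat, 'a::field) mpoly set \<Rightarrow> nat \<Rightarrow> nat \<Rightarrow> nat" where
  "cohomology_dim n J d p = (LEAST r. \<exists>B \<subseteq> cech_cocycles n J d p. finite B \<and> card B = r \<and>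
     cech_cocycles n J d p \<subseteq> cochain.span (B \<union> cech_coboundaries n J d p))"

end

(*
  The tangent space to the cone over the secant variety at a generic point is the sum over the points
  P_i of the osculating spaces of order k and of one two-dimensional contribution in the osculating
  space of order k+1. Write x and t for the dimensions of the joins of the osculating spaces of order k
  and k+1 at generic points. Then the dimension y of the tangent space is min t (x + 2s): unless it
  already is the whole join of order k+1, symmetry makes the osculating space of order k+1 at every
  point exceed it, and a product of linear forms shows that each point then contributes two independent
  directions. In characteristic 0 the secant variety has dimension y - 1, by the Jacobian criterion for
  algebraic independence. By duality h^0(I_T(d)) = C - t, and the Cech complex gives h^1(I_X(d)) = R - x,
  where C is the number of forms and R the degree of X. Defectivity y < min C (R + 2s) is therefore
  (i) or (ii).
*)

theory Submission
 imports Defs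
begin

text \<open>The notions of the statement are ideal-theoretic or topological, whereas the count of
  dimensions is linear algebra. They meet in the vectors \<open>hrow n d v a\<close> of Hasse
  derivatives of all monomials of degree d at v: a hyperplane contains those of order k iff the
  corresponding form vanishes to order k + 1 at v. This serves the saturated ideals, the fat points
  and, for Laurent monomials, the sections over charts. Order exactly k is enough, as Euler's
  relation recovers lower orders in characteristic 0. The same relation hides the motion of a point
  along its own coordinate vector, so the three coordinates of a point contribute two directions.
  Krull dimension is defined by chains, and both bounds need work: a chain of length l yields l + 1
  algebraically independent functions, and a chain of the expected length has to be constructed. In
  the count of y, a form that is good at one point must not spoil another point. All ranks are lower
  semicontinuous, so one parameter value maximizes them simultaneously, and submodularity adds up
  the gains of the points.\<close>

type_synonym expo = "nat \<Rightarrow>\<^sub>0 nat"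

abbreviation lookup :: "('b \<Rightarrow>\<^sub>0 'c::zero) => 'b => 'c" where "lookup == Poly_Mapping.lookup"
abbreviation keys :: "('b \<Rightarrow>\<^sub>0 'c::zero) => 'b set" where "keys == Poly_Mapping.keys"
abbreviation single :: "'b => 'c::zero => 'b \<Rightarrow>\<^sub>0 'c" where "single == Poly_Mapping.single"

section \<open>Polynomial functions\<close>

text \<open>Defined without coefficients, so that composition and restriction to lines are plain
  inductions; \<open>polyfun_imp_mpoly\<close> returns to formal polynomials where the statement
  speaks of them. Coordinates outside \<open>J\<close> have no influence, by
  \<open>polyfun_cong\<close>.\<close>

inductive polyfun :: "'i set => (('i => 'a::field) => 'a) => bool" for J where
 polyfun_const: "polyfun J (%_. c)"
| polyfun_var: "i \<in> J ==> polyfun J (%x. x i)"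
| polyfun_add: "polyfun J f ==> polyfun J g ==> polyfun J (%x. f x + g x)"
| polyfun_mult: "polyfun J f ==> polyfun J g ==> polyfun J (%x. f x * g x)"

lemma polyfun_cmult: "polyfun J f ==> polyfun J (%x. c * f x)"
 by (intro polyfun_mult polyfun_const)

lemma polyfun_uminus: "polyfun J f ==> polyfun J (%x. - f x)"
 using polyfun_cmult[of J f "-1"] by simp

lemma polyfun_minus: "polyfun J f ==> polyfun J g ==> polyfun J (%x. f x - g x)"
 using polyfun_add[OF _ polyfun_uminus, of J f g] by simp

lemma polyfun_sum: "(!!i. i \<in> A ==> polyfun J (f i)) ==> polyfun J (%x. \<Sum>i\<in>A. f i x)"
 by (induction A rule: infinite_finite_induct) (auto intro: polyfun_const polyfun_add)

lemma polyfun_prod: "(!!i. i \<in> A ==> polyfun J (f i)) ==> polyfun J (%x. \<Prod>i\<in>A. f i x)"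
 by (induction A rule: infinite_finite_induct) (auto intro: polyfun_const polyfun_mult)

lemma polyfun_power: "polyfun J f ==> polyfun J (%x. f x ^ n)"
 by (induction n) (auto intro: polyfun_const polyfun_mult)

lemmas polyfun_intros = polyfun_const polyfun_var polyfun_add polyfun_mult polyfun_cmult
 polyfun_uminus polyfun_minus polyfun_sum polyfun_prod polyfun_power

lemma polyfun_compose:
 "polyfun J f ==> (!!i. i \<in> J ==> polyfun K (%t. \<phi> t i)) ==> polyfun K (%t. f (\<phi> t))"
 by (induction rule: polyfun.induct) (auto intro: polyfun_intros)

lemma polyfun_cong: "polyfun J f ==> \<forall>i\<in>J. x i = y i ==> f x = f y"
 by (induction rule: polyfun.induct) auto

lemma polyfun_line:
 "polyfun J f ==> EX q. ALL t. poly q t = f (%i. a i + t * b i)"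
proof (induction rule: polyfun.induct)
 case (polyfun_const c)
 show ?case by (rule exI[of _ "[:c:]"]) auto
next
 case (polyfun_var i)
 show ?case by (rule exI[of _ "[:a i, b i:]"]) auto
next
 case (polyfun_add f g)
 then show ?case by (metis poly_add)
next
 case (polyfun_mult f g)
 then show ?case by (metis poly_mult)
qed

text \<open>Restricting to the line through two points reduces to one variable.\<close>

lemma polyfun_mult_neq_0:
 fixes f g :: "('i => 'a::field_char_0) => 'a"
 assumes "polyfun J f" "polyfun J g" "f a ~= 0" "g b ~= 0"
 shows "EX x. f x ~= 0 & g x ~= 0"
proof -
 obtain p q where p: "!!t. poly p t = f (%i. a i + t * (b i - a i))"
  and q: "!!t. poly q t = g (%i. a i + t * (b i - a i))"
  using polyfun_line[OF assms(1)] polyfun_line[OF assms(2)] by metis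
 have "poly p 0 ~= 0" "poly q 1 ~= 0" unfolding p q using assms by (auto simp: algebra_simps)
 hence "p * q ~= 0" by auto
 then obtain t where "poly (p * q) t ~= 0" by (meson poly_all_0_iff_0)
 thus ?thesis using p q by auto
qed

lemma polyfun_prod_neq_0:
 fixes f :: "'k => ('i => 'a::field_char_0) => 'a"
 assumes "finite A" "!!k. k \<in> A ==> polyfun J (f k)" "!!k. k \<in> A ==> EX a. f k a ~= 0"
 shows "EX x. \<forall>k\<in>A. f k x ~= 0"
 using assms
proof (induction A)
 case (insert k A)
 then obtain x where x: "\<forall>k\<in>A. f k x ~= 0" by auto
 obtain a where a: "f k a ~= 0" using insert.prems(2)[of k] by auto
 have "EX x. f k x ~= 0 & (\<Prod>k\<in>A. f k x) ~= 0"
  by (rule polyfun_mult_neq_0[of J _ _ a x]) (use insert x a in \<open>auto intro: polyfun_intros\<close>)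
 thus ?case using insert by auto
qed auto

section \<open>Derivatives along lines\<close>

definition dirpoly :: "(('i => 'a::field_char_0) => 'a) => ('i => 'a) => ('i => 'a) => 'a poly" where
 "dirpoly f a b = (THE q. ALL t. poly q t = f (%i. a i + t * b i))"

text \<open>The derivative of \<open>f\<close> at \<open>a\<close> in direction \<open>b\<close>.\<close>

definition dd :: "(('i => 'a::field_char_0) => 'a) => ('i => 'a) => ('i => 'a) => 'a" where
 "dd f a b = poly.coeff (dirpoly f a b) 1"

lemma dirpoly_unique: "(!!t. poly q t = f (%i. a i + t * b i)) ==> dirpoly f a b = q"
 unfolding dirpoly_def by (rule the_equality) (auto simp flip: poly_eq_poly_eq_iff)

lemma poly_dirpoly: "polyfun J f ==> poly (dirpoly f a b) t = f (%i. a i + t * b i)"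
 using polyfun_line[of J f a b] dirpoly_unique by metis

lemma dd_unique: "(!!t. poly q t = f (%i. a i + t * b i)) ==> dd f a b = poly.coeff q 1"
 unfolding dd_def by (subst dirpoly_unique[of q]) auto

lemma dd_const [simp]: "dd (%_. c) a b = 0"
 by (subst dd_unique[of "[:c:]"]) auto

lemma dd_var [simp]: "dd (%x. x i) a b = b i"
 by (subst dd_unique[of "[:a i, b i:]"]) auto

lemma dd_add:
 assumes "polyfun J f" "polyfun J g"
 shows "dd (%x. f x + g x) a b = dd f a b + dd g a b"
proof -
 have "dd (%x. f x + g x) a b = poly.coeff (dirpoly f a b + dirpoly g a b) 1"
  by (rule dd_unique) (use assms in \<open>auto simp: poly_dirpoly\<close>)
 thus ?thesis by (simp add: dd_def)
qed

lemma dd_mult: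
 assumes "polyfun J f" "polyfun J g"
 shows "dd (%x. f x * g x) a b = f a * dd g a b + dd f a b * g a"
proof -
 have "dd (%x. f x * g x) a b = poly.coeff (dirpoly f a b * dirpoly g a b) 1"
  by (rule dd_unique) (use assms in \<open>auto simp: poly_dirpoly\<close>)
 moreover have "poly.coeff (dirpoly f a b) 0 = f a" "poly.coeff (dirpoly g a b) 0 = g a"
  using poly_dirpoly[OF assms(1), of a b 0] poly_dirpoly[OF assms(2), of a b 0]
  by (auto simp: poly_0_coeff_0)
 ultimately show ?thesis by (simp add: dd_def coeff_mult)
qed

lemma dd_cmult: "polyfun J f ==> dd (%x. c * f x) a b = c * dd f a b"
 by (subst dd_mult[OF polyfun_const]) auto

lemma dd_sum:
 "(!!i. i \<in> A ==> polyfun J (f i)) ==> dd (%x. \<Sum>i\<in>A. f i x) a b = (\<Sum>i\<in>A. dd (f i) a b)"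
proof (induction A rule: infinite_finite_induct)
 case (insert x F)
 then show ?case by (simp, subst dd_add[of J]) (auto intro: polyfun_intros)
qed auto

lemma dd_power: "polyfun J f ==> dd (%x. f x ^ n) a b = of_nat n * f a ^ (n - 1) * dd f a b"
proof (induction n)
 case (Suc n)
 have "dd (%x. f x * f x ^ n) a b = f a * dd (%x. f x ^ n) a b + dd f a b * f a ^ n"
  by (rule dd_mult[of J]) (use Suc in \<open>auto intro: polyfun_intros\<close>)
 thus ?case using Suc by (cases n) (simp_all add: algebra_simps)
qed auto

lemma polyfun_dd: "polyfun J f ==> polyfun J (%x. dd f x b)"
 by (induction rule: polyfun.induct) (auto simp: dd_add[of J] dd_mult[of J] intro: polyfun_intros)

lemma dd_lin: "polyfun J f ==> dd f a (%i. s * b i + t * c i) = s * dd f a b + t * dd f a c"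
 by (induction rule: polyfun.induct) (auto simp: dd_add[of J] dd_mult[of J] algebra_simps)

lemma dd_cong: "polyfun J f ==> \<forall>i\<in>J. b i = c i ==> dd f a b = dd f a c"
 by (induction rule: polyfun.induct) (auto simp: dd_add[of J] dd_mult[of J])

lemma dd_zero [simp]: "dd f a (%_. 0) = 0"
 by (subst dd_unique[of "[:f a:]"]) auto

lemma dd_coords:
 "polyfun J f ==> finite J ==> dd f a b = (\<Sum>i\<in>J. b i * dd f a (%l. if l = i then 1 else 0))"
proof (induction rule: polyfun.induct)
 case (polyfun_var i)
 have "(\<Sum>l\<in>J. b l * (if i = l then 1 else 0)) = b i"
  using polyfun_var by (simp add: if_distrib[of "(*) _"] cong: if_cong)
 then show ?case by (simp)
qed (auto simp: dd_add[of J] dd_mult[of J] sum.distrib sum_distrib_left sum_distrib_right algebra_simps)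

lemma dd_compose:
 "polyfun J f ==> (!!i. i \<in> J ==> polyfun K (%t. \<phi> t i)) ==>
  dd (%t. f (\<phi> t)) a b = dd f (\<phi> a) (%i. dd (%t. \<phi> t i) a b)"
proof (induction rule: polyfun.induct)
 case (polyfun_add f g)
 then show ?case by (simp add: dd_add[of J] dd_add[of K] polyfun_compose)
next
 case (polyfun_mult f g)
 then show ?case by (simp add: dd_mult[of J] dd_mult[of K] polyfun_compose)
qed auto

text \<open>Taylor expansion along a line.\<close>

lemma polyfun_zero_of_derivs:
 fixes f :: "('i => 'a::field_char_0) => 'a"
 assumes "!!f. f \<in> S ==> polyfun J f" "!!f. f \<in> S ==> (%x. dd f x b) \<in> S"
  "!!f. f \<in> S ==> f a = 0" "f \<in> S"
 shows "f (%i. a i + t * b i) = 0"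
proof -
 \<comment> \<open>Recentring the line at the parameter t exchanges the derivative of the
   one-variable polynomial with the derivative of f along b. The coefficients are thus, up to
   non-zero factors, iterated derivatives at a.\<close>
 have step: "pderiv (dirpoly f a b) = dirpoly (%x. dd f x b) a b" if f: "polyfun J f" for f
 proof (rule sym, rule dirpoly_unique)
  fix t
  let ?x = "%i. a i + t * b i"
  have "dd f ?x b = poly.coeff (pcompose (dirpoly f a b) [:t, 1:]) 1"
   by (rule dd_unique) (auto simp: poly_pcompose poly_dirpoly[OF f] algebra_simps)
  also have "\<dots> = poly (pderiv (pcompose (dirpoly f a b) [:t, 1:])) 0"
   by (simp add: poly_0_coeff_0 coeff_pderiv)
  also have "\<dots> = poly (pderiv (dirpoly f a b)) t"
   by (simp add: pderiv_pcompose poly_pcompose pderiv_pCons)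
  finally show "poly (pderiv (dirpoly f a b)) t = dd f ?x b" by simp
 qed
 have "\<forall>f\<in>S. poly.coeff (dirpoly f a b) n = 0" for n
 proof (induction n)
  case 0
  show ?case using poly_dirpoly[OF assms(1), of _ a b 0] assms(3) by (auto simp: poly_0_coeff_0)
 next
  case (Suc n)
  show ?case
  proof
   fix f assume f: "f \<in> S"
   have "poly.coeff (pderiv (dirpoly f a b)) n = 0"
    using Suc assms(2)[OF f] step[OF assms(1)[OF f]] by auto
   thus "poly.coeff (dirpoly f a b) (Suc n) = 0" by (auto simp: coeff_pderiv simp del: of_nat_Suc)
  qed
 qed
 hence "dirpoly f a b = 0" using assms(4) by (intro poly_eqI) auto
 thus ?thesis using poly_dirpoly[OF assms(1)[OF assms(4)], of a b t] by simp
qed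

section \<open>Evaluation of polynomials\<close>

lemma monom_eval_superset:
 "finite A ==> keys m \<subseteq> A ==> monom_eval m v = (\<Prod>i\<in>A. v i ^ lookup m i)"
 unfolding monom_eval_def by (rule prod.mono_neutral_left) (auto simp: in_keys_iff)

lemma monom_eval_add: "monom_eval (m + n) v = monom_eval m v * monom_eval n v"
proof -
 let ?A = "keys m \<union> keys n"
 show ?thesis
  by (subst (1 2 3) monom_eval_superset[of ?A])
   (use keys_add[of m n] in \<open>auto simp: lookup_add power_add prod.distrib\<close>)
qed

lemma monom_eval_0 [simp]: "monom_eval 0 v = 1"
 by (simp add: monom_eval_def)

lemma monom_eval_single [simp]: "monom_eval (single i n) v = v i ^ n"
 by (cases "n = 0") (auto simp: monom_eval_def)

lemma mdeg_superset:
 "finite A ==> keys m \<subseteq> A ==> mdeg m = (\<Sum>i\<in>A. lookup m i)"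
 unfolding mdeg_def by (rule sum.mono_neutral_left) (auto simp: in_keys_iff)

lemma mdeg_add: "mdeg (m + n) = mdeg m + mdeg n"
proof -
 let ?A = "keys m \<union> keys n"
 show ?thesis
  by (subst (1 2 3) mdeg_superset[of ?A]) (use keys_add[of m n] in \<open>auto simp: lookup_add sum.distrib\<close>)
qed

lemma mdeg_single [simp]: "mdeg (single i n) = n"
 by (cases "n = 0") (auto simp: mdeg_def)

lemma mdeg_0 [simp]: "mdeg 0 = 0"
 by (simp add: mdeg_def)

lemma monom_eval_vscale: "monom_eval m (vscale c v) = c ^ mdeg m * monom_eval m v"
 by (simp add: monom_eval_def vscale_def mdeg_def power_mult_distrib prod.distrib power_sum)

lemma mpoly_eval_superset:
 "finite A ==> keys p \<subseteq> A ==>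
  mpoly_eval p v = (\<Sum>m\<in>A. lookup p m * monom_eval m v)"
 unfolding mpoly_eval_def by (rule sum.mono_neutral_left) (auto simp: in_keys_iff)

lemma mpoly_eval_add: "mpoly_eval (p + q) v = mpoly_eval p v + mpoly_eval q v"
proof -
 let ?A = "keys p \<union> keys q"
 show ?thesis
  by (subst (1 2 3) mpoly_eval_superset[of ?A])
   (use keys_add[of p q] in \<open>auto simp: lookup_add sum.distrib algebra_simps\<close>)
qed

lemma mpoly_eval_0 [simp]: "mpoly_eval 0 v = 0"
 by (simp add: mpoly_eval_def)

lemma mpoly_eval_single [simp]: "mpoly_eval (single m c) v = c * monom_eval m v"
 by (cases "c = 0") (auto simp: mpoly_eval_def)

lemma mpoly_eval_1 [simp]: "mpoly_eval 1 v = 1"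
 using mpoly_eval_single[of 0 1 v] by simp

lemma mpoly_eval_sum: "mpoly_eval (\<Sum>i\<in>A. f i) v = (\<Sum>i\<in>A. mpoly_eval (f i) v)"
 by (induction A rule: infinite_finite_induct) (auto simp: mpoly_eval_add)

lemma poly_mapping_sum_single:
 "p = (\<Sum>m\<in>keys p. single m (lookup p m))"
 by (rule poly_mapping_eqI)
  (auto simp: lookup_sum lookup_single when_def sum.delta' in_keys_iff)

lemma mpoly_eval_mult: "mpoly_eval (p * q) v = mpoly_eval p v * mpoly_eval q v"
proof -
 have "p * q = (\<Sum>m\<in>keys p. \<Sum>n\<in>keys q.
   single (m + n) (lookup p m * lookup q n))"
  by (subst (1) poly_mapping_sum_single[of p], subst (1) poly_mapping_sum_single[of q])
   (simp add: sum_product mult_single)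
 also have "mpoly_eval \<dots> v = mpoly_eval p v * mpoly_eval q v"
  by (simp add: mpoly_eval_sum monom_eval_add mpoly_eval_def[of p] mpoly_eval_def[of q]
    sum_product mult_ac)
 finally show ?thesis .
qed

lemma mpoly_eval_uminus: "mpoly_eval (- p) v = - mpoly_eval p v"
 using mpoly_eval_add[of p "- p" v] by (simp add: eq_neg_iff_add_eq_0 add.commute)

lemma mpoly_eval_diff: "mpoly_eval (p - q) v = mpoly_eval p v - mpoly_eval q v"
 using mpoly_eval_add[of p "- q" v] by (simp add: mpoly_eval_uminus)

lemma mpoly_eval_prod: "mpoly_eval (\<Prod>i\<in>A. f i) v = (\<Prod>i\<in>A. mpoly_eval (f i) v)"
 by (induction A rule: infinite_finite_induct) (auto simp: mpoly_eval_mult)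

lemma mpoly_eval_power: "mpoly_eval (p ^ n) v = mpoly_eval p v ^ n"
 by (induction n) (auto simp: mpoly_eval_mult)

lemma mpoly_eval_var [simp]: "mpoly_eval (mpoly_var i) v = v i"
 by (simp add: mpoly_var_def)

lemma polys_const: "single 0 c \<in> polys I"
 by (simp add: polys_def)

lemma polys_0 [simp]: "0 \<in> polys I" and polys_1 [simp]: "1 \<in> polys I"
 by (auto simp: polys_def)

lemma polys_var: "i \<in> I ==> mpoly_var i \<in> polys I"
 by (simp add: polys_def mpoly_var_def)

lemma polys_add: "p \<in> polys I ==> q \<in> polys I ==> p + q \<in> polys I"
 using keys_add[of p q] by (auto simp: polys_def)

lemma polys_uminus: "p \<in> polys I ==> - p \<in> polys I"
 by (auto simp: polys_def in_keys_iff)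

lemma polys_diff: "p \<in> polys I ==> q \<in> polys I ==> p - q \<in> polys I"
 using polys_add[of p I "- q"] polys_uminus by auto

lemma polys_mult: "p \<in> polys I ==> q \<in> polys I ==> p * q \<in> polys I"
proof -
 assume "p \<in> polys I" "q \<in> polys I"
 moreover have "keys m \<subseteq> I"
  if m: "m \<in> keys (p * q)" and pq: "p \<in> polys I" "q \<in> polys I" for m
 proof -
  obtain a b where "m = a + b" "a \<in> keys p" "b \<in> keys q"
   using keys_mult[of p q] m by auto
  thus ?thesis using keys_add[of a b] pq by (auto simp: polys_def)
 qed
 ultimately show ?thesis by (auto simp: polys_def)
qed

lemma polys_sum: "(!!i. i \<in> A ==> f i \<in> polys I) ==> (\<Sum>i\<in>A. f i) \<in> polys I"
 by (induction A rule: infinite_finite_induct) (auto intro: polys_add)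

lemma polys_prod: "(!!i. i \<in> A ==> f i \<in> polys I) ==> (\<Prod>i\<in>A. f i) \<in> polys I"
 by (induction A rule: infinite_finite_induct) (auto intro: polys_mult)

lemma polys_power: "p \<in> polys I ==> p ^ n \<in> polys I"
 by (induction n) (auto intro: polys_mult)

lemma polys_single: "keys m \<subseteq> I ==> single m c \<in> polys I"
 by (simp add: polys_def)

lemma polyfun_mpoly_eval: "p \<in> polys I ==> polyfun I (mpoly_eval p)"
proof -
 assume "p \<in> polys I"
 hence "polyfun I (%v. \<Sum>m\<in>keys p. lookup p m *
   (\<Prod>i\<in>keys m. v i ^ lookup m i))"
  by (intro polyfun_intros) (auto simp: polys_def)
 thus ?thesis by (simp add: mpoly_eval_def[abs_def] monom_eval_def)
qed

lemma polyfun_imp_mpoly: "polyfun I f ==> \<exists>p\<in>polys I. f = mpoly_eval p"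
proof (induction rule: polyfun.induct)
 case (polyfun_const c)
 show ?case by (rule bexI[of _ "single 0 c"]) (auto simp: polys_const)
next
 case (polyfun_var i)
 show ?case by (rule bexI[of _ "mpoly_var i"]) (auto simp: polys_var polyfun_var)
next
 case (polyfun_add f g)
 then show ?case by (metis (no_types, lifting) ext mpoly_eval_add polys_add)
next
 case (polyfun_mult f g)
 then show ?case by (metis (no_types, lifting) ext mpoly_eval_mult polys_mult)
qed

lemma dd_monom_eval:
 fixes v :: "'b => 'a::field_char_0"
 shows "dd (monom_eval m) v (%l. if l = i then 1 else 0) =
  of_nat (lookup m i) * monom_eval (m - single i 1) v"
proof -
 let ?A = "insert i (keys m)" and ?B = "keys m - {i}"
 let ?R = "%v. \<Prod>l\<in>?B. v l ^ lookup m l"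
 let ?e = "%l. if l = i then 1 else (0::'a)"
 have *: "monom_eval n v = (\<Prod>l\<in>?B. v l ^ lookup n l) * v i ^ lookup n i"
  if "keys n \<subseteq> ?A" for n and v :: "'b => 'a"
  by (subst monom_eval_superset[of ?A]) (use that in \<open>auto simp: prod.insert_remove mult.commute\<close>)
 have R: "polyfun ?B ?R" by (intro polyfun_intros)
 have "dd ?R v ?e = dd ?R v (%_. 0)" by (rule dd_cong[OF R]) auto
 hence R0: "dd ?R v ?e = 0" by simp
 have "monom_eval m = (%v :: 'b => 'a. ?R v * v i ^ lookup m i)" by (intro ext, subst *) auto
 hence "dd (monom_eval m) v ?e = dd (%v. ?R v * v i ^ lookup m i) v ?e" by simp
 also have "\<dots> = ?R v * (of_nat (lookup m i) * v i ^ (lookup m i - 1))"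
  by (subst dd_mult[of ?A]) (auto intro!: polyfun_intros simp: R0 dd_power[of ?A] polyfun_var)
 also have "\<dots> = of_nat (lookup m i) * (?R v * v i ^ (lookup m i - 1))"
  by (simp add: mult_ac)
 also have "?R v * v i ^ (lookup m i - 1) = monom_eval (m - single i 1) v"
  by (subst *) (auto simp: in_keys_iff lookup_minus lookup_single when_def intro!: prod.cong)
 finally show ?thesis .
qed

lemma polyfun_monom_eval: "keys m \<subseteq> J ==> polyfun J (monom_eval m)"
 unfolding monom_eval_def[abs_def] by (intro polyfun_intros) auto

text \<open>Connects the formal derivatives in \<open>tangent_space\<close> with derivatives along
  lines.\<close>

lemma mpoly_eval_deriv:
 "mpoly_eval (mpoly_deriv i p) v = dd (mpoly_eval p) v (%l. if l = i then 1 else 0)"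
proof -
 have "dd (mpoly_eval p) v b = (\<Sum>m\<in>keys p. lookup p m * dd (monom_eval m) v b)" for b
  unfolding mpoly_eval_def[abs_def]
  by (subst dd_sum[of _ UNIV]) (auto intro!: polyfun_cmult polyfun_monom_eval simp: dd_cmult[OF polyfun_monom_eval[of _ UNIV]])
 thus ?thesis by (simp add: mpoly_deriv_def mpoly_eval_sum dd_monom_eval mult_ac)
qed

lemma sum_mpoly_deriv:
 "finite I ==> p \<in> polys I ==> (\<Sum>i\<in>I. mpoly_eval (mpoly_deriv i p) v * w i) = dd (mpoly_eval p) v w"
 by (simp add: dd_coords[OF polyfun_mpoly_eval, of p I v w] mpoly_eval_deriv mult.commute)

section \<open>Homogeneous components\<close>

lemma homogeneous_eval_vscale: "homogeneous e p ==> mpoly_eval p (vscale c v) = c ^ e * mpoly_eval p v"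
 by (simp add: mpoly_eval_def homogeneous_def monom_eval_vscale sum_distrib_left mult_ac)

text \<open>The weight is arbitrary because three gradings occur: by total degree, by the degree in
  a single variable, and by a positional encoding of multidegrees.\<close>

definition graded_part :: "(('i \<Rightarrow>\<^sub>0 nat) => nat) => nat => ('i, 'a::field) mpoly => ('i, 'a) mpoly" where
 "graded_part w e p = (\<Sum>m | m \<in> keys p & w m = e. single m (lookup p m))"

lemma keys_graded_part: "keys (graded_part w e p) = {m \<in> keys p. w m = e}"
 by (auto simp: graded_part_def in_keys_iff lookup_sum lookup_single when_def split: if_splits)

lemma sum_graded_part:
 "p = (\<Sum>e\<in>w ` keys p. graded_part w e p)"
proof -
 have "(\<Sum>e\<in>w ` keys p. graded_part w e p) = (\<Sum>m\<in>keys p. single m (lookup p m))"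
  unfolding graded_part_def by (rule sum.image_gen[symmetric]) auto
 thus ?thesis using poly_mapping_sum_single by metis
qed

lemma graded_part_polys: "p \<in> polys I ==> graded_part w e p \<in> polys I"
 by (auto simp: polys_def keys_graded_part)

text \<open>The substitution scales the monomial \<open>m\<close> by \<open>c ^ w m\<close>, so over an infinite field a
  vanishing polynomial has vanishing components.\<close>

lemma graded_part_eval_eq_0:
 fixes p :: "('i, 'a::field_char_0) mpoly"
 assumes w: "!!m c. m \<in> keys p ==> monom_eval m (\<phi> c) = c ^ w m * monom_eval m v"
  and 0: "!!c. c ~= 0 ==> mpoly_eval p (\<phi> c) = 0"
 shows "mpoly_eval (graded_part w e p) v = 0"
proof (cases "e \<in> w ` keys p")
 case True
 define q where "q = (\<Sum>e\<in>w ` keys p. Polynomial.monom (mpoly_eval (graded_part w e p) v) e)"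
 have ev: "mpoly_eval (graded_part w e p) (\<phi> c) = c ^ e * mpoly_eval (graded_part w e p) v" for e c
  unfolding graded_part_def mpoly_eval_sum by (simp add: sum_distrib_left w mult_ac)
 have "poly q c = mpoly_eval p (\<phi> c)" for c
  unfolding q_def by (subst (3) sum_graded_part[of p w]) (simp add: poly_sum poly_monom mpoly_eval_sum ev mult_ac)
 \<comment> \<open>The factor X takes care of c = 0, where nothing is assumed.\<close>
 hence "poly ([:0, 1:] * q) c = 0" for c using 0[of c] by (cases "c = 0") auto
 hence "[:0, 1:] * q = 0" by (meson poly_all_0_iff_0)
 hence "q = 0" by simp
 hence "poly.coeff q e = 0" by simp
 thus ?thesis using True by (simp add: q_def coeff_sum)
next
 case False
 hence "keys (graded_part w e p) = {}" by (auto simp: keys_graded_part)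
 thus ?thesis by (simp add: mpoly_eval_def)
qed

section \<open>Finite-dimensional coordinate spaces\<close>

lemma vscale_apply: "vscale c v i = c * v i"
 by (simp add: vscale_def)

lemma sum_fun_apply: "(\<Sum>x\<in>A. f x) i = (\<Sum>x\<in>A. f x i)"
 by (induction A rule: infinite_finite_induct) auto

lemmas fun_arith = vscale_apply sum_fun_apply

definition unit_vec :: "'i => 'i => 'a::field" where
 "unit_vec i = (%l. if l = i then 1 else 0)"

lemma subspace_coord_space [simp]: "vec.subspace (coord_space I)"
 by (auto intro!: vec.subspaceI simp: fun_arith coord_space_def)

lemma coord_space_0 [simp]: "0 \<in> coord_space I"
 by (simp add: coord_space_def)

lemma unit_vec_in_coord_space: "i \<in> I ==> unit_vec i \<in> coord_space I"
 by (auto simp: unit_vec_def coord_space_def)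

lemma sum_unit_vec: "finite I ==> v \<in> coord_space I ==> v = (\<Sum>i\<in>I. vscale (v i) (unit_vec i))"
 by (rule ext) (auto simp: fun_arith unit_vec_def coord_space_def if_distrib[of "(*) _"] cong: if_cong)

lemma coord_space_subset_span: "finite I ==> coord_space I \<subseteq> vec.span (unit_vec ` I)"
 using sum_unit_vec by (metis (no_types, lifting) image_eqI subsetI vec.span_base vec.span_scale vec.span_sum)

text \<open>The space of all functions may be infinite-dimensional. Containment in
  \<open>coord_space I\<close> with \<open>I\<close> finite is what makes \<open>vec.dim\<close>
  monotone and bases finite, and it accompanies every dimension statement from here on.\<close>

lemma coord_space_basis:
 assumes "V \<subseteq> coord_space I" "finite I"
 obtains B where "B \<subseteq> V" "vec.independent B" "V \<subseteq> vec.span B" "card B = vec.dim V" "finite B"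
proof -
 obtain B where B: "B \<subseteq> V" "vec.independent B" "V \<subseteq> vec.span B" "card B = vec.dim V"
  using vec.basis_exists by blast
 moreover have "finite B"
  by (rule vec.independent_span_bound[of "unit_vec ` I", THEN conjunct1])
   (use assms B coord_space_subset_span[OF assms(2)] in auto)
 ultimately show thesis using that by auto
qed

lemma independent_card_le:
 assumes "vec.independent B" "B \<subseteq> vec.span V" "V \<subseteq> coord_space I" "finite I"
 shows "finite B & card B <= vec.dim V"
proof -
 obtain C where C: "V \<subseteq> vec.span C" "card C = vec.dim V" "finite C"
  using coord_space_basis assms by metis
 have "B \<subseteq> vec.span C" using assms C vec.span_mono vec.span_span by blast
 thus ?thesis using vec.independent_span_bound[of C B] assms C by auto
qed

lemma span_subset_coord_space: "V \<subseteq> coord_space I ==> vec.span V \<subseteq> coord_space I"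
 by (rule vec.span_minimal) auto

lemma dim_mono_span:
 assumes "V \<subseteq> vec.span W" "W \<subseteq> coord_space I" "finite I"
 shows "vec.dim V <= vec.dim W"
proof -
 have "V \<subseteq> coord_space I" using assms span_subset_coord_space by blast
 then obtain B where "B \<subseteq> V" "vec.independent B" "card B = vec.dim V"
  using coord_space_basis assms by metis
 thus ?thesis using independent_card_le[of B W I] assms by auto
qed

lemma dim_mono: "V \<subseteq> W ==> W \<subseteq> coord_space I ==> finite I ==> vec.dim V <= vec.dim W"
 by (rule dim_mono_span) (auto intro: vec.span_base)

lemma span_eq_of_dim_le:
 assumes "V \<subseteq> vec.span W" "W \<subseteq> coord_space I" "finite I" "vec.dim W <= vec.dim V"
 shows "vec.span V = vec.span W"
proof -
 have V: "V \<subseteq> coord_space I" using assms span_subset_coord_space by blast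
 obtain B where B: "B \<subseteq> V" "vec.independent B" "V \<subseteq> vec.span B" "card B = vec.dim V" "finite B"
  using coord_space_basis V assms by metis
 obtain C where C: "B \<subseteq> C" "C \<subseteq> vec.span W" "vec.independent C" "vec.span W \<subseteq> vec.span C"
  using vec.maximal_independent_subset_extend[of B "vec.span W"] B assms by blast
 have "finite C" "card C <= card B"
  using independent_card_le[of C W I] C assms B by auto
 hence "C = B" using C(1) card_seteq by blast
 hence "vec.span W \<subseteq> vec.span V" using C B vec.span_mono by (metis subset_trans)
 thus ?thesis using assms by (simp add: vec.span_minimal subset_antisym)
qed

lemma dim_insert_le:
 assumes "V \<subseteq> coord_space I" "finite I"
 shows "vec.dim (insert x V) <= vec.dim V + 1"
proof -
 obtain B where B: "B \<subseteq> V" "vec.independent B" "V \<subseteq> vec.span B" "card B = vec.dim V" "finite B"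
  using coord_space_basis assms by metis
 have "vec.dim (insert x V) <= card (insert x B)"
  by (rule vec.dim_le_card) (use B vec.span_mono[of B "insert x B"] in \<open>auto intro: vec.span_base\<close>)
 also have "\<dots> <= card B + 1" using B by (simp add: card_insert_if)
 finally show ?thesis using B by simp
qed

lemma dim_Un_card_le:
 assumes "finite S" "V \<subseteq> coord_space I" "finite I"
 shows "vec.dim (V \<union> S) <= vec.dim V + card S"
proof -
 obtain B where B: "B \<subseteq> V" "vec.independent B" "V \<subseteq> vec.span B" "card B = vec.dim V" "finite B"
  using coord_space_basis assms by metis
 have "vec.dim (V \<union> S) <= card (B \<union> S)"
  by (rule vec.dim_le_card) (use B assms vec.span_mono[of B "B \<union> S"] in \<open>auto intro: vec.span_base\<close>)
 also have "\<dots> <= card B + card S" by (rule card_Un_le)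
 finally show ?thesis using B by simp
qed


text \<open>A basis of the kernel on \<open>V\<close> is extended by preimages of a basis
  \<open>D\<close> of the image. The preimages are added one at a time: a dependence of the next one
  would be carried by \<open>f\<close> to a dependence inside \<open>D\<close>.\<close>

lemma rank_nullity:
 fixes f :: "('i => 'a::field) => 'j => 'a"
 assumes lin: "Vector_Spaces.linear vscale vscale f" and V: "vec.subspace V" "V \<subseteq> coord_space I" "finite I"
 shows "vec.dim V = vec.dim (f ` V) + vec.dim {v\<in>V. f v = 0}"
proof -
 interpret f: Vector_Spaces.linear vscale vscale f by fact
 let ?K = "{v\<in>V. f v = 0}"
 have sK: "vec.subspace ?K" using V vec.subspace_inter[OF V(1) f.subspace_kernel] by (simp add: Int_def)
 have "?K \<subseteq> coord_space I" using V by auto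
 from coord_space_basis[OF this V(3)] obtain K
  where K: "K \<subseteq> ?K" "vec.independent K" "?K \<subseteq> vec.span K" "card K = vec.dim ?K" "finite K" by blast
 obtain C where C: "V \<subseteq> vec.span C" "finite C" using coord_space_basis[OF V(2,3)] by blast
 obtain D where D: "D \<subseteq> f ` V" "vec.independent D" "f ` V \<subseteq> vec.span D" "card D = vec.dim (f ` V)"
  using vec.basis_exists by blast
 have "f ` V \<subseteq> vec.span (f ` C)" using C by (simp add: f.spans_image)
 with D(1) have "D \<subseteq> vec.span (f ` C)" by (rule order_trans)
 hence fD: "finite D" using vec.independent_span_bound[of "f ` C" D] C(2) D(2) by blast
 have "\<forall>d\<in>D. EX v. v \<in> V & f v = d" using D(1) by blast
 from bchoice[OF this] obtain g where g: "!!d. d \<in> D ==> g d \<in> V & f (g d) = d" by blast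
 have ind: "vec.independent (K \<union> g ` D') & card (K \<union> g ` D') = card K + card D'" if "D' \<subseteq> D" for D'
 proof -
  have "finite D'" using that fD finite_subset by blast
  thus ?thesis using that
  proof (induction D')
   case empty
   show ?case using K by simp
  next
   case (insert d D')
   have n: "g d \<notin> vec.span (K \<union> g ` D')"
   proof
    assume "g d \<in> vec.span (K \<union> g ` D')"
    hence "f (g d) \<in> vec.span (f ` (K \<union> g ` D'))" unfolding f.span_image by blast
    also have "f ` (K \<union> g ` D') \<subseteq> insert 0 D'" using K g insert by (auto simp: subset_iff)
    hence "vec.span (f ` (K \<union> g ` D')) \<subseteq> vec.span (insert 0 D')" by (rule vec.span_mono)
    finally have "d \<in> vec.span D'" using g insert by auto
    hence "d \<in> vec.span (D - {d})" using vec.span_mono[of D' "D - {d}"] insert by auto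
    thus False using D(2) insert by (auto simp: vec.dependent_def)
   qed
   have IH: "vec.independent (K \<union> g ` D')" "card (K \<union> g ` D') = card K + card D'"
    using insert by auto
   have "g d \<notin> K \<union> g ` D'" using n vec.span_base[of "g d" "K \<union> g ` D'"] by blast
   hence "card (insert (g d) (K \<union> g ` D')) = card K + card (insert d D')"
    using IH insert.hyps K by simp
   thus ?case using vec.independent_insertI[OF n IH(1)] by simp
  qed
 qed
 have "card (K \<union> g ` D) = vec.dim V"
 proof (rule vec.basis_card_eq_dim)
  show "K \<union> g ` D \<subseteq> V" using K g by auto
  show "V \<subseteq> vec.span (K \<union> g ` D)"
  proof
   fix v assume v: "v \<in> V"
   have "f ` (g ` D) = D" using g by (auto simp: image_image)
   hence "f v \<in> f ` vec.span (g ` D)" using v D(3) f.span_image[of "g ` D"] by auto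
   then obtain u where u: "u \<in> vec.span (g ` D)" "f u = f v" by auto
   have "u \<in> V" using u g V vec.span_minimal[of "g ` D" V] by auto
   hence "v - u \<in> ?K" using v V u by (auto simp: f.diff vec.subspace_diff)
   hence "v - u \<in> vec.span (K \<union> g ` D)" using K vec.span_mono[of K "K \<union> g ` D"] by auto
   moreover have "u \<in> vec.span (K \<union> g ` D)" using u vec.span_mono[of "g ` D" "K \<union> g ` D"] by auto
   ultimately show "v \<in> vec.span (K \<union> g ` D)" using vec.span_add by fastforce
  qed
  show "vec.independent (K \<union> g ` D)" using ind by auto
 qed
 thus ?thesis using ind[of D] K D by auto
qed

section \<open>Duality with respect to the coordinate pairing\<close>

definition dotp :: "'i set => ('i => 'a::field) => ('i => 'a) => 'a" where
 "dotp I u w = (\<Sum>i\<in>I. u i * w i)"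

definition ann :: "'i set => ('i => 'a::field) set => ('i => 'a) set" where
 "ann I W = {g \<in> coord_space I. \<forall>w\<in>W. dotp I g w = 0}"

lemma dotp_commute: "dotp I u w = dotp I w u"
 by (simp add: dotp_def mult.commute)

lemma dotp_add_right: "dotp I g (u + w) = dotp I g u + dotp I g w"
 by (simp add: dotp_def distrib_left sum.distrib)

lemma dotp_scale_right: "dotp I g (vscale c w) = c * dotp I g w"
 by (simp add: dotp_def vscale_apply sum_distrib_left mult_ac)

lemma dotp_add_left: "dotp I (u + w) g = dotp I u g + dotp I w g"
 by (simp add: dotp_def distrib_right sum.distrib)

lemma dotp_scale_left: "dotp I (vscale c w) g = c * dotp I w g"
 by (simp add: dotp_def vscale_apply sum_distrib_left mult_ac)

lemma dotp_zero_right [simp]: "dotp I g 0 = 0" and dotp_zero_left [simp]: "dotp I 0 g = 0"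
 by (simp_all add: dotp_def)

lemma dotp_sum_right: "dotp I g (\<Sum>x\<in>A. f x) = (\<Sum>x\<in>A. dotp I g (f x))"
 by (induction A rule: infinite_finite_induct)
  (simp_all add: dotp_add_right del: plus_fun_apply zero_fun_apply)

lemma dotp_unit_vec: "finite I ==> i \<in> I ==> dotp I g (unit_vec i) = g i"
 by (simp add: dotp_def unit_vec_def if_distrib[of "(*) _"] cong: if_cong)

lemma subspace_dotp: "vec.subspace {w. dotp I g w = 0}"
 by (auto intro!: vec.subspaceI simp: dotp_add_right dotp_scale_right)

lemma subspace_ann: "vec.subspace (ann I W)"
 by (auto intro!: vec.subspaceI simp: ann_def dotp_add_left dotp_scale_left coord_space_def fun_arith)

lemma dotp_span_eq_0: "w \<in> vec.span W ==> (!!w. w \<in> W ==> dotp I g w = 0) ==> dotp I g w = 0"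
 using vec.span_minimal[of W "{w. dotp I g w = 0}"] subspace_dotp by blast

lemma ann_span: "ann I (vec.span W) = ann I W"
 unfolding ann_def using dotp_span_eq_0 vec.span_base by blast

text \<open>Values prescribed on an independent set extend to a linear functional; on
  \<open>coord_space I\<close> this functional is the pairing with the vector of its values at the
  unit vectors.\<close>

lemma dual_extend:
 fixes B :: "('i => 'a::field) set"
 assumes "vec.independent B" "B \<subseteq> coord_space I" "finite I"
 shows "\<exists>\<gamma>\<in>coord_space I. \<forall>b\<in>B. dotp I \<gamma> b = f b"
proof -
 interpret vecdual: vector_space_pair "vscale :: 'a => ('i => 'a) => _" "(*) :: 'a => 'a => 'a"
  by unfold_locales (auto simp: algebra_simps)
 obtain g where g: "Vector_Spaces.linear vscale (*) g" "\<forall>b\<in>B. g b = f b"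
  using vecdual.linear_independent_extend[OF assms(1)] by blast
 interpret g: Vector_Spaces.linear vscale "(*)" g by fact
 define \<gamma> where "\<gamma> = (%i. if i \<in> I then g (unit_vec i) else 0)"
 have "dotp I \<gamma> b = f b" if b: "b \<in> B" for b
 proof -
  have "g b = g (\<Sum>i\<in>I. vscale (b i) (unit_vec i))" using sum_unit_vec[of I b] assms b by auto
  thus ?thesis using g b by (simp add: g.sum g.scale dotp_def \<gamma>_def mult.commute)
 qed
 moreover have "\<gamma> \<in> coord_space I" by (auto simp: \<gamma>_def coord_space_def)
 ultimately show ?thesis by blast
qed

lemma dim_coord_space:
 assumes "finite I"
 shows "vec.dim (coord_space I :: ('i => 'a::field) set) = card I"
proof -
 have inj: "inj_on (unit_vec :: 'i => 'i => 'a) I"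
  by (rule inj_onI) (metis unit_vec_def zero_neq_one)
 have "card (unit_vec ` I :: ('i => 'a) set) = vec.dim (coord_space I :: ('i => 'a) set)"
 proof (rule vec.basis_card_eq_dim)
  show "unit_vec ` I \<subseteq> coord_space I" using unit_vec_in_coord_space by auto
  show "vec.independent (unit_vec ` I :: ('i => 'a) set)"
   unfolding vec.dependent_def
  proof safe
   fix i assume i: "i \<in> I" "unit_vec i \<in> vec.span (unit_vec ` I - {unit_vec i :: 'i => 'a})"
   have "dotp I (unit_vec i) (unit_vec i :: 'i => 'a) = 0"
   proof (rule dotp_span_eq_0[OF i(2)])
    fix w assume "w \<in> unit_vec ` I - {unit_vec i :: 'i => 'a}"
    then obtain l where "w = unit_vec l" "l \<in> I" "l ~= i" by auto
    thus "dotp I (unit_vec i) w = 0" using assms by (simp add: dotp_unit_vec) (simp add: unit_vec_def)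
   qed
   thus False using i assms by (simp add: dotp_unit_vec) (simp add: unit_vec_def)
  qed
 qed (use coord_space_subset_span assms in auto)
 thus ?thesis using card_image[OF inj] by simp
qed

text \<open>Pairing with the members of a basis \<open>B\<close> of \<open>W\<close> maps
  \<open>coord_space I\<close> onto \<open>coord_space B\<close>, by \<open>dual_extend\<close>, and
  its kernel is the annihilator.\<close>

lemma dim_ann:
 fixes W :: "('i => 'a::field) set"
 assumes "W \<subseteq> coord_space I" "finite I"
 shows "vec.dim (ann I W) + vec.dim W = card I"
proof -
 obtain B where B: "B \<subseteq> W" "vec.independent B" "W \<subseteq> vec.span B" "card B = vec.dim W" "finite B"
  using coord_space_basis assms by metis
 define f :: "('i => 'a) => ('i => 'a) => 'a" where "f = (%g b. if b \<in> B then dotp I g b else 0)"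
 have lin: "Vector_Spaces.linear vscale vscale f"
  unfolding Vector_Spaces.linear_iff
  by (auto simp: f_def fun_eq_iff fun_arith dotp_add_left dotp_scale_left vec.vector_space_axioms)
 have "ann I W = ann I B"
  using ann_span[of I B] B unfolding ann_def by blast
 also have "\<dots> = {g \<in> coord_space I. f g = 0}" by (auto simp: ann_def f_def fun_eq_iff)
 finally have 1: "ann I W = {g \<in> coord_space I. f g = 0}" .
 have "f ` coord_space I = coord_space B"
 proof (intro subset_antisym subsetI)
  fix u :: "('i => 'a) => 'a" assume u: "u \<in> coord_space B"
  obtain \<gamma> where "\<gamma> \<in> coord_space I" "\<forall>b\<in>B. dotp I \<gamma> b = u b"
   using dual_extend[of B I u] B assms by blast
  hence "f \<gamma> = u" using u by (auto simp: f_def fun_eq_iff coord_space_def)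
  thus "u \<in> f ` coord_space I" using \<open>\<gamma> \<in> _\<close> by auto
 qed (auto simp: f_def coord_space_def)
 thus ?thesis using rank_nullity[OF lin subspace_coord_space subset_refl assms(2)] 1 B assms
  by (simp add: dim_coord_space)
qed

lemma ann_ann:
 assumes "W \<subseteq> coord_space I" "finite I"
 shows "ann I (ann I W) = vec.span W"
proof (intro subset_antisym subsetI)
 fix x assume x: "x \<in> ann I (ann I W)"
 show "x \<in> vec.span W"
 proof (rule ccontr)
  assume nx: "x \<notin> vec.span W"
  obtain B where B: "B \<subseteq> W" "vec.independent B" "W \<subseteq> vec.span B" using coord_space_basis assms by metis
  have "x \<notin> vec.span B" using nx B vec.span_mono by blast
  hence "vec.independent (insert x B)" "x \<notin> B" using B vec.independent_insertI vec.span_base by blast+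
  then obtain \<gamma> where \<gamma>: "\<gamma> \<in> coord_space I" "\<forall>b\<in>insert x B. dotp I \<gamma> b = (if b = x then 1 else 0)"
   using dual_extend[of "insert x B" I "%b. if b = x then 1 else 0"] x B assms by (auto simp: ann_def)
  have "dotp I \<gamma> w = 0" if "w \<in> W" for w
   by (rule dotp_span_eq_0[of _ B]) (use \<gamma> B \<open>x \<notin> B\<close> that in auto)
  hence "\<gamma> \<in> ann I W" using \<gamma> by (auto simp: ann_def)
  hence "dotp I x \<gamma> = 0" using x by (auto simp: ann_def)
  thus False using \<gamma> by (simp add: dotp_commute)
 qed
next
 fix x assume x: "x \<in> vec.span W"
 hence "x \<in> coord_space I" using assms span_subset_coord_space by blast
 moreover have "dotp I x g = 0" if "g \<in> ann I W" for g
  using that dotp_span_eq_0[OF x, of I g] by (auto simp: ann_def dotp_commute)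
 ultimately show "x \<in> ann I (ann I W)" by (auto simp: ann_def)
qed

section \<open>Linear independence is an open condition\<close>

text \<open>A family rather than a set: members that coincide at a special parameter value must
  count as dependent.\<close>

definition indep_family :: "'k set => ('k => 'i => 'a::field) => bool" where
 "indep_family K w \<longleftrightarrow> (ALL c. (\<Sum>k\<in>K. vscale (c k) (w k)) = 0 --> (\<forall>k\<in>K. c k = 0))"

lemma indep_familyD: "indep_family K w ==> (\<Sum>k\<in>K. vscale (c k) (w k)) = 0 ==> k \<in> K ==> c k = 0"
 by (auto simp: indep_family_def)

lemma indep_family_independent:
 assumes "finite K" "indep_family K w"
 shows "inj_on w K" "vec.independent (w ` K)"
proof -
 show inj: "inj_on w K"
 proof (rule inj_onI, rule ccontr)
  fix k l assume kl: "k \<in> K" "l \<in> K" "w k = w l" "k ~= l"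
  define c :: "_ => 'c" where "c = (%x. if x = k then 1 else if x = l then -1 else 0)"
  have "(\<Sum>x\<in>K. vscale (c x) (w x)) = (\<Sum>x\<in>{k,l}. vscale (c x) (w x))"
   by (rule sum.mono_neutral_right) (use kl assms in \<open>auto simp: c_def fun_eq_iff fun_arith\<close>)
  also have "\<dots> = 0" using kl by (auto simp: c_def fun_eq_iff fun_arith)
  finally show False using indep_familyD[OF assms(2), of c k] kl by (auto simp: c_def)
 qed
 show "vec.independent (w ` K)"
 proof (rule vec.independent_if_scalars_zero)
  fix f x assume f: "(\<Sum>x\<in>w ` K. vscale (f x) x) = 0" "x \<in> w ` K"
  thus "f x = 0" using indep_familyD[OF assms(2), of "%k. f (w k)"] by (auto simp: sum.reindex[OF inj])
 qed (use assms in auto)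
qed

lemma independent_indep_family:
 assumes "inj_on w K" "vec.independent (w ` K)" "finite K"
 shows "indep_family K w"
 unfolding indep_family_def
proof (intro allI impI ballI)
 fix c k assume c: "(\<Sum>k\<in>K. vscale (c k) (w k)) = 0" "k \<in> K"
 define f where "f = (%x. c (the_inv_into K w x))"
 have f: "f (w k) = c k" if "k \<in> K" for k using assms that by (simp add: f_def the_inv_into_f_f)
 have "(\<Sum>x\<in>w ` K. vscale (f x) x) = 0"
  using c by (subst sum.reindex[OF assms(1)]) (simp add: f)
 hence "f (w k) = 0" using vec.independentD[OF assms(2), of "w ` K" f "w k"] assms c by auto
 thus "c k = 0" using f c by auto
qed

lemma indep_family_card_le:
 assumes "indep_family K w" "finite K" "w ` K \<subseteq> vec.span V" "V \<subseteq> coord_space I" "finite I"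
 shows "card K <= vec.dim V"
 using independent_card_le[of "w ` K" V I] indep_family_independent[OF assms(2,1)] assms
 by (auto simp: card_image)

text \<open>Gaussian elimination without division. With a pivot coordinate \<open>i\<close> of the
  first vector, cross-multiplication clears this coordinate in the remaining vectors and keeps their
  entries polynomial in the parameter; the open condition \<open>g\<close> is the product of the
  pivots.\<close>

lemma indep_family_open:
 fixes w :: "'k => ('j => 'a::field_char_0) => 'i => 'a"
 assumes "finite K" "!!k i. k \<in> K ==> polyfun J (%t. w k t i)" "indep_family K (%k. w k a)"
 shows "EX g. polyfun J g & g a ~= 0 & (ALL t. g t ~= 0 --> indep_family K (%k. w k t))"
 using assms
proof (induction K arbitrary: w)
 case empty
 show ?case by (rule exI[of _ "%_. 1"]) (auto simp: indep_family_def intro: polyfun_const)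
next
 case (insert k K)
 note ind = insert.prems(2)
 have "w k a ~= 0"
 proof
  assume "w k a = 0"
  hence "(\<Sum>x\<in>insert k K. vscale (if x = k then 1 else 0) (w x a)) = 0"
   using insert by (auto simp: fun_eq_iff fun_arith intro!: sum.neutral)
  from indep_familyD[OF ind this, of k] show False by simp
 qed
 then obtain i where i: "w k a i ~= 0" by (auto simp: fun_eq_iff)
 define w' where "w' = (%l t. vscale (w k t i) (w l t) - vscale (w l t i) (w k t))"
 have pf: "polyfun J (%t. w' l t i')" if "l \<in> K" for l i'
  using insert.prems(1) that by (auto simp: w'_def fun_arith intro!: polyfun_intros)
 have comb: "(\<Sum>l\<in>K. vscale (c l) (w' l t)) = (\<Sum>x\<in>insert k K. vscale
   (if x = k then - (\<Sum>l\<in>K. c l * w l t i) else c x * w k t i) (w x t))" for c t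
 proof -
  have "(\<Sum>x\<in>K. vscale (if x = k then - (\<Sum>l\<in>K. c l * w l t i) else c x * w k t i) (w x t))
   = (\<Sum>x\<in>K. vscale (c x * w k t i) (w x t))"
   using insert.hyps by (intro sum.cong) auto
  thus ?thesis using insert.hyps
   by (simp add: fun_eq_iff fun_arith w'_def right_diff_distrib sum_subtractf sum_distrib_left sum_distrib_right mult_ac)
 qed
 have "indep_family K (%l. w' l a)"
  unfolding indep_family_def
 proof (intro allI impI ballI)
  fix c l assume c: "(\<Sum>l\<in>K. vscale (c l) (w' l a)) = 0" and l: "l \<in> K"
  from indep_familyD[OF ind c[unfolded comb], of l] l have "c l * w k a i = 0"
   using insert.hyps by (auto split: if_splits)
  thus "c l = 0" using i by simp
 qed
 from insert.IH[OF pf this] obtain g where g: "polyfun J g" "g a ~= 0"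
  "!!t. g t ~= 0 ==> indep_family K (%k. w' k t)" by blast
 show ?case
 proof (intro exI[of _ "%t. g t * w k t i"] conjI allI impI)
  show "polyfun J (%t. g t * w k t i)" using g insert.prems by (intro polyfun_mult) auto
  show "g a * w k a i ~= 0" using g i by simp
  fix t assume t: "g t * w k t i ~= 0"
  show "indep_family (insert k K) (%k. w k t)"
   unfolding indep_family_def
  proof (intro allI impI)
   fix c assume c: "(\<Sum>x\<in>insert k K. vscale (c x) (w x t)) = 0"
   have c': "c k * w k t j + (\<Sum>l\<in>K. c l * w l t j) = 0" for j
    using fun_cong[OF c, of j] insert.hyps by (simp add: fun_arith)
   have "(\<Sum>l\<in>K. vscale (c l) (w' l t)) = 0"
   proof
    fix j
    have "(\<Sum>l\<in>K. vscale (c l) (w' l t)) j = w k t i * (\<Sum>l\<in>K. c l * w l t j) - w k t j * (\<Sum>l\<in>K. c l * w l t i)"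
     by (simp add: fun_arith w'_def sum_subtractf right_diff_distrib sum_distrib_left mult_ac)
    also have "(\<Sum>l\<in>K. c l * w l t j) = - c k * w k t j" using c'[of j] by (simp add: eq_neg_iff_add_eq_0 add.commute)
    also have "(\<Sum>l\<in>K. c l * w l t i) = - c k * w k t i" using c'[of i] by (simp add: eq_neg_iff_add_eq_0 add.commute)
    finally show "(\<Sum>l\<in>K. vscale (c l) (w' l t)) j = 0 j" by simp
   qed
   hence K0: "\<forall>l\<in>K. c l = 0" using g(3)[of t] t by (auto simp: indep_family_def)
   hence "c k * w k t i = 0" using c'[of i] by simp
   thus "\<forall>l\<in>insert k K. c l = 0" using K0 t by auto
  qed
 qed
qed

lemma obtain_indep_family:
 fixes w :: "'k => 'i => 'a::field"
 assumes "finite K"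
 obtains L where "L \<subseteq> K" "indep_family L w" "card L = vec.dim (w ` K)" "w ` K \<subseteq> vec.span (w ` L)"
proof -
 obtain B where B: "B \<subseteq> w ` K" "vec.independent B" "w ` K \<subseteq> vec.span B" "card B = vec.dim (w ` K)"
  using vec.basis_exists by blast
 obtain L where L: "L \<subseteq> K" "inj_on w L" "w ` L = B" using B(1) by (metis subset_image_inj)
 have "indep_family L w" using independent_indep_family[of w L] L B assms finite_subset by blast
 thus thesis using that[of L] L B by (simp add: card_image[symmetric])
qed

text \<open>Lower semicontinuity of the rank: a maximal independent subfamily at \<open>a\<close>
  stays independent on an open set.\<close>

lemma dim_family_open:
 fixes w :: "'k => ('j => 'a::field_char_0) => 'i => 'a"
 assumes "finite K" "!!k i. k \<in> K ==> polyfun J (%t. w k t i)"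
  and I: "finite I" "!!k t. k \<in> K ==> w k t \<in> coord_space I"
 shows "EX g. polyfun J g & g a ~= 0 &
  (ALL t. g t ~= 0 --> vec.dim ((%k. w k a) ` K) <= vec.dim ((%k. w k t) ` K))"
proof -
 obtain L where L: "L \<subseteq> K" "indep_family L (%k. w k a)" "card L = vec.dim ((%k. w k a) ` K)"
  using obtain_indep_family[OF assms(1), of "%k. w k a"] by metis
 have fL: "finite L" using L assms finite_subset by blast
 obtain g where g: "polyfun J g" "g a ~= 0" "!!t. g t ~= 0 ==> indep_family L (%k. w k t)"
  using indep_family_open[of L J w a] fL L(1,2) assms(2) by blast
 have "card L <= vec.dim ((%k. w k t) ` K)" if "g t ~= 0" for t
  by (rule indep_family_card_le[OF g(3)[OF that] fL _ _ I(1)])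
   (use L I in \<open>auto intro!: vec.span_base\<close>)
 thus ?thesis using g L by auto
qed

section \<open>Algebraic independence\<close>

text \<open>Relations are tested on \<open>A\<close> only, so that the notion covers both functions
  on the parameter space, with \<open>A = UNIV\<close>, and functions on the cone over a closed
  set.\<close>

definition alg_indep :: "('i => 'a::field) set => nat => (nat => ('i => 'a) => 'a) => bool" where
 "alg_indep A n f \<longleftrightarrow>
  (ALL P. polyfun {..<n} P --> (\<forall>x\<in>A. P (%i. f i x) = 0) --> (ALL y. P y = 0))"

lemma alg_indepD:
 "alg_indep A n f ==> polyfun {..<n} P ==> (!!x. x \<in> A ==> P (%i. f i x) = 0) ==> P y = 0"
 by (auto simp: alg_indep_def)

lemma sum_digits: "(\<Sum>i<n. (N div B ^ i mod B) * B ^ i) = N mod (B ^ n :: nat)"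
proof (induction n)
 case (Suc n)
 show ?case using Suc mod_mult2_eq[of N "B ^ n" B] by (simp add: mult.commute)
qed auto

lemma vanishing_power_sum:
 fixes c :: "nat => 'a::field_char_0"
 assumes "!!t. (\<Sum>N<M. c N * t ^ N) = 0" "N < M"
 shows "c N = 0"
proof -
 define q where "q = (\<Sum>N<M. Polynomial.monom (c N) N)"
 have "poly q t = 0" for t using assms(1)[of t] by (simp add: q_def poly_sum poly_monom)
 hence "q = 0" by (meson poly_all_0_iff_0)
 moreover have "poly.coeff q N = c N" using assms(2) by (simp add: q_def coeff_sum)
 ultimately show ?thesis by simp
qed

text \<open>Bounding each exponent separately, instead of the total degree, makes the number of
  monomials at most a power, which is easy to compare with \<open>B ^ n\<close> below.\<close>

definition monomial_funs :: "'i set => nat => (('i => 'a::field) => 'a) set" where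
 "monomial_funs J D = (%\<alpha> x. \<Prod>i\<in>J. x i ^ \<alpha> i) ` (J \<rightarrow>\<^sub>E {..D})"

lemma monomial_fun_mem:
 "(!!i. i \<in> J ==> \<alpha> i <= D) ==> (%x. \<Prod>i\<in>J. x i ^ \<alpha> i) \<in> monomial_funs J D"
 unfolding monomial_funs_def by (rule image_eqI[of _ _ "restrict \<alpha> J"]) auto

lemma card_monomial_funs:
 assumes "finite J"
 shows "finite (monomial_funs J D)" "card (monomial_funs J D) <= (D + 1) ^ card J"
proof -
 have "finite (J \<rightarrow>\<^sub>E {..D})" "card (J \<rightarrow>\<^sub>E {..D}) = (D + 1) ^ card J"
  using assms by (auto simp: card_PiE intro: finite_PiE)
 thus "finite (monomial_funs J D)" "card (monomial_funs J D) <= (D + 1) ^ card J"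
  unfolding monomial_funs_def using card_image_le[of "J \<rightarrow>\<^sub>E {..D}"] by auto
qed

lemma monomial_funs_mono: "D <= D' ==> monomial_funs J D \<subseteq> monomial_funs J D'"
 unfolding monomial_funs_def by (rule image_mono) (auto simp: PiE_iff extensional_def intro: order_trans)

lemma span_monomial_funs_mult:
 assumes "g \<in> vec.span (monomial_funs J D)" "h \<in> vec.span (monomial_funs J D')"
 shows "(%x. g x * h x) \<in> vec.span (monomial_funs J (D + D'))"
proof -
 let ?S = "vec.span (monomial_funs J (D + D'))"
 have 1: "(%x. g x * h x) \<in> ?S" if g: "g \<in> monomial_funs J D" and h: "h \<in> monomial_funs J D'"
  for g h :: "('a => 'b) => 'b"
 proof -
  obtain \<alpha> \<beta> where \<alpha>: "\<alpha> \<in> J \<rightarrow>\<^sub>E {..D}" "g = (%x. \<Prod>i\<in>J. x i ^ \<alpha> i)"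
   and \<beta>: "\<beta> \<in> J \<rightarrow>\<^sub>E {..D'}" "h = (%x. \<Prod>i\<in>J. x i ^ \<beta> i)"
   using g h by (auto simp: monomial_funs_def)
  have "(%x. g x * h x) = (%x. \<Prod>i\<in>J. x i ^ (\<alpha> i + \<beta> i))"
   by (simp add: \<alpha> \<beta> power_add prod.distrib)
  also have "\<dots> \<in> monomial_funs J (D + D')"
   by (rule monomial_fun_mem) (use \<alpha> \<beta> in \<open>auto simp: PiE_iff intro: add_mono\<close>)
  finally show ?thesis by (rule vec.span_base)
 qed
 have sub: "vec.subspace {g. (%x. g x * h x) \<in> ?S}" for h
 proof (rule vec.subspaceI)
  show "0 \<in> {g. (%x. g x * h x) \<in> ?S}" using vec.span_zero by (auto simp: zero_fun_def)
  fix g g' assume "g \<in> {g. (%x. g x * h x) \<in> ?S}" "g' \<in> {g. (%x. g x * h x) \<in> ?S}"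
  hence "(%x. g x * h x) + (%x. g' x * h x) \<in> ?S" by (auto intro: vec.span_add)
  thus "g + g' \<in> {g. (%x. g x * h x) \<in> ?S}" by (simp add: plus_fun_def distrib_right)
 next
  fix c g assume "g \<in> {g. (%x. g x * h x) \<in> ?S}"
  hence "vscale c (%x. g x * h x) \<in> ?S" by (auto intro: vec.span_scale)
  thus "vscale c g \<in> {g. (%x. g x * h x) \<in> ?S}" by (simp add: vscale_def mult_ac)
 qed
 have 2: "(%x. g x * h x) \<in> ?S" if "h \<in> monomial_funs J D'" for h
  using vec.span_minimal[OF _ sub[of h], of "monomial_funs J D"] 1 that assms(1) by blast
 have "monomial_funs J D' \<subseteq> {h. (%x. h x * g x) \<in> ?S}" using 2 by (auto simp: mult.commute)
 hence "h \<in> {h. (%x. h x * g x) \<in> ?S}" using vec.span_minimal[OF _ sub[of g]] assms(2) by blast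
 thus ?thesis by (simp add: mult.commute)
qed

lemma polyfun_span_monomials:
 fixes f :: "('b => 'a::field) => 'a"
 assumes "finite J" "polyfun J f"
 shows "EX D. f \<in> vec.span (monomial_funs J D)"
 using assms(2)
proof (induction rule: polyfun.induct)
 case (polyfun_const c)
 have "vscale c (%x. \<Prod>i\<in>J. x i ^ 0) \<in> vec.span (monomial_funs J 0)"
  by (intro vec.span_scale vec.span_base monomial_fun_mem) auto
 moreover have "vscale c (%x::'b => 'a. \<Prod>i\<in>J. x i ^ 0) = (%_. c)" by (auto simp: vscale_def)
 ultimately show ?case by metis
next
 case (polyfun_var l)
 have "(%x::'b => 'a. x l) = (%x. \<Prod>i\<in>J. x i ^ (if i = l then 1 else 0))"
  using polyfun_var assms(1) by (simp add: if_distrib[of "%n. _ ^ n"] prod.delta cong: if_cong)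
 also have "\<dots> \<in> monomial_funs J 1" by (intro monomial_fun_mem) auto
 finally show ?case using vec.span_base by blast
next
 case (polyfun_add f g)
 then obtain D D' where "f \<in> vec.span (monomial_funs J D)" "g \<in> vec.span (monomial_funs J D')" by blast
 hence "f \<in> vec.span (monomial_funs J (D + D'))" "g \<in> vec.span (monomial_funs J (D + D'))"
  using vec.span_mono[OF monomial_funs_mono[of D "D + D'" J]]
   vec.span_mono[OF monomial_funs_mono[of D' "D + D'" J]] by auto
 hence "f + g \<in> vec.span (monomial_funs J (D + D'))" by (rule vec.span_add)
 thus ?case by (auto simp: plus_fun_def)
next
 case (polyfun_mult f g)
 thus ?case using span_monomial_funs_mult by blast
qed

lemma span_monomials_power:
 "f \<in> vec.span (monomial_funs J D) ==> (%x. f x ^ n) \<in> vec.span (monomial_funs J (n * D))"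
proof (induction n)
 case 0
 have "(%x. \<Prod>i\<in>J. x i ^ 0) \<in> monomial_funs J 0" by (intro monomial_fun_mem) auto
 thus ?case by (auto intro: vec.span_base)
next
 case (Suc n)
 thus ?case using span_monomial_funs_mult[of f J D "%x. f x ^ n" "n * D"] by (simp add: add.commute)
qed

lemma span_monomials_prod:
 "(!!i. i < n ==> f i \<in> vec.span (monomial_funs J D)) ==>
  (%x. \<Prod>i<(n::nat). f i x) \<in> vec.span (monomial_funs J (n * D))"
proof (induction n)
 case 0
 have "(%x. \<Prod>i\<in>J. x i ^ 0) \<in> monomial_funs J 0" by (intro monomial_fun_mem) auto
 thus ?case by (auto intro: vec.span_base)
next
 case (Suc n)
 thus ?case using span_monomial_funs_mult[of "%x. \<Prod>i<n. f i x" J "n * D" "f n" D] by (simp add: add.commute)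
qed

text \<open>The monomials in \<open>f 0, \<dots>, f (n - 1)\<close> with exponents below \<open>B\<close> are indexed by the base-\<open>B\<close>
  digits of the numbers below \<open>B ^ n\<close>; their number outgrows that of the monomials in \<open>J\<close>
  unless \<open>n \<le> card J\<close>.\<close>

lemma alg_indep_card_le:
 fixes f :: "nat => ('i => 'a::field_char_0) => 'a"
 assumes J: "finite J" and f: "!!i. i < n ==> polyfun J (f i)" and ind: "alg_indep A n f"
 shows "n <= card J"
proof (rule ccontr)
 assume n: "\<not> n <= card J"
 have "ALL i. EX D. i < n --> f i \<in> vec.span (monomial_funs J D)"
  using polyfun_span_monomials[OF J f] by blast
 then obtain d where d: "!!i. i < n ==> f i \<in> vec.span (monomial_funs J (d i))" by metis
 define D where "D = (\<Sum>i<n. d i)"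
 have fD: "f i \<in> vec.span (monomial_funs J D)" if "i < n" for i
  using d[OF that] vec.span_mono[OF monomial_funs_mono[of "d i" D J]] that
  by (auto simp: D_def intro!: member_le_sum)
 define m where "m = card J"
 \<comment> \<open>Chosen so that \<open>B - 1 = (n * D + 1) ^ m\<close>. The \<open>B ^ n\<close>
   monomials in the \<open>f i\<close> lie in a span of at most
   \<open>((n * D + 1) * B) ^ m = (B - 1) * B ^ m\<close> monomials in the variables, and this is
   less than \<open>B ^ (m + 1)\<close>.\<close>
 define B where "B = (n * D + 1) ^ m + 1"
 define dg where "dg = (%N i. N div B ^ i mod B)"
 define F where "F = (%N x. \<Prod>i<n. f i x ^ dg N i)"
 have B: "B > 0" by (simp add: B_def)
 have dg: "dg N i <= B - 1" for N i using B mod_less_divisor[of B "N div B ^ i"] unfolding dg_def by linarith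
 have FS: "F N \<in> vec.span (monomial_funs J (n * ((B - 1) * D)))" for N
  unfolding F_def
 proof (rule span_monomials_prod)
  fix i assume "i < n"
  have "(%x. f i x ^ dg N i) \<in> vec.span (monomial_funs J (dg N i * D))"
   by (rule span_monomials_power) (use fD \<open>i < n\<close> in auto)
  thus "(%x. f i x ^ dg N i) \<in> vec.span (monomial_funs J ((B - 1) * D))"
   using vec.span_mono[OF monomial_funs_mono[of "dg N i * D" "(B - 1) * D" J]] dg[of N i] by auto
 qed
 have "indep_family {..<B ^ n} F"
  unfolding indep_family_def
 proof (intro allI impI ballI)
  fix c N assume c: "(\<Sum>N<B ^ n. vscale (c N) (F N)) = 0" and N: "N \<in> {..<B ^ n}"
  define P where "P = (%y. \<Sum>N<B ^ n. c N * (\<Prod>i<n. y i ^ dg N i))"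
  have "polyfun {..<n} P" unfolding P_def by (intro polyfun_intros) auto
  moreover have "P (%i. f i x) = 0" for x
   using fun_cong[OF c, of x] by (simp add: P_def F_def fun_arith)
  ultimately have P0: "P y = 0" for y using alg_indepD[OF ind] by blast
  \<comment> \<open>Substituting \<open>t ^ (B ^ i)\<close> for the i-th variable turns the monomial
    with the digits of N into \<open>t ^ N\<close>, so the relation becomes a polynomial in t with
    coefficients \<open>c N\<close>.\<close>
  have "(\<Sum>N<B ^ n. c N * t ^ N) = 0" for t
  proof -
   have "(\<Prod>i<n. (t ^ (B ^ i)) ^ dg N i) = t ^ N" if "N < B ^ n" for N
   proof -
    have "(\<Prod>i<n. (t ^ (B ^ i)) ^ dg N i) = t ^ (\<Sum>i<n. dg N i * B ^ i)"
     by (simp add: power_sum mult.commute flip: power_mult)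
    thus ?thesis using sum_digits[of N B n] that by (simp add: dg_def)
   qed
   thus ?thesis using P0[of "%i. t ^ (B ^ i)"] by (simp add: P_def)
  qed
  thus "c N = 0" using vanishing_power_sum N by blast
 qed
 hence "inj_on F {..<B ^ n}" "vec.independent (F ` {..<B ^ n})"
  using indep_family_independent by (metis finite_lessThan)+
 hence "B ^ n <= card (monomial_funs J (n * ((B - 1) * D)) :: (('i => 'a) => 'a) set)"
  using vec.independent_span_bound[OF card_monomial_funs(1)[OF J], of "F ` {..<B ^ n}"] FS
  by (auto simp: card_image)
 also have "\<dots> <= (n * ((B - 1) * D) + 1) ^ m" unfolding m_def by (rule card_monomial_funs(2)[OF J])
 also have "\<dots> <= ((n * D + 1) * B) ^ m"
  by (rule power_mono) (use B in \<open>auto simp: algebra_simps intro: diff_le_self add_mono mult_le_mono\<close>)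
 also have "\<dots> < B * B ^ m"
 proof -
  have "B - 1 = (n * D + 1) ^ m" by (simp add: B_def)
  hence "((n * D + 1) * B) ^ m = (B - 1) * B ^ m" by (simp only: power_mult_distrib)
  also have "\<dots> < B * B ^ m" using B by simp
  finally show ?thesis .
 qed
 also have "\<dots> <= B ^ n" using power_increasing[of "Suc m" n B] n B by (simp add: m_def)
 finally show False by simp
qed

section \<open>The Jacobian criterion in characteristic zero\<close>

lemma linear_dd:
 fixes g :: "'l => ('i => 'a::field_char_0) => 'a"
 assumes "!!l. l \<in> L ==> polyfun J (g l)"
 shows "Vector_Spaces.linear vscale vscale (%b l. if l \<in> L then dd (g l) a b else 0)"
proof -
 have "dd (g l) a (b + c) = dd (g l) a b + dd (g l) a c" if "l \<in> L" for l b c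
  using dd_lin[OF assms[OF that], of a 1 b 1 c] by (simp add: plus_fun_def)
 moreover have "dd (g l) a (vscale s b) = s * dd (g l) a b" if "l \<in> L" for l s b
  using dd_lin[OF assms[OF that], of a s b 0 b] by (simp add: vscale_def)
 ultimately show ?thesis
  unfolding Vector_Spaces.linear_iff by (auto simp: fun_eq_iff vscale_apply vec.vector_space_axioms)
qed

text \<open>Otherwise the derivative of every relation in the last variable would again be a
  relation. By Taylor expansion in that variable a relation would then hold for any value of the
  last coordinate; freezing it leaves a relation among the independent \<open>g\<close>. In
  characteristic 0 this replaces the choice of a relation of least degree.\<close>

lemma alg_indep_extend_derivative:
 fixes g :: "nat => ('i => 'a::field_char_0) => 'a"
 assumes ind: "alg_indep UNIV n g" and nind: "\<not> alg_indep UNIV (Suc n) (g(n := h))"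
  and pf: "!!l. l < n ==> polyfun J (g l)" "polyfun J h"
 shows "EX P. polyfun {..<Suc n} P & (ALL x. P (%l. (g(n := h)) l x) = 0) &
  (EX a. dd P (%l. (g(n := h)) l a) (unit_vec n) ~= 0)"
proof (rule ccontr)
 let ?g = "g(n := h)"
 assume *: "\<not> ?thesis"
 define S where "S = {P. polyfun {..<Suc n} P & (ALL x. P (%l. ?g l x) = 0)}"
 have cl: "(%y. dd P y (unit_vec n)) \<in> S" if "P \<in> S" for P
  using * that polyfun_dd by (auto simp: S_def)
 obtain P y where P: "P \<in> S" "P y ~= 0" using nind by (auto simp: alg_indep_def S_def)
 define R where "R = (%z. P (%l. if l = n then y n else z l))"
 have "polyfun {..<n} R"
  unfolding R_def by (rule polyfun_compose[of "{..<Suc n}"])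
   (use P in \<open>auto simp: S_def less_Suc_eq intro: polyfun_intros\<close>)
 moreover have "R (%l. g l x) = 0" for x
 proof -
  have "P (%l. ?g l x + (y n - h x) * unit_vec n l) = 0"
   by (rule polyfun_zero_of_derivs[where S = S and J = "{..<Suc n}"]) (use cl P in \<open>auto simp: S_def\<close>)
  moreover have "(%l. ?g l x + (y n - h x) * unit_vec n l) = (%l. if l = n then y n else g l x)"
   by (auto simp: unit_vec_def)
  ultimately show ?thesis by (simp add: R_def)
 qed
 ultimately have "R y = 0" using alg_indepD[OF ind] by blast
 moreover have "(%l. if l = n then y n else y l) = y" by auto
 ultimately show False using P by (simp add: R_def)
qed

text \<open>A maximal algebraically independent extension of the family makes every coordinate
  algebraic over it; differentiating the relations bounds the rank of the Jacobian from below.\<close>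

lemma alg_indep_jacobian:
 fixes f :: "nat => ('i => 'a::field_char_0) => 'a"
 assumes J: "finite J" and f: "!!i. i < n ==> polyfun J (f i)" and ind: "alg_indep UNIV n f"
 shows "EX a b. \<forall>i<n. \<forall>l<n. dd (f i) a (b l) = (if i = l then 1 else 0)"
proof -
 define Q where "Q = (%m. EX g. n <= m & (\<forall>i<n. g i = f i) & (\<forall>i<m. polyfun J (g i)) & alg_indep UNIV m g)"
 have "Q n" using f ind by (auto simp: Q_def)
 moreover have "ALL m. Q m --> m < Suc (card J)"
  using alg_indep_card_le[OF J] by (auto simp: Q_def less_Suc_eq_le)
 ultimately obtain m where m: "Q m" "!!m'. Q m' ==> m' <= m"
  using ex_has_greatest_nat[of Q n "%x. x" "Suc (card J)"] by blast
 obtain g where g: "n <= m" "!!i. i < n ==> g i = f i" "!!i. i < m ==> polyfun J (g i)" "alg_indep UNIV m g"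
  using m(1) by (auto simp: Q_def)
 define g' where "g' = (%i. g(m := (%x. x i)))"
 have "EX P. polyfun {..<Suc m} P & (ALL x. P (%l. g' i l x) = 0) & (EX a. dd P (%l. g' i l a) (unit_vec m) ~= 0)"
  if i: "i \<in> J" for i
  unfolding g'_def
 proof (rule alg_indep_extend_derivative[OF g(4)])
  show "\<not> alg_indep UNIV (Suc m) (g(m := %x. x i))"
  proof
   assume "alg_indep UNIV (Suc m) (g(m := %x. x i))"
   hence "Q (Suc m)" unfolding Q_def using g i
    by (intro exI[of _ "g(m := %x. x i)"]) (auto simp: less_Suc_eq intro: polyfun_var)
   thus False using m(2) by fastforce
  qed
 qed (use g i in \<open>auto intro: polyfun_var\<close>)
 hence "\<forall>i\<in>J. EX P. polyfun {..<Suc m} P & (ALL x. P (%l. g' i l x) = 0) & (EX a. dd P (%l. g' i l a) (unit_vec m) ~= 0)"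
  by blast
 from bchoice[OF this] obtain P where P: "!!i. i \<in> J ==> polyfun {..<Suc m} (P i)"
  "!!i x. i \<in> J ==> P i (%l. g' i l x) = 0" "!!i. i \<in> J ==> EX a. dd (P i) (%l. g' i l a) (unit_vec m) ~= 0"
  by blast
 have g'pf: "polyfun J (g' i l)" if "i \<in> J" "l < Suc m" for i l
  using that g by (auto simp: g'_def less_Suc_eq intro: polyfun_var)
 have "EX a. \<forall>i\<in>J. dd (P i) (%l. g' i l a) (unit_vec m) ~= 0"
 proof (rule polyfun_prod_neq_0[OF J])
  fix i assume i: "i \<in> J"
  show "polyfun J (%a. dd (P i) (%l. g' i l a) (unit_vec m))"
   by (rule polyfun_compose[OF polyfun_dd[OF P(1)[OF i]]]) (use g'pf i in auto)
 qed (use P in auto)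
 then obtain a where a: "!!i. i \<in> J ==> dd (P i) (%l. g' i l a) (unit_vec m) ~= 0" by blast
 define \<Psi> where "\<Psi> = (%b l. if l \<in> {..<m} then dd (g l) a b else 0)"
 have lin: "Vector_Spaces.linear vscale vscale \<Psi>"
  unfolding \<Psi>_def by (rule linear_dd[of _ J]) (use g in auto)
 \<comment> \<open>Differentiate the i-th relation along b: the derivatives of all
   \<open>g l\<close> along b vanish, so only the term of the last variable survives, and its
   coefficient at a is non-zero.\<close>
 have inj: "b = 0" if b: "b \<in> coord_space J" "\<Psi> b = 0" for b
 proof
  fix i
  show "b i = 0 i"
  proof (cases "i \<in> J")
   case True
   have gb: "dd (g' i l) a b = b i * unit_vec m l" if l: "l < Suc m" for l
   proof (cases "l = m")
    case False
    hence "dd (g l) a b = 0" using fun_cong[OF b(2), of l] l by (simp add: \<Psi>_def)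
    thus ?thesis using False by (simp add: g'_def unit_vec_def)
   qed (simp add: g'_def unit_vec_def)
   have "(%x. P i (%l. g' i l x)) = (%_. 0)" using P(2)[OF True] by auto
   hence "0 = dd (%x. P i (%l. g' i l x)) a b" by simp
   also have "\<dots> = dd (P i) (%l. g' i l a) (%l. dd (g' i l) a b)"
    by (rule dd_compose[OF P(1)[OF True]]) (use g'pf True in auto)
   also have "\<dots> = dd (P i) (%l. g' i l a) (%l. b i * unit_vec m l + 0 * 0)"
    by (rule dd_cong[OF P(1)[OF True]]) (use gb in auto)
   also have "\<dots> = b i * dd (P i) (%l. g' i l a) (unit_vec m)"
    by (subst dd_lin[OF P(1)[OF True]]) simp
   finally show ?thesis using a[OF True] by simp
  qed (use b in \<open>auto simp: coord_space_def\<close>)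
 qed
 interpret \<Psi>: Vector_Spaces.linear vscale vscale \<Psi> by fact
 have "{b \<in> coord_space J. \<Psi> b = 0} = {0}" using inj \<Psi>.zero by auto
 \<comment> \<open>Injectivity gives rank \<open>card J\<close>, while the target has dimension
   \<open>m <= card J\<close>. The map is therefore onto, and directions dual to all the
   \<open>g l\<close>, in particular to the \<open>f i\<close>, exist.\<close>
 hence "vec.dim (\<Psi> ` coord_space J) = card J"
  using rank_nullity[OF lin subspace_coord_space subset_refl J] vec.dim_le_card[of "{0}" "{}"]
  by (simp add: dim_coord_space[OF J])
 moreover have sub: "\<Psi> ` coord_space J \<subseteq> coord_space {..<m}" by (auto simp: \<Psi>_def coord_space_def)
 moreover have "m <= card J" by (rule alg_indep_card_le[OF J _ g(4)]) (use g in auto)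
 ultimately have "vec.span (\<Psi> ` coord_space J) = vec.span (coord_space {..<m})"
  by (intro span_eq_of_dim_le[of _ _ "{..<m}"]) (auto simp: dim_coord_space intro: vec.span_base)
 moreover have "vec.span (\<Psi> ` coord_space J) = \<Psi> ` coord_space J"
  using \<Psi>.span_image[of "coord_space J"] vec.span_eq_iff[THEN iffD2, OF subspace_coord_space] by metis
 moreover have "vec.span (coord_space {..<m}) = (coord_space {..<m} :: (nat => 'a) set)" by simp
 ultimately have "\<Psi> ` coord_space J = coord_space {..<m}" by simp
 hence "\<forall>l\<in>{..<m}. EX b. \<Psi> b = unit_vec l"
  using unit_vec_in_coord_space[of _ "{..<m}"] by (metis imageE)
 from bchoice[OF this] obtain b where b: "!!l. l < m ==> \<Psi> (b l) = unit_vec l" by auto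
 have "dd (f i) a (b l) = (if i = l then 1 else 0)" if "i < n" "l < n" for i l
  using fun_cong[OF b[of l], of i] that g by (auto simp: \<Psi>_def unit_vec_def split: if_splits)
 thus ?thesis by blast
qed

text \<open>Where the differentials of the \<open>f i\<close> are independent, which is an open
  condition, differentiating a relation shows that its first derivatives vanish on the image as
  well. Relations are thus closed under derivation, and Taylor expansion at one point of the image
  shows that they are zero.\<close>

lemma jacobian_alg_indep:
 fixes f :: "nat => ('i => 'a::field_char_0) => 'a"
 assumes J: "finite J" and f: "!!i. i < n ==> polyfun J (f i)"
  and d: "!!i l. i < n ==> l < n ==> dd (f i) a (b l) = (if i = l then 1 else 0)"
 shows "alg_indep UNIV n f"
proof -
 define w where "w = (%i x j. if j \<in> J then dd (f i) x (unit_vec j) else 0)"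
 have dw: "dd (f i) x c = (\<Sum>j\<in>J. c j * w i x j)" if "i < n" for i x c
  using dd_coords[OF f[OF that] J, of x c] by (simp add: w_def unit_vec_def)
 have wpf: "polyfun J (%t. w i t j)" if "i < n" for i j
 proof (cases "j \<in> J")
  case True
  thus ?thesis using polyfun_dd[OF f[OF that], of "unit_vec j"] by (simp add: w_def)
 qed (simp add: w_def polyfun_const)
 have "indep_family {..<n} (%i. w i a)"
  unfolding indep_family_def
 proof (intro allI impI ballI)
  fix c l assume c: "(\<Sum>i<n. vscale (c i) (w i a)) = 0" and l: "l \<in> {..<n}"
  have "(\<Sum>i<n. c i * dd (f i) a (b l)) = (\<Sum>i<n. \<Sum>j\<in>J. b l j * (c i * w i a j))"
   by (simp add: dw sum_distrib_left mult_ac)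
  also have "\<dots> = (\<Sum>j\<in>J. b l j * (\<Sum>i<n. vscale (c i) (w i a)) j)"
   by (subst sum.swap) (simp add: sum_distrib_left fun_arith)
  also have "\<dots> = 0" using c by simp
  also have "(\<Sum>i<n. c i * dd (f i) a (b l)) = (\<Sum>i<n. if i = l then c i else 0)"
   using l d by (intro sum.cong) auto
  finally show "c l = 0" using l by simp
 qed
 hence "EX g. polyfun J g & g a ~= 0 & (ALL x. g x ~= 0 --> indep_family {..<n} (%i. w i x))"
  by (intro indep_family_open) (simp_all add: wpf)
 then obtain g where g: "polyfun J g" "g a ~= 0" "!!x. g x ~= 0 ==> indep_family {..<n} (%i. w i x)"
  by blast
 define S where "S = {P. polyfun {..<n} P & (ALL x. P (%i. f i x) = 0)}"
 have cl: "(%y. dd P y c) \<in> S" if P: "P \<in> S" for P c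
 proof -
  have pP: "polyfun {..<n} P" and P0: "!!x. P (%i. f i x) = 0" using P by (auto simp: S_def)
  have "dd P (%i. f i x) c = 0" for x
  proof (rule ccontr)
   assume x: "dd P (%i. f i x) c ~= 0"
   have "polyfun J (%x. dd P (%i. f i x) c)"
    by (rule polyfun_compose[OF polyfun_dd[OF pP]]) (use f in auto)
   hence "EX z. dd P (%i. f i z) c ~= 0 & g z ~= 0"
    using polyfun_mult_neq_0[where f = "%x. dd P (%i. f i x) c" and g = g and a = x and b = a]
     g x by blast
   then obtain z where z: "dd P (%i. f i z) c ~= 0" "g z ~= 0" by blast
   have "(\<Sum>i<n. vscale (dd P (%i. f i z) (unit_vec i)) (w i z)) = 0"
   proof
    fix j
    show "(\<Sum>i<n. vscale (dd P (%i. f i z) (unit_vec i)) (w i z)) j = 0 j"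
    proof (cases "j \<in> J")
     case True
     have "(%x. P (%i. f i x)) = (%_. 0)" using P0 by auto
     hence "0 = dd (%x. P (%i. f i x)) z (unit_vec j)" by simp
     also have "\<dots> = dd P (%i. f i z) (%i. dd (f i) z (unit_vec j))"
      by (rule dd_compose[OF pP, where \<phi> = "%x i. f i x"]) (use f in auto)
     also have "\<dots> = (\<Sum>i<n. dd (f i) z (unit_vec j) * dd P (%i. f i z) (unit_vec i))"
      by (subst dd_coords[OF pP finite_lessThan]) (simp add: unit_vec_def)
     finally show ?thesis using True by (simp add: fun_arith w_def mult.commute)
    qed (simp add: fun_arith w_def)
   qed
   hence "\<forall>i<n. dd P (%i. f i z) (unit_vec i) = 0" using g(3)[OF z(2)] by (auto simp: indep_family_def)
   hence "dd P (%i. f i z) c = 0"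
    using dd_coords[OF pP finite_lessThan, of "%i. f i z" c] by (simp add: unit_vec_def)
   thus False using z by simp
  qed
  thus ?thesis using polyfun_dd[OF pP] by (auto simp: S_def)
 qed
 show ?thesis
  unfolding alg_indep_def
 proof (intro allI impI)
  fix P y assume P: "polyfun {..<n} P" "\<forall>x\<in>UNIV. P (%i. f i x) = 0"
  have "P \<in> S" using P by (auto simp: S_def)
  have "P (%i. f i a + 1 * (y i - f i a)) = 0"
   by (rule polyfun_zero_of_derivs[where S = S and J = "{..<n}" and f = P and a = "%i. f i a"
     and b = "%i. y i - f i a" and t = 1])
    (use cl \<open>P \<in> S\<close> in \<open>auto simp: S_def\<close>)
  thus "P y = 0" by simp
 qed
qed

section \<open>Projective closures and their cones\<close>

definition conical :: "('i => 'a::field) set => bool" where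
 "conical A \<longleftrightarrow> (\<forall>a\<in>A. ALL c. c ~= 0 --> vscale c a \<in> A)"

text \<open>The affine closure inside \<open>coord_space I\<close>, by all polynomial functions and
  not only homogeneous ones. For conical sets it gives the cone over the projective closure, see
  \<open>zariski_closure_projectivization\<close>.\<close>

definition acl :: "'i set => ('i => 'a::field) set => ('i => 'a) set" where
 "acl I A = {v \<in> coord_space I. ALL f. polyfun I f --> (\<forall>a\<in>A. f a = 0) --> f v = 0}"

lemma conicalD: "conical A ==> a \<in> A ==> c ~= 0 ==> vscale c a \<in> A"
 by (auto simp: conical_def)

lemma aclD: "v \<in> acl I A ==> polyfun I f ==> (!!a. a \<in> A ==> f a = 0) ==> f v = 0"
 by (auto simp: acl_def)

lemma acl_coord_space: "acl I A \<subseteq> coord_space I"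
 by (auto simp: acl_def)

lemma acl_superset: "A \<subseteq> coord_space I ==> A \<subseteq> acl I A"
 by (auto simp: acl_def)

lemma acl_mono: "A \<subseteq> B ==> acl I A \<subseteq> acl I B"
 unfolding acl_def by blast

lemma polyfun_vscale: "polyfun I f ==> polyfun I (%x. f (vscale c x))"
 by (erule polyfun_compose) (auto simp: vscale_apply intro: polyfun_intros)

lemma conical_acl: "conical A ==> conical (acl I A)"
 unfolding conical_def
proof (intro ballI allI impI)
 fix v c assume A: "\<forall>a\<in>A. ALL c. c ~= 0 --> vscale c a \<in> A" and v: "v \<in> acl I A" and c: "(c::'b) ~= 0"
 have "f (vscale c v) = 0" if "polyfun I f" "\<forall>a\<in>A. f a = 0" for f
  by (rule aclD[OF v polyfun_vscale[OF that(1)]]) (use A c that in auto)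
 thus "vscale c v \<in> acl I A" using v by (auto simp: acl_def coord_space_def vscale_apply)
qed

lemma ppoint_of_self: "v \<in> ppoint_of v"
 unfolding ppoint_of_def by (rule CollectI, rule exI[of _ 1]) simp

lemma ppoint_ofE: "w \<in> ppoint_of v ==> (!!c. c ~= 0 ==> w = vscale c v ==> thesis) ==> thesis"
 unfolding ppoint_of_def by blast

lemma ppoint_of_vscale:
 assumes "c ~= 0"
 shows "ppoint_of (vscale c v) = ppoint_of v"
proof (intro subset_antisym subsetI)
 fix w assume "w \<in> ppoint_of (vscale c v)"
 then obtain b where "b ~= 0" "w = vscale b (vscale c v)" by (rule ppoint_ofE)
 thus "w \<in> ppoint_of v" unfolding ppoint_of_def using assms
  by (intro CollectI exI[of _ "b * c"]) (simp add: vec.scale_scale)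
next
 fix w assume "w \<in> ppoint_of v"
 then obtain b where "b ~= 0" "w = vscale b v" by (rule ppoint_ofE)
 thus "w \<in> ppoint_of (vscale c v)" unfolding ppoint_of_def using assms
  by (intro CollectI exI[of _ "b / c"]) (simp add: vec.scale_scale)
qed

lemma projectivization_mem: "v \<in> W ==> v ~= 0 ==> ppoint_of v \<in> projectivization W"
 by (auto simp: projectivization_def)

lemma projectivizationE:
 "P \<in> projectivization W ==> (!!v. v \<in> W ==> v ~= 0 ==> P = ppoint_of v ==> thesis) ==> thesis"
 by (auto simp: projectivization_def)

lemma projectivization_mono: "V \<subseteq> W ==> projectivization V \<subseteq> projectivization W"
 by (auto simp: projectivization_def)

lemma projectivization_rep:
 assumes "P \<in> projectivization W" "conical W" "w \<in> P"
 shows "w \<in> W" "w ~= 0" "P = ppoint_of w"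
proof -
 obtain v where v: "v \<in> W" "v ~= 0" "P = ppoint_of v" using assms(1) by (rule projectivizationE)
 obtain c where c: "c ~= 0" "w = vscale c v" using assms(3) v ppoint_ofE by metis
 show "w \<in> W" "w ~= 0" "P = ppoint_of w" using v c assms ppoint_of_vscale[of c v]
  by (auto simp: conical_def)
qed

lemma conical_coord_space: "conical (coord_space I)"
 by (auto simp: conical_def coord_space_def vscale_apply)

lemma proj_space_rep:
 "P \<in> proj_space I ==> w \<in> P ==> w \<in> coord_space I & w ~= 0 & P = ppoint_of w"
 unfolding proj_space_def using projectivization_rep conical_coord_space by metis

text \<open>On a conical set the homogeneous components of a vanishing polynomial vanish too, so
  homogeneous equations suffice.\<close>

lemma zariski_closed_projectivization_acl:
 fixes A :: "('i => 'a::field_char_0) set"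
 assumes A: "conical A"
 shows "zariski_closed I (projectivization (acl I A))"
proof -
 define F where "F = {f \<in> polys I. (EX e. homogeneous e f) & (\<forall>a\<in>A. mpoly_eval f a = 0)}"
 have "projectivization (acl I A) = zero_locus I F"
 proof (intro subset_antisym subsetI)
  fix P assume P: "P \<in> projectivization (acl I A)"
  have "mpoly_eval f w = 0" if f: "f \<in> F" and w: "w \<in> P" for f w
   using aclD[OF projectivization_rep(1)[OF P conical_acl[OF A] w], of "mpoly_eval f"]
    polyfun_mpoly_eval f by (auto simp: F_def)
  moreover have "P \<in> proj_space I"
   using P projectivization_mono[OF acl_coord_space] unfolding proj_space_def by blast
  ultimately show "P \<in> zero_locus I F" by (auto simp: zero_locus_def)
 next
  fix P assume P: "P \<in> zero_locus I F"
  then obtain v where v: "v \<in> coord_space I" "v ~= 0" "P = ppoint_of v"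
   unfolding zero_locus_def proj_space_def by (auto elim: projectivizationE)
  have "f v = 0" if f: "polyfun I f" "\<forall>a\<in>A. f a = 0" for f
  proof -
   obtain p where p: "p \<in> polys I" "f = mpoly_eval p" using polyfun_imp_mpoly[OF f(1)] by blast
   have "graded_part mdeg e p \<in> F" for e
   proof -
    have "mpoly_eval (graded_part mdeg e p) a = 0" if a: "a \<in> A" for a
     by (rule graded_part_eval_eq_0[where \<phi> = "%c. vscale c a"])
      (use f p A a in \<open>auto simp: monom_eval_vscale conical_def\<close>)
    moreover have "homogeneous e (graded_part mdeg e p)"
     by (auto simp: homogeneous_def keys_graded_part)
    ultimately show ?thesis using graded_part_polys p by (auto simp: F_def)
   qed
   hence "mpoly_eval (graded_part mdeg e p) v = 0" for e
    using P v ppoint_of_self by (auto simp: zero_locus_def)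
   hence "mpoly_eval (\<Sum>e\<in>mdeg ` keys p. graded_part mdeg e p) v = 0"
    by (simp add: mpoly_eval_sum)
   thus ?thesis using sum_graded_part[of p mdeg] p by simp
  qed
  hence "v \<in> acl I A" using v by (auto simp: acl_def)
  thus "P \<in> projectivization (acl I A)" using v by (auto intro: projectivization_mem)
 qed
 moreover have "F \<subseteq> polys I" "\<forall>f\<in>F. EX e. homogeneous e f" by (auto simp: F_def)
 ultimately show ?thesis unfolding zariski_closed_def by blast
qed

text \<open>The factor \<open>x i\<close> accounts for constants, whose zero set contains no point but for which
  the origin of the cone is relevant.\<close>

lemma projectivization_acl_subset:
 assumes Z: "zariski_closed I Z" "projectivization A \<subseteq> Z"
 shows "projectivization (acl I A) \<subseteq> Z"
proof
 fix P assume P: "P \<in> projectivization (acl I A)"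
 then obtain v where v: "v \<in> acl I A" "v ~= 0" "P = ppoint_of v" by (rule projectivizationE)
 have vI: "v \<in> coord_space I" using v acl_coord_space by blast
 obtain i where i: "v i ~= 0" using v by (auto simp: fun_eq_iff)
 hence "i \<in> I" using vI by (auto simp: coord_space_def)
 obtain F where F: "F \<subseteq> polys I" "\<forall>f\<in>F. EX e. homogeneous e f" "Z = zero_locus I F"
  using Z unfolding zariski_closed_def by blast
 have "mpoly_eval f w = 0" if f: "f \<in> F" and w: "w \<in> P" for f w
 proof -
  have "v i * mpoly_eval f v = 0"
  proof (rule aclD[OF v(1)])
   show "polyfun I (%x. x i * mpoly_eval f x)"
    using f F \<open>i \<in> I\<close> by (intro polyfun_intros polyfun_mpoly_eval) auto
   fix a assume a: "a \<in> A"
   show "a i * mpoly_eval f a = 0"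
   proof (cases "a = 0")
    case False
    hence "ppoint_of a \<in> zero_locus I F" using a Z F projectivization_mem by blast
    thus ?thesis using f ppoint_of_self by (auto simp: zero_locus_def)
   qed simp
  qed
  moreover obtain e where "homogeneous e f" using F f by blast
  moreover obtain c where "w = vscale c v" using w v ppoint_ofE by metis
  ultimately show ?thesis using i by (simp add: homogeneous_eval_vscale)
 qed
 moreover have "P \<in> proj_space I" using vI v by (auto simp: proj_space_def intro: projectivization_mem)
 ultimately show "P \<in> Z" using F by (auto simp: zero_locus_def)
qed

lemma zariski_closure_projectivization:
 fixes A :: "('i => 'a::field_char_0) set"
 assumes "conical A" "A \<subseteq> coord_space I"
 shows "zariski_closure I (projectivization A) = projectivization (acl I A)"
proof (rule subset_antisym)
 show "zariski_closure I (projectivization A) \<subseteq> projectivization (acl I A)"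
  unfolding zariski_closure_def
  using zariski_closed_projectivization_acl[OF assms(1)] projectivization_mono[OF acl_superset[OF assms(2)]]
  by blast
 show "projectivization (acl I A) \<subseteq> zariski_closure I (projectivization A)"
  unfolding zariski_closure_def using projectivization_acl_subset[of I _ A] by blast
qed

lemma zariski_closed_subset_proj_space: "zariski_closed I Z ==> Z \<subseteq> proj_space I"
 by (auto simp: zariski_closed_def zero_locus_def)

lemma zariski_closed_mem:
 assumes Z: "zariski_closed I Z" and v: "v \<in> coord_space I" "v ~= 0"
  and f: "!!f. polyfun I f ==> (!!a. a \<in> \<Union>Z ==> f a = 0) ==> f v = 0"
 shows "ppoint_of v \<in> Z"
proof -
 obtain F where F: "F \<subseteq> polys I" "\<forall>f\<in>F. EX e. homogeneous e f" "Z = zero_locus I F"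
  using Z unfolding zariski_closed_def by blast
 have "mpoly_eval f w = 0" if fF: "f \<in> F" and w: "w \<in> ppoint_of v" for f w
 proof -
  have "mpoly_eval f v = 0"
  proof (rule f)
   show "polyfun I (mpoly_eval f)" using polyfun_mpoly_eval F(1) fF by blast
   show "mpoly_eval f a = 0" if "a \<in> \<Union>Z" for a
    using that fF unfolding F(3) zero_locus_def by blast
  qed
  moreover obtain e where "homogeneous e f" using F(2) fF by blast
  moreover obtain c where "w = vscale c v" using w by (auto elim: ppoint_ofE)
  ultimately show ?thesis by (simp add: homogeneous_eval_vscale)
 qed
 moreover have "ppoint_of v \<in> proj_space I" using v by (auto simp: proj_space_def intro: projectivization_mem)
 ultimately show ?thesis using F by (auto simp: zero_locus_def)
qed

lemma cone_vscale:
 assumes "Z \<subseteq> proj_space I" "v \<in> \<Union>Z" "c ~= 0"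
 shows "vscale c v \<in> \<Union>Z"
proof -
 obtain P where P: "P \<in> Z" "v \<in> P" using assms by blast
 hence "P = ppoint_of v" using proj_space_rep assms by blast
 thus ?thesis using P assms ppoint_of_self[of "vscale c v"] ppoint_of_vscale[of c v] by auto
qed

lemma conical_cone: "Z \<subseteq> proj_space I ==> conical (\<Union>Z)"
 unfolding conical_def using cone_vscale by blast

text \<open>Primality of the vanishing ideal, also for inhomogeneous polynomials. The points on
  whose representatives f, respectively g, vanishes identically form subsets \<open>C f\<close> and
  \<open>C g\<close> that cover \<open>Z\<close>: on a line through the origin where neither does,
  the product is non-zero at some non-zero vector. Their closures \<open>K f\<close> and
  \<open>K g\<close> retain the vanishing, and irreducibility applies to these.\<close>

lemma irreducible_closed_prime:
 fixes f g :: "('i => 'a::field_char_0) => 'a"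
 assumes Z: "irreducible_closed I Z" and f: "polyfun I f" and g: "polyfun I g"
  and fg: "!!v. v \<in> \<Union>Z ==> f v * g v = 0"
 shows "(\<forall>v\<in>\<Union>Z. f v = 0) \<or> (\<forall>v\<in>\<Union>Z. g v = 0)"
proof -
 have Zp: "Z \<subseteq> proj_space I"
  using Z zariski_closed_subset_proj_space by (auto simp: irreducible_closed_def)
 define C where "C = (%f. {P \<in> Z. \<forall>v\<in>P. (f v :: 'a) = 0})"
 define K where "K = (%f. projectivization (acl I (\<Union>(C f))))"
 have con: "conical (\<Union>(C f))" for f by (rule conical_cone[of _ I]) (use Zp in \<open>auto simp: C_def\<close>)
 have K: "zariski_closed I (K f)" for f unfolding K_def by (rule zariski_closed_projectivization_acl[OF con])
 have Kv: "f v = 0" if "polyfun I f" "P \<in> K f" "v \<in> P" for f P v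
 proof -
  have "v \<in> acl I (\<Union>(C f))" using projectivization_rep(1)[OF _ conical_acl[OF con]] that by (auto simp: K_def)
  thus ?thesis using that(1) by (rule aclD) (auto simp: C_def)
 qed
 have CK: "C f \<subseteq> K f" for f
 proof
  fix P assume P: "P \<in> C f"
  then obtain v where v: "v \<in> coord_space I" "v ~= 0" "P = ppoint_of v"
   using Zp by (auto simp: C_def proj_space_def elim!: projectivizationE)
  have "v \<in> acl I (\<Union>(C f))" using v P ppoint_of_self by (auto simp: acl_def)
  thus "P \<in> K f" using v by (auto simp: K_def intro: projectivization_mem)
 qed
 have "Z \<subseteq> C f \<union> C g"
 proof (rule subsetI, rule ccontr)
  fix P assume P: "P \<in> Z" "P \<notin> C f \<union> C g"
  then obtain v w where vw: "v \<in> P" "w \<in> P" "f v ~= 0" "g w ~= 0" by (auto simp: C_def)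
  have Pv: "P = ppoint_of v" using proj_space_rep Zp P vw by blast
  then obtain c where c: "c ~= 0" "w = vscale c v" using vw ppoint_ofE by metis
  obtain p q where p: "!!t. poly p t = f (%i. 0 + t * v i)" and q: "!!t. poly q t = g (%i. 0 + t * v i)"
   using polyfun_line[OF f, of "%_. 0" v] polyfun_line[OF g, of "%_. 0" v] by blast
  have "poly p 1 ~= 0" "poly q c ~= 0" unfolding p q using vw c by (auto simp: vscale_def)
  \<comment> \<open>The factor X keeps t away from 0, since the origin represents no point.\<close>
  hence "[:0, 1:] * p * q ~= 0" by auto
  then obtain t where t: "poly ([:0, 1:] * p * q) t ~= 0" by (meson poly_all_0_iff_0)
  hence "t ~= 0" "f (vscale t v) * g (vscale t v) ~= 0" using p q by (auto simp: vscale_def)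
  moreover have "vscale t v \<in> P" using \<open>t ~= 0\<close> Pv ppoint_of_self[of "vscale t v"] ppoint_of_vscale by metis
  ultimately show False using fg P by blast
 qed
 hence "Z \<subseteq> K f \<union> K g" using CK by blast
 hence "Z \<subseteq> K f \<or> Z \<subseteq> K g" using Z K by (auto simp: irreducible_closed_def)
 thus ?thesis using Kv f g by blast
qed

section \<open>Dimension of parametrized varieties\<close>

lemma polyfun_if:
 "(b ==> polyfun J f) ==> (\<not> b ==> polyfun J g) ==> polyfun J (%x. if b then f x else g x)"
 by (cases b) auto

lemma polyfun_decompose:
 assumes "polyfun {..<Suc n} P"
 shows "EX D p. (ALL a. polyfun {..<n} (p a)) & (ALL y. P y = (\<Sum>a\<le>D. p a y * y n ^ a))"
 using assms
proof (induction rule: polyfun.induct)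
 case (polyfun_const c)
 show ?case by (rule exI[of _ 0], rule exI[of _ "%_ _. c"]) (auto intro: polyfun.polyfun_const)
next
 case (polyfun_var i)
 show ?case
 proof (cases "i = n")
  case True
  show ?thesis
   by (rule exI[of _ 1], rule exI[of _ "%a _. if a = 1 then 1 else 0"])
    (auto simp: True intro: polyfun.polyfun_const)
 next
  case False
  thus ?thesis using polyfun_var
   by (intro exI[of _ 0] exI[of _ "%_ y. y i"]) (auto intro: polyfun.polyfun_var)
 qed
next
 case (polyfun_add f g)
 then obtain D p D' q where p: "!!a. polyfun {..<n} (p a)" "!!y. f y = (\<Sum>a\<le>D. p a y * y n ^ a)"
  and q: "!!a. polyfun {..<n} (q a)" "!!y. g y = (\<Sum>a\<le>D'. q a y * y n ^ a)" by blast
 define r where "r = (%a y. (if a <= D then p a y else 0) + (if a <= D' then q a y else 0))"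
 have "polyfun {..<n} (r a)" for a
  unfolding r_def by (intro polyfun.polyfun_add polyfun_if p(1) q(1) polyfun_const)
 moreover have "f y + g y = (\<Sum>a\<le>D + D'. r a y * y n ^ a)" for y
 proof -
  have "f y = (\<Sum>a\<le>D + D'. (if a <= D then p a y else 0) * y n ^ a)"
   unfolding p by (rule sum.mono_neutral_cong_left) auto
  moreover have "g y = (\<Sum>a\<le>D + D'. (if a <= D' then q a y else 0) * y n ^ a)"
   unfolding q by (rule sum.mono_neutral_cong_left) auto
  ultimately show ?thesis by (simp add: r_def sum.distrib[symmetric] distrib_right)
 qed
 ultimately show ?case by blast
next
 case (polyfun_mult f g)
 then obtain D p D' q where p: "!!a. polyfun {..<n} (p a)" "!!y. f y = (\<Sum>a\<le>D. p a y * y n ^ a)"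
  and q: "!!a. polyfun {..<n} (q a)" "!!y. g y = (\<Sum>a\<le>D'. q a y * y n ^ a)" by blast
 define r where "r = (%c y. \<Sum>a\<le>D. \<Sum>b\<le>D'. if a + b = c then p a y * q b y else 0)"
 have "polyfun {..<n} (%y. if a + b = c then p a y * q b y else 0)" for a b c
  by (intro polyfun_if polyfun.polyfun_mult p(1) q(1) polyfun_const)
 hence "polyfun {..<n} (r c)" for c
  unfolding r_def by (intro polyfun_sum)
 moreover have "f y * g y = (\<Sum>c\<le>D + D'. r c y * y n ^ c)" for y
 proof -
  have "(\<Sum>c\<le>D + D'. r c y * y n ^ c) =
   (\<Sum>c\<le>D + D'. \<Sum>a\<le>D. \<Sum>b\<le>D'. if a + b = c then p a y * q b y * y n ^ c else 0)"
   unfolding r_def sum_distrib_right by (intro sum.cong) auto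
  also have "\<dots> = (\<Sum>a\<le>D. \<Sum>b\<le>D'. \<Sum>c\<le>D + D'. if a + b = c then p a y * q b y * y n ^ c else 0)"
   by (subst sum.swap, rule sum.cong[OF refl], rule sum.swap)
  also have "\<dots> = (\<Sum>a\<le>D. \<Sum>b\<le>D'. p a y * q b y * y n ^ (a + b))"
   by (intro sum.cong refl) (auto simp: sum.delta')
  also have "\<dots> = f y * g y" unfolding p q sum_product by (simp add: power_add mult_ac)
  finally show ?thesis by simp
 qed
 ultimately show ?case by blast
qed

text \<open>Turns a chain into functions on the cone over its top member. The extra function beyond
  the length is a coordinate, which takes all non-zero values on a line through the origin. Each
  step adds a function f that vanishes on the smaller set but not on the larger one: in a relation
  expanded in powers of f, the constant coefficient vanishes on the smaller cone, hence identically,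
  and irreducibility of the larger set allows division by f.\<close>

lemma chain_alg_indep:
 fixes Z :: "nat => ('i, 'a::field_char_0) ppoint set"
 assumes "!!j. j <= l ==> irreducible_closed I (Z j)" "!!j. j < l ==> Z j \<subset> Z (Suc j)"
 shows "EX h. (\<forall>j\<le>l. polyfun I (h j)) & alg_indep (\<Union>(Z l)) (Suc l) h"
 using assms
proof (induction l)
 case 0
 hence Z: "zariski_closed I (Z 0)" "Z 0 ~= {}" by (auto simp: irreducible_closed_def)
 then obtain P where "P \<in> Z 0" "P \<in> proj_space I" using zariski_closed_subset_proj_space by blast
 then obtain v where v: "v \<in> coord_space I" "v ~= 0" "ppoint_of v \<in> Z 0"
  by (auto simp: proj_space_def elim: projectivizationE)
 obtain i where i: "v i ~= 0" using v by (auto simp: fun_eq_iff)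
 have "alg_indep (\<Union>(Z 0)) 1 (%_ x. x i)"
  unfolding alg_indep_def
 proof (intro allI impI)
  fix P :: "(nat => 'a) => 'a" and y :: "nat => 'a"
  assume P: "polyfun {..<1} P" "\<forall>x\<in>\<Union>(Z 0). P (%_. x i) = 0"
  obtain q where q: "!!t. poly q t = P (%_. 0 + t * 1)" using polyfun_line[OF P(1), of "%_. 0" "%_. 1"] by blast
  have "poly q t = 0" if "t ~= 0" for t
  proof -
   have "vscale (t / v i) v \<in> \<Union>(Z 0)" using v i that ppoint_of_self[of v]
    by (intro cone_vscale[of _ I] zariski_closed_subset_proj_space Z) auto
   hence "P (%_. vscale (t / v i) v i) = 0" using P by blast
   thus ?thesis using i q by (simp add: vscale_apply)
  qed
  hence "poly ([:0, 1:] * q) t = 0" for t by (cases "t = 0") auto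
  hence "[:0, 1:] * q = 0" by (meson poly_all_0_iff_0)
  hence "poly q (y 0) = 0" by simp
  moreover have "P y = P (%_. y 0)" by (rule polyfun_cong[OF P(1)]) auto
  ultimately show "P y = 0" using q by simp
 qed
 moreover have "i \<in> I" using i v by (auto simp: coord_space_def)
 ultimately show ?case by (auto intro: polyfun_var)
next
 case (Suc l)
 then obtain h where h: "!!j. j <= l ==> polyfun I (h j)" "alg_indep (\<Union>(Z l)) (Suc l) h" by force
 let ?Z' = "Z (Suc l)"
 have irr: "irreducible_closed I ?Z'" and cl: "zariski_closed I (Z l)"
  using Suc.prems(1)[of "Suc l"] Suc.prems(1)[of l] by (auto simp: irreducible_closed_def)
 hence Z'p: "?Z' \<subseteq> proj_space I" by (auto simp: irreducible_closed_def dest: zariski_closed_subset_proj_space)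
 obtain P where P: "P \<in> ?Z'" "P \<notin> Z l" using Suc.prems(2)[of l] by blast
 then obtain v where v: "v \<in> coord_space I" "v ~= 0" "P = ppoint_of v" using Z'p
  by (auto simp: proj_space_def elim: projectivizationE)
 obtain f where f: "polyfun I f" "!!a. a \<in> \<Union>(Z l) ==> f a = 0" "f v ~= 0"
  using zariski_closed_mem[OF cl v(1,2)] P v by blast
 have sub: "\<Union>(Z l) \<subseteq> \<Union>?Z'" using Suc.prems(2)[of l] by blast
 have coeffs: "\<forall>a\<le>D. ALL y. p a y = 0" if "!!a. polyfun {..<Suc l} (p a)"
  "!!x. x \<in> \<Union>?Z' ==> (\<Sum>a\<le>D. p a (%j. h j x) * f x ^ a) = 0" for D p
  using that
 proof (induction D arbitrary: p)
  case 0
  have "p 0 (%j. h j x) = 0" if "x \<in> \<Union>(Z l)" for x using 0(2)[of x] that sub by auto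
  thus ?case using alg_indepD[OF h(2) 0(1)] by blast
 next
  case (Suc D)
  have "p 0 (%j. h j x) = 0" if "x \<in> \<Union>(Z l)" for x
   using Suc.prems(2)[of x] that sub f(2)[OF that] by (auto simp: power_0_left if_distrib cong: if_cong)
  hence p0: "p 0 y = 0" for y using alg_indepD[OF h(2) Suc.prems(1)] by blast
  define g where "g = (%x. \<Sum>a\<le>D. p (Suc a) (%j. h j x) * f x ^ a)"
  have "polyfun I (%x. p a (%j. h j x))" for a
   by (rule polyfun_compose[OF Suc.prems(1), where \<phi> = "%x j. h j x"]) (use h in auto)
  hence "polyfun I g" unfolding g_def by (intro polyfun_sum polyfun_mult polyfun_power f)
  moreover have "f x * g x = 0" if "x \<in> \<Union>?Z'" for x
   using Suc.prems(2)[OF that] unfolding sum.atMost_Suc_shift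
   by (simp add: p0 g_def sum_distrib_left mult_ac)
  ultimately have "(\<forall>v\<in>\<Union>?Z'. f v = 0) \<or> (\<forall>v\<in>\<Union>?Z'. g v = 0)"
   using irreducible_closed_prime[OF irr f(1)] by blast
  moreover have "v \<in> \<Union>?Z'" using P v ppoint_of_self by blast
  ultimately have g0: "g x = 0" if "x \<in> \<Union>?Z'" for x using f(3) that by blast
  have IH: "\<forall>a\<le>D. ALL y. p (Suc a) y = 0"
  proof (rule Suc.IH)
   show "polyfun {..<Suc l} (p (Suc a))" for a by (rule Suc.prems(1))
   show "(\<Sum>a\<le>D. p (Suc a) (%j. h j x) * f x ^ a) = 0" if "x \<in> \<Union>?Z'" for x
    using g0[OF that] by (simp add: g_def)
  qed
  show ?case
  proof (intro allI impI)
   fix a y assume "a <= Suc D"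
   thus "p a y = 0" using p0 IH by (cases a) auto
  qed
 qed
 define h' where "h' = h(Suc l := f)"
 have "alg_indep (\<Union>?Z') (Suc (Suc l)) h'"
  unfolding alg_indep_def
 proof (intro allI impI)
  fix P y assume P: "polyfun {..<Suc (Suc l)} P" "\<forall>x\<in>\<Union>?Z'. P (%i. h' i x) = 0"
  obtain D p where p: "!!a. polyfun {..<Suc l} (p a)" "!!y. P y = (\<Sum>a\<le>D. p a y * y (Suc l) ^ a)"
   using polyfun_decompose[OF P(1)] by blast
  have "\<forall>a\<le>D. ALL y. p a y = 0"
  proof (rule coeffs[OF p(1)])
   fix x assume x: "x \<in> \<Union>?Z'"
   have "p a (%i. h' i x) = p a (%i. h i x)" for a
    by (rule polyfun_cong[OF p(1)]) (auto simp: h'_def)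
   moreover have "P (%i. h' i x) = 0" using P x by blast
   ultimately show "(\<Sum>a\<le>D. p a (%j. h j x) * f x ^ a) = 0" by (simp add: p(2)) (simp add: h'_def)
  qed
  thus "P y = 0" by (simp add: p(2))
 qed
 moreover have "\<forall>j\<le>Suc l. polyfun I (h' j)" using h f by (auto simp: h'_def le_Suc_eq)
 ultimately show ?case by blast
qed

section \<open>The differential of a polynomial parametrization\<close>

definition dmap :: "(('j => 'a::field_char_0) => 'i => 'a) => ('j => 'a) => ('j => 'a) => 'i => 'a" where
 "dmap \<Phi> a b = (%i. dd (%t. \<Phi> t i) a b)"

lemma dd_sum_dir:
 "polyfun J f ==> dd f a (%i. \<Sum>k\<in>K. c k * b k i) = (\<Sum>k\<in>K. c k * dd f a (b k))"
proof (induction K rule: infinite_finite_induct)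
 case (insert x F)
 thus ?case using dd_lin[of J f a "c x" "b x" 1 "%i. \<Sum>k\<in>F. c k * b k i"] by simp
qed auto

lemma linear_dmap:
 assumes "!!i. polyfun J (%t. \<Phi> t i)"
 shows "Vector_Spaces.linear vscale vscale (dmap \<Phi> a)"
proof -
 have "dmap \<Phi> a = (%b i. if i \<in> UNIV then dd (%t. \<Phi> t i) a b else 0)" by (simp add: dmap_def fun_eq_iff)
 thus ?thesis using linear_dd[of UNIV J "%i t. \<Phi> t i" a] assms by simp
qed

lemma dmap_coord_space: "(!!t. \<Phi> t \<in> coord_space I) ==> dmap \<Phi> a b \<in> coord_space I"
 by (simp add: coord_space_def dmap_def)

lemma dmap_coords:
 assumes "finite J" "!!i. polyfun J (%t. \<Phi> t i)"
 shows "dmap \<Phi> a b = (\<Sum>j\<in>J. vscale (b j) (dmap \<Phi> a (unit_vec j)))"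
proof
 fix i
 show "dmap \<Phi> a b i = (\<Sum>j\<in>J. vscale (b j) (dmap \<Phi> a (unit_vec j))) i"
  using dd_coords[OF assms(2)[of i] assms(1), of a b] by (simp add: dmap_def fun_arith unit_vec_def)
qed

lemma range_dmap:
 assumes "finite J" "!!i. polyfun J (%t. \<Phi> t i)"
 shows "range (dmap \<Phi> a) = vec.span ((%j. dmap \<Phi> a (unit_vec j)) ` J)"
proof (rule subset_antisym)
 show "range (dmap \<Phi> a) \<subseteq> vec.span ((%j. dmap \<Phi> a (unit_vec j)) ` J)"
 proof
  fix x assume "x \<in> range (dmap \<Phi> a)"
  then obtain b where x: "x = dmap \<Phi> a b" by blast
  show "x \<in> vec.span ((%j. dmap \<Phi> a (unit_vec j)) ` J)"
   unfolding x dmap_coords[where \<Phi> = \<Phi> and b = b, OF assms]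
   by (intro vec.span_sum vec.span_scale vec.span_base) auto
 qed
 interpret Vector_Spaces.linear vscale vscale "dmap \<Phi> a" by (rule linear_dmap[OF assms(2)])
 have "vec.subspace (range (dmap \<Phi> a))" by (rule subspace_image) simp
 thus "vec.span ((%j. dmap \<Phi> a (unit_vec j)) ` J) \<subseteq> range (dmap \<Phi> a)"
  by (intro vec.span_minimal) auto
qed

lemma dim_dmap_open:
 fixes \<Phi> :: "('j => 'a::field_char_0) => 'i => 'a"
 assumes "finite J" "!!i. polyfun J (%t. \<Phi> t i)" "finite I" "!!t. \<Phi> t \<in> coord_space I"
 shows "EX g. polyfun J g & g a ~= 0 &
  (ALL t. g t ~= 0 --> vec.dim (range (dmap \<Phi> a)) <= vec.dim (range (dmap \<Phi> t)))"
proof -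
 have eq: "vec.dim (range (dmap \<Phi> t)) = vec.dim ((%j. dmap \<Phi> t (unit_vec j)) ` J)" for t
  by (subst range_dmap[OF assms(1,2)]) (rule vec.dim_span)
 have "polyfun J (%t. dmap \<Phi> t (unit_vec j) i)" for i j
  unfolding dmap_def by (rule polyfun_dd[OF assms(2)])
 moreover have cs: "dmap \<Phi> t b \<in> coord_space I" for t b by (rule dmap_coord_space[OF assms(4)])
 ultimately show ?thesis unfolding eq
  by (intro dim_family_open[where I = I and w = "%j t. dmap \<Phi> t (unit_vec j)"])
   (use assms(1,3) cs in auto)
qed

text \<open>The l + 1 functions of \<open>chain_alg_indep\<close> stay independent after pulling
  back along \<Phi>. The Jacobian criterion yields directions dual to them, whose images under the
  differential are independent, so l + 1 is at most the rank; the difference of one passes from the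
  cone to the projective set.\<close>

lemma zariski_dim_param_le:
 fixes \<Phi> :: "('j => 'a::field_char_0) => 'i => 'a"
 assumes J: "finite J" and I: "finite I"
  and pf: "!!i. polyfun J (%t. \<Phi> t i)" and supp: "!!t. \<Phi> t \<in> coord_space I"
  and con: "conical (range \<Phi>)" and r: "!!a. vec.dim (range (dmap \<Phi> a)) <= r"
 shows "zariski_dim I (projectivization (acl I (range \<Phi>))) <= enat (r - 1)"
 unfolding zariski_dim_def
proof (rule Sup_least)
 let ?X = "projectivization (acl I (range \<Phi>))"
 fix x assume "x \<in> {enat l |l. EX Z. (\<forall>j\<le>l. irreducible_closed I (Z j) & Z j \<subseteq> ?X) & (\<forall>j<l. Z j \<subset> Z (Suc j))}"
 then obtain l Z where x: "x = enat l" and irr: "!!j. j <= l ==> irreducible_closed I (Z j)"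
  and ZX: "!!j. j <= l ==> Z j \<subseteq> ?X" and st: "!!j. j < l ==> Z j \<subset> Z (Suc j)" by blast
 from chain_alg_indep[of l I Z, OF irr st] obtain h
  where h: "!!j. j <= l ==> polyfun I (h j)" "alg_indep (\<Union>(Z l)) (Suc l) h" by blast
 have "alg_indep UNIV (Suc l) (%j t. h j (\<Phi> t))"
  unfolding alg_indep_def
 proof (intro allI impI)
  fix P y assume P: "polyfun {..<Suc l} P" "\<forall>t\<in>UNIV. P (%j. h j (\<Phi> t)) = 0"
  show "P y = 0"
  proof (rule alg_indepD[OF h(2) P(1)])
   fix v assume "v \<in> \<Union>(Z l)"
   then obtain Q where "Q \<in> ?X" "v \<in> Q" using ZX[of l] by blast
   hence "v \<in> acl I (range \<Phi>)" using projectivization_rep(1)[OF _ conical_acl[OF con]] by blast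
   moreover have "polyfun I (%v. P (%j. h j v))"
    by (rule polyfun_compose[OF P(1), where \<phi> = "%v j. h j v"]) (use h in auto)
   ultimately show "P (%j. h j v) = 0" by (rule aclD) (use P in auto)
  qed
 qed
 moreover have pf': "polyfun J (%t. h j (\<Phi> t))" if "j < Suc l" for j
  by (rule polyfun_compose[OF h(1)]) (use pf that in auto)
 ultimately have "EX a b. \<forall>i<Suc l. \<forall>k<Suc l. dd (%t. h i (\<Phi> t)) a (b k) = (if i = k then 1 else 0)"
  by (intro alg_indep_jacobian[OF J])
 then obtain a b where ab: "!!i k. i < Suc l ==> k < Suc l ==>
   dd (%t. h i (\<Phi> t)) a (b k) = (if i = k then 1 else 0)" by blast
 have hd: "dd (%t. h i (\<Phi> t)) a b = dd (h i) (\<Phi> a) (dmap \<Phi> a b)" if "i <= l" for i b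
  unfolding dmap_def by (rule dd_compose[OF h(1)[OF that]]) (rule pf)
 have "indep_family {..<Suc l} (%k. dmap \<Phi> a (b k))"
  unfolding indep_family_def
 proof (intro allI impI ballI)
  fix c k assume c: "(\<Sum>k<Suc l. vscale (c k) (dmap \<Phi> a (b k))) = 0" and k: "k \<in> {..<Suc l}"
  hence kl: "k <= l" by auto
  define b' where "b' = (%i. \<Sum>k<Suc l. c k * b k i)"
  interpret L: Vector_Spaces.linear vscale vscale "dmap \<Phi> a" by (rule linear_dmap[OF pf])
  have b': "b' = (\<Sum>k<Suc l. vscale (c k) (b k))" by (simp add: b'_def fun_eq_iff fun_arith)
  have "dmap \<Phi> a b' = 0" using c by (simp add: b' L.sum L.scale del: sum.lessThan_Suc)
  hence "dd (h k) (\<Phi> a) (dmap \<Phi> a b') = 0" by (simp add: zero_fun_def)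
  hence 0: "dd (%t. h k (\<Phi> t)) a b' = 0" using hd[OF kl] by simp
  have "dd (%t. h k (\<Phi> t)) a b' = (\<Sum>i<Suc l. c i * dd (%t. h k (\<Phi> t)) a (b i))"
   unfolding b'_def by (rule dd_sum_dir[OF pf']) (use k in auto)
  also have "\<dots> = (\<Sum>i<Suc l. if i = k then c i else 0)"
   using ab k by (intro sum.cong) auto
  also have "\<dots> = c k" using k by (subst sum.delta) auto
  finally show "c k = 0" using 0 by simp
 qed
 hence "card {..<Suc l} <= vec.dim (range (dmap \<Phi> a))"
  by (rule indep_family_card_le[where I = I])
   (use dmap_coord_space[of \<Phi> I] supp I in \<open>auto intro!: vec.span_base\<close>)
 thus "x <= enat (r - 1)" using r[of a] x by simp
qed

text \<open>The parameter space is irreducible: two polynomials that are not zero along \<Psi> are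
  non-zero at a common parameter. A coordinate of \<Psi> is included as a third factor so that the
  image there is a point of projective space.\<close>

lemma irreducible_closed_param:
 fixes \<Psi> :: "('j => 'a::field_char_0) => 'i => 'a"
 assumes pf: "!!i. polyfun J (%t. \<Psi> t i)" and supp: "!!t. \<Psi> t \<in> coord_space I"
  and con: "conical (range \<Psi>)" and nz: "\<Psi> a ~= 0"
 shows "irreducible_closed I (projectivization (acl I (range \<Psi>)))"
proof -
 let ?Z = "projectivization (acl I (range \<Psi>))"
 have R: "range \<Psi> \<subseteq> acl I (range \<Psi>)" by (rule acl_superset) (use supp in auto)
 have "?Z ~= {}" using R nz projectivization_mem[of "\<Psi> a" "acl I (range \<Psi>)"] by blast
 moreover have "?Z \<subseteq> A \<or> ?Z \<subseteq> B"
  if A: "zariski_closed I A" and B: "zariski_closed I B" and AB: "?Z \<subseteq> A \<union> B" for A B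
 proof (rule ccontr)
  assume n: "\<not> (?Z \<subseteq> A \<or> ?Z \<subseteq> B)"
  have ex: "EX f t. polyfun I f & (\<forall>v\<in>\<Union>C. f v = 0) & f (\<Psi> t) ~= 0"
   if C: "zariski_closed I C" and nC: "\<not> ?Z \<subseteq> C" for C
  proof (rule ccontr)
   assume no: "\<not> ?thesis"
   have "?Z \<subseteq> C"
   proof
    fix P assume "P \<in> ?Z"
    then obtain v where v: "v \<in> acl I (range \<Psi>)" "v ~= 0" "P = ppoint_of v" by (rule projectivizationE)
    have "ppoint_of v \<in> C"
    proof (rule zariski_closed_mem[OF C])
     show "v \<in> coord_space I" using v acl_coord_space by blast
     fix f assume f: "polyfun I f" "!!a. a \<in> \<Union>C ==> f a = 0"
     show "f v = 0" by (rule aclD[OF v(1) f(1)]) (use no f in blast)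
    qed (use v in auto)
    thus "P \<in> C" using v by simp
   qed
   thus False using nC by simp
  qed
  obtain f t where f: "polyfun I f" "!!v. v \<in> \<Union>A ==> f v = 0" "f (\<Psi> t) ~= 0" using ex[OF A] n by blast
  obtain g u where g: "polyfun I g" "!!v. v \<in> \<Union>B ==> g v = 0" "g (\<Psi> u) ~= 0" using ex[OF B] n by blast
  obtain i where i: "\<Psi> a i ~= 0" using nz by (auto simp: fun_eq_iff)
  define F where "F = (%k::nat. if k = 0 then (%t. f (\<Psi> t)) else if k = 1 then (%t. g (\<Psi> t)) else (%t. \<Psi> t i))"
  have "EX x. \<forall>k\<in>{0,1,2}. F k x ~= 0"
  proof (rule polyfun_prod_neq_0[where J = J])
   show "polyfun J (F k)" for k
    using polyfun_compose[OF f(1) pf] polyfun_compose[OF g(1) pf] pf by (simp add: F_def)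
   show "EX x. F k x ~= 0" if "k \<in> {0,1,2}" for k using that f(3) g(3) i by (auto simp: F_def)
  qed simp
  then obtain x where x: "f (\<Psi> x) ~= 0" "g (\<Psi> x) ~= 0" "\<Psi> x i ~= 0" by (auto simp: F_def)
  hence "\<Psi> x ~= 0" by auto
  hence "ppoint_of (\<Psi> x) \<in> ?Z" using R by (intro projectivization_mem) auto
  hence "\<Psi> x \<in> \<Union>A \<or> \<Psi> x \<in> \<Union>B" using AB ppoint_of_self[of "\<Psi> x"] by blast
  thus False using f g x by blast
 qed
 ultimately show ?thesis
  using zariski_closed_projectivization_acl[OF con] unfolding irreducible_closed_def by blast
qed

text \<open>As many linear coordinates as the rank of \<Psi>' are algebraically independent along
  \<Psi>', but dependent along \<Psi>, which has too few parameters. The resulting relation holds on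
  the closure of the image of \<Psi> and fails on the image of \<Psi>'.\<close>

lemma param_strict:
 fixes \<Psi> :: "('j => 'a::field_char_0) => 'i => 'a" and \<Psi>' :: "('k => 'a) => 'i => 'a"
 assumes J: "finite J" "finite J'" and I: "finite I"
  and pf: "!!i. polyfun J (%t. \<Psi> t i)" "!!i. polyfun J' (%t. \<Psi>' t i)"
  and supp: "!!t. \<Psi>' t \<in> coord_space I"
  and r: "card J < vec.dim (range (dmap \<Psi>' a))"
 shows "\<not> range \<Psi>' \<subseteq> acl I (range \<Psi>)"
proof
 assume sub: "range \<Psi>' \<subseteq> acl I (range \<Psi>)"
 let ?n = "vec.dim (range (dmap \<Psi>' a))"
 have sub0: "range (dmap \<Psi>' a) \<subseteq> coord_space I" using dmap_coord_space[of \<Psi>' I, OF supp] by blast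
 from coord_space_basis[OF sub0 I] obtain C where CC: "C \<subseteq> range (dmap \<Psi>' a)" "vec.independent C"
  "range (dmap \<Psi>' a) \<subseteq> vec.span C" "card C = ?n" "finite C" .
 note C = CC(1,2,4,5)
 obtain u where u: "bij_betw u {..<?n} C" using ex_bij_betw_nat_finite[OF C(4)] C(3) by (auto simp: atLeast0LessThan)
 have uC: "u k \<in> C" if "k < ?n" for k using u that by (auto simp: bij_betw_def)
 have "\<forall>k\<in>{..<?n}. EX b. dmap \<Psi>' a b = u k" using C(1) uC by (fastforce simp: image_iff)
 from bchoice[OF this] obtain b where b: "!!k. k < ?n ==> dmap \<Psi>' a (b k) = u k" by auto
 have CI: "C \<subseteq> coord_space I" using C(1) sub0 by blast
 have "\<forall>i\<in>{..<?n}. \<exists>\<gamma>. \<gamma> \<in> coord_space I & (\<forall>c\<in>C. dotp I \<gamma> c = (if c = u i then 1 else 0))"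
 proof
  fix i
  show "\<exists>\<gamma>. \<gamma> \<in> coord_space I & (\<forall>c\<in>C. dotp I \<gamma> c = (if c = u i then 1 else 0))"
   using dual_extend[OF C(2) CI I, of "%c. if c = u i then 1 else 0"] by blast
 qed
 from bchoice[OF this] obtain \<gamma> where \<gamma>: "!!i c. i < ?n ==> c \<in> C ==> dotp I (\<gamma> i) c = (if c = u i then 1 else 0)"
  by auto
 have pd: "polyfun I (%v. dotp I (\<gamma> i) v)" for i
  unfolding dotp_def by (intro polyfun_sum polyfun_cmult polyfun_var)
 have "alg_indep UNIV ?n (%i t. dotp I (\<gamma> i) (\<Psi>' t))"
 proof (rule jacobian_alg_indep[OF J(2)])
  show "polyfun J' (%t. dotp I (\<gamma> i) (\<Psi>' t))" for i by (rule polyfun_compose[OF pd pf(2)])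
  fix i k assume ik: "i < ?n" "k < ?n"
  have "dd (%t. dotp I (\<gamma> i) (\<Psi>' t)) a (b k) = (\<Sum>l\<in>I. \<gamma> i l * dmap \<Psi>' a (b k) l)"
   unfolding dotp_def dmap_def
   by (subst dd_sum[of _ J']) (auto simp: dd_cmult[OF pf(2)] intro: polyfun_cmult pf)
  also have "\<dots> = dotp I (\<gamma> i) (u k)" by (simp add: dotp_def b[OF ik(2)])
  also have "\<dots> = (if u k = u i then 1 else 0)" by (rule \<gamma>[OF ik(1) uC[OF ik(2)]])
  also have "\<dots> = (if i = k then 1 else 0)"
   using u ik by (auto simp: bij_betw_def inj_on_def)
  finally show "dd (%t. dotp I (\<gamma> i) (\<Psi>' t)) a (b k) = (if i = k then 1 else 0)" .
 qed
 moreover have "\<not> alg_indep UNIV ?n (%i t. dotp I (\<gamma> i) (\<Psi> t))"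
  using alg_indep_card_le[OF J(1), of ?n "%i t. dotp I (\<gamma> i) (\<Psi> t)" UNIV] polyfun_compose[OF pd pf(1)] r by auto
 then obtain P y where P: "polyfun {..<?n} P" "!!t. P (%i. dotp I (\<gamma> i) (\<Psi> t)) = 0" "P y ~= 0"
  unfolding alg_indep_def by blast
 have "P (%i. dotp I (\<gamma> i) (\<Psi>' t)) = 0" for t
 proof (rule aclD[where f = "%v. P (%i. dotp I (\<gamma> i) v)" and v = "\<Psi>' t" and A = "range \<Psi>" and I = I])
  show "\<Psi>' t \<in> acl I (range \<Psi>)" using sub by blast
  show "polyfun I (%v. P (%i. dotp I (\<gamma> i) v))"
   by (rule polyfun_compose[OF P(1), where \<phi> = "%v i. dotp I (\<gamma> i) v"]) (rule pd)
 qed (use P in auto)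
 ultimately show False using P unfolding alg_indep_def by blast
qed

text \<open>The chain witnessing the dimension consists of the closures of the images of a flag of
  affine subspaces of the parameter space, transversal at a generic point to the kernel of the
  differential.\<close>

theorem zariski_dim_param:
 fixes \<Phi> :: "('j => 'a::field_char_0) => 'i => 'a"
 assumes J: "finite J" and I: "finite I"
  and pf: "!!i. polyfun J (%t. \<Phi> t i)" and supp: "!!t. \<Phi> t \<in> coord_space I"
  and cone: "!!t c. EX t'. \<Phi> t' = vscale c (\<Phi> t)" and euler: "!!t. \<Phi> t \<in> range (dmap \<Phi> t)"
  and r: "!!a. vec.dim (range (dmap \<Phi> a)) <= r" "vec.dim (range (dmap \<Phi> a0)) = r" "r >= 1"
 shows "zariski_dim I (projectivization (acl I (range \<Phi>))) = enat (r - 1)"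
proof (rule antisym)
 have con: "conical (range \<Phi>)" unfolding conical_def using cone by (metis rangeE rangeI)
 show "zariski_dim I (projectivization (acl I (range \<Phi>))) <= enat (r - 1)"
  by (rule zariski_dim_param_le[OF J I pf supp con r(1)])
 have "EX t i. \<Phi> t i ~= 0"
 proof (rule ccontr)
  assume "\<not> (EX t i. \<Phi> t i ~= 0)"
  hence "dmap \<Phi> a0 b = 0" for b by (simp add: dmap_def fun_eq_iff)
  hence "range (dmap \<Phi> a0) \<subseteq> vec.span {}" by auto
  from vec.dim_le_card[OF this] show False using r by simp
 qed
 then obtain t1 i1 where t1: "\<Phi> t1 i1 ~= 0" by blast
 obtain g where g: "polyfun J g" "g a0 ~= 0" "!!t. g t ~= 0 ==> r <= vec.dim (range (dmap \<Phi> t))"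
  using dim_dmap_open[of J \<Phi> I a0, OF J pf I supp] r(2) by blast
 have "EX a. g a ~= 0 & \<Phi> a i1 ~= 0"
  by (rule polyfun_mult_neq_0[where f = g and g = "%a. \<Phi> a i1", OF g(1) pf g(2) t1])
 then obtain a where a: "g a ~= 0" "\<Phi> a i1 ~= 0" by blast
 let ?V = "range (dmap \<Phi> a)"
 have dV: "vec.dim ?V = r" using g(3)[OF a(1)] r(1)[of a] by simp
 have VI: "?V \<subseteq> coord_space I" using dmap_coord_space[of \<Phi> I, OF supp] by blast
 \<comment> \<open>By \<open>euler\<close> the vector \<open>\<Phi> a\<close> is itself tangent. It
   is placed into the basis first, because it will be the derivative of the scaling parameter; the
   other r - 1 vectors are realized by moving a.\<close>
 have "vec.independent {\<Phi> a}" using a by auto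
 from vec.maximal_independent_subset_extend[OF _ this, of ?V] euler[of a] obtain C
  where C: "{\<Phi> a} \<subseteq> C" "C \<subseteq> ?V" "vec.independent C" "?V \<subseteq> vec.span C" by auto
 have cC: "card C = r" using vec.basis_card_eq_dim[OF C(2,4,3)] dV by simp
 have fC: "finite C" using independent_card_le[OF C(3) _ VI I] C(2) vec.span_superset[of ?V] by blast
 have "card (C - {\<Phi> a}) = r - 1" using C(1) cC fC by simp
 then obtain u where u: "bij_betw u {..<r - 1} (C - {\<Phi> a})"
  using ex_bij_betw_nat_finite[of "C - {\<Phi> a}"] fC by (auto simp: atLeast0LessThan)
 have uC: "u k \<in> C - {\<Phi> a}" if "k < r - 1" for k using u that by (auto simp: bij_betw_def)
 have "\<forall>k\<in>{..<r - 1}. EX b. dmap \<Phi> a b = u k"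
 proof
  fix k assume "k \<in> {..<r - 1}"
  hence "u k \<in> ?V" using uC[of k] C(2) by auto
  thus "EX b. dmap \<Phi> a b = u k" by (metis rangeE)
 qed
 from bchoice[OF this] obtain b where b: "!!k. k < r - 1 ==> dmap \<Phi> a (b k) = u k" by auto
 \<comment> \<open>An affine subspace through a with m directions. Together with the scaling factor
   \<open>s 0\<close>, \<Psi> has m + 1 parameters and rank m + 1 at \<open>s0\<close>, so
   \<open>param_strict\<close> separates consecutive members of the flag: m + 1 parameters on one
   side, rank m + 2 on the other.\<close>
 define L where "L = (%m (s :: nat => 'a) i. a i + (\<Sum>k<m. s (Suc k) * b k i))"
 define \<Psi> where "\<Psi> = (%m s. vscale (s 0) (\<Phi> (L m s)))"
 define Z where "Z = (%m. projectivization (acl I (range (\<Psi> m))))"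
 have pL: "polyfun {..m} (%s. L m s i)" for m i
  unfolding L_def by (intro polyfun_intros) auto
 have p\<Phi>L: "polyfun {..m} (%s. \<Phi> (L m s) i)" for m i by (rule polyfun_compose[OF pf pL])
 have p\<Psi>: "polyfun {..m} (%s. \<Psi> m s i)" for m i
  unfolding \<Psi>_def vscale_apply by (intro polyfun_mult p\<Phi>L polyfun_var) auto
 have s\<Psi>: "\<Psi> m s \<in> coord_space I" for m s
  using supp[of "L m s"] by (auto simp: \<Psi>_def coord_space_def vscale_apply)
 have con\<Psi>: "conical (range (\<Psi> m))" for m
  unfolding conical_def
 proof (intro ballI allI impI)
  fix x c assume "x \<in> range (\<Psi> m)"
  then obtain s where s: "x = \<Psi> m s" by blast
  have "L m (s(0 := c * s 0)) = L m s" by (simp add: L_def fun_eq_iff)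
  hence "vscale c x = \<Psi> m (s(0 := c * s 0))" by (simp add: s \<Psi>_def vec.scale_scale)
  thus "vscale c x \<in> range (\<Psi> m)" by blast
 qed
 define s0 where "s0 = (unit_vec 0 :: nat => 'a)"
 have L0: "L m s0 = a" for m by (simp add: L_def s0_def unit_vec_def)
 have s00: "s0 0 = 1" by (simp add: s0_def unit_vec_def)
 have \<Psi>0: "\<Psi> m s0 = \<Phi> a" for m by (simp add: \<Psi>_def L0 s00)
 have irr: "irreducible_closed I (Z m)" for m
  unfolding Z_def
  by (rule irreducible_closed_param[where \<Psi> = "\<Psi> m" and a = s0, OF p\<Psi> s\<Psi> con\<Psi>])
   (use a in \<open>auto simp: \<Psi>0\<close>)
 have ZX: "Z m \<subseteq> projectivization (acl I (range \<Phi>))" for m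
  unfolding Z_def
 proof (intro projectivization_mono acl_mono subsetI)
  fix x assume "x \<in> range (\<Psi> m)"
  then obtain s where "x = vscale (s 0) (\<Phi> (L m s))" by (auto simp: \<Psi>_def)
  thus "x \<in> range \<Phi>" using cone[of "s 0" "L m s"] by (metis rangeI)
 qed
 have d\<Psi>: "dmap (\<Psi> m) s0 c = vscale (c 0) (\<Phi> a) + dmap \<Phi> a (%i. \<Sum>k<m. c (Suc k) * b k i)" for m c
 proof
  fix i
  have "dmap (\<Psi> m) s0 c i = dd (%s. s 0 * \<Phi> (L m s) i) s0 c" by (simp add: dmap_def \<Psi>_def vscale_apply)
  also have "\<dots> = s0 0 * dd (%s. \<Phi> (L m s) i) s0 c + dd (%s. s 0) s0 c * \<Phi> (L m s0) i"
   by (rule dd_mult[of "{..m}"]) (auto intro: polyfun_var p\<Phi>L)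
  also have "dd (%s. \<Phi> (L m s) i) s0 c = dd (%t. \<Phi> t i) (L m s0) (%i'. dd (%s. L m s i') s0 c)"
   by (rule dd_compose[OF pf pL])
  also have "(%i'. dd (%s. L m s i') s0 c) = (%i. \<Sum>k<m. c (Suc k) * b k i)"
  proof
   fix i'
   have "dd (%s. L m s i') s0 c = dd (%s. \<Sum>k<m. b k i' * s (Suc k)) s0 c"
    unfolding L_def by (subst dd_add[of "{..m}"]) (auto intro!: polyfun_intros simp: mult.commute)
   also have "\<dots> = (\<Sum>k<m. b k i' * c (Suc k))"
    by (subst dd_sum[of _ "{..m}"]) (auto intro!: polyfun_intros sum.cong simp: dd_cmult[OF polyfun_var[of _ UNIV]])
   finally show "dd (%s. L m s i') s0 c = (\<Sum>k<m. c (Suc k) * b k i')" by (simp add: mult.commute)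
  qed
  finally show "dmap (\<Psi> m) s0 c i = (vscale (c 0) (\<Phi> a) + dmap \<Phi> a (%i. \<Sum>k<m. c (Suc k) * b k i)) i"
   by (simp add: L0 s00 vscale_apply dmap_def)
 qed
 have rank: "m + 1 <= vec.dim (range (dmap (\<Psi> m) s0))" if m: "m <= r - 1" for m
 proof -
  have "\<Phi> a = dmap (\<Psi> m) s0 (unit_vec 0)"
   unfolding d\<Psi> by (simp add: unit_vec_def dmap_def fun_eq_iff vscale_apply)
  moreover have "u k = dmap (\<Psi> m) s0 (unit_vec (Suc k))" if k: "k < m" for k
  proof -
   have "(%i. \<Sum>l<m. unit_vec (Suc k) (Suc l) * b l i) = b k"
    using k by (auto simp: unit_vec_def fun_eq_iff if_distrib[of "%x. x * _"] cong: if_cong)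
   thus ?thesis unfolding d\<Psi> using b[of k] k m by (simp add: unit_vec_def fun_eq_iff vscale_apply)
  qed
  ultimately have sub: "insert (\<Phi> a) (u ` {..<m}) \<subseteq> range (dmap (\<Psi> m) s0)" by auto
  have um: "u ` {..<m} \<subseteq> C - {\<Phi> a}"
  proof
   fix x assume "x \<in> u ` {..<m}"
   then obtain k where "x = u k" "k < r - 1" using m by auto
   thus "x \<in> C - {\<Phi> a}" using uC by simp
  qed
  hence "insert (\<Phi> a) (u ` {..<m}) \<subseteq> C" using C(1) by blast
  hence ind: "vec.independent (insert (\<Phi> a) (u ` {..<m}))" using C(3) vec.independent_mono by blast
  have "inj_on u {..<m}" using u m by (auto simp: bij_betw_def intro: inj_on_subset)
  moreover have "\<Phi> a \<notin> u ` {..<m}" using um by blast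
  ultimately have card: "card (insert (\<Phi> a) (u ` {..<m})) = m + 1" by (simp add: card_image)
  have "card (insert (\<Phi> a) (u ` {..<m})) <= vec.dim (range (dmap (\<Psi> m) s0))"
   using independent_card_le[OF ind _ _ I, of "range (dmap (\<Psi> m) s0)"] sub
    vec.span_superset[of "range (dmap (\<Psi> m) s0)"] dmap_coord_space[of "\<Psi> m" I, OF s\<Psi>] by blast
  thus ?thesis using card by simp
 qed
 have strict: "Z m \<subset> Z (Suc m)" if m: "m < r - 1" for m
 proof
  show "Z m \<subseteq> Z (Suc m)"
   unfolding Z_def
  proof (intro projectivization_mono acl_mono subsetI)
   fix x assume "x \<in> range (\<Psi> m)"
   then obtain s where s: "x = \<Psi> m s" by blast
   have "L (Suc m) (s(Suc m := 0)) = L m s" by (simp add: L_def fun_eq_iff)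
   hence "x = \<Psi> (Suc m) (s(Suc m := 0))" by (simp add: s \<Psi>_def)
   thus "x \<in> range (\<Psi> (Suc m))" by blast
  qed
  show "Z m ~= Z (Suc m)"
  proof
   assume eq: "Z m = Z (Suc m)"
   have "range (\<Psi> (Suc m)) \<subseteq> acl I (range (\<Psi> m))"
   proof
    fix x assume x: "x \<in> range (\<Psi> (Suc m))"
    show "x \<in> acl I (range (\<Psi> m))"
    proof (cases "x = 0")
     case True
     have "\<Psi> m 0 = 0" by (simp add: \<Psi>_def fun_eq_iff vscale_apply)
     hence "x \<in> range (\<Psi> m)" using True by (metis rangeI)
     thus ?thesis using acl_superset[of "range (\<Psi> m)" I] s\<Psi> by blast
    next
     case False
     have "x \<in> acl I (range (\<Psi> (Suc m)))" using x acl_superset[of "range (\<Psi> (Suc m))" I] s\<Psi> by blast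
     hence "ppoint_of x \<in> Z (Suc m)" unfolding Z_def using False by (rule projectivization_mem)
     hence "ppoint_of x \<in> Z m" using eq by simp
     thus ?thesis unfolding Z_def using projectivization_rep(1)[OF _ conical_acl[OF con\<Psi>] ppoint_of_self] by blast
    qed
   qed
   moreover have "card {..m} < vec.dim (range (dmap (\<Psi> (Suc m)) s0))" using rank[of "Suc m"] m by simp
   ultimately show False
    using param_strict[of "{..m}" "{..Suc m}" I "\<Psi> m" "\<Psi> (Suc m)" s0] p\<Psi> s\<Psi> I by blast
  qed
 qed
 show "enat (r - 1) <= zariski_dim I (projectivization (acl I (range \<Phi>)))"
  unfolding zariski_dim_def
  by (rule Sup_upper) (use irr ZX strict in blast)
qed

section \<open>Exponent vectors\<close>

lemma exponents_iff:
 "m \<in> exponents n d \<longleftrightarrow> keys m \<subseteq> {..n} & (\<Sum>i\<le>n. lookup m i) = d"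
 using mdeg_superset[of "{..n}" m] by (auto simp: exponents_def)

lemma exponentsD: "m \<in> exponents n d ==> keys m \<subseteq> {..n}" "m \<in> exponents n d ==> mdeg m = d"
 by (auto simp: exponents_def)

definition exp_of :: "nat => (nat => nat) => nat \<Rightarrow>\<^sub>0 nat" where
 "exp_of n f = (\<Sum>i\<le>n. single i (f i))"

lemma lookup_exp_of: "lookup (exp_of n f) i = (if i <= n then f i else 0)"
 by (auto simp: exp_of_def lookup_sum lookup_single when_def)

lemma keys_exp_of: "keys (exp_of n f) \<subseteq> {..n}"
 by (auto simp: in_keys_iff lookup_exp_of split: if_splits)

lemma lookup_gt_0:
 fixes n :: nat
 shows "keys m \<subseteq> {..n} ==> i > n ==> lookup m i = 0"
proof -
 assume "keys m \<subseteq> {..n}" "i > n"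
 hence "i \<notin> keys m" by auto
 thus ?thesis by (simp add: in_keys_iff)
qed

lemma exponent_eqI:
 fixes n :: nat
 assumes "keys a \<subseteq> {..n}" "keys b \<subseteq> {..n}"
  "!!i. i <= n ==> lookup a i = lookup b i"
 shows "a = b"
proof (rule poly_mapping_eqI)
 fix i
 show "lookup a i = lookup b i"
  using assms(3)[of i] lookup_gt_0[OF assms(1), of i] lookup_gt_0[OF assms(2), of i] by (metis not_le)
qed

lemma exponents_le_eq:
 assumes "a \<in> exponents n k" "b \<in> exponents n k" "!!i. i <= n ==> lookup a i <= lookup b i"
 shows "a = b"
proof (rule exponent_eqI[of _ n])
 fix i assume "i <= n"
 have "(\<Sum>i\<le>n. lookup b i - lookup a i) = 0"
  using assms by (subst sum_subtractf_nat) (auto simp: exponents_iff)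
 thus "lookup a i = lookup b i" using assms(3)[OF \<open>i <= n\<close>] \<open>i <= n\<close> by (simp add: order_antisym)
qed (use assms in \<open>auto dest: exponentsD(1)\<close>)

lemma card_exponents: "finite (exponents n d) & card (exponents n d) = (n + d) choose n"
proof -
 let ?L = "{l :: nat list. length l = Suc n & sum_list l = d}"
 have bij: "bij_betw (%m. map (lookup m) [0..<Suc n]) (exponents n d) ?L"
 proof (rule bij_betw_imageI)
  show "inj_on (%m. map (lookup m) [0..<Suc n]) (exponents n d)"
  proof (rule inj_onI)
   fix a b assume ab: "a \<in> exponents n d" "b \<in> exponents n d"
    "map (lookup a) [0..<Suc n] = map (lookup b) [0..<Suc n]"
   show "a = b" by (rule exponent_eqI[of _ n]) (use ab in \<open>auto dest: exponentsD(1)\<close>)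
  qed
  show "(%m. map (lookup m) [0..<Suc n]) ` exponents n d = ?L"
  proof (intro subset_antisym subsetI)
   fix l assume "l \<in> (%m. map (lookup m) [0..<Suc n]) ` exponents n d"
   then obtain m where m: "m \<in> exponents n d" "l = map (lookup m) [0..<Suc n]" by blast
   have "sum_list l = (\<Sum>i\<in>{0..<Suc n}. lookup m i)"
    unfolding m(2) by (subst interv_sum_list_conv_sum_set_nat) simp
   also have "{0..<Suc n} = {..n}" by auto
   finally show "l \<in> ?L" using m by (simp add: exponents_iff del: upt_Suc)
  next
   fix l assume l: "l \<in> ?L"
   have map: "map (lookup (exp_of n (%i. l ! i))) [0..<Suc n] = l"
    using l by (intro nth_equalityI) (auto simp: lookup_exp_of simp del: upt_Suc)
   have "sum_list l = (\<Sum>i\<in>{0..<Suc n}. l ! i)" using l by (simp add: sum_list_sum_nth)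
   also have "{0..<Suc n} = {..n}" by auto
   finally have "exp_of n (%i. l ! i) \<in> exponents n d"
    using l keys_exp_of by (auto simp: exponents_iff lookup_exp_of)
   thus "l \<in> (%m. map (lookup m) [0..<Suc n]) ` exponents n d" using map by force
  qed
 qed
 have "card ?L = (n + d) choose n"
  using card_length_sum_list[of "Suc n" d] binomial_symmetric[of d "d + n"] by (simp add: add.commute)
 moreover have "finite ?L"
 proof (rule finite_subset)
  show "?L \<subseteq> {l. set l \<subseteq> {..d} & length l = Suc n}" using member_le_sum_list by fastforce
 qed (rule finite_lists_length_eq, simp)
 ultimately show ?thesis using bij_betw_same_card[OF bij] bij_betw_finite[OF bij] by simp
qed

lemma finite_exponents [simp]: "finite (exponents n d)"
 using card_exponents by blast

lemma mdeg_0_iff: "mdeg a = 0 \<longleftrightarrow> a = 0"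
 by (auto simp: mdeg_def in_keys_iff intro!: poly_mapping_eqI)

lemma exponents_add_single: "a \<in> exponents n k ==> i <= n ==> a + single i l \<in> exponents n (k + l)"
 using keys_add[of a "single i l"] by (auto simp: exponents_def mdeg_add split: if_splits)

lemma exponents_minus_single:
 assumes "a \<in> exponents n (Suc k)" "lookup a i > 0"
 shows "a - single i 1 \<in> exponents n k" "(a - single i 1) + single i 1 = a"
proof -
 show eq: "(a - single i 1) + single i 1 = a"
  by (rule poly_mapping_eqI) (use assms in \<open>auto simp: lookup_add lookup_minus lookup_single when_def\<close>)
 have "keys (a - single i 1) \<subseteq> {..n}"
  using assms exponentsD(1)[of a n "Suc k"] by (auto simp: in_keys_iff lookup_minus subset_iff)
 moreover have "mdeg (a - single i 1) + 1 = Suc k"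
  using exponentsD(2)[OF assms(1)] mdeg_add[of "a - single i 1" "single i 1", unfolded eq]
  by simp
 ultimately show "a - single i 1 \<in> exponents n k" by (simp add: exponents_def)
qed

section \<open>Hasse derivatives\<close>

definition binprod :: "nat => expo => expo => nat" where
 "binprod n e a = (\<Prod>i\<le>n. lookup e i choose lookup a i)"

text \<open>The coefficient of \<open>y ^ a\<close> in \<open>(v + y) ^ e\<close>.\<close>

definition hcoef :: "nat => (nat => 'a::field_char_0) => expo => expo => 'a" where
 "hcoef n v e a = of_nat (binprod n e a) * monom_eval (e - a) v"

lemma hcoef_prod:
 assumes "keys e \<subseteq> {..n}"
 shows "hcoef n v e a = (\<Prod>i\<le>n. of_nat (lookup e i choose lookup a i)
  * v i ^ (lookup e i - lookup a i))"
proof -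
 have "keys (e - a) \<subseteq> {..n}" using assms by (auto simp: in_keys_iff lookup_minus subset_iff)
 thus ?thesis
  by (simp add: hcoef_def binprod_def monom_eval_superset[of "{..n}"] lookup_minus prod.distrib)
qed

lemma binprod_neq_0D: "binprod n e a ~= 0 ==> i <= n ==> lookup a i <= lookup e i"
 unfolding binprod_def by (auto simp: prod_zero_iff binomial_eq_0_iff not_less)

lemma hcoef_neq_0D: "hcoef n v e a ~= 0 ==> i <= n ==> lookup a i <= lookup e i"
 using binprod_neq_0D[of n e a i] by (auto simp: hcoef_def)

lemma hcoef_mdeg_less:
 assumes "keys a \<subseteq> {..n}" "keys e \<subseteq> {..n}" "mdeg e < mdeg a"
 shows "hcoef n v e a = 0"
proof (rule ccontr)
 assume "hcoef n v e a ~= 0"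
 hence "(\<Sum>i\<le>n. lookup a i) <= (\<Sum>i\<le>n. lookup e i)"
  using hcoef_neq_0D by (intro sum_mono) auto
 thus False using assms by (simp add: mdeg_superset[of "{..n}"])
qed

lemma hcoef_0: "keys e \<subseteq> {..n} ==> hcoef n v e 0 = monom_eval e v"
 by (simp add: hcoef_def binprod_def)

text \<open>Compares coefficients of \<open>y ^ a\<close> in (v + y)^e multiplied by v_j +
  y_j.\<close>

lemma hcoef_pascal:
 assumes "keys e \<subseteq> {..n}" "j <= n"
 shows "hcoef n v (e + single j 1) a = v j * hcoef n v e a +
  (if lookup a j > 0 then hcoef n v e (a - single j 1) else 0)"
proof -
 let ?f = "%e a i. of_nat (lookup e i choose lookup a i)
  * v i ^ (lookup e i - lookup a i)"
 let ?e = "e + single j 1" and ?a = "a - single j 1"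
 have ke: "keys ?e \<subseteq> {..n}" using assms keys_add[of e "single j 1"] by auto
 have split: "(\<Prod>i\<le>n. F i) = F j * (\<Prod>i\<in>{..n} - {j}. F i)" for F :: "nat => 'a"
  using assms(2) by (intro prod.remove) auto
 have R1: "(\<Prod>i\<in>{..n} - {j}. ?f ?e a i) = (\<Prod>i\<in>{..n} - {j}. ?f e a i)"
  by (intro prod.cong) (auto simp: lookup_add lookup_single)
 have R2: "(\<Prod>i\<in>{..n} - {j}. ?f e ?a i) = (\<Prod>i\<in>{..n} - {j}. ?f e a i)"
  by (intro prod.cong) (auto simp: lookup_minus lookup_single)
 define x where "x = lookup e j"
 define y where "y = lookup a j"
 have one: "of_nat (Suc x choose y) * v j ^ (Suc x - y) = v j * (of_nat (x choose y) * v j ^ (x - y))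
   + (if y > 0 then of_nat (x choose (y - 1)) * v j ^ (x - (y - 1)) else 0)"
 proof (cases y)
  case (Suc z)
  consider "z < x" | "z = x" | "z > x" by linarith
  thus ?thesis
  proof cases
   case 1
   hence "v j ^ (x - z) = v j * v j ^ (x - Suc z)" by (metis Suc_diff_Suc power_Suc)
   thus ?thesis using Suc by (simp add: algebra_simps)
  qed (auto simp: Suc)
 qed simp
 have ej: "?f ?e a j = of_nat (Suc x choose y) * v j ^ (Suc x - y)"
  by (simp add: x_def y_def lookup_add)
 have aj: "?f e ?a j = of_nat (x choose (y - 1)) * v j ^ (x - (y - 1))"
  by (simp add: x_def y_def lookup_minus)
 show ?thesis
  unfolding hcoef_prod[OF ke] hcoef_prod[OF assms(1)] split[of "?f ?e a"] split[of "?f e a"] split[of "?f e ?a"]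
   R1 R2 ej aj one
  by (simp add: x_def y_def algebra_simps)
qed

lemma binprod_Suc:
 assumes "i <= n"
 shows "(lookup a i + 1) * binprod n e (a + single i 1) =
  (lookup e i - lookup a i) * binprod n e a"
proof -
 let ?f = "%a i. lookup e i choose lookup a i"
 have split: "(\<Prod>l\<le>n. F l) = F i * (\<Prod>l\<in>{..n} - {i}. F l)" for F :: "nat => nat"
  using assms by (intro prod.remove) auto
 have R: "(\<Prod>l\<in>{..n} - {i}. ?f (a + single i 1) l) = (\<Prod>l\<in>{..n} - {i}. ?f a l)"
  by (intro prod.cong) (auto simp: lookup_add lookup_single)
 have "(x + 1) * (y choose (x + 1)) = (y - x) * (y choose x)" for x y :: nat
  using binomial_absorb_comp[of y x] Suc_times_binomial_eq[of "y - 1" x]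
  by (cases y) (auto simp: mult.commute)
 thus ?thesis
  unfolding binprod_def split[of "?f (a + single i 1)"] split[of "?f a"] R
  by (simp add: lookup_add) (metis (no_types, lifting) Suc_eq_plus1 mult.assoc mult_Suc)
qed

lemma hcoef_Suc:
 fixes v :: "nat => 'a::field_char_0"
 assumes "i <= n"
 shows "of_nat (lookup a i + 1) * hcoef n v e (a + single i 1) =
  of_nat (lookup e i - lookup a i) * of_nat (binprod n e a)
   * monom_eval (e - a - single i 1) v"
proof -
 have "e - (a + single i 1) = e - a - single i 1"
  by (rule poly_mapping_eqI) (simp add: lookup_minus lookup_add)
 moreover have "of_nat (lookup a i + 1) * of_nat (binprod n e (a + single i 1)) =
   (of_nat (lookup e i - lookup a i) * of_nat (binprod n e a) :: 'a)"
  using binprod_Suc[OF assms, of a e] by (metis of_nat_mult)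
 ultimately show ?thesis unfolding hcoef_def by (simp only: mult.assoc[symmetric])
qed

lemma monom_eval_mult_var:
 "lookup m i > 0 ==> v i * monom_eval (m - single i 1) v = monom_eval m v"
proof -
 assume "lookup m i > 0"
 hence eq: "m = (m - single i 1) + single i 1"
  by (intro poly_mapping_eqI) (auto simp: lookup_add lookup_minus lookup_single when_def)
 have "monom_eval m v = monom_eval (m - single i 1) v * v i"
  by (subst (1) eq) (simp add: monom_eval_add)
 thus ?thesis by (simp add: mult.commute)
qed

text \<open>Euler's relation: as a function of v the coefficient is homogeneous of degree
  \<open>mdeg e - mdeg a\<close>, and its partial derivatives are the coefficients one order higher,
  with the factors \<open>lookup a i + 1\<close> of divided powers.\<close>

lemma hcoef_euler:
 assumes e: "keys e \<subseteq> {..n}" and a: "keys a \<subseteq> {..n}"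
 shows "(\<Sum>i\<le>n. v i * (of_nat (lookup a i + 1) * hcoef n v e (a + single i 1)))
  = (of_nat (mdeg e) - of_nat (mdeg a)) * hcoef n v e a"
proof -
 have "v i * (of_nat (lookup a i + 1) * hcoef n v e (a + single i 1)) =
   (of_nat (lookup e i) - of_nat (lookup a i)) * hcoef n v e a" if i: "i <= n" for i
 proof (cases "binprod n e a = 0")
  case False
  hence le: "lookup a i <= lookup e i" using i by (rule binprod_neq_0D)
  show ?thesis
  proof (cases "lookup e i - lookup a i = 0")
   case True
   thus ?thesis using le hcoef_Suc[OF i, of a v e] by simp
  next
   case False
   hence "v i * monom_eval (e - a - single i 1) v = monom_eval (e - a) v"
    by (intro monom_eval_mult_var) (simp add: lookup_minus)
   thus ?thesis unfolding hcoef_Suc[OF i] hcoef_def[of n v e a] using le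
    by (simp add: of_nat_diff mult_ac)
  qed
 next
  case True
  thus ?thesis unfolding hcoef_Suc[OF i] by (simp add: hcoef_def)
 qed
 hence "(\<Sum>i\<le>n. v i * (of_nat (lookup a i + 1) * hcoef n v e (a + single i 1)))
  = (\<Sum>i\<le>n. (of_nat (lookup e i) - of_nat (lookup a i)) * hcoef n v e a)"
  by (intro sum.cong) auto
 thus ?thesis using e a
  by (simp add: mdeg_superset[of "{..n}"] sum_distrib_right[symmetric] sum_subtractf)
qed

lemma polyfun_hcoef: "keys e \<subseteq> {..n} ==> polyfun {..n} (%v. hcoef n v e a)"
 unfolding hcoef_def
 by (rule polyfun_cmult, rule polyfun_monom_eval) (auto simp: in_keys_iff lookup_minus subset_iff)

lemma dd_hcoef:
 assumes e: "keys e \<subseteq> {..n}"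
 shows "dd (%v. hcoef n v e a) v b =
  (\<Sum>i\<le>n. b i * (of_nat (lookup a i + 1) * hcoef n v e (a + single i 1)))"
proof -
 have k: "keys (e - a) \<subseteq> {..n}" using e by (auto simp: in_keys_iff lookup_minus subset_iff)
 have "dd (%v. hcoef n v e a) v b = (\<Sum>i\<le>n. b i * dd (%v. hcoef n v e a) v (%l. if l = i then 1 else 0))"
  by (rule dd_coords[OF polyfun_hcoef[OF e]]) simp
 also have "\<dots> = (\<Sum>i\<le>n. b i * (of_nat (lookup a i + 1) * hcoef n v e (a + single i 1)))"
 proof (intro sum.cong refl arg_cong2[where f = "(*)"])
  fix i assume i: "i \<in> {..n}"
  show "dd (%v. hcoef n v e a) v (%l. if l = i then 1 else 0) =
   of_nat (lookup a i + 1) * hcoef n v e (a + single i 1)"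
   using i unfolding hcoef_Suc[OF i[unfolded atMost_iff]] unfolding hcoef_def
   by (subst dd_cmult[OF polyfun_monom_eval[OF k]], subst dd_monom_eval) (simp add: lookup_minus)
 qed
 finally show ?thesis .
qed

section \<open>Order of vanishing at a point\<close>

definition hasse :: "nat => (nat => 'a::field_char_0) => expo => (nat, 'a) mpoly => 'a" where
 "hasse n v a g = (\<Sum>e\<in>keys g. lookup g e * hcoef n v e a)"

lemma hasse_superset:
 "finite A ==> keys g \<subseteq> A ==> hasse n v a g = (\<Sum>e\<in>A. lookup g e * hcoef n v e a)"
 unfolding hasse_def by (rule sum.mono_neutral_left) (auto simp: in_keys_iff)

lemma hasse_add: "hasse n v a (f + g) = hasse n v a f + hasse n v a g"
proof -
 let ?A = "keys f \<union> keys g"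
 show ?thesis
  by (subst (1 2 3) hasse_superset[of ?A])
   (use keys_add[of f g] in \<open>auto simp: lookup_add sum.distrib algebra_simps\<close>)
qed

lemma hasse_zero [simp]: "hasse n v a 0 = 0"
 by (simp add: hasse_def)

lemma hasse_single: "hasse n v a (single e c) = c * hcoef n v e a"
 by (cases "c = 0") (auto simp: hasse_def)

lemma hasse_sum: "hasse n v a (\<Sum>i\<in>A. f i) = (\<Sum>i\<in>A. hasse n v a (f i))"
 by (induction A rule: infinite_finite_induct) (auto simp: hasse_add)

lemma single_mult_eq:
 "single m c * g = (\<Sum>e\<in>keys g. single (m + e) (c * lookup g e))"
 by (subst (1) poly_mapping_sum_single[of g]) (simp add: sum_distrib_left mult_single)

lemma hasse_cmult: "hasse n v a (single 0 c * g) = c * hasse n v a g"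
 by (simp add: single_mult_eq hasse_sum hasse_single hasse_def[of n v a g] sum_distrib_left mult.assoc)

lemma hasse_var_mult:
 assumes "g \<in> polys {..n}" "j <= n"
 shows "hasse n v a (mpoly_var j * g) = v j * hasse n v a g +
  (if lookup a j > 0 then hasse n v (a - single j 1) g else 0)"
proof -
 have "hasse n v a (mpoly_var j * g) =
   (\<Sum>e\<in>keys g. lookup g e * hcoef n v (e + single j 1) a)"
  by (simp add: mpoly_var_def single_mult_eq hasse_sum hasse_single add.commute)
 also have "\<dots> = (\<Sum>e\<in>keys g. lookup g e * (v j * hcoef n v e a +
   (if lookup a j > 0 then hcoef n v e (a - single j 1) else 0)))"
  using assms by (intro sum.cong refl arg_cong2[where f = "(*)"] hcoef_pascal) (auto simp: polys_def)
 finally show ?thesis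
  by (simp add: hasse_def distrib_left sum.distrib sum_distrib_left mult_ac)
qed

definition vanishes :: "nat => nat => (nat => 'a::field_char_0) => (nat, 'a) mpoly => bool" where
 "vanishes n m v g \<longleftrightarrow> (ALL a. keys a \<subseteq> {..n} --> mdeg a < m --> hasse n v a g = 0)"

lemma vanishesD: "vanishes n m v g ==> keys a \<subseteq> {..n} ==> mdeg a < m ==> hasse n v a g = 0"
 by (auto simp: vanishes_def)

lemma vanishes_mono: "vanishes n m v g ==> m' <= m ==> vanishes n m' v g"
 by (auto simp: vanishes_def)

lemma vanishes_add: "vanishes n m v f ==> vanishes n m v g ==> vanishes n m v (f + g)"
 by (auto simp: vanishes_def hasse_add)

text \<open>Only the leading term of the Leibniz rule survives.\<close>

lemma hasse_mult_vanishes: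
 assumes f: "f \<in> polys {..n}" and g: "g \<in> polys {..n}" and van: "vanishes n m v g"
  and a: "keys a \<subseteq> {..n}" "mdeg a <= m"
 shows "hasse n v a (f * g) = mpoly_eval f v * hasse n v a g"
proof -
 have single: "hasse n v a (single e 1 * g) = monom_eval e v * hasse n v a g"
  if "keys e \<subseteq> {..n}" "mdeg e = l" "keys a \<subseteq> {..n}" "mdeg a <= m" for e l a
  using that
 proof (induction l arbitrary: e a)
  case 0
  hence "e = 0" using mdeg_0_iff by blast
  thus ?case using hasse_cmult[of n v a 1 g] by simp
 next
  case (Suc l)
  hence "e \<in> exponents n (Suc l)" by (simp add: exponents_def)
  moreover have "keys e ~= {}" using Suc.prems(2) by (auto simp: mdeg_def)
  then obtain j where j: "j \<in> keys e" by blast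
  ultimately have e': "e - single j 1 \<in> exponents n l"
   "(e - single j 1) + single j 1 = e"
   using exponents_minus_single[of e n l j] by (auto simp: in_keys_iff)
  define e1 where "e1 = e - single j 1"
  have e1: "keys e1 \<subseteq> {..n}" "mdeg e1 = l" "e = single j 1 + e1"
   using e' exponentsD[of e1 n l] by (auto simp: e1_def add.commute)
  have jn: "j <= n" using j Suc.prems(1) by auto
  have pol: "single e1 1 * g \<in> polys {..n}" using e1 g by (intro polys_mult polys_single)
  have "single e 1 * g = mpoly_var j * (single e1 1 * g)"
   by (simp add: mpoly_var_def e1(3) mult_single flip: mult.assoc)
  hence "hasse n v a (single e 1 * g) = v j * hasse n v a (single e1 1 * g) +
   (if lookup a j > 0 then hasse n v (a - single j 1) (single e1 1 * g) else 0)"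
   by (simp only: hasse_var_mult[OF pol jn])
  also have "hasse n v a (single e1 1 * g) = monom_eval e1 v * hasse n v a g"
   by (rule Suc.IH[OF e1(1,2) Suc.prems(3,4)])
  also have "(if lookup a j > 0 then hasse n v (a - single j 1) (single e1 1 * g) else 0) = 0"
  proof (cases "lookup a j > 0")
   case True
   hence "mdeg a ~= 0" by (auto simp: mdeg_0_iff)
   then obtain l' where l': "mdeg a = Suc l'" using not0_implies_Suc by blast
   hence "a \<in> exponents n (Suc l')" using Suc.prems by (simp add: exponents_def)
   hence a': "a - single j 1 \<in> exponents n l'" using exponents_minus_single True by blast
   have "hasse n v (a - single j 1) (single e1 1 * g) =
     monom_eval e1 v * hasse n v (a - single j 1) g"
    by (rule Suc.IH[OF e1(1,2)]) (use exponentsD[OF a'] l' Suc.prems in auto)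
   also have "hasse n v (a - single j 1) g = 0"
    by (rule vanishesD[OF van]) (use exponentsD[OF a'] l' Suc.prems in auto)
   finally show ?thesis by simp
  qed simp
  finally show ?case by (simp add: e1(3) monom_eval_add)
 qed
 have "f * g = (\<Sum>e\<in>keys f. single 0 (lookup f e) * (single e 1 * g))"
  by (subst (1) poly_mapping_sum_single[of f]) (simp add: sum_distrib_right mult_single flip: mult.assoc)
 hence "hasse n v a (f * g) = (\<Sum>e\<in>keys f. lookup f e * (monom_eval e v * hasse n v a g))"
  using single[OF _ refl a] f by (auto simp: hasse_sum hasse_cmult polys_def intro!: sum.cong)
 thus ?thesis by (simp add: mpoly_eval_def sum_distrib_right mult.assoc)
qed

lemma vanishes_mult: "f \<in> polys {..n} ==> g \<in> polys {..n} ==> vanishes n m v g ==> vanishes n m v (f * g)"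
 unfolding vanishes_def[of n m v "f * g"] by (simp add: hasse_mult_vanishes[where m = m] vanishesD)

lemma vanishes_mult_Suc:
 assumes "f \<in> polys {..n}" "g \<in> polys {..n}" "vanishes n m v g" "mpoly_eval f v = 0"
 shows "vanishes n (Suc m) v (f * g)"
 unfolding vanishes_def using hasse_mult_vanishes[OF assms(1-3)] assms(4) by (simp add: less_Suc_eq_le)

text \<open>A factor that does not vanish at v is a unit locally. The order is raised step by step,
  since the leading term of the Leibniz rule only multiplies the lowest derivatives by the value of
  f.\<close>

lemma vanishes_cancel:
 assumes "f \<in> polys {..n}" "g \<in> polys {..n}" "mpoly_eval f v ~= 0" "vanishes n m v (f * g)"
 shows "vanishes n m v g"
 using assms(4)
proof (induction m)
 case 0
 show ?case by (simp add: vanishes_def)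
next
 case (Suc m)
 hence v: "vanishes n m v g" using vanishes_mono[of n "Suc m" v "f * g" m] by simp
 show ?case
  unfolding vanishes_def
 proof (intro allI impI)
  fix a assume a: "keys a \<subseteq> {..n}" "mdeg a < Suc m"
  have "hasse n v a (f * g) = 0" by (rule vanishesD[OF Suc.prems a])
  thus "hasse n v a g = 0" using hasse_mult_vanishes[OF assms(1,2) v a(1)] a(2) assms(3) by simp
 qed
qed

section \<open>Powers of the ideal of a point\<close>

lemma gen_ideal_base: "g \<in> G ==> g \<in> gen_ideal I G"
 unfolding gen_ideal_def by (rule CollectI, rule exI[of _ "{g}"], rule exI[of _ "%_. 1"]) auto

lemma gen_ideal_mult:
 assumes "p \<in> polys I" "f \<in> gen_ideal I G"
 shows "p * f \<in> gen_ideal I G"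
proof -
 obtain A r where A: "f = (\<Sum>g\<in>A. r g * g)" "finite A" "A \<subseteq> G" "\<forall>g\<in>A. r g \<in> polys I"
  using assms(2) unfolding gen_ideal_def by blast
 have "p * f = (\<Sum>g\<in>A. (p * r g) * g)" by (simp add: A(1) sum_distrib_left mult.assoc)
 moreover have "\<forall>g\<in>A. p * r g \<in> polys I" using A(4) assms(1) polys_mult by blast
 ultimately show ?thesis unfolding gen_ideal_def using A(2,3)
  by (intro CollectI exI[of _ A] exI[of _ "%g. p * r g"]) simp
qed

lemma gen_ideal_add:
 assumes "f \<in> gen_ideal I G" "h \<in> gen_ideal I G"
 shows "f + h \<in> gen_ideal I G"
proof -
 obtain A r where A: "f = (\<Sum>g\<in>A. r g * g)" "finite A" "A \<subseteq> G" "\<forall>g\<in>A. r g \<in> polys I"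
  using assms(1) unfolding gen_ideal_def by blast
 obtain B q where B: "h = (\<Sum>g\<in>B. q g * g)" "finite B" "B \<subseteq> G" "\<forall>g\<in>B. q g \<in> polys I"
  using assms(2) unfolding gen_ideal_def by blast
 define t where "t = (%g. (if g \<in> A then r g else 0) + (if g \<in> B then q g else 0))"
 have "f = (\<Sum>g\<in>A \<union> B. (if g \<in> A then r g else 0) * g)"
  unfolding A(1) by (rule sum.mono_neutral_cong_left) (use A B in auto)
 moreover have "h = (\<Sum>g\<in>A \<union> B. (if g \<in> B then q g else 0) * g)"
  unfolding B(1) by (rule sum.mono_neutral_cong_left) (use A B in auto)
 ultimately have "f + h = (\<Sum>g\<in>A \<union> B. t g * g)"
  by (simp only: t_def distrib_right sum.distrib)
 moreover have "\<forall>g\<in>A \<union> B. t g \<in> polys I" using A B by (auto simp: t_def intro!: polys_add)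
 ultimately show ?thesis unfolding gen_ideal_def using A B
  by (intro CollectI exI[of _ "A \<union> B"] exI[of _ t]) auto
qed

lemma gen_ideal_zero: "0 \<in> gen_ideal I G"
 unfolding gen_ideal_def by (rule CollectI, rule exI[of _ "{}"], rule exI[of _ "%_. 1"]) auto

lemma gen_ideal_minimal:
 assumes "f \<in> gen_ideal I G" "!!g. g \<in> G ==> Q g" "Q 0"
  "!!f g. Q f ==> Q g ==> Q (f + g)" "!!p g. p \<in> polys I ==> Q g ==> Q (p * g)"
 shows "Q f"
proof -
 obtain A r where A: "f = (\<Sum>g\<in>A. r g * g)" "finite A" "A \<subseteq> G" "\<forall>g\<in>A. r g \<in> polys I"
  using assms(1) unfolding gen_ideal_def by blast
 have "Q (\<Sum>g\<in>A. r g * g)" using A(2-4)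
 proof (induction A)
  case (insert x F)
  have "Q (r x * x)" by (rule assms(5)) (use insert.prems assms(2) in auto)
  moreover have "Q (\<Sum>g\<in>F. r g * g)" using insert by simp
  ultimately have "Q (r x * x + (\<Sum>g\<in>F. r g * g))" by (rule assms(4))
  thus ?case using insert by simp
 qed (simp add: assms)
 thus ?thesis using A by simp
qed

lemma vanishing_ideal_point:
 "f \<in> vanishing_ideal I {ppoint_of v} \<longleftrightarrow> f \<in> polys I & (ALL c. c ~= 0 --> mpoly_eval f (vscale c v) = 0)"
 unfolding vanishing_ideal_def ppoint_of_def by auto

lemma vanishing_ideal_pointD: "f \<in> vanishing_ideal I {ppoint_of v} ==> mpoly_eval f v = 0"
 unfolding vanishing_ideal_def using ppoint_of_self by blast

lemma ideal_power_vanishes: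
 assumes "f \<in> ideal_power {..n} (vanishing_ideal {..n} {ppoint_of v}) m"
 shows "f \<in> polys {..n} & vanishes n m v f"
 using assms unfolding ideal_power_def
proof (rule gen_ideal_minimal)
 fix g assume "g \<in> {(\<Prod>j<m. f j) |f. \<forall>j<m. f j \<in> vanishing_ideal {..n} {ppoint_of v}}"
 then obtain f where f: "g = (\<Prod>j<m. f j)" "!!j. j < m ==> f j \<in> vanishing_ideal {..n} {ppoint_of v}" by blast
 have fp: "f j \<in> polys {..n}" "mpoly_eval (f j) v = 0" if "j < m" for j
  using f(2)[OF that] vanishing_ideal_pointD by (auto simp: vanishing_ideal_def)
 have "(\<Prod>j<l. f j) \<in> polys {..n} & vanishes n l v (\<Prod>j<l. f j)" if "l <= m" for l
  using that
 proof (induction l)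
  case (Suc l)
  hence IH: "(\<Prod>j<l. f j) \<in> polys {..n}" "vanishes n l v (\<Prod>j<l. f j)" by auto
  have "vanishes n (Suc l) v (f l * (\<Prod>j<l. f j))"
   by (rule vanishes_mult_Suc) (use fp[of l] IH Suc.prems in auto)
  thus ?case using fp[of l] IH Suc.prems by (auto simp: mult.commute intro: polys_mult)
 qed (auto simp: vanishes_def)
 thus "g \<in> polys {..n} & vanishes n m v g" using f by auto
qed (auto simp: vanishes_def[of _ _ _ 0] intro: polys_add polys_mult vanishes_add vanishes_mult)

definition cst :: "'a::field => ('i, 'a) mpoly" where
 "cst c = single 0 c"

lemma cst_mult: "cst (a * b) = cst a * cst b" and cst_add: "cst (a + b) = cst a + cst b"
 and cst_0 [simp]: "cst 0 = 0" and cst_1 [simp]: "cst 1 = 1" and cst_polys [simp]: "cst c \<in> polys I"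
 and eval_cst [simp]: "mpoly_eval (cst c) v = c"
 by (simp_all add: cst_def mult_single single_add polys_const)

lemma cst_sum: "cst (\<Sum>i\<in>A. f i) = (\<Sum>i\<in>A. cst (f i))"
 by (induction A rule: infinite_finite_induct) (auto simp: cst_add)

lemma cst_mult_single: "cst c * single e b = single e (c * b)"
 by (simp add: cst_def mult_single)

lemma mpoly_var_mult_single: "mpoly_var j * single e b = single (e + single j 1) b"
 by (simp add: mpoly_var_def mult_single add.commute)

lemma mpoly_sum_cst: "g = (\<Sum>e\<in>keys g. cst (lookup g e) * single e 1)"
 by (subst (1) poly_mapping_sum_single[of g]) (simp add: cst_mult_single)

text \<open>Explicit certificates for membership in the m-th power of the ideal generated by the
  \<open>y j\<close>. The index D records the total degree when the \<open>y j\<close> are linear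
  forms.\<close>

inductive prod_span :: "nat => (nat => (nat, 'a::field_char_0) mpoly) => nat => nat => (nat, 'a) mpoly => bool"
 for n y m where
 base: "\<forall>l<m. f l <= n ==> keys e \<subseteq> {..n} ==> mdeg e + m = D ==>
  prod_span n y m D (single e c * (\<Prod>l<m. y (f l)))"
| zero: "prod_span n y m D 0"
| add: "prod_span n y m D p ==> prod_span n y m D q ==> prod_span n y m D (p + q)"

lemma prod_span_cst: "prod_span n y m D p ==> prod_span n y m D (cst c * p)"
proof (induction rule: prod_span.induct)
 case (base f e D b)
 show ?case unfolding mult.assoc[symmetric] cst_mult_single by (rule prod_span.base[OF base])
qed (auto simp: distrib_left intro: prod_span.intros)

lemma prod_span_var: "prod_span n y m D p ==> j <= n ==> prod_span n y m (Suc D) (mpoly_var j * p)"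
proof (induction rule: prod_span.induct)
 case (base f e D b)
 show ?case unfolding mult.assoc[symmetric] mpoly_var_mult_single
  by (rule prod_span.base) (use base keys_add[of e "single j 1"] in \<open>auto simp: mdeg_add\<close>)
qed (auto simp: distrib_left intro: prod_span.intros)

lemma prod_span_sum: "(!!i. i \<in> A ==> prod_span n y m D (f i)) ==> prod_span n y m D (\<Sum>i\<in>A. f i)"
 by (induction A rule: infinite_finite_induct) (auto intro: prod_span.intros)

definition var_pow :: "nat => (nat => (nat, 'a::field_char_0) mpoly) => expo => (nat, 'a) mpoly" where
 "var_pow n y a = (\<Prod>j\<le>n. y j ^ lookup a j)"

lemma var_pow_Suc: "j <= n ==> var_pow n y (a + single j 1) = y j * var_pow n y a"
proof -
 assume j: "j <= n"
 have split: "(\<Prod>i\<le>n. F i) = F j * (\<Prod>i\<in>{..n} - {j}. F i)" for F :: "nat => ('b \<Rightarrow>\<^sub>0 nat) \<Rightarrow>\<^sub>0 'c::field_char_0"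
  using j by (intro prod.remove) auto
 have "(\<Prod>i\<in>{..n} - {j}. y i ^ lookup (a + single j 1) i) = (\<Prod>i\<in>{..n} - {j}. y i ^ lookup a i)"
  by (intro prod.cong) (auto simp: lookup_add lookup_single)
 thus ?thesis
  unfolding var_pow_def split[of "%i. y i ^ lookup (a + single j 1) i"]
   split[of "%i. y i ^ lookup a i"]
  by (simp add: lookup_add mult.assoc)
qed

lemma var_pow_list:
 "a \<in> exponents n m ==> EX f. (\<forall>l<m. f l <= n) & var_pow n y a = (\<Prod>l<m. y (f l))"
proof (induction m arbitrary: a)
 case 0
 hence "a = 0" by (auto simp: exponents_def mdeg_0_iff)
 thus ?case by (simp add: var_pow_def)
next
 case (Suc m)
 have "a ~= 0" using Suc.prems by (auto simp: exponents_def)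
 then obtain j where j: "j \<in> keys a" by (metis equals0I mdeg_0_iff mdeg_def sum.empty)
 have "j \<in> {..n}" using j exponentsD(1)[OF Suc.prems] by blast
 with j have jn: "j <= n" "lookup a j > 0" by (auto simp: in_keys_iff)
 define b where "b = a - single j 1"
 have b: "b \<in> exponents n m" "a = b + single j 1"
  using exponents_minus_single[OF Suc.prems jn(2)] by (auto simp: b_def)
 then obtain f where f: "\<forall>l<m. f l <= n" "var_pow n y b = (\<Prod>l<m. y (f l))" using Suc.IH by blast
 have "(\<Prod>l<Suc m. y ((f(m := j)) l)) = (\<Prod>l<m. y (f l)) * y j" by simp
 hence "var_pow n y a = (\<Prod>l<Suc m. y ((f(m := j)) l))"
  unfolding b(2) var_pow_Suc[OF jn(1)] f(2) by (simp add: mult.commute)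
 thus ?case using f(1) jn(1) by (intro exI[of _ "f(m := j)"]) (auto simp: less_Suc_eq)
qed

definition low_exponents :: "nat => nat => expo set" where
 "low_exponents n m = {a. keys a \<subseteq> {..n} & mdeg a < m}"

lemma finite_low_exponents: "finite (low_exponents n m)"
proof -
 have "low_exponents n m = (\<Union>t<m. exponents n t)" by (auto simp: low_exponents_def exponents_def)
 thus ?thesis by simp
qed

text \<open>Homogeneous coordinates centred at v: the linear form X takes the value 1 at v, the
  forms \<open>y j\<close> vanish on the line of v, and every variable is
  \<open>v j * X + y j\<close>. They replace the affine coordinates x_j - v_j without leaving the
  graded setting.\<close>

context
 fixes n i0 :: nat and v :: "nat => 'a::field_char_0" and X :: "(nat, 'a) mpoly" and y
 assumes i0: "i0 <= n" "v i0 ~= 0"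
 defines "X \<equiv> cst (1 / v i0) * mpoly_var i0"
  and "y \<equiv> (%j. mpoly_var j - cst (v j) * X)"
begin

lemma y_vanishing: "j <= n ==> y j \<in> vanishing_ideal {..n} {ppoint_of v}"
 unfolding vanishing_ideal_point using i0
 by (auto simp: y_def X_def mpoly_eval_diff mpoly_eval_mult vscale_apply intro!: polys_diff polys_mult polys_var)

lemma prod_span_X: "prod_span n y m D p ==> prod_span n y m (Suc D) (X * p)"
 unfolding X_def mult.assoc by (intro prod_span_cst prod_span_var i0)

lemma prod_span_X_pow: "prod_span n y m D p ==> prod_span n y m (r + D) (X ^ r * p)"
 by (induction r) (auto simp: mult.assoc intro: prod_span_X)

text \<open>The terms of order less than m in the expansion of the monomial e at v, where powers of
  X fill up the degree. Where the exponent of X truncates, the coefficient is zero by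
  \<open>hcoef_mdeg_less\<close>.\<close>

definition taylor :: "nat => expo => (nat, 'a) mpoly" where
 "taylor m e = (\<Sum>a\<in>low_exponents n m. cst (hcoef n v e a) * (X ^ (mdeg e - mdeg a) * var_pow n y a))"

text \<open>Multiplying the expansion by \<open>y j + v j * X\<close> and applying
  \<open>hcoef_pascal\<close>, everything cancels except the terms of order exactly k multiplied by
  \<open>y j\<close>. These contain k + 1 factors y and lie in the required power.\<close>

lemma taylor_step:
 assumes e: "keys e \<subseteq> {..n}" and j: "j <= n"
 shows "prod_span n y (Suc k) (Suc (mdeg e))
  (mpoly_var j * taylor (Suc k) e - taylor (Suc k) (e + single j 1))"
proof -
 let ?D = "mdeg e" and ?s = "single j (1::nat)" and ?A = "low_exponents n (Suc k)"
 let ?B = "low_exponents n k"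
 have var: "mpoly_var j = y j + cst (v j) * X" by (simp add: y_def)
 define F where "F = (%a. cst (hcoef n v e a) * (X ^ (?D - mdeg a) * var_pow n y (a + ?s)))"
 define G where "G = (%a. cst (v j * hcoef n v e a) * (X ^ (Suc ?D - mdeg a) * var_pow n y a))"
 define H where "H = (%a. if lookup a j > 0
   then cst (hcoef n v e (a - ?s)) * (X ^ (Suc ?D - mdeg a) * var_pow n y a) else 0)"
 have "mpoly_var j * taylor (Suc k) e = (\<Sum>a\<in>?A. F a + G a)"
  unfolding taylor_def sum_distrib_left
 proof (intro sum.cong refl)
  fix a assume a: "a \<in> ?A"
  have "cst (hcoef n v e a) * X ^ (Suc ?D - mdeg a) = cst (hcoef n v e a) * X ^ (?D - mdeg a) * X"
  proof (cases "mdeg a <= ?D")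
   case True
   thus ?thesis by (simp add: Suc_diff_le mult.commute mult.left_commute)
  next
   case False
   hence "hcoef n v e a = 0" using a e by (intro hcoef_mdeg_less) (auto simp: low_exponents_def)
   thus ?thesis by simp
  qed
  hence "G a = cst (v j) * ((cst (hcoef n v e a) * X ^ (?D - mdeg a) * X) * var_pow n y a)"
   unfolding G_def cst_mult by (metis mult.assoc)
  thus "mpoly_var j * (cst (hcoef n v e a) * (X ^ (?D - mdeg a) * var_pow n y a)) = F a + G a"
   unfolding F_def var_pow_Suc[OF j] var by (simp add: algebra_simps)
 qed
 moreover have "taylor (Suc k) (e + ?s) = (\<Sum>a\<in>?A. G a + H a)"
  unfolding taylor_def
  by (intro sum.cong refl, subst hcoef_pascal[OF e j]) (simp add: mdeg_add G_def H_def cst_add distrib_right)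
 moreover have "sum H ?A = sum F ?B"
 proof -
  have bij: "bij_betw (%a. a + ?s) ?B {a \<in> ?A. lookup a j > 0}"
  proof (rule bij_betw_imageI)
   show "inj_on (%a. a + ?s) ?B" by (auto intro: inj_onI)
   show "(%a. a + ?s) ` ?B = {a \<in> ?A. lookup a j > 0}"
   proof (intro subset_antisym subsetI)
    fix a assume "a \<in> (%a. a + ?s) ` ?B"
    then obtain b where b: "a = b + ?s" "b \<in> ?B" by blast
    hence "b \<in> exponents n (mdeg b)" by (auto simp: low_exponents_def exponents_def)
    hence "a \<in> exponents n (mdeg b + 1)" unfolding b(1) using j by (rule exponents_add_single)
    thus "a \<in> {a \<in> ?A. lookup a j > 0}" using b
     by (auto simp: low_exponents_def exponents_def lookup_add)
   next
    fix a assume a: "a \<in> {a \<in> ?A. lookup a j > 0}"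
    hence "mdeg a ~= 0" by (auto simp: mdeg_0_iff)
    then obtain l where l: "mdeg a = Suc l" using not0_implies_Suc by blast
    hence "a \<in> exponents n (Suc l)" using a by (auto simp: low_exponents_def exponents_def)
    from exponents_minus_single[OF this] a have "a - ?s \<in> exponents n l" "a = (a - ?s) + ?s" by auto
    moreover have "l < k" using a l by (auto simp: low_exponents_def)
    ultimately show "a \<in> (%a. a + ?s) ` ?B" by (intro image_eqI[of _ _ "a - ?s"]) (auto simp: low_exponents_def exponents_def)
   qed
  qed
  have "sum H ?A = sum H {a \<in> ?A. lookup a j > 0}"
   by (rule sum.mono_neutral_right) (auto simp: finite_low_exponents H_def)
  also have "\<dots> = (\<Sum>a\<in>?B. H (a + ?s))" by (rule sum.reindex_bij_betw[OF bij, symmetric])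
  also have "\<dots> = sum F ?B" by (intro sum.cong refl) (auto simp: H_def F_def lookup_add mdeg_add)
  finally show ?thesis .
 qed
 ultimately have "mpoly_var j * taylor (Suc k) e - taylor (Suc k) (e + ?s) = sum F ?A - sum F ?B"
  by (simp add: sum.distrib)
 also have "\<dots> = sum F (?A - ?B)"
  by (rule sum_diff[symmetric, OF finite_low_exponents]) (auto simp: low_exponents_def)
 also have "prod_span n y (Suc k) (Suc ?D) \<dots>"
 proof (rule prod_span_sum)
  fix a assume a: "a \<in> ?A - ?B"
  hence ak: "a \<in> exponents n k" by (auto simp: low_exponents_def exponents_def)
  show "prod_span n y (Suc k) (Suc ?D) (F a)"
  proof (cases "k <= ?D")
   case True
   have "a + ?s \<in> exponents n (Suc k)" using exponents_add_single[OF ak j, of 1] by simp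
   then obtain f where f: "\<forall>l<Suc k. f l <= n" "var_pow n y (a + ?s) = (\<Prod>l<Suc k. y (f l))"
    using var_pow_list by blast
   have "prod_span n y (Suc k) (Suc k) (single 0 1 * (\<Prod>l<Suc k. y (f l)))"
    by (rule prod_span.base) (use f in auto)
   hence "prod_span n y (Suc k) (Suc k) (var_pow n y (a + ?s))" by (simp only: f(2) single_one mult_1)
   from prod_span_cst[OF prod_span_X_pow[OF this, of "?D - mdeg a"]]
   show ?thesis using True exponentsD(2)[OF ak] by (simp add: F_def)
  next
   case False
   hence "hcoef n v e a = 0" using ak e by (intro hcoef_mdeg_less) (auto simp: exponents_def)
   thus ?thesis by (simp add: F_def prod_span.zero)
  qed
 qed
 finally show ?thesis .
qed

lemma taylor_monomial:
 "keys e \<subseteq> {..n} ==> mdeg e = D ==>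
  prod_span n y (Suc k) D (single e 1 - taylor (Suc k) e)"
proof (induction D arbitrary: e)
 case 0
 hence e: "e = 0" by (simp add: mdeg_0_iff)
 have "taylor (Suc k) e = (\<Sum>a\<in>{0}. cst (hcoef n v e a) * (X ^ (mdeg e - mdeg a) * var_pow n y a))"
  unfolding taylor_def
 proof (rule sum.mono_neutral_right[OF finite_low_exponents])
  show "\<forall>a\<in>low_exponents n (Suc k) - {0}. cst (hcoef n v e a) * (X ^ (mdeg e - mdeg a) * var_pow n y a) = 0"
  proof
   fix a assume a: "a \<in> low_exponents n (Suc k) - {0}"
   hence "mdeg a ~= 0" by (auto simp: mdeg_0_iff)
   hence "hcoef n v e a = 0" using a e by (intro hcoef_mdeg_less) (auto simp: low_exponents_def)
   thus "cst (hcoef n v e a) * (X ^ (mdeg e - mdeg a) * var_pow n y a) = 0" by simp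
  qed
 qed (auto simp: low_exponents_def)
 also have "\<dots> = 1" by (simp add: e hcoef_0 var_pow_def)
 finally show ?case by (simp add: e prod_span.zero)
next
 case (Suc D)
 hence eD: "e \<in> exponents n (Suc D)" by (simp add: exponents_def)
 have "e ~= 0" using Suc.prems by auto
 then obtain j where j: "j \<in> keys e" by (metis equals0I mdeg_0_iff mdeg_def sum.empty)
 hence "j \<in> {..n}" using Suc.prems by blast
 with j have jn: "j <= n" "lookup e j > 0" by (auto simp: in_keys_iff)
 define b where "b = e - single j 1"
 have b: "b \<in> exponents n D" "e = b + single j 1"
  using exponents_minus_single[OF eD jn(2)] by (auto simp: b_def)
 note b' = exponentsD[OF b(1)]
 have "prod_span n y (Suc k) (Suc D) (mpoly_var j * (single b 1 - taylor (Suc k) b))"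
  by (rule prod_span_var[OF Suc.IH[OF b'] jn(1)])
 moreover have "prod_span n y (Suc k) (Suc D) (mpoly_var j * taylor (Suc k) b - taylor (Suc k) e)"
  using taylor_step[OF b'(1) jn(1), of k] b'(2) b(2) by simp
 ultimately have "prod_span n y (Suc k) (Suc D) (mpoly_var j * (single b 1 - taylor (Suc k) b)
   + (mpoly_var j * taylor (Suc k) b - taylor (Suc k) e))" by (rule prod_span.add)
 thus ?case by (simp add: right_diff_distrib mpoly_var_mult_single b(2))
qed

text \<open>Summed over the monomials of g, the coefficients of the truncated expansions are the
  Hasse derivatives of g, which are zero. Only the remainders of \<open>taylor_monomial\<close> are
  left.\<close>

lemma vanishes_prod_span:
 assumes g: "g \<in> polys {..n}" "homogeneous D g" and van: "vanishes n (Suc k) v g"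
 shows "prod_span n y (Suc k) D g"
proof -
 let ?K = "keys g"
 have deg: "mdeg e = D" "keys e \<subseteq> {..n}" if "e \<in> ?K" for e
  using g that by (auto simp: homogeneous_def polys_def)
 have "prod_span n y (Suc k) D (\<Sum>e\<in>?K. cst (lookup g e) * (single e 1 - taylor (Suc k) e))"
  by (intro prod_span_sum prod_span_cst taylor_monomial deg)
 also have "(\<Sum>e\<in>?K. cst (lookup g e) * (single e 1 - taylor (Suc k) e)) =
   g - (\<Sum>e\<in>?K. cst (lookup g e) * taylor (Suc k) e)"
  by (subst (6) mpoly_sum_cst) (simp add: right_diff_distrib sum_subtractf)
 also have "(\<Sum>e\<in>?K. cst (lookup g e) * taylor (Suc k) e) =
   (\<Sum>e\<in>?K. \<Sum>a\<in>low_exponents n (Suc k). cst (lookup g e * hcoef n v e a) * (X ^ (D - mdeg a) * var_pow n y a))"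
  unfolding taylor_def sum_distrib_left
  by (intro sum.cong refl) (simp add: deg cst_mult mult.assoc)
 also have "\<dots> = (\<Sum>a\<in>low_exponents n (Suc k). cst (hasse n v a g) * (X ^ (D - mdeg a) * var_pow n y a))"
  by (subst sum.swap) (simp add: hasse_def cst_sum sum_distrib_right)
 also have "\<dots> = 0"
  using vanishesD[OF van] by (intro sum.neutral) (auto simp: low_exponents_def)
 finally show ?thesis by simp
qed

lemma prod_span_ideal_power:
 assumes "prod_span n y m D g"
 shows "g \<in> ideal_power {..n} (vanishing_ideal {..n} {ppoint_of v}) m"
 using assms unfolding ideal_power_def
proof (induction rule: prod_span.induct)
 case (base f e D c)
 show ?case
  by (intro gen_ideal_mult gen_ideal_base polys_single base CollectI exI[of _ "%l. y (f l)"] conjI refl)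
   (use base y_vanishing in auto)
qed (auto intro: gen_ideal_zero gen_ideal_add)

end

lemma ideal_power_iff_vanishes:
 fixes v :: "nat => 'a::field_char_0"
 assumes "v \<in> coord_space {..n}" "v ~= 0" "g \<in> polys {..n}" "homogeneous D g"
 shows "g \<in> ideal_power {..n} (vanishing_ideal {..n} {ppoint_of v}) (Suc k) \<longleftrightarrow> vanishes n (Suc k) v g"
proof
 assume van: "vanishes n (Suc k) v g"
 obtain i where i: "v i ~= 0" using assms by (auto simp: fun_eq_iff)
 hence "i <= n" using assms by (auto simp: coord_space_def)
 from prod_span_ideal_power[OF this i vanishes_prod_span[OF this i assms(3,4) van]]
 show "g \<in> ideal_power {..n} (vanishing_ideal {..n} {ppoint_of v}) (Suc k)" .
qed (use ideal_power_vanishes in blast)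

text \<open>Euler's relation expresses D minus the order times a derivative through the derivatives
  of the next order. Below order k <= D this factor is non-zero in characteristic 0, so vanishing
  propagates downwards.\<close>

lemma vanishes_iff_top:
 assumes g: "g \<in> polys {..n}" "homogeneous D g" and k: "k <= D"
 shows "vanishes n (Suc k) v g \<longleftrightarrow> (\<forall>a\<in>exponents n k. hasse n v a g = 0)"
proof
 assume top: "\<forall>a\<in>exponents n k. hasse n v a g = 0"
 have euler: "(of_nat D - of_nat (mdeg a)) * hasse n v a g =
   (\<Sum>i\<le>n. v i * (of_nat (lookup a i + 1) * hasse n v (a + single i 1) g))"
  if a: "keys a \<subseteq> {..n}" for a
 proof -
  have "(of_nat D - of_nat (mdeg a)) * hasse n v a g =
   (\<Sum>e\<in>keys g. lookup g e * ((of_nat (mdeg e) - of_nat (mdeg a)) * hcoef n v e a))"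
   unfolding hasse_def sum_distrib_left using g by (intro sum.cong) (auto simp: homogeneous_def)
  also have "\<dots> = (\<Sum>e\<in>keys g. \<Sum>i\<le>n. lookup g e *
    (v i * (of_nat (lookup a i + 1) * hcoef n v e (a + single i 1))))"
   using g a by (intro sum.cong refl) (auto simp: polys_def hcoef_euler[symmetric] sum_distrib_left)
  also have "\<dots> = (\<Sum>i\<le>n. v i * (of_nat (lookup a i + 1) * hasse n v (a + single i 1) g))"
   by (subst sum.swap) (simp add: hasse_def sum_distrib_left mult_ac)
  finally show ?thesis .
 qed
 have "hasse n v a g = 0" if "a \<in> exponents n (k - l)" "l <= k" for a l
  using that
 proof (induction l arbitrary: a)
  case 0
  thus ?case using top by simp
 next
  case (Suc l)
  note a = exponentsD[OF Suc.prems(1)]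
  have "hasse n v (a + single i 1) g = 0" if "i <= n" for i
   using Suc.IH[of "a + single i 1"] exponents_add_single[OF Suc.prems(1) that, of 1] Suc.prems(2)
   by (simp add: Suc_diff_Suc)
  hence "(of_nat D - of_nat (mdeg a)) * hasse n v a g = 0" unfolding euler[OF a(1)] by simp
  moreover have "mdeg a < D" using a(2) Suc.prems(2) k by simp
  hence "of_nat D - of_nat (mdeg a) ~= (0::'a)" by simp
  ultimately show ?case by simp
 qed
 note * = this
 show "vanishes n (Suc k) v g"
  unfolding vanishes_def
 proof (intro allI impI)
  fix a assume "keys a \<subseteq> {..n}" "mdeg a < Suc k"
  thus "hasse n v a g = 0" using *[of a "k - mdeg a"] by (simp add: exponents_def)
 qed
qed (auto simp: vanishes_def exponents_def)

section \<open>Osculating spaces of the Veronese variety\<close>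

text \<open>In the coordinates of \<open>veronese_map\<close>, the \<open>k\<close>-th osculating space at the image of \<open>v\<close> is
  spanned by the vectors of Hasse derivatives of order \<open>k\<close> of all monomials.\<close>

definition hrow :: "nat => nat => (nat => 'a::field_char_0) => expo => expo => 'a" where
 "hrow n d v a = (%e. if e \<in> exponents n d then hcoef n v e a else 0)"

text \<open>The osculating space is written as the image of a linear map in the coefficients G of a
  degree-k form in divided powers. The pairs (v, G) then parametrize the osculating variety
  polynomially.\<close>

definition osc :: "nat => nat => nat => (nat => 'a::field_char_0) => (expo => 'a) => expo => 'a" where
 "osc n d k v G = (%e. if e \<in> exponents n d then \<Sum>a\<in>exponents n k. G a * hcoef n v e a else 0)"

definition osc_space :: "nat => nat => nat => (nat => 'a::field_char_0) => (expo => 'a) set" where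
 "osc_space n d k v = range (osc n d k v)"

lemma hrow_coord_space: "hrow n d v a \<in> coord_space (exponents n d)"
 by (simp add: hrow_def coord_space_def)

lemma osc_coord_space: "osc n d k v G \<in> coord_space (exponents n d)"
 by (simp add: osc_def coord_space_def)

lemma osc_space_coord_space: "osc_space n d k v \<subseteq> coord_space (exponents n d)"
 using osc_coord_space by (auto simp: osc_space_def)

lemma osc_eq: "osc n d k v G = (\<Sum>a\<in>exponents n k. vscale (G a) (hrow n d v a))"
 by (rule ext) (simp add: osc_def hrow_def fun_arith)

lemma osc_add: "osc n d k v (G + H) = osc n d k v G + osc n d k v H"
 by (rule ext) (simp add: osc_def distrib_right sum.distrib)

lemma osc_scale: "osc n d k v (vscale c G) = vscale c (osc n d k v G)"
 by (rule ext) (simp add: osc_def vscale_apply sum_distrib_left mult.assoc)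

lemma linear_osc: "Vector_Spaces.linear vscale vscale (osc n d k v)"
 unfolding Vector_Spaces.linear_iff using osc_add osc_scale vec.vector_space_axioms by blast

lemma subspace_osc_space: "vec.subspace (osc_space n d k v)"
proof -
 interpret Vector_Spaces.linear vscale vscale "osc n d k v" by (rule linear_osc)
 show ?thesis unfolding osc_space_def by (rule subspace_image) simp
qed

lemma osc_unit_vec: "a \<in> exponents n k ==> osc n d k v (unit_vec a) = hrow n d v a"
 by (rule ext) (auto simp: osc_def hrow_def unit_vec_def if_distrib[of "%x. x * _"] cong: if_cong)

lemma osc_space_span: "osc_space n d k v = vec.span (hrow n d v ` exponents n k)"
proof (rule subset_antisym)
 show "osc_space n d k v \<subseteq> vec.span (hrow n d v ` exponents n k)"
 proof
  fix x assume "x \<in> osc_space n d k v"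
  then obtain G where x: "x = osc n d k v G" by (auto simp: osc_space_def)
  show "x \<in> vec.span (hrow n d v ` exponents n k)" unfolding x osc_eq
   by (intro vec.span_sum vec.span_scale vec.span_base) auto
 qed
 show "vec.span (hrow n d v ` exponents n k) \<subseteq> osc_space n d k v"
 proof (rule vec.span_minimal[OF _ subspace_osc_space], rule subsetI)
  fix x assume "x \<in> hrow n d v ` exponents n k"
  then obtain a where "a \<in> exponents n k" "x = hrow n d v a" by blast
  hence "x = osc n d k v (unit_vec a)" by (simp add: osc_unit_vec)
  thus "x \<in> osc_space n d k v" by (simp add: osc_space_def)
 qed
qed

lemma osc_cong: "(!!i. i <= n ==> v i = u i) ==> osc n d k v G = osc n d k u G"
 unfolding osc_def by (intro ext if_cong sum.cong refl) (auto simp: hcoef_prod exponentsD(1))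

lemma osc_cong_form: "(!!a. a \<in> exponents n k ==> G a = H a) ==> osc n d k v G = osc n d k v H"
 unfolding osc_def by (intro ext if_cong sum.cong refl) auto

text \<open>Triangularity: among the exponents with nonzero coefficient take one with the largest
  entry at an index where \<open>v\<close> does not vanish.\<close>

lemma osc_inj:
 fixes v :: "nat => 'a::field_char_0"
 assumes i0: "i0 <= n" "v i0 ~= 0" and k: "k <= d"
  and 0: "!!e. e \<in> exponents n d ==> (\<Sum>a\<in>exponents n k. G a * hcoef n v e a) = 0"
  and a: "a \<in> exponents n k"
 shows "G a = 0"
proof (rule ccontr)
 assume Ga: "G a ~= 0"
 let ?A = "{a \<in> exponents n k. G a ~= 0}"
 define M where "M = Max ((%a. lookup a i0) ` ?A)"
 have fin: "finite ((%a. lookup a i0) ` ?A)" by simp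
 have "M \<in> (%a. lookup a i0) ` ?A" unfolding M_def by (rule Max_in) (use Ga a in auto)
 then obtain b where b: "b \<in> exponents n k" "G b ~= 0" "M = lookup b i0" by auto
 have max: "lookup c i0 <= lookup b i0" if "c \<in> exponents n k" "G c ~= 0" for c
  unfolding b(3)[symmetric] M_def by (rule Max_ge[OF fin]) (use that in auto)
 \<comment> \<open>Among the exponents c with \<open>G c\<close> non-zero, only b divides this
   monomial: all entries other than i0 are bounded by those of b, and the entry at i0 is bounded by
   maximality.\<close>
 define e where "e = b + single i0 (d - k)"
 have e: "e \<in> exponents n d" using exponents_add_single[OF b(1) i0(1), of "d - k"] k by (simp add: e_def)
 have z: "G c * hcoef n v e c = 0" if c: "c \<in> exponents n k - {b}" for c
 proof (rule ccontr)
  assume "G c * hcoef n v e c ~= 0"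
  hence Gc: "G c ~= 0" "hcoef n v e c ~= 0" by auto
  have "c = b"
  proof (rule exponents_le_eq[of _ n k])
   fix i assume "i <= n"
   show "lookup c i <= lookup b i"
    using hcoef_neq_0D[OF Gc(2) \<open>i <= n\<close>] max[of c] c Gc(1)
    by (cases "i = i0") (auto simp: e_def lookup_add lookup_single)
  qed (use b c in auto)
  thus False using c by simp
 qed
 have "(\<Sum>a\<in>exponents n k - {b}. G a * hcoef n v e a) = 0"
  by (rule sum.neutral) (use z in blast)
 hence "(\<Sum>a\<in>exponents n k. G a * hcoef n v e a) = G b * hcoef n v e b"
  using b(1) by (subst sum.remove[of _ b]) simp_all
 moreover have "e - b = single i0 (d - k)" by (simp add: e_def)
 hence "hcoef n v e b = of_nat (binprod n e b) * v i0 ^ (d - k)" by (simp add: hcoef_def)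
 moreover have "binprod n e b ~= 0"
  by (auto simp: binprod_def e_def lookup_add binomial_eq_0_iff)
 ultimately show False using 0[OF e] b(2) i0 by simp
qed

lemma dim_osc_space_le: "vec.dim (osc_space n d k v) <= card (exponents n k)"
proof -
 have "vec.dim (osc_space n d k v) <= card (hrow n d v ` exponents n k)"
  by (rule vec.dim_le_card) (auto simp: osc_space_span)
 thus ?thesis using card_image_le[of "exponents n k" "hrow n d v"] by simp
qed

lemma dim_osc_space:
 fixes v :: "nat => 'a::field_char_0"
 assumes "i0 <= n" "v i0 ~= 0" "k <= d"
 shows "vec.dim (osc_space n d k v) = card (exponents n k)"
proof (rule antisym[OF dim_osc_space_le])
 have "indep_family (exponents n k) (hrow n d v)"
  unfolding indep_family_def
 proof (intro allI impI ballI)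
  fix c a assume c: "(\<Sum>a\<in>exponents n k. vscale (c a) (hrow n d v a)) = 0" and a: "a \<in> exponents n k"
  show "c a = 0"
  proof (rule osc_inj[where v = v, OF assms _ a])
   fix e assume "e \<in> exponents n d"
   thus "(\<Sum>a\<in>exponents n k. c a * hcoef n v e a) = 0"
    using fun_cong[OF c, of e] by (simp add: fun_arith hrow_def)
  qed
 qed
 thus "card (exponents n k) <= vec.dim (osc_space n d k v)"
  by (rule indep_family_card_le[where I = "exponents n d"])
   (auto simp: osc_space_span osc_space_coord_space[unfolded osc_space_span] intro!: vec.span_base
    intro: osc_space_coord_space[unfolded osc_space_span, THEN subsetD])
qed

text \<open>Multiplication of the divided-power form \<open>G\<close> by the linear form \<open>b\<close>.\<close>

definition lin_mult :: "nat => (nat => 'a::field_char_0) => (expo => 'a) => expo => 'a" where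
 "lin_mult n b G = (%c. \<Sum>i\<le>n. b i * (if lookup c i > 0
   then of_nat (lookup c i) * G (c - single i 1) else 0))"

lemma sum_exponents_Suc:
 assumes "i <= n"
 shows "(\<Sum>c\<in>exponents n (Suc k). if lookup c i > 0 then F (c - single i 1) c else 0) =
  (\<Sum>a\<in>exponents n k. F a (a + single i 1))"
proof -
 let ?s = "single i (1::nat)" and ?B = "{c \<in> exponents n (Suc k). lookup c i > 0}"
 have bij: "bij_betw (%a. a + ?s) (exponents n k) ?B"
 proof (rule bij_betw_imageI)
  show "inj_on (%a. a + ?s) (exponents n k)" by (auto intro: inj_onI)
  show "(%a. a + ?s) ` exponents n k = ?B"
  proof (intro subset_antisym subsetI)
   fix c assume "c \<in> (%a. a + ?s) ` exponents n k"
   then obtain a where a: "a \<in> exponents n k" "c = a + ?s" by blast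
   thus "c \<in> ?B" using exponents_add_single[OF a(1) assms, of 1] by (simp add: lookup_add)
  next
   fix c assume c: "c \<in> ?B"
   from exponents_minus_single[of c n k i] c have "c - ?s \<in> exponents n k" "c = (c - ?s) + ?s" by auto
   thus "c \<in> (%a. a + ?s) ` exponents n k" by blast
  qed
 qed
 have "(\<Sum>c\<in>exponents n (Suc k). if lookup c i > 0 then F (c - ?s) c else 0) = (\<Sum>c\<in>?B. F (c - ?s) c)"
  by (rule sum.mono_neutral_cong_right) auto
 also have "\<dots> = (\<Sum>a\<in>exponents n k. F (a + ?s - ?s) (a + ?s))" by (rule sum.reindex_bij_betw[OF bij, symmetric])
 finally show ?thesis by simp
qed

lemma osc_lin_mult:
 "osc n d (Suc k) v (lin_mult n b G) = (%e. if e \<in> exponents n d then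
   \<Sum>a\<in>exponents n k. G a * (\<Sum>i\<le>n. b i * (of_nat (lookup a i + 1) * hcoef n v e (a + single i 1))) else 0)"
proof (rule ext)
 fix e
 have "(\<Sum>c\<in>exponents n (Suc k). lin_mult n b G c * hcoef n v e c) =
  (\<Sum>i\<le>n. \<Sum>c\<in>exponents n (Suc k). if lookup c i > 0 then
    b i * (of_nat (lookup c i) * G (c - single i 1)) * hcoef n v e c else 0)"
  unfolding lin_mult_def sum_distrib_right by (subst sum.swap) (intro sum.cong refl, simp)
 also have "\<dots> = (\<Sum>i\<le>n. \<Sum>a\<in>exponents n k. b i * (of_nat (lookup (a + single i 1) i) * G a)
   * hcoef n v e (a + single i 1))"
  by (intro sum.cong refl sum_exponents_Suc[where F = "%a c. b _ * (of_nat (lookup c _) * G a) * hcoef n v e c"]) simp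
 also have "\<dots> = (\<Sum>a\<in>exponents n k. G a * (\<Sum>i\<le>n. b i * (of_nat (lookup a i + 1) * hcoef n v e (a + single i 1))))"
  by (subst sum.swap) (simp add: sum_distrib_left lookup_add mult_ac)
 finally show "osc n d (Suc k) v (lin_mult n b G) e = (if e \<in> exponents n d then
   \<Sum>a\<in>exponents n k. G a * (\<Sum>i\<le>n. b i * (of_nat (lookup a i + 1) * hcoef n v e (a + single i 1))) else 0)"
  by (simp add: osc_def)
qed

text \<open>Multiplication by v itself leads back to order k. Moving a point along its own
  coordinate vector therefore yields no new tangent direction.\<close>

lemma osc_euler:
 "osc n d (Suc k) v (lin_mult n v G) = vscale (of_nat d - of_nat k) (osc n d k v G)"
proof (rule ext)
 fix e
 show "osc n d (Suc k) v (lin_mult n v G) e = vscale (of_nat d - of_nat k) (osc n d k v G) e"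
 proof (cases "e \<in> exponents n d")
  case True
  have "(\<Sum>a\<in>exponents n k. G a * (\<Sum>i\<le>n. v i * (of_nat (lookup a i + 1) * hcoef n v e (a + single i 1))))
   = (\<Sum>a\<in>exponents n k. G a * ((of_nat d - of_nat k) * hcoef n v e a))"
  proof (intro sum.cong refl arg_cong2[where f = "(*)"])
   fix a assume "a \<in> exponents n k"
   thus "(\<Sum>i\<le>n. v i * (of_nat (lookup a i + 1) * hcoef n v e (a + single i 1)))
    = (of_nat d - of_nat k) * hcoef n v e a"
    using hcoef_euler[of e n a v] True by (simp only: exponentsD)
  qed
  thus ?thesis using True unfolding osc_lin_mult by (simp add: osc_def vscale_apply sum_distrib_left mult_ac)
 qed (simp add: osc_lin_mult osc_def vscale_apply)
qed

lemma osc_space_Suc: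
 assumes "k < d"
 shows "osc_space n d k v \<subseteq> osc_space n d (Suc k) v"
proof
 fix x assume "x \<in> osc_space n d k v"
 then obtain G where x: "x = osc n d k v G" by (auto simp: osc_space_def)
 let ?c = "of_nat d - of_nat k :: 'a"
 have "?c ~= 0" using assms by simp
 hence "x = osc n d (Suc k) v (vscale (inverse ?c) (lin_mult n v G))"
  by (simp add: x osc_scale osc_euler vec.scale_scale)
 thus "x \<in> osc_space n d (Suc k) v" by (simp add: osc_space_def)
qed

section \<open>Forms of degree d as coefficient vectors\<close>

definition poly_of :: "nat => nat => (expo => 'a::field_char_0) => (nat, 'a) mpoly" where
 "poly_of n d w = (\<Sum>e\<in>exponents n d. single e (w e))"

lemma lookup_poly_of: "lookup (poly_of n d w) e = (if e \<in> exponents n d then w e else 0)"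
 by (auto simp: poly_of_def lookup_sum lookup_single when_def)

lemma keys_poly_of: "keys (poly_of n d w) \<subseteq> exponents n d"
 by (auto simp: in_keys_iff lookup_poly_of split: if_splits)

lemma poly_of_polys: "poly_of n d w \<in> polys {..n}" and poly_of_homogeneous: "homogeneous d (poly_of n d w)"
 using keys_poly_of[of n d w] by (auto simp: polys_def homogeneous_def exponents_def)

lemma keys_homogeneous: "g \<in> polys {..n} ==> homogeneous d g ==> keys g \<subseteq> exponents n d"
 by (auto simp: polys_def homogeneous_def exponents_def)

lemma poly_of_lookup: "g \<in> polys {..n} ==> homogeneous d g ==> poly_of n d (lookup g) = g"
 by (rule poly_mapping_eqI) (use keys_homogeneous[of g n d] in \<open>auto simp: lookup_poly_of in_keys_iff\<close>)

text \<open>A Hasse derivative of a form at v is the pairing of its coefficient vector with a row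
  \<open>hrow\<close>, and by \<open>vanishes_iff_top\<close> order k suffices. This is the duality
  through which vanishing conditions become dimensions of osculating spaces.\<close>

lemma vanishes_iff_ann:
 fixes v :: "nat => 'a::field_char_0"
 assumes w: "w \<in> coord_space (exponents n d)" and k: "k <= d"
 shows "vanishes n (Suc k) v (poly_of n d w) \<longleftrightarrow> w \<in> ann (exponents n d) (osc_space n d k v)"
proof -
 have "hasse n v a (poly_of n d w) = dotp (exponents n d) w (hrow n d v a)" for a
  by (subst hasse_superset[of "exponents n d"])
   (auto simp: keys_poly_of[THEN subsetD] lookup_poly_of dotp_def hrow_def intro!: sum.cong)
 hence "vanishes n (Suc k) v (poly_of n d w) \<longleftrightarrow> w \<in> ann (exponents n d) (hrow n d v ` exponents n k)"
  unfolding vanishes_iff_top[OF poly_of_polys poly_of_homogeneous k] using w by (auto simp: ann_def)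
 thus ?thesis by (simp add: osc_space_span ann_span)
qed

section \<open>Parametrization of the secant varieties of the osculating varieties\<close>

text \<open>One function holds, for each of the s indices, the coordinates of a point under
  \<open>Inl\<close> and the coefficients of a form under \<open>Inr\<close>; in this shape the
  calculus of \<open>polyfun\<close> applies to all parameters at once.\<close>

type_synonym 'a params = "nat \<times> (nat + expo) => 'a"

definition pt :: "'a params => nat => nat => 'a" where
 "pt t j = (%i. t (j, Inl i))"

definition form :: "'a params => nat => expo => 'a" where
 "form t j = (%a. t (j, Inr a))"

definition param_index :: "nat => nat => nat => (nat \<times> (nat + expo)) set" where
 "param_index n k s = {..<s} \<times> ({..n} <+> exponents n k)"

text \<open>Sums of s vectors from osculating spaces at arbitrary points. The closure of the image
  is the cone over the secant variety, see \<open>secant_variety_veronese\<close>.\<close>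

definition secant_param :: "nat => nat => nat => nat => 'a::field_char_0 params => expo => 'a" where
 "secant_param n d k s t = (\<Sum>j<s. osc n d k (pt t j) (form t j))"

lemma finite_param_index: "finite (param_index n k s)"
 by (auto simp: param_index_def)

lemma secant_param_coord_space: "secant_param n d k s t \<in> coord_space (exponents n d)"
 unfolding secant_param_def by (intro vec.subspace_sum subspace_coord_space osc_coord_space)

lemma polyfun_pt: "j < s ==> i <= n ==> polyfun (param_index n k s) (%t. pt t j i)"
 unfolding pt_def by (rule polyfun_var) (auto simp: param_index_def)

lemma polyfun_form: "j < s ==> a \<in> exponents n k ==> polyfun (param_index n k s) (%t. form t j a)"
 unfolding form_def by (rule polyfun_var) (auto simp: param_index_def)

lemma polyfun_hcoef_pt: "j < s ==> e \<in> exponents n d ==> polyfun (param_index n k s) (%t. hcoef n (pt t j) e a)"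
 by (rule polyfun_compose[OF polyfun_hcoef]) (auto intro: polyfun_pt dest: exponentsD)

lemma polyfun_osc: "j < s ==> polyfun (param_index n k s) (%t. osc n d k (pt t j) (form t j) e)"
 unfolding osc_def
 by (intro polyfun_if polyfun_sum polyfun_mult polyfun_const polyfun_form polyfun_hcoef_pt) auto

lemma polyfun_secant_param: "polyfun (param_index n k s) (%t. secant_param n d k s t e)"
 unfolding secant_param_def sum_fun_apply by (intro polyfun_sum polyfun_osc) auto

text \<open>Varying a form stays in the osculating space of order k. Varying a point raises the
  order by one and multiplies the form by the direction of motion.\<close>

lemma dmap_secant_param:
 "dmap (secant_param n d k s) t u =
  (\<Sum>j<s. osc n d k (pt t j) (form u j) + osc n d (Suc k) (pt t j) (lin_mult n (pt u j) (form t j)))"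
proof (rule ext)
 fix e
 let ?J = "param_index n k s"
 have "dd (%t. osc n d k (pt t j) (form t j) e) t u =
   osc n d k (pt t j) (form u j) e + osc n d (Suc k) (pt t j) (lin_mult n (pt u j) (form t j)) e" if j: "j < s" for j
 proof (cases "e \<in> exponents n d")
  case True
  have "dd (%t. form t j a * hcoef n (pt t j) e a) t u =
    form t j a * (\<Sum>i\<le>n. pt u j i * (of_nat (lookup a i + 1) * hcoef n (pt t j) e (a + single i 1)))
    + form u j a * hcoef n (pt t j) e a" if a: "a \<in> exponents n k" for a
  proof -
   have "dd (%t. hcoef n (pt t j) e a) t u = dd (%v. hcoef n v e a) (pt t j) (%i. dd (%t. pt t j i) t u)"
    by (rule dd_compose[OF polyfun_hcoef, where K = ?J]) (use True j in \<open>auto intro: polyfun_pt dest: exponentsD\<close>)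
   also have "(%i. dd (%t. pt t j i) t u) = pt u j" by (simp add: pt_def)
   finally have 1: "dd (%t. hcoef n (pt t j) e a) t u =
     (\<Sum>i\<le>n. pt u j i * (of_nat (lookup a i + 1) * hcoef n (pt t j) e (a + single i 1)))"
    using dd_hcoef[OF exponentsD(1)[OF True]] by simp
   have 2: "dd (%t. form t j a) t u = form u j a" by (simp add: form_def)
   show ?thesis
    by (subst dd_mult[OF polyfun_form[OF j a] polyfun_hcoef_pt[OF j True]]) (simp only: 1 2)
  qed
  hence "dd (%t. \<Sum>a\<in>exponents n k. form t j a * hcoef n (pt t j) e a) t u =
    (\<Sum>a\<in>exponents n k. form t j a * (\<Sum>i\<le>n. pt u j i * (of_nat (lookup a i + 1) * hcoef n (pt t j) e (a + single i 1)))
    + form u j a * hcoef n (pt t j) e a)"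
   by (subst dd_sum[of _ ?J]) (use True j in \<open>auto intro!: polyfun_mult polyfun_form polyfun_hcoef_pt\<close>)
  thus ?thesis using True by (simp add: osc_def[of n d k] osc_lin_mult sum.distrib add.commute)
 next
  case False
  thus ?thesis by (simp add: osc_def)
 qed
 thus "dmap (secant_param n d k s) t u e =
  (\<Sum>j<s. osc n d k (pt t j) (form u j) + osc n d (Suc k) (pt t j) (lin_mult n (pt u j) (form t j))) e"
  unfolding dmap_def secant_param_def sum_fun_apply
  by (subst dd_sum[of _ ?J]) (auto intro: polyfun_osc)
qed

lemma secant_param_cone: "EX t'. secant_param n d k s t' = vscale c (secant_param n d k s t)"
proof
 define t' where "t' = (%(j, x). case x of Inl i => t (j, Inl i) | Inr a => c * t (j, Inr a))"
 have "pt t' j = pt t j" "form t' j = vscale c (form t j)" for j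
  by (auto simp: t'_def pt_def form_def fun_eq_iff vscale_apply)
 thus "secant_param n d k s t' = vscale c (secant_param n d k s t)"
  by (simp add: secant_param_def osc_scale vec.scale_sum_right)
qed

lemma secant_param_euler:
 fixes t :: "'a::field_char_0 params"
 shows "secant_param n d k s t \<in> range (dmap (secant_param n d k s) t)"
proof -
 define u :: "'a params" where "u = (%(j, x). case x of Inl i => 0 | Inr a => t (j, Inr a))"
 have "pt u j = (%_. 0)" "form u j = form t j" for j
  by (auto simp: u_def pt_def form_def fun_eq_iff)
 moreover have "osc n d (Suc k) v (lin_mult n (%_. 0) G) = 0" for v :: "nat => 'a" and G
  by (simp add: lin_mult_def osc_def fun_eq_iff)
 ultimately have "secant_param n d k s t = dmap (secant_param n d k s) t u"
  by (simp add: dmap_secant_param secant_param_def)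
 thus ?thesis by blast
qed

lemma conical_secant_param: "conical (range (secant_param n d k s))"
 unfolding conical_def using secant_param_cone by (metis rangeE rangeI)

section \<open>The Veronese variety\<close>

lemma exponents_0: "exponents n 0 = {0}"
 by (auto simp: exponents_def mdeg_0_iff)

lemma exponents_1: "exponents n (Suc 0) = (%i. single i 1) ` {..n}"
proof (intro subset_antisym subsetI)
 fix c assume c: "c \<in> exponents n (Suc 0)"
 hence "c ~= 0" by (auto simp: exponents_def)
 then obtain i where i: "i \<in> keys c" by (metis equals0I mdeg_0_iff mdeg_def sum.empty)
 hence "i \<in> {..n}" "lookup c i > 0" using exponentsD(1)[OF c] by (auto simp: in_keys_iff subset_iff)
 moreover from exponents_minus_single[OF c this(2)] have "c = single i 1"
  by (simp add: exponents_0)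
 ultimately show "c \<in> (%i. single i 1) ` {..n}" by blast
qed (auto simp: exponents_def)

lemma veronese_map_hrow: "veronese_map n d v = hrow n d v 0"
 by (rule ext) (simp add: veronese_map_def hrow_def hcoef_0 exponentsD)

lemma osc_0: "osc n d 0 v G = vscale (G 0) (veronese_map n d v)"
 by (simp add: osc_eq exponents_0 veronese_map_hrow)

lemma veronese_map_coord_space: "veronese_map n d v \<in> coord_space (exponents n d)"
 by (simp add: veronese_map_def coord_space_def)

lemma single_exponents: "i <= n ==> single i d \<in> exponents n d"
 by (auto simp: exponents_def split: if_splits)

lemma veronese_map_neq_0: "i <= n ==> v i ~= 0 ==> veronese_map n d v (single i d) ~= 0"
 by (simp add: veronese_map_def single_exponents)

definition veronese_cone :: "nat => nat => (expo => 'a::field_char_0) set" where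
 "veronese_cone n d = {vscale c (veronese_map n d v) |c v. True}"

lemma range_secant_param_1: "range (secant_param n d k 1) = {osc n d k v G |v G. True}"
proof (intro subset_antisym subsetI)
 fix x :: "expo => 'a" assume "x \<in> {osc n d k v G |v G. True}"
 then obtain v G where x: "x = osc n d k v G" by blast
 have "secant_param n d k 1 (%(j, y). case y of Inl i => v i | Inr a => G a) = x"
  by (simp add: secant_param_def pt_def form_def x)
 thus "x \<in> range (secant_param n d k 1)" by (metis rangeI)
qed (auto simp: secant_param_def)

lemma range_secant_param_veronese: "range (secant_param n d 0 1) = veronese_cone n d"
 unfolding range_secant_param_1 veronese_cone_def osc_0
proof (intro subset_antisym subsetI)
 fix x :: "expo => 'a" assume "x \<in> {vscale c (veronese_map n d v) |c v. True}"
 then obtain c v where "x = vscale c (veronese_map n d v)" by blast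
 thus "x \<in> {vscale (G 0) (veronese_map n d v) |v G. True}"
  by (intro CollectI exI[of _ v] exI[of _ "%_. c"]) simp
qed blast

lemma restrict_coord_space:
 "\<exists>u\<in>coord_space {..n}. (\<forall>i\<le>n. u i = v i) & veronese_map n d u = veronese_map n d (v :: nat => 'a::field_char_0)"
proof (rule bexI[of _ "%i. if i <= n then v i else 0"], intro conjI ext)
 fix e
 have "keys e \<subseteq> {..n} ==> monom_eval e (%i. if i <= n then v i else 0) = monom_eval e v"
  unfolding monom_eval_def by (intro prod.cong) (auto simp: subset_iff)
 thus "veronese_map n d (%i. if i <= n then v i else 0) e = veronese_map n d v e"
  by (auto simp: veronese_map_def exponentsD)
qed (auto simp: coord_space_def)

lemma veronese_map_zero: "0 < d ==> (!!i. i <= n ==> v i = 0) ==> veronese_map n d v = 0"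
proof (rule ext)
 fix e assume d: "0 < d" and v: "!!i. i <= n ==> v i = 0"
 show "veronese_map n d v e = 0 e"
 proof (cases "e \<in> exponents n d")
  case True
  hence "e ~= 0" using d by (auto simp: exponents_def)
  then obtain i where i: "i \<in> keys e" by (metis equals0I mdeg_0_iff mdeg_def sum.empty)
  hence "i \<in> {..n}" using exponentsD(1)[OF True] by blast
  moreover have "lookup e i > 0" using i by (simp add: in_keys_iff)
  ultimately have "v i ^ lookup e i = 0" using v by simp
  hence "monom_eval e v = 0" unfolding monom_eval_def using i by (auto simp: prod_zero_iff)
  thus ?thesis by (simp add: veronese_map_def)
 qed (simp add: veronese_map_def)
qed

lemma veronese_variety_eq:
 assumes d: "0 < d"
 shows "(veronese_variety n d :: (nat \<Rightarrow>\<^sub>0 nat, 'a::field_char_0) ppoint set) = projectivization (veronese_cone n d)"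
proof (intro subset_antisym subsetI)
 fix P :: "(nat \<Rightarrow>\<^sub>0 nat, 'a) ppoint" assume "P \<in> veronese_variety n d"
 then obtain v where v: "P = ppoint_of (veronese_map n d v)" "v \<in> coord_space {..n}" "v ~= 0"
  by (auto simp: veronese_variety_def)
 then obtain i where "v i ~= 0" by (auto simp: fun_eq_iff)
 hence "veronese_map n d v ~= 0"
  using veronese_map_neq_0[of i n v d] v(2) by (auto simp: coord_space_def fun_eq_iff)
 moreover have "veronese_map n d v = vscale 1 (veronese_map n d v)" by simp
 hence "veronese_map n d v \<in> veronese_cone n d" unfolding veronese_cone_def by blast
 ultimately show "P \<in> projectivization (veronese_cone n d)" using v projectivization_mem by blast
next
 fix P :: "(nat \<Rightarrow>\<^sub>0 nat, 'a) ppoint" assume "P \<in> projectivization (veronese_cone n d)"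
 then obtain c v where v: "P = ppoint_of (vscale c (veronese_map n d v))" "vscale c (veronese_map n d v) ~= 0"
  by (auto simp: veronese_cone_def elim!: projectivizationE)
 obtain u where u: "u \<in> coord_space {..n}" "veronese_map n d u = veronese_map n d v"
  using restrict_coord_space by blast
 have c: "c ~= 0" and "veronese_map n d u ~= 0" using v(2) u by auto
 hence "u ~= 0" using veronese_map_zero[OF d, of n u] by auto
 moreover have "P = ppoint_of (veronese_map n d u)" using v(1) ppoint_of_vscale[OF c] u by simp
 ultimately show "P \<in> veronese_variety n d" using u(1) unfolding veronese_variety_def by blast
qed

text \<open>Moving one unit of the exponent \<open>e\<close> from \<open>j\<close> to \<open>i\<close>.\<close>

definition shift_exp :: "expo => nat => nat => nat \<Rightarrow>\<^sub>0 nat" where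
 "shift_exp e j i = (e - single j 1) + single i 1"

lemma shift_exp:
 assumes "e \<in> exponents n d" "lookup e j > 0" "i <= n"
 shows "shift_exp e j i \<in> exponents n d" "e + single i 1 = shift_exp e j i + single j 1"
proof -
 have "d ~= 0" using assms(1,2) by (cases d) (auto simp: exponents_0)
 then obtain d' where d': "d = Suc d'" using not0_implies_Suc by blast
 note e = exponents_minus_single[of e n d' j]
 show "shift_exp e j i \<in> exponents n d"
  unfolding shift_exp_def d' using exponents_add_single[of _ n d' i 1] e assms d' by simp
 show "e + single i 1 = shift_exp e j i + single j 1"
  unfolding shift_exp_def using e(2) assms(1,2) d' by (metis add.assoc add.commute)
qed

lemma veronese_quadric:
 assumes "e + e' = f + f'" "e \<in> exponents n d" "e' \<in> exponents n d" "f \<in> exponents n d" "f' \<in> exponents n d"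
 shows "veronese_map n d v e * veronese_map n d v e' = veronese_map n d v f * veronese_map n d v f'"
 using assms by (simp add: veronese_map_def flip: monom_eval_add)

lemma exponents_last:
 assumes "e \<in> exponents n d" "lookup e i = d" "i <= n"
 shows "e = single i d"
 by (rule exponents_le_eq[symmetric, of _ n d])
  (use assms single_exponents in \<open>auto simp: lookup_single when_def\<close>)

lemma exponents_other:
 assumes "e \<in> exponents n d" "lookup e i ~= d" "i <= n"
 obtains j where "j <= n" "j ~= i" "lookup e j > 0"
proof -
 have "EX j. j <= n & j ~= i & lookup e j > 0"
 proof (rule ccontr)
  assume "\<not> ?thesis"
  hence "(\<Sum>j\<in>{..n} - {i}. lookup e j) = 0" by auto
  hence "(\<Sum>j\<le>n. lookup e j) = lookup e i"
   using assms(3) by (subst sum.remove[of _ i]) auto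
  thus False using assms by (simp add: exponents_iff)
 qed
 thus thesis using that by blast
qed

text \<open>The cone is cut out by the quadrics \<open>z e * z e' = z f * z f'\<close> with
  \<open>e + e' = f + f'\<close>. They force a non-zero coordinate at some pure power x_i^d, and
  then all coordinates are determined by those at the neighbours x_i^(d-1) x_j.\<close>

lemma acl_veronese_cone:
 assumes d: "0 < d"
 shows "acl (exponents n d) (veronese_cone n d) = (veronese_cone n d :: (expo => 'a::field_char_0) set)"
proof (rule subset_antisym)
 show "veronese_cone n d \<subseteq> acl (exponents n d) (veronese_cone n d)"
  by (rule acl_superset) (auto simp: veronese_cone_def intro: vec.subspace_scale veronese_map_coord_space)
 show "acl (exponents n d) (veronese_cone n d) \<subseteq> (veronese_cone n d :: (expo => 'a) set)"
 proof
  fix z :: "expo => 'a" assume z: "z \<in> acl (exponents n d) (veronese_cone n d)"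
  let ?E = "exponents n d"
  have quad: "z e * z e' = z f * z f'"
   if "e + e' = f + f'" "e \<in> ?E" "e' \<in> ?E" "f \<in> ?E" "f' \<in> ?E" for e e' f f'
  proof -
   have "z e * z e' - z f * z f' = 0"
   proof (rule aclD[OF z, where f = "%z. z e * z e' - z f * z f'"])
    fix a :: "expo => 'a" assume "a \<in> veronese_cone n d"
    then obtain c v where a: "a = vscale c (veronese_map n d v)" by (auto simp: veronese_cone_def)
    have "a x * a y = (c * c) * (veronese_map n d v x * veronese_map n d v y)" for x y
     by (simp add: a vscale_apply mult_ac)
    thus "a e * a e' - a f * a f' = 0" using veronese_quadric[OF that, of v] by simp
   qed (use that in \<open>intro polyfun_intros\<close>)
   thus ?thesis by simp
  qed
  show "z \<in> veronese_cone n d"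
  proof (cases "z = 0")
   case True
   hence "z = vscale 0 (veronese_map n d 0)" by simp
   thus ?thesis unfolding veronese_cone_def by blast
  next
   case False
   then obtain e0 where e0: "z e0 ~= 0" by (auto simp: fun_eq_iff)
   hence e0E: "e0 \<in> ?E" using z acl_coord_space by (auto simp: coord_space_def subset_iff)
   hence "e0 ~= 0" using d by (auto simp: exponents_def)
   then obtain i where i: "i \<in> keys e0" by (metis equals0I mdeg_0_iff mdeg_def sum.empty)
   hence "i \<in> {..n}" using exponentsD(1)[OF e0E] by blast
   hence "i <= n" by simp
   \<comment> \<open>The square of \<open>z e\<close> is the product of the coordinates at two
     opposite shifts of e, so a non-zero coordinate stays non-zero when one unit is moved from j to
     i.\<close>
   have "\<exists>e\<in>?E. z e ~= 0 & lookup e i >= l" if "1 <= l" "l <= d" for l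
    using that
   proof (induction l rule: dec_induct)
    case base
    have "lookup e0 i >= 1" using i by (simp add: in_keys_iff)
    thus ?case using e0 e0E by blast
   next
    case (step l)
    then obtain e where e: "e \<in> ?E" "z e ~= 0" "lookup e i >= l" by auto
    show ?case
    proof (cases "lookup e i = l")
     case True
     hence "lookup e i ~= d" using step by simp
     then obtain j where j: "j <= n" "j ~= i" "lookup e j > 0"
      using exponents_other[OF e(1) _ \<open>i <= n\<close>] by blast
     have li: "lookup e i > 0" using True step by simp
     note s1 = shift_exp[OF e(1) j(3) \<open>i <= n\<close>] and s2 = shift_exp[OF e(1) li j(1)]
     have "(e + single i 1) + (e + single j 1) =
       (shift_exp e j i + single j 1) + (shift_exp e i j + single i 1)"
      using s1(2) s2(2) by simp
     hence "(e + e) + (single i 1 + single j 1) =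
       (shift_exp e j i + shift_exp e i j) + (single i 1 + single j 1)"
      by (simp add: add_ac)
     hence "e + e = shift_exp e j i + shift_exp e i j" by (rule add_right_imp_eq)
     from quad[OF this e(1,1) s1(1) s2(1)] have "z (shift_exp e j i) ~= 0" using e(2) by auto
     moreover have "lookup (shift_exp e j i) i = Suc l"
      using True j(2) by (simp add: shift_exp_def lookup_add lookup_minus lookup_single)
     ultimately show ?thesis using s1(1) by (intro bexI[of _ "shift_exp e j i"]) auto
    qed (use e in \<open>auto intro!: bexI[of _ e]\<close>)
   qed
   from this[of d] d obtain e1 where e1: "e1 \<in> ?E" "z e1 ~= 0" "lookup e1 i >= d" by auto
   have "lookup e1 i <= (\<Sum>i\<le>n. lookup e1 i)"
    by (rule member_le_sum) (use \<open>i <= n\<close> in auto)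
   hence "e1 = single i d" using exponents_last[OF e1(1) _ \<open>i <= n\<close>] e1 by (simp add: exponents_iff)
   hence zd: "z (single i d) ~= 0" using e1 by simp
   define c where "c = z (single i d)"
   let ?m = "%j. shift_exp (single i d) i j"
   have m: "?m j \<in> ?E" "single i d + single j 1 = ?m j + single i 1"
    if "j <= n" for j
    using shift_exp[OF single_exponents[OF \<open>i <= n\<close>], of d i j] d that by auto
   \<comment> \<open>The preimage is read off at the neighbours of x_i^d, normalized so that
     \<open>v i = 1\<close>.\<close>
   define v where "v = (%j. z (?m j) / c)"
   have "?m i = single i d" using m(2)[OF \<open>i <= n\<close>] by (metis add_right_imp_eq)
   hence vi: "v i = 1" using zd by (simp add: v_def c_def)
   have "z e = c * monom_eval e v" if "e \<in> ?E" "lookup e i = d - l" "l <= d" for e l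
    using that
   proof (induction l arbitrary: e)
    case 0
    hence "e = single i d" using exponents_last[OF _ _ \<open>i <= n\<close>] by simp
    thus ?case by (simp add: c_def vi)
   next
    case (Suc l)
    hence "lookup e i ~= d" by simp
    then obtain j where j: "j <= n" "j ~= i" "lookup e j > 0"
     using exponents_other[OF Suc.prems(1) _ \<open>i <= n\<close>] by blast
    note s = shift_exp[OF Suc.prems(1) j(3) \<open>i <= n\<close>]
    have "(e + single i 1) + (single i d + single j 1) =
      (shift_exp e j i + single j 1) + (?m j + single i 1)"
     using s(2) m(2)[OF j(1)] by simp
    hence "(e + single i d) + (single i 1 + single j 1) =
      (shift_exp e j i + ?m j) + (single i 1 + single j 1)"
     by (simp add: add_ac)
    hence "e + single i d = shift_exp e j i + ?m j" by (rule add_right_imp_eq)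
    from quad[OF this Suc.prems(1) single_exponents[OF \<open>i <= n\<close>] s(1) m(1)[OF j(1)]]
    have "z e * c = z (shift_exp e j i) * z (?m j)" by (simp add: c_def)
    also have "z (shift_exp e j i) = c * monom_eval (shift_exp e j i) v"
     by (rule Suc.IH[OF s(1)]) (use Suc.prems j(2) in \<open>auto simp: shift_exp_def lookup_add lookup_minus lookup_single\<close>)
    also have "z (?m j) = c * v j" using zd by (simp add: v_def c_def)
    finally have "z e = c * (monom_eval (shift_exp e j i) v * v j)" using zd by (simp add: c_def)
    also have "monom_eval (shift_exp e j i) v * v j = monom_eval e v"
     using arg_cong[OF s(2), of "%m. monom_eval m v"] by (simp add: monom_eval_add vi)
    finally show ?case .
   qed
   note zv = this
   have "z = vscale c (veronese_map n d v)"
   proof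
    fix e
    show "z e = vscale c (veronese_map n d v) e"
    proof (cases "e \<in> ?E")
     case True
     have "lookup e i <= (\<Sum>i\<le>n. lookup e i)"
      by (rule member_le_sum) (use \<open>i <= n\<close> in auto)
     hence "lookup e i <= d" using True by (simp add: exponents_iff)
     thus ?thesis using zv[OF True, of "d - lookup e i"] True by (simp add: vscale_apply veronese_map_def)
    next
     case False
     thus ?thesis using z acl_coord_space[of ?E "veronese_cone n d"]
      by (auto simp: coord_space_def vscale_apply veronese_map_def subset_iff)
    qed
   qed
   thus ?thesis unfolding veronese_cone_def by blast
  qed
 qed
qed

lemma range_dmap_veronese_le:
 assumes d: "0 < d"
 shows "range (dmap (secant_param n d 0 1) t) \<subseteq> osc_space n d 1 (pt t 0)"
proof
 fix x assume "x \<in> range (dmap (secant_param n d 0 1) t)"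
 then obtain u where x: "x = osc n d 0 (pt t 0) (form u 0) + osc n d 1 (pt t 0) (lin_mult n (pt u 0) (form t 0))"
  by (auto simp: dmap_secant_param)
 have "osc n d 0 (pt t 0) (form u 0) \<in> osc_space n d (Suc 0) (pt t 0)"
  using osc_space_Suc[OF d, of n "pt t 0"] by (auto simp: osc_space_def)
 thus "x \<in> osc_space n d 1 (pt t 0)" unfolding x
  by (intro vec.subspace_add[OF subspace_osc_space]) (auto simp: osc_space_def)
qed

lemma range_dmap_veronese_ge:
 assumes t: "form t 0 0 = (c :: 'a::field_char_0)" "c ~= 0"
 shows "osc_space n d 1 (pt t 0) \<subseteq> range (dmap (secant_param n d 0 1) t)"
proof
 fix x assume "x \<in> osc_space n d 1 (pt t 0)"
 then obtain H where x: "x = osc n d 1 (pt t 0) H" by (auto simp: osc_space_def)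
 define u :: "'a params" where "u = (%(j, y). case y of Inl i => H (single i 1) / c | Inr a => 0)"
 have "osc n d (Suc 0) (pt t 0) (lin_mult n (pt u 0) (form t 0)) = osc n d (Suc 0) (pt t 0) H"
 proof (rule osc_cong_form)
  fix a assume "a \<in> exponents n (Suc 0)"
  then obtain i where i: "i <= n" "a = single i 1" unfolding exponents_1 by auto
  have "lin_mult n (pt u 0) (form t 0) a = (\<Sum>l\<le>n. if l = i then pt u 0 i * c else 0)"
   unfolding lin_mult_def using t(1)
   by (intro sum.cong refl) (auto simp: i(2) lookup_single when_def)
  also have "\<dots> = pt u 0 i * c" using i by simp
  finally show "lin_mult n (pt u 0) (form t 0) a = H a" using t i by (simp add: u_def pt_def)
 qed
 moreover have "osc n d 0 (pt t 0) (form u 0) = 0" by (simp add: osc_def u_def form_def fun_eq_iff)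
 ultimately have "x = dmap (secant_param n d 0 1) t u" by (simp add: x dmap_secant_param)
 thus "x \<in> range (dmap (secant_param n d 0 1) t)" by blast
qed

lemma card_exponents_1: "card (exponents n 1) = n + 1"
 using card_exponents[of n 1] binomial_symmetric[of 1 "n + 1"] by simp

text \<open>The Veronese variety is the case k = 0, s = 1 of the parametrization; its differential
  has rank n + 1 wherever the point and the scalar \<open>form t 0 0\<close> are non-zero.\<close>

lemma zariski_dim_veronese:
 assumes d: "0 < d"
 shows "zariski_dim (exponents n d) (veronese_variety n d :: (nat \<Rightarrow>\<^sub>0 nat, 'a::field_char_0) ppoint set) = enat n"
proof -
 define t0 :: "'a params" where "t0 = (%_. 1)"
 have "zariski_dim (exponents n d) (projectivization (acl (exponents n d) (range (secant_param n d 0 1 :: 'a params => _)))) = enat (n + 1 - 1)"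
 proof (rule zariski_dim_param[where J = "param_index n 0 1" and ?a0.0 = t0])
  show le: "vec.dim (range (dmap (secant_param n d 0 1) t)) <= n + 1" for t :: "'a params"
  proof -
   have "vec.dim (range (dmap (secant_param n d 0 1) t)) <= vec.dim (osc_space n d 1 (pt t 0))"
    by (rule dim_mono[OF range_dmap_veronese_le[OF d] osc_space_coord_space finite_exponents])
   also have "\<dots> <= n + 1" using dim_osc_space_le[of n d 1 "pt t 0"] card_exponents_1[of n] by simp
   finally show ?thesis .
  qed
  have "vec.dim (osc_space n d 1 (pt t0 0)) = card (exponents n 1)"
   by (rule dim_osc_space[of 0]) (use d in \<open>auto simp: t0_def pt_def\<close>)
  moreover have "vec.dim (osc_space n d 1 (pt t0 0)) <= vec.dim (range (dmap (secant_param n d 0 1) t0))"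
   by (rule dim_mono[where I = "exponents n d", OF range_dmap_veronese_ge[of t0 1]])
    (use dmap_coord_space[of "secant_param n d 0 1" "exponents n d", OF secant_param_coord_space] in \<open>auto simp: t0_def form_def\<close>)
  ultimately show "vec.dim (range (dmap (secant_param n d 0 1) t0)) = n + 1"
   using le[of t0] card_exponents_1[of n] by simp
 qed (simp_all add: finite_param_index secant_param_cone secant_param_euler polyfun_secant_param secant_param_coord_space)
 thus ?thesis
  by (simp only: range_secant_param_veronese acl_veronese_cone[OF d] veronese_variety_eq[OF d] add_diff_cancel_right')
qed

lemma polyfun_veronese_map: "polyfun {..n} (%v. veronese_map n d v e)"
 unfolding veronese_map_def
 by (intro polyfun_if polyfun_const polyfun_monom_eval exponentsD)

lemma veronese_cone_imp_variety:
 assumes "v \<in> coord_space {..n}" "v ~= 0"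
 shows "ppoint_of (veronese_map n d v) \<in> veronese_variety n d"
 using assms by (auto simp: veronese_variety_def)

text \<open>Vectors with c = 0 or u = 0 represent no point of the variety. If f were non-zero there,
  it would also be non-zero at a generic parameter, where the vector does represent a point.\<close>

lemma vanishing_ideal_veronese:
 fixes f :: "(nat \<Rightarrow>\<^sub>0 nat, 'a::field_char_0) mpoly"
 assumes f: "f \<in> vanishing_ideal (exponents n d) (veronese_variety n d)" and d: "0 < d"
 shows "mpoly_eval f (vscale c (veronese_map n d u)) = 0"
proof (rule ccontr)
 assume n0: "mpoly_eval f (vscale c (veronese_map n d u)) ~= 0"
 let ?g = "%t. mpoly_eval f (secant_param n d 0 1 t)" and ?J = "param_index n 0 1"
 have fp: "f \<in> polys (exponents n d)" using f by (simp add: vanishing_ideal_def)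
 have pg: "polyfun ?J ?g" by (rule polyfun_compose[OF polyfun_mpoly_eval[OF fp] polyfun_secant_param])
 have "vscale c (veronese_map n d u) \<in> range (secant_param n d 0 1)"
  unfolding range_secant_param_veronese by (auto simp: veronese_cone_def)
 then obtain t where t: "?g t ~= 0" using n0 by (metis rangeE)
 define F where "F = (%k::nat. if k = 0 then ?g else if k = 1 then (%t. pt t 0 0) else (%t. form t 0 0))"
 have "EX x. \<forall>k\<in>{0,1,2}. F k x ~= 0"
 proof (rule polyfun_prod_neq_0[where J = ?J])
  fix k :: nat assume k: "k \<in> {0,1,2}"
  have "polyfun ?J (%t :: 'a params. pt t 0 0)" "polyfun ?J (%t :: 'a params. form t 0 0)"
   by (auto intro: polyfun_pt polyfun_form simp: exponents_0)
  thus "polyfun ?J (F k)" using pg unfolding F_def by simp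
  have "pt (%_. 1 :: 'a) 0 0 ~= 0" "form (%_. 1 :: 'a) 0 0 ~= 0" by (simp_all add: pt_def form_def)
  thus "EX a. F k a ~= 0" using k t by (auto simp: F_def)
 qed simp
 then obtain x where x: "?g x ~= 0" "pt x 0 0 ~= 0" "form x 0 0 ~= 0" by (auto simp: F_def)
 have sx: "secant_param n d 0 1 x = vscale (form x 0 0) (veronese_map n d (pt x 0))"
  by (simp add: secant_param_def osc_0)
 obtain w where w: "w \<in> coord_space {..n}" "\<forall>i\<le>n. w i = pt x 0 i" "veronese_map n d w = veronese_map n d (pt x 0)"
  using restrict_coord_space by blast
 have "w 0 ~= 0" using w x by simp
 hence "w ~= 0" by auto
 hence P: "ppoint_of (veronese_map n d w) \<in> veronese_variety n d" using w(1) veronese_cone_imp_variety by blast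
 have "vscale (form x 0 0) (veronese_map n d w) \<in> ppoint_of (veronese_map n d w)"
  unfolding ppoint_of_def using x(3) by blast
 hence "mpoly_eval f (vscale (form x 0 0) (veronese_map n d w)) = 0"
  using f P unfolding vanishing_ideal_def by blast
 thus False using x(1) sx w(3) by simp
qed

lemma tangent_space_veronese_ge:
 fixes v :: "nat => 'a::field_char_0"
 assumes d: "0 < d"
 shows "osc_space n d 1 v \<subseteq> tangent_space (exponents n d) (veronese_variety n d) (ppoint_of (veronese_map n d v))"
proof
 fix w assume w: "w \<in> osc_space n d 1 v"
 have "(\<Sum>i\<in>exponents n d. mpoly_eval (mpoly_deriv i f) z * w i) = 0"
  if f: "f \<in> vanishing_ideal (exponents n d) (veronese_variety n d)" and z: "z \<in> ppoint_of (veronese_map n d v)" for f z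
 proof -
  obtain c where c: "c ~= 0" "z = vscale c (veronese_map n d v)" using z by (rule ppoint_ofE)
  have fp: "f \<in> polys (exponents n d)" using f by (simp add: vanishing_ideal_def)
  define t :: "'a params" where "t = (%(j, y). case y of Inl i => v i | Inr a => c)"
  have t: "pt t 0 = v" "form t 0 0 = c" by (simp_all add: t_def pt_def form_def)
  have st: "secant_param n d 0 1 t = z" by (simp add: secant_param_def osc_0 t c)
  obtain u where u: "w = dmap (secant_param n d 0 1) t u"
   using range_dmap_veronese_ge[OF t(2) c(1), of n d] w t(1) by blast
  have "mpoly_eval f (secant_param n d 0 1 x) = 0" for x
   using vanishing_ideal_veronese[OF f d] by (simp add: secant_param_def osc_0)
  hence "dd (%x. mpoly_eval f (secant_param n d 0 1 x)) t u = 0" by simp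
  hence "dd (mpoly_eval f) (secant_param n d 0 1 t) (dmap (secant_param n d 0 1) t u) = 0"
   unfolding dmap_def by (subst (asm) dd_compose[OF polyfun_mpoly_eval[OF fp] polyfun_secant_param])
  thus ?thesis using sum_mpoly_deriv[OF finite_exponents fp] st u by simp
 qed
 thus "w \<in> tangent_space (exponents n d) (veronese_variety n d) (ppoint_of (veronese_map n d v))"
  using w osc_space_coord_space[of n d 1 v] unfolding tangent_space_def by blast
qed

lemma quadric_vanishing:
 assumes "e + e' = f + f'" "e \<in> exponents n d" "e' \<in> exponents n d" "f \<in> exponents n d" "f' \<in> exponents n d"
 shows "mpoly_var e * mpoly_var e' - mpoly_var f * mpoly_var f'
  \<in> vanishing_ideal (exponents n d) (veronese_variety n d :: (nat \<Rightarrow>\<^sub>0 nat, 'a::field_char_0) ppoint set)"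
proof -
 let ?q = "mpoly_var e * mpoly_var e' - mpoly_var f * mpoly_var f' :: (nat \<Rightarrow>\<^sub>0 nat, 'a) mpoly"
 have "?q \<in> polys (exponents n d)" using assms by (intro polys_diff polys_mult polys_var)
 moreover have "mpoly_eval ?q z = 0" if z: "z \<in> ppoint_of (veronese_map n d v)" for z and v :: "nat => 'a"
 proof -
  obtain c where c: "c ~= 0" "z = vscale c (veronese_map n d v)" using z by (rule ppoint_ofE)
  have "z x * z y = (c * c) * (veronese_map n d v x * veronese_map n d v y)" for x y
   by (simp add: c vscale_apply mult_ac)
  thus ?thesis using veronese_quadric[OF assms, of v] by (simp add: mpoly_eval_diff mpoly_eval_mult)
 qed
 ultimately show ?thesis unfolding vanishing_ideal_def veronese_variety_def by blast
qed

text \<open>The image of the differential gives the lower bound. For the upper bound, choose i with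
  \<open>v i\<close> non-zero: the differentiated quadrics determine a tangent vector by its n + 1
  coordinates at x_i^(d-1) x_j, by induction on the distance from x_i^d.\<close>

lemma dim_tangent_space_veronese:
 fixes v :: "nat => 'a::field_char_0"
 assumes d: "0 < d" and v: "v \<in> coord_space {..n}" "v ~= 0"
 shows "vec.dim (tangent_space (exponents n d) (veronese_variety n d) (ppoint_of (veronese_map n d v))) = n + 1"
proof (rule antisym)
 let ?E = "exponents n d" and ?V = "veronese_variety n d :: (nat \<Rightarrow>\<^sub>0 nat, 'a) ppoint set"
 let ?z = "veronese_map n d v"
 let ?T = "tangent_space ?E ?V (ppoint_of ?z)"
 obtain i where vi: "v i ~= 0" using v by (auto simp: fun_eq_iff)
 hence i: "i <= n" using v by (auto simp: coord_space_def)
 have TE: "?T \<subseteq> coord_space ?E" by (auto simp: tangent_space_def)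
 have "vec.dim (osc_space n d 1 v) = n + 1"
  using dim_osc_space[of i n v 1 d, OF i vi] card_exponents_1[of n] d by simp
 thus "n + 1 <= vec.dim ?T"
  using dim_mono[OF tangent_space_veronese_ge[OF d] TE finite_exponents] by simp
 have sub: "vec.subspace ?T"
  by (rule vec.subspaceI)
   (auto simp: tangent_space_def coord_space_def vscale_apply distrib_left sum.distrib
     mult.left_commute simp flip: sum_distrib_left)
 have quad: "?z e * w e' + w e * ?z e' = ?z f * w f' + w f * ?z f'"
  if w: "w \<in> ?T" and q: "e + e' = f + f'" "e \<in> ?E" "e' \<in> ?E" "f \<in> ?E" "f' \<in> ?E" for w e e' f f'
 proof -
  let ?q = "mpoly_var e * mpoly_var e' - mpoly_var f * mpoly_var f' :: (nat \<Rightarrow>\<^sub>0 nat, 'a) mpoly"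
  have pq: "polyfun ?E (%z. z x * z y)" if "x \<in> ?E" "y \<in> ?E" for x y
   using that by (intro polyfun_mult polyfun_var)
  have qI: "?q \<in> vanishing_ideal ?E ?V" by (rule quadric_vanishing[OF q])
  hence "0 = (\<Sum>i\<in>?E. mpoly_eval (mpoly_deriv i ?q) ?z * w i)"
   using w ppoint_of_self[of ?z] unfolding tangent_space_def by auto
  also have "\<dots> = dd (mpoly_eval ?q) ?z w"
   by (rule sum_mpoly_deriv) (use qI in \<open>auto simp: vanishing_ideal_def\<close>)
  also have "mpoly_eval ?q = (%z. z e * z e' + (- 1) * (z f * z f'))"
   by (rule ext) (simp add: mpoly_eval_diff mpoly_eval_mult)
  also have "dd \<dots> ?z w = dd (%z. z e * z e') ?z w + dd (%z. (- 1) * (z f * z f')) ?z w"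
   by (rule dd_add[OF pq polyfun_cmult[OF pq]]) (use q in auto)
  also have "dd (%z. (- 1) * (z f * z f')) ?z w = (- 1) * dd (%z. z f * z f') ?z w"
   by (rule dd_cmult[OF pq]) (use q in auto)
  also have "dd (%z. z e * z e') ?z w = ?z e * w e' + w e * ?z e'"
   by (subst dd_mult[of ?E]) (use q in \<open>auto intro: polyfun_var\<close>)
  also have "dd (%z. z f * z f') ?z w = ?z f * w f' + w f * ?z f'"
   by (subst dd_mult[of ?E]) (use q in \<open>auto intro: polyfun_var\<close>)
  finally show ?thesis by (simp add: algebra_simps)
 qed
 let ?s = "single i d"
 let ?m = "%j. shift_exp ?s i j"
 have m: "?m j \<in> ?E" "?s + single j 1 = ?m j + single i 1"
  if "j <= n" for j
  using shift_exp[OF single_exponents[OF i], of d i j] d that by auto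
 have mi: "?m i = ?s" using m(2)[OF i] by (metis add_right_imp_eq)
 have zs: "?z ?s ~= 0" by (rule veronese_map_neq_0[where v = v, OF i vi])
 define R where "R = (%w j. if j \<in> {..n} then w (?m j) else (0::'a))"
 have lin: "Vector_Spaces.linear vscale vscale R"
  unfolding Vector_Spaces.linear_iff by (auto simp: R_def fun_eq_iff vscale_apply vec.vector_space_axioms)
 have inj: "w = 0" if w: "w \<in> ?T" and R: "R w = 0" for w
 proof -
  have w0: "w (?m j) = 0" if "j <= n" for j using fun_cong[OF R, of j] that by (simp add: R_def)
  have "w e = 0" if "e \<in> ?E" "lookup e i = d - l" "l <= d" for e l
   using that
  proof (induction l arbitrary: e)
   case 0
   hence "e = ?m i" using exponents_last[OF _ _ i] mi by simp
   thus ?case using w0[OF i] by simp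
  next
   case (Suc l)
   hence "lookup e i ~= d" by simp
   then obtain j where j: "j <= n" "j ~= i" "lookup e j > 0"
    using exponents_other[OF Suc.prems(1) _ i] by blast
   note s = shift_exp[OF Suc.prems(1) j(3) i]
   have "(e + single i 1) + (?s + single j 1) =
     (shift_exp e j i + single j 1) + (?m j + single i 1)"
    using s(2) m(2)[OF j(1)] by simp
   hence "(e + ?s) + (single i 1 + single j 1) =
     (shift_exp e j i + ?m j) + (single i 1 + single j 1)"
    by (simp add: add_ac)
   hence "e + ?s = shift_exp e j i + ?m j" by (rule add_right_imp_eq)
   from quad[OF w this Suc.prems(1) single_exponents[OF i] s(1) m(1)[OF j(1)]]
   have "?z e * w ?s + w e * ?z ?s = ?z (shift_exp e j i) * w (?m j) + w (shift_exp e j i) * ?z (?m j)" .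
   moreover have "w (shift_exp e j i) = 0"
    by (rule Suc.IH[OF s(1)]) (use Suc.prems j(2) in \<open>auto simp: shift_exp_def lookup_add lookup_minus lookup_single\<close>)
   moreover have "w ?s = 0" using w0[OF i] mi by simp
   ultimately show ?case using w0[OF j(1)] zs by simp
  qed
  note we = this
  show "w = 0"
  proof
   fix e
   show "w e = 0 e"
   proof (cases "e \<in> ?E")
    case True
    have "lookup e i <= (\<Sum>i\<le>n. lookup e i)"
     by (rule member_le_sum) (use i in auto)
    hence "lookup e i <= d" using True by (simp add: exponents_iff)
    thus ?thesis using we[OF True, of "d - lookup e i"] by simp
   next
    case False
    thus ?thesis using w TE by (auto simp: coord_space_def)
   qed
  qed
 qed
 interpret R: Vector_Spaces.linear vscale vscale R by (rule lin)
 have "{w \<in> ?T. R w = 0} \<subseteq> vec.span {}" using inj by auto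
 from vec.dim_le_card[OF this] have "vec.dim {w \<in> ?T. R w = 0} = 0" by simp
 hence "vec.dim ?T = vec.dim (R ` ?T)" using rank_nullity[OF lin sub TE finite_exponents] by simp
 also have "\<dots> <= vec.dim (coord_space {..n} :: (nat => 'a) set)"
  by (rule dim_mono[where I = "{..n}"]) (auto simp: R_def coord_space_def)
 also have "\<dots> = n + 1" by (simp add: dim_coord_space)
 finally show "vec.dim ?T <= n + 1" .
qed

lemma smooth_points_veronese:
 assumes d: "0 < d"
 shows "smooth_points (exponents n d) (veronese_variety n d :: (nat \<Rightarrow>\<^sub>0 nat, 'a::field_char_0) ppoint set)
  = veronese_variety n d"
proof -
 have "enat (vec.dim (tangent_space (exponents n d) (veronese_variety n d) P)) =
   zariski_dim (exponents n d) (veronese_variety n d :: (nat \<Rightarrow>\<^sub>0 nat, 'a) ppoint set) + 1"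
  if "P \<in> veronese_variety n d" for P :: "(nat \<Rightarrow>\<^sub>0 nat, 'a) ppoint"
 proof -
  obtain v where "P = ppoint_of (veronese_map n d v)" "v \<in> coord_space {..n}" "v ~= 0"
   using \<open>P \<in> _\<close> unfolding veronese_variety_def by blast
  thus ?thesis using dim_tangent_space_veronese[OF d] zariski_dim_veronese[OF d, of n, where 'a = 'a]
   by (simp add: one_enat_def)
 qed
 thus ?thesis unfolding smooth_points_def by blast
qed

section \<open>Polynomials are determined by their values\<close>

lemma monom_eval_upd:
 fixes v :: "'i => 'a::field"
 shows "monom_eval m (v(i := c * v i)) = c ^ lookup m i * monom_eval m v"
proof -
 let ?A = "insert i (keys m)"
 have *: "monom_eval m u = u i ^ lookup m i * (\<Prod>l\<in>?A - {i}. u l ^ lookup m l)"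
  for u :: "'i => 'a"
  by (subst monom_eval_superset[of ?A]) (auto simp: prod.insert_remove)
 have "(\<Prod>l\<in>?A - {i}. (v(i := c * v i)) l ^ lookup m l) = (\<Prod>l\<in>?A - {i}. v l ^ lookup m l)"
  by (intro prod.cong) auto
 thus ?thesis by (simp add: * power_mult_distrib mult.assoc)
qed

text \<open>Taking graded parts with respect to one variable after another isolates a single
  monomial, whose value at the all-ones vector is its coefficient.\<close>

lemma mpoly_eval_eq_0:
 fixes p :: "('i, 'a::field_char_0) mpoly"
 assumes "!!v. mpoly_eval p v = 0"
 shows "p = 0"
proof (rule poly_mapping_eqI, rule ccontr)
 fix m assume m: "lookup p m ~= lookup 0 m"
 have "\<exists>q :: ('i, 'a) mpoly. keys q = {m' \<in> keys p. \<forall>i\<in>J. lookup m' i = lookup m i} &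
   (ALL v. mpoly_eval q v = 0)" if "finite J" for J
  using that
 proof (induction J)
  case empty
  show ?case using assms by (intro exI[of _ p]) auto
 next
  case (insert i J)
  then obtain q :: "('i, 'a) mpoly" where q: "keys q = {m' \<in> keys p. \<forall>i\<in>J. lookup m' i = lookup m i}"
   "!!v. mpoly_eval q v = 0" by blast
  have "mpoly_eval (graded_part (%m. lookup m i) (lookup m i) q) v = 0" for v
   by (rule graded_part_eval_eq_0[where \<phi> = "%c. v(i := c * v i)"]) (simp_all add: monom_eval_upd q(2))
  thus ?case using q(1)
   by (intro exI[of _ "graded_part (%m. lookup m i) (lookup m i) q"])
    (auto simp: keys_graded_part)
 qed
 from this[of "\<Union>(keys ` insert m (keys p))"] obtain q :: "('i, 'a) mpoly" where
  q: "keys q = {m' \<in> keys p. \<forall>i\<in>\<Union>(keys ` insert m (keys p)).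
    lookup m' i = lookup m i}" "!!v. mpoly_eval q v = 0" by auto
 have "m' = m" if "m' \<in> keys q" for m'
 proof (rule poly_mapping_eqI)
  fix i
  show "lookup m' i = lookup m i"
  proof (cases "i \<in> \<Union>(keys ` insert m (keys p))")
   case False
   hence "i \<notin> keys m'" "i \<notin> keys m" using that q(1) by auto
   thus ?thesis by (simp add: in_keys_iff)
  qed (use that q(1) in auto)
 qed
 moreover have "m \<in> keys q" using m q(1) by (auto simp: in_keys_iff)
 ultimately have "keys q = {m}" by blast
 hence "mpoly_eval q (%_. 1) = lookup q m" "lookup q m ~= 0"
  by (auto simp: mpoly_eval_def monom_eval_def in_keys_iff)
 thus False using q(2) by metis
qed

section \<open>Osculating varieties of the Veronese variety\<close>

lemma homogeneous_mult: "homogeneous a p ==> homogeneous b q ==> homogeneous (a + b) (p * q)"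
 unfolding homogeneous_def using keys_mult[of p q] by (auto simp: mdeg_add dest!: subsetD)

lemma homogeneous_single: "mdeg m = e ==> homogeneous e (single m c)"
 by (simp add: homogeneous_def)

lemma homogeneous_add: "homogeneous e p ==> homogeneous e q ==> homogeneous e (p + q)"
 unfolding homogeneous_def using keys_add[of p q] by blast

lemma homogeneous_diff: "homogeneous e p ==> homogeneous e q ==> homogeneous e (p - q)"
 unfolding homogeneous_def by (auto simp: in_keys_iff lookup_minus)

lemma homogeneous_zero: "homogeneous e 0"
 by (simp add: homogeneous_def)

lemma homogeneous_sum: "(!!i. i \<in> A ==> homogeneous e (f i)) ==> homogeneous e (\<Sum>i\<in>A. f i)"
 by (induction A rule: infinite_finite_induct) (simp_all add: homogeneous_zero homogeneous_add)

lemma homogeneous_prod: "(!!l. l < m ==> homogeneous 1 (f l)) ==> homogeneous m (\<Prod>l<m. f l)"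
proof (induction m)
 case 0
 show ?case by (simp add: homogeneous_def)
next
 case (Suc m)
 thus ?case using homogeneous_mult[of m "\<Prod>l<m. f l" 1 "f m"] by simp
qed

lemma exponents_split:
 "e \<in> exponents n (D + D') ==> \<exists>b\<in>exponents n D. \<exists>b'\<in>exponents n D'. e = b + b'"
proof (induction D arbitrary: e)
 case 0
 thus ?case by (simp add: exponents_0)
next
 case (Suc D)
 hence eS: "e \<in> exponents n (Suc (D + D'))" by simp
 hence "e ~= 0" by (auto simp: exponents_def)
 then obtain j where j: "j \<in> keys e" by (metis equals0I mdeg_0_iff mdeg_def sum.empty)
 hence "j \<in> {..n}" using exponentsD(1)[OF eS] by blast
 moreover have "lookup e j > 0" using j by (simp add: in_keys_iff)
 note e' = exponents_minus_single[OF eS this]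
 ultimately obtain b b' where b: "b \<in> exponents n D" "b' \<in> exponents n D'" "e - single j 1 = b + b'"
  using Suc.IH[OF e'(1)] by blast
 have "b + single j 1 \<in> exponents n (Suc D)"
  using exponents_add_single[OF b(1), of j 1] \<open>j \<in> {..n}\<close> by simp
 moreover have "e = (b + single j 1) + b'" using e'(2) b(3) by (simp add: add_ac)
 ultimately show ?case using b(2) by blast
qed

lemma exponents_split_many:
 "e \<in> exponents n (r * D) ==> EX M. (\<forall>l<r. M l \<in> exponents n D) & e = (\<Sum>l<r. M l)"
proof (induction r arbitrary: e)
 case 0
 thus ?case by (simp add: exponents_0)
next
 case (Suc r)
 hence "e \<in> exponents n (D + r * D)" by simp
 then obtain b b' where b: "b \<in> exponents n D" "b' \<in> exponents n (r * D)" "e = b + b'"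
  using exponents_split by blast
 then obtain M where M: "\<forall>l<r. M l \<in> exponents n D" "b' = (\<Sum>l<r. M l)" using Suc.IH by blast
 have "(\<Sum>l<r. (M(r := b)) l) = (\<Sum>l<r. M l)" by (intro sum.cong) auto
 hence "e = (\<Sum>l<Suc r. (M(r := b)) l)" using M b by (simp add: add.commute)
 moreover have "\<forall>l<Suc r. (M(r := b)) l \<in> exponents n D" using M b by (auto simp: less_Suc_eq)
 ultimately show ?case by blast
qed

lemma exponents_add: "a \<in> exponents n k ==> b \<in> exponents n l ==> a + b \<in> exponents n (k + l)"
 using keys_add[of a b] by (auto simp: exponents_def mdeg_add)

lemma exponents_sum: "(!!i. i < r ==> M i \<in> exponents n D) ==> (\<Sum>i<r. M i) \<in> exponents n (r * D)"
proof (induction r)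
 case (Suc r)
 thus ?case using exponents_add[of "\<Sum>i<r. M i" n "r * D" "M r" D] by (simp add: add.commute)
qed (simp add: exponents_0)

text \<open>The hyperplane equation on the ambient space of the embedding with the coefficients of
  p. If p has degree d, its pullback along \<open>veronese_map\<close> is p.\<close>

definition lin_form :: "nat => nat => (nat, 'a::field_char_0) mpoly => (nat \<Rightarrow>\<^sub>0 nat, 'a) mpoly" where
 "lin_form n d p = (\<Sum>e\<in>exponents n d. single (single e 1) (lookup p e))"

lemma lin_form_add: "lin_form n d (p + q) = lin_form n d p + lin_form n d q"
 by (simp add: lin_form_def lookup_add single_add sum.distrib)

lemma lin_form_zero [simp]: "lin_form n d 0 = 0"
 by (simp add: lin_form_def)

lemma lin_form_polys: "lin_form n d p \<in> polys (exponents n d)"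
 unfolding lin_form_def by (intro polys_sum polys_single) auto

lemma homogeneous_lin_form: "homogeneous 1 (lin_form n d p)"
 unfolding lin_form_def by (intro homogeneous_sum homogeneous_single) simp

lemma eval_lin_form: "mpoly_eval (lin_form n d p) z = dotp (exponents n d) (lookup p) z"
 by (simp add: lin_form_def mpoly_eval_sum dotp_def)

lemma eval_lin_form_veronese:
 assumes "p \<in> polys {..n}" "homogeneous d p"
 shows "mpoly_eval (lin_form n d p) (vscale c (veronese_map n d u)) = c * mpoly_eval p u"
proof -
 have "mpoly_eval p u = (\<Sum>e\<in>exponents n d. lookup p e * monom_eval e u)"
  by (rule mpoly_eval_superset) (use keys_homogeneous assms in auto)
 thus ?thesis by (simp add: eval_lin_form dotp_scale_right) (simp add: dotp_def veronese_map_def)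
qed

lemma mdeg_1E:
 assumes "mdeg m = 1"
 obtains e where "m = single e 1"
proof -
 have "m ~= 0" using assms by auto
 then obtain e where e: "e \<in> keys m" by (metis equals0I mdeg_0_iff mdeg_def sum.empty)
 define m' where "m' = m - single e 1"
 have m: "m = m' + single e 1"
  using e by (intro poly_mapping_eqI) (auto simp: m'_def lookup_add lookup_minus lookup_single when_def in_keys_iff)
 hence "mdeg m' = 0" using assms mdeg_add[of m' "single e 1"] by simp
 hence "m = single e 1" using m by (simp add: mdeg_0_iff)
 thus thesis by (rule that)
qed

lemma eval_homogeneous_1:
 fixes l :: "('i, 'a::field_char_0) mpoly"
 assumes "homogeneous 1 l" "l \<in> polys E" "finite E"
 shows "mpoly_eval l z = (\<Sum>e\<in>E. lookup l (single e 1) * z e)"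
proof -
 have inj: "inj_on (%e. single e (1::nat)) E"
  by (rule inj_onI) (metis keys_single zero_neq_one singleton_inject)
 have "keys l \<subseteq> (%e. single e 1) ` E"
 proof
  fix m assume m: "m \<in> keys l"
  hence "mdeg m = 1" using assms(1) by (simp add: homogeneous_def)
  then obtain e where e: "m = single e 1" by (rule mdeg_1E)
  hence "e \<in> E" using m assms(2) by (auto simp: polys_def)
  thus "m \<in> (%e. single e 1) ` E" using e by blast
 qed
 hence "mpoly_eval l z = (\<Sum>m\<in>(%e. single e 1) ` E. lookup l m * monom_eval m z)"
  by (intro mpoly_eval_superset) (use assms(3) in auto)
 also have "\<dots> = (\<Sum>e\<in>E. lookup l (single e 1) * z e)"
  by (subst sum.reindex[OF inj]) simp
 finally show ?thesis .
qed

definition osc_ideal :: "nat => nat => nat => (nat => 'a::field_char_0) => (nat \<Rightarrow>\<^sub>0 nat, 'a) mpoly set" where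
 "osc_ideal n d k v = gen_ideal (exponents n d)
   (ideal_power (exponents n d) (vanishing_ideal (exponents n d) {ppoint_of (veronese_map n d v)}) (Suc k)
   \<union> vanishing_ideal (exponents n d) (veronese_variety n d))"

text \<open>Pulling back along the Veronese map turns membership into vanishing order at \<open>v\<close>.\<close>

lemma osc_ideal_pullback:
 fixes v :: "nat => 'a::field_char_0"
 assumes f: "f \<in> osc_ideal n d k v" and d: "0 < d"
 shows "\<exists>h\<in>polys {..n}. (ALL u. mpoly_eval h u = mpoly_eval f (veronese_map n d u)) & vanishes n (Suc k) v h"
proof -
 let ?E = "exponents n d"
 define Q where "Q = (%m f. \<exists>h\<in>polys {..n}. (ALL u. mpoly_eval h u = mpoly_eval f (veronese_map n d u)) & vanishes n m v h)"
 have pull: "\<exists>h\<in>polys {..n}. ALL u. mpoly_eval h u = mpoly_eval p (veronese_map n d u)" if p: "p \<in> polys ?E" for p :: "(nat \<Rightarrow>\<^sub>0 nat, 'a) mpoly"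
 proof -
  have "polyfun {..n} (%u. mpoly_eval p (veronese_map n d u))"
   by (rule polyfun_compose[OF polyfun_mpoly_eval[OF p] polyfun_veronese_map])
  from polyfun_imp_mpoly[OF this] obtain h where "h \<in> polys {..n}" "(%u. mpoly_eval p (veronese_map n d u)) = mpoly_eval h" by blast
  thus ?thesis by metis
 qed
 have Q0: "Q m 0" for m unfolding Q_def by (rule bexI[of _ 0]) (auto simp: vanishes_def)
 have Qadd: "Q m (f + g)" if fg: "Q m f" "Q m g" for m f g
 proof -
  obtain h h' where "h \<in> polys {..n}" "ALL u. mpoly_eval h u = mpoly_eval f (veronese_map n d u)" "vanishes n m v h"
   "h' \<in> polys {..n}" "ALL u. mpoly_eval h' u = mpoly_eval g (veronese_map n d u)" "vanishes n m v h'"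
   using fg unfolding Q_def by blast
  thus ?thesis unfolding Q_def by (intro bexI[of _ "h + h'"]) (auto simp: mpoly_eval_add intro: polys_add vanishes_add)
 qed
 have Qmult: "Q m (p * g)" if p: "p \<in> polys ?E" and g: "Q m g" for m p g
 proof -
  obtain h where "h \<in> polys {..n}" "ALL u. mpoly_eval h u = mpoly_eval g (veronese_map n d u)" "vanishes n m v h"
   using g unfolding Q_def by blast
  moreover obtain q where "q \<in> polys {..n}" "ALL u. mpoly_eval q u = mpoly_eval p (veronese_map n d u)" using pull[OF p] by blast
  ultimately show ?thesis unfolding Q_def
   by (intro bexI[of _ "q * h"]) (auto simp: mpoly_eval_mult intro: polys_mult vanishes_mult)
 qed
 have "Q (Suc k) f"
 proof (rule gen_ideal_minimal[OF f[unfolded osc_ideal_def], where Q = "Q (Suc k)"])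
  fix g assume "g \<in> ideal_power ?E (vanishing_ideal ?E {ppoint_of (veronese_map n d v)}) (Suc k) \<union> vanishing_ideal ?E (veronese_variety n d)"
  thus "Q (Suc k) g"
  proof
   assume "g \<in> vanishing_ideal ?E (veronese_variety n d)"
   from vanishing_ideal_veronese[OF this d, of 1] show ?thesis
    unfolding Q_def by (intro bexI[of _ 0]) (auto simp: vanishes_def)
  next
   assume "g \<in> ideal_power ?E (vanishing_ideal ?E {ppoint_of (veronese_map n d v)}) (Suc k)"
   thus ?thesis unfolding ideal_power_def
   proof (rule gen_ideal_minimal[where Q = "Q (Suc k)"])
    fix q assume "q \<in> {\<Prod>j<Suc k. f j |f. \<forall>j<Suc k. f j \<in> vanishing_ideal ?E {ppoint_of (veronese_map n d v)}}"
    then obtain F where F: "q = (\<Prod>j<Suc k. F j)" "!!j. j < Suc k ==> F j \<in> vanishing_ideal ?E {ppoint_of (veronese_map n d v)}"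
     by blast
    have "Q l (\<Prod>j<l. F j)" if "l <= Suc k" for l
     using that
    proof (induction l)
     case 0
     show ?case unfolding Q_def by (rule bexI[of _ 1]) (auto simp: vanishes_def)
    next
     case (Suc l)
     then obtain h where h: "h \<in> polys {..n}" "ALL u. mpoly_eval h u = mpoly_eval (\<Prod>j<l. F j) (veronese_map n d u)" "vanishes n l v h"
      unfolding Q_def by auto
     have Fl: "F l \<in> polys ?E" "mpoly_eval (F l) (veronese_map n d v) = 0"
      using F(2)[of l] Suc.prems vanishing_ideal_pointD by (auto simp: vanishing_ideal_def)
     obtain q where q: "q \<in> polys {..n}" "ALL u. mpoly_eval q u = mpoly_eval (F l) (veronese_map n d u)"
      using pull[OF Fl(1)] by blast
     have "vanishes n (Suc l) v (q * h)"
      by (rule vanishes_mult_Suc[OF q(1) h(1,3)]) (use q Fl in simp)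
     thus ?case unfolding Q_def using q h
      by (intro bexI[of _ "q * h"]) (auto simp: mpoly_eval_mult mult.commute intro: polys_mult)
    qed
    thus "Q (Suc k) q" using F(1) by blast
   qed (use Q0 Qadd Qmult in auto)
  qed
 qed (use Q0 Qadd Qmult in auto)
 thus ?thesis unfolding Q_def .
qed

text \<open>Choose i with \<open>v i\<close> non-zero. A power of the ambient variable at x_i^d
  brings l into the ideal; pulled back, this power becomes a power of x_i, which is non-zero at v
  and cancels from the vanishing condition.\<close>

lemma saturation_imp_ann:
 fixes v :: "nat => 'a::field_char_0"
 assumes l: "l \<in> saturation (exponents n d) (osc_ideal n d k v)" "homogeneous 1 l"
  and i: "i <= n" "v i ~= 0" and k: "k <= d" "0 < d"
 shows "\<exists>c\<in>ann (exponents n d) (osc_space n d k v). ALL z. mpoly_eval l z = dotp (exponents n d) c z"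
proof -
 let ?E = "exponents n d"
 define c where "c = (%e. if e \<in> ?E then lookup l (single e 1) else 0)"
 have lp: "l \<in> polys ?E" using l by (simp add: saturation_def)
 have ev: "mpoly_eval l z = dotp ?E c z" for z
  using eval_homogeneous_1[OF l(2) lp finite_exponents, of z] by (simp add: dotp_def c_def)
 have cE: "c \<in> coord_space ?E" by (simp add: c_def coord_space_def)
 let ?s = "single i d"
 obtain m where m: "mpoly_var ?s ^ m * l \<in> osc_ideal n d k v"
  using l(1) single_exponents[OF i(1), of d] unfolding saturation_def by blast
 obtain h where h: "h \<in> polys {..n}" "!!u. mpoly_eval h u = mpoly_eval (mpoly_var ?s ^ m * l) (veronese_map n d u)"
  "vanishes n (Suc k) v h" using osc_ideal_pullback[OF m k(2)] by blast
 define M where "M = (single (single i (d * m)) 1 :: (nat, 'a) mpoly)"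
 have Mp: "M \<in> polys {..n}" unfolding M_def by (rule polys_single) (use i in auto)
 have "mpoly_eval (h - M * poly_of n d c) u = 0" for u
 proof -
  have "mpoly_eval l (veronese_map n d u) = mpoly_eval (poly_of n d c) u"
   unfolding ev by (subst mpoly_eval_superset[OF finite_exponents keys_poly_of])
    (simp add: dotp_def lookup_poly_of veronese_map_def)
  thus ?thesis
   by (simp add: mpoly_eval_diff mpoly_eval_mult h(2) mpoly_eval_power veronese_map_def
     single_exponents[OF i(1)] M_def power_mult)
 qed
 hence "h = M * poly_of n d c" using mpoly_eval_eq_0[of "h - M * poly_of n d c"] by simp
 hence "vanishes n (Suc k) v (M * poly_of n d c)" using h(3) by simp
 hence "vanishes n (Suc k) v (poly_of n d c)"
  by (rule vanishes_cancel[OF Mp poly_of_polys, rotated]) (use i in \<open>simp add: M_def\<close>)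
 hence "c \<in> ann ?E (osc_space n d k v)" using vanishes_iff_ann[OF cE k(1)] by blast
 thus ?thesis using ev by blast
qed

text \<open>By duality the form vanishes to order k + 1 at v, so it is a sum of terms x^e times k +
  1 linear forms that vanish at v. Such a term becomes a product of k + 1 forms of degree d after
  multiplication by the k-th power of a monomial b of degree d, when x^e b^k is distributed over the
  k + 1 factors. Modulo the ideal of the Veronese variety this is a product of k + 1 hyperplane
  equations through the point.\<close>

lemma ann_imp_saturation:
 fixes v :: "nat => 'a::field_char_0"
 assumes c: "c \<in> ann (exponents n d) (osc_space n d k v)"
  and i: "i <= n" "v i ~= 0" and v: "v \<in> coord_space {..n}" and k: "k <= d" "0 < d"
 shows "lin_form n d (poly_of n d c) \<in> saturation (exponents n d) (osc_ideal n d k v)"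
proof -
 let ?E = "exponents n d"
 define y where "y = (%j. mpoly_var j - cst (v j) * (cst (1 / v i) * mpoly_var i) :: (nat, 'a) mpoly)"
 have cE: "c \<in> coord_space ?E" using c by (simp add: ann_def)
 have "vanishes n (Suc k) v (poly_of n d c)" using vanishes_iff_ann[OF cE k(1)] c by blast
 from vanishes_prod_span[where v = v, OF i poly_of_polys poly_of_homogeneous this]
 have ps: "prod_span n y (Suc k) d (poly_of n d c)" unfolding y_def .
 have yv: "mpoly_eval (y j) v = 0" if "j <= n" for j
  using vanishing_ideal_pointD[OF y_vanishing[where v = v, OF i that]] unfolding y_def .
 have yp: "y j \<in> polys {..n}" if "j <= n" for j
  using y_vanishing[where v = v, OF i that] unfolding y_def by (simp add: vanishing_ideal_def)
 have yh: "homogeneous 1 (y j)" for j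
  unfolding y_def cst_def mpoly_var_def by (intro homogeneous_diff) (auto simp: mult_single intro!: homogeneous_single)
 have "mpoly_var b ^ k * lin_form n d g \<in> osc_ideal n d k v" if g: "prod_span n y (Suc k) D g" and D: "D = d" and b: "b \<in> ?E" for D g b
  using g D
 proof (induction rule: prod_span.induct)
  case (base f e D x)
  have edeg: "mdeg e + Suc k = d" using base by simp
  hence "e \<in> exponents n (d - Suc k)" using base by (simp add: exponents_def)
  moreover have "(\<Sum>l<k. b) \<in> exponents n (k * d)" by (rule exponents_sum) (rule b)
  ultimately have "e + (\<Sum>l<k. b) \<in> exponents n (d - Suc k + k * d)" by (rule exponents_add)
  \<comment> \<open>The total degree is (k + 1) d, and the k + 1 linear forms take one each, which
    leaves d - 1 for every factor.\<close>
  also have "d - Suc k + k * d = Suc k * (d - 1)"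
  proof -
   obtain d' where d': "d = Suc k + d'" using edeg by (metis add.commute)
   show ?thesis by (simp add: d' algebra_simps)
  qed
  finally have "e + (\<Sum>l<k. b) \<in> exponents n (Suc k * (d - 1))" .
  then obtain M where M: "\<forall>l<Suc k. M l \<in> exponents n (d - 1)" "e + (\<Sum>l<k. b) = (\<Sum>l<Suc k. M l)"
   using exponents_split_many by blast
  define L where "L = (%l. y (f l) * single (M l) 1)"
  have Lp: "L l \<in> polys {..n}" "homogeneous d (L l)" "mpoly_eval (L l) v = 0" if l: "l < Suc k" for l
  proof -
   have fl: "f l <= n" and Ml: "M l \<in> exponents n (d - 1)" using base(1) M(1) l by auto
   show "L l \<in> polys {..n}" unfolding L_def by (intro polys_mult yp[OF fl] polys_single exponentsD(1)[OF Ml])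
   show "homogeneous d (L l)"
    unfolding L_def using homogeneous_mult[OF yh homogeneous_single[OF exponentsD(2)[OF Ml]]] k(2) by simp
   show "mpoly_eval (L l) v = 0" unfolding L_def using yv[OF fl] by (simp add: mpoly_eval_mult)
  qed
  have LI: "lin_form n d (L l) \<in> vanishing_ideal ?E {ppoint_of (veronese_map n d v)}" if l: "l < Suc k" for l
   unfolding vanishing_ideal_point using eval_lin_form_veronese[OF Lp(1,2)[OF l]] Lp(3)[OF l] lin_form_polys by auto
  define q where "q = cst x * (\<Prod>l<Suc k. lin_form n d (L l))"
  have "(\<Prod>l<Suc k. lin_form n d (L l)) \<in> ideal_power ?E (vanishing_ideal ?E {ppoint_of (veronese_map n d v)}) (Suc k)"
   unfolding ideal_power_def by (rule gen_ideal_base) (use LI in blast)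
  hence qI: "q \<in> osc_ideal n d k v"
   unfolding q_def osc_ideal_def by (intro gen_ideal_mult cst_polys gen_ideal_base UnI1)
  define g where "g = single e x * (\<Prod>l<Suc k. y (f l))"
  have gp: "g \<in> polys {..n}" unfolding g_def by (intro polys_mult polys_single base polys_prod yp) (use base in auto)
  have "homogeneous (mdeg e + Suc k) g" unfolding g_def
   by (intro homogeneous_mult homogeneous_single refl homogeneous_prod yh)
  hence gh: "homogeneous d g" using edeg by simp
  have "mpoly_var b ^ k * lin_form n d g - q \<in> vanishing_ideal ?E (veronese_variety n d)"
  proof -
   have "mpoly_eval (mpoly_var b ^ k * lin_form n d g - q) z = 0" if z: "z \<in> ppoint_of (veronese_map n d u)" for z u
   proof -
    obtain t where t: "t ~= 0" "z = vscale t (veronese_map n d u)" using z by (rule ppoint_ofE)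
    have "mpoly_eval q z = x * (\<Prod>l<Suc k. t * mpoly_eval (L l) u)"
     unfolding q_def mpoly_eval_mult mpoly_eval_prod eval_cst t(2)
     by (intro arg_cong2[where f = "(*)"] refl prod.cong) (auto simp: eval_lin_form_veronese[OF Lp(1,2)])
    also have "\<dots> = x * (t ^ Suc k * (\<Prod>l<Suc k. mpoly_eval (y (f l)) u) * (\<Prod>l<Suc k. monom_eval (M l) u))"
     by (simp only: L_def mpoly_eval_mult mpoly_eval_single mult_1 prod.distrib prod_constant card_lessThan mult.assoc)
    also have "(\<Prod>l<Suc k. monom_eval (M l) u) = monom_eval (\<Sum>l<Suc k. M l) u"
    proof -
     have "(\<Prod>l<r. monom_eval (M l) u) = monom_eval (\<Sum>l<r. M l) u" for r
      by (induction r) (auto simp: monom_eval_add mult.commute)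
     thus ?thesis .
    qed
    also have "\<dots> = monom_eval e u * monom_eval b u ^ k"
    proof -
     have "monom_eval (\<Sum>l<r. b) u = monom_eval b u ^ r" for r :: nat
      by (induction r) (simp_all add: monom_eval_add mult.commute del: sum_constant)
     thus ?thesis unfolding M(2)[symmetric] monom_eval_add by (simp only:)
    qed
    finally have qz: "mpoly_eval q z = x * (t ^ Suc k * (\<Prod>l<Suc k. mpoly_eval (y (f l)) u) * (monom_eval e u * monom_eval b u ^ k))" .
    have "mpoly_eval g u = x * monom_eval e u * (\<Prod>l<Suc k. mpoly_eval (y (f l)) u)"
     by (simp only: g_def mpoly_eval_mult mpoly_eval_prod mpoly_eval_single)
    hence "mpoly_eval (mpoly_var b ^ k * lin_form n d g) z =
      (t * monom_eval b u) ^ k * (t * (x * monom_eval e u * (\<Prod>l<Suc k. mpoly_eval (y (f l)) u)))"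
     unfolding mpoly_eval_mult mpoly_eval_power t(2) eval_lin_form_veronese[OF gp gh]
     using b by (simp add: vscale_apply veronese_map_def)
    thus ?thesis unfolding mpoly_eval_diff qz by (simp add: power_mult_distrib mult_ac)
   qed
   moreover have "mpoly_var b ^ k * lin_form n d g - q \<in> polys ?E"
    unfolding q_def by (intro polys_diff polys_mult polys_power polys_var b lin_form_polys cst_polys polys_prod)
   ultimately show ?thesis unfolding vanishing_ideal_def veronese_variety_def by blast
  qed
  hence "mpoly_var b ^ k * lin_form n d g - q \<in> osc_ideal n d k v"
   unfolding osc_ideal_def by (intro gen_ideal_base UnI2)
  hence "(mpoly_var b ^ k * lin_form n d g - q) + q \<in> osc_ideal n d k v"
   using qI unfolding osc_ideal_def by (rule gen_ideal_add)
  thus ?case by (simp add: g_def)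
 next
  case (add D p q)
  thus ?case unfolding lin_form_add distrib_left osc_ideal_def by (intro gen_ideal_add) auto
 qed (auto simp: osc_ideal_def intro: gen_ideal_zero)
 from this[OF ps refl] show ?thesis unfolding saturation_def using lin_form_polys by blast
qed

text \<open>The linear equations in the saturation are those given by the annihilator of
  \<open>osc_space\<close>, so the span of the scheme is a double annihilator.\<close>

lemma osculating_space_veronese:
 fixes v :: "nat => 'a::field_char_0"
 assumes v: "v \<in> coord_space {..n}" "v ~= 0" and k: "k <= d" "0 < d"
 shows "osculating_space (exponents n d) k (veronese_variety n d) (ppoint_of (veronese_map n d v)) = osc_space n d k v"
proof -
 let ?E = "exponents n d"
 obtain i where vi: "v i ~= 0" using v by (auto simp: fun_eq_iff)
 hence i: "i <= n" using v by (auto simp: coord_space_def)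
 have "osculating_space ?E k (veronese_variety n d) (ppoint_of (veronese_map n d v)) = scheme_span ?E (osc_ideal n d k v)"
  by (simp add: osculating_space_def osc_ideal_def)
 also have "\<dots> = ann ?E (ann ?E (osc_space n d k v))"
 proof (intro subset_antisym subsetI)
  fix w assume w: "w \<in> scheme_span ?E (osc_ideal n d k v)"
  have "dotp ?E w c = 0" if c: "c \<in> ann ?E (osc_space n d k v)" for c
  proof -
   have "mpoly_eval (lin_form n d (poly_of n d c)) w = 0"
    using w ann_imp_saturation[OF c i vi v(1) k] homogeneous_lin_form unfolding scheme_span_def by blast
   thus ?thesis by (simp add: eval_lin_form dotp_def lookup_poly_of mult.commute)
  qed
  thus "w \<in> ann ?E (ann ?E (osc_space n d k v))" using w by (auto simp: ann_def scheme_span_def)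
 next
  fix w assume w: "w \<in> ann ?E (ann ?E (osc_space n d k v))"
  have "mpoly_eval l w = 0" if l: "l \<in> saturation ?E (osc_ideal n d k v)" "homogeneous 1 l" for l
  proof -
   obtain c where c: "c \<in> ann ?E (osc_space n d k v)" "mpoly_eval l w = dotp ?E c w"
    using saturation_imp_ann[OF l i vi k] by blast
   thus ?thesis using w by (simp add: ann_def[of ?E "ann _ _"] dotp_commute)
  qed
  thus "w \<in> scheme_span ?E (osc_ideal n d k v)" using w by (auto simp: ann_def scheme_span_def)
 qed
 also have "\<dots> = vec.span (osc_space n d k v)" by (rule ann_ann[OF osc_space_coord_space finite_exponents])
 also have "\<dots> = osc_space n d k v" using subspace_osc_space by simp
 finally show ?thesis .
qed

text \<open>The parametrization also allows v = 0, which is no point of the plane. For k < d it then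
  produces only the zero vector and adds nothing to the image.\<close>

lemma osc_zero_point:
 assumes "k < d" "!!i. i <= n ==> v i = 0"
 shows "osc n d k v G = 0"
proof (rule ext)
 fix e
 have "hcoef n v e a = 0" if e: "e \<in> exponents n d" and a: "a \<in> exponents n k" for a
 proof (rule ccontr)
  assume h: "hcoef n v e a ~= 0"
  hence le: "lookup a i <= lookup e i" if "i <= n" for i using hcoef_neq_0D that by blast
  have "\<exists>i\<le>n. lookup a i < lookup e i"
  proof (rule ccontr)
   assume "\<not> ?thesis"
   hence "lookup e i <= lookup a i" if "i <= n" for i using that by (auto simp: not_less)
   hence "(\<Sum>i\<le>n. lookup e i) <= (\<Sum>i\<le>n. lookup a i)" by (intro sum_mono) auto
   thus False using e a assms(1) by (simp add: exponents_iff)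
  qed
  then obtain i where i: "i <= n" "lookup a i < lookup e i" by blast
  hence "i \<in> keys (e - a)" "v i ^ lookup (e - a) i = 0"
   using assms(2)[of i] by (auto simp: in_keys_iff lookup_minus)
  hence "monom_eval (e - a) v = 0" unfolding monom_eval_def by (auto simp: prod_zero_iff)
  thus False using h by (simp add: hcoef_def)
 qed
 thus "osc n d k v G e = 0 e" by (simp add: osc_def)
qed

text \<open>All points are smooth and all osculating spaces have the same dimension, so the set of
  admissible points in the definition is the whole Veronese variety.\<close>

lemma osculating_variety_veronese:
 assumes kd: "k < d"
 shows "(veronese_osculating_variety k n d :: (nat \<Rightarrow>\<^sub>0 nat, 'a::field_char_0) ppoint set) =
  projectivization (acl (exponents n d) (range (secant_param n d k 1)))"
proof -
 let ?E = "exponents n d" and ?V = "veronese_variety n d :: (nat \<Rightarrow>\<^sub>0 nat, 'a) ppoint set"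
 have d: "0 < d" and kd': "k <= d" using kd by auto
 have dim: "vec.dim (osculating_space ?E k ?V P) = card (exponents n k)" if "P \<in> ?V" for P
 proof -
  obtain v where v: "P = ppoint_of (veronese_map n d v)" "v \<in> coord_space {..n}" "v ~= 0"
   using \<open>P \<in> ?V\<close> unfolding veronese_variety_def by blast
  obtain i where vi: "v i ~= 0" using v by (auto simp: fun_eq_iff)
  hence "i <= n" using v by (auto simp: coord_space_def)
  thus ?thesis using osculating_space_veronese[OF v(2,3) kd' d] dim_osc_space[of i n v k d] vi kd' v(1) by simp
 qed
 have U: "{P \<in> smooth_points ?E ?V. \<forall>Q \<in> smooth_points ?E ?V.
   vec.dim (osculating_space ?E k ?V Q) <= vec.dim (osculating_space ?E k ?V P)} = ?V"
  unfolding smooth_points_veronese[OF d] using dim by auto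
 have un: "(\<Union>P\<in>?V. projectivization (osculating_space ?E k ?V P)) = projectivization (range (secant_param n d k 1))"
 proof (intro subset_antisym subsetI)
  fix P assume "P \<in> (\<Union>P\<in>?V. projectivization (osculating_space ?E k ?V P))"
  then obtain v where v: "P \<in> projectivization (osculating_space ?E k ?V (ppoint_of (veronese_map n d v)))"
   "v \<in> coord_space {..n}" "v ~= 0"
   unfolding veronese_variety_def by blast
  hence "P \<in> projectivization (osc_space n d k v)" using osculating_space_veronese[OF v(2,3) kd' d] by simp
  moreover have "osc_space n d k v \<subseteq> range (secant_param n d k 1)"
   unfolding range_secant_param_1 osc_space_def by blast
  ultimately show "P \<in> projectivization (range (secant_param n d k 1))" using projectivization_mono by blast
 next
  fix P :: "(nat \<Rightarrow>\<^sub>0 nat, 'a) ppoint" assume "P \<in> projectivization (range (secant_param n d k 1))"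
  then obtain v G where P: "P = ppoint_of (osc n d k v G)" "osc n d k v G ~= 0"
   unfolding range_secant_param_1 by (auto elim: projectivizationE)
  obtain u where u: "u \<in> coord_space {..n}" "\<forall>i\<le>n. u i = v i" using restrict_coord_space by blast
  have eq: "osc n d k u G = osc n d k v G" by (rule osc_cong) (use u in auto)
  have "u ~= 0" using osc_zero_point[OF kd, of n u G] P(2) eq by auto
  hence "ppoint_of (veronese_map n d u) \<in> ?V" using u by (intro veronese_cone_imp_variety)
  moreover have "P \<in> projectivization (osc_space n d k u)"
   using P(2) unfolding P(1) eq[symmetric] osc_space_def by (intro projectivization_mem) blast+
  hence "P \<in> projectivization (osculating_space ?E k ?V (ppoint_of (veronese_map n d u)))"
   using osculating_space_veronese[OF u(1) \<open>u ~= 0\<close> kd' d] by simp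
  ultimately show "P \<in> (\<Union>P\<in>?V. projectivization (osculating_space ?E k ?V P))" by blast
 qed
 show ?thesis
  unfolding veronese_osculating_variety_def osculating_variety_def U Let_def un
  by (rule zariski_closure_projectivization[OF conical_secant_param]) (use secant_param_coord_space in blast)
qed

section \<open>Secant varieties of the osculating varieties\<close>

text \<open>Move one summand into its closure at a time. This is needed because secant varieties are
  formed from the closed osculating variety, while the parametrization only adds vectors of
  osculating spaces.\<close>

lemma acl_add:
 fixes x y :: "'i => 'a::field"
 assumes x: "x \<in> acl I A" and y: "y \<in> acl I B"
 shows "x + y \<in> acl I {a + b |a b. a \<in> A & b \<in> B}"
proof -
 have shift: "polyfun I (%u. f (u + c))" if "polyfun I f" for f :: "('i => 'a) => 'a" and c
  by (rule polyfun_compose[OF that, where \<phi> = "%u. u + c"]) (auto intro: polyfun_intros)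
 have "f (x + y) = 0" if f: "polyfun I f" "\<forall>u\<in>{a + b |a b. a \<in> A & b \<in> B}. f u = 0" for f
 proof (rule aclD[OF x shift[OF f(1)]])
  fix a assume a: "a \<in> A"
  have "f (y + a) = 0"
  proof (rule aclD[OF y shift[OF f(1)]])
   fix b assume "b \<in> B"
   hence "a + b \<in> {a + b |a b. a \<in> A & b \<in> B}" using a by blast
   hence "f (a + b) = 0" by (rule bspec[OF f(2)])
   thus "f (b + a) = 0" by (subst add.commute)
  qed
  thus "f (a + y) = 0" by (subst add.commute)
 qed
 moreover have "x + y \<in> coord_space I"
  using x y acl_coord_space by (intro vec.subspace_add subspace_coord_space) blast+
 ultimately show ?thesis unfolding acl_def by blast
qed

lemma range_secant_param:
 "range (secant_param n d k s) = {(\<Sum>j<s. osc n d k (v j) (G j)) |v G. True}"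
proof (intro subset_antisym subsetI)
 fix x :: "expo => 'a" assume "x \<in> {(\<Sum>j<s. osc n d k (v j) (G j)) |v G. True}"
 then obtain v G where x: "x = (\<Sum>j<s. osc n d k (v j) (G j))" by blast
 have "secant_param n d k s (%(j, y). case y of Inl i => v j i | Inr a => G j a) = x"
  by (simp add: secant_param_def pt_def form_def x)
 thus "x \<in> range (secant_param n d k s)" by (metis rangeI)
qed (auto simp: secant_param_def)

lemma range_secant_param_Suc:
 "{a + b |a b. a \<in> range (secant_param n d k m) & b \<in> range (secant_param n d k 1)} \<subseteq> range (secant_param n d k (Suc m))"
proof
 fix x :: "expo => 'a"
 assume "x \<in> {a + b |a b. a \<in> range (secant_param n d k m) & b \<in> range (secant_param n d k 1)}"
 then obtain v G u H where x: "x = (\<Sum>j<m. osc n d k (v j) (G j)) + osc n d k u H"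
  unfolding range_secant_param[of n d k m] range_secant_param_1 by blast
 have "x = (\<Sum>j<Suc m. osc n d k ((v(m := u)) j) ((G(m := H)) j))" unfolding x by simp
 thus "x \<in> range (secant_param n d k (Suc m))" unfolding range_secant_param by blast
qed

lemma acl_sum_secant_param:
 "(!!j. j < s ==> u j \<in> acl (exponents n d) (range (secant_param n d k 1))) ==>
  (\<Sum>j<s. u j) \<in> acl (exponents n d) (range (secant_param n d k s :: 'a::field_char_0 params => _))"
proof (induction s)
 case 0
 have "range (secant_param n d k 0 :: 'a params => _) = {0}" by (auto simp: secant_param_def)
 moreover have "(0 :: expo => 'a) \<in> acl (exponents n d) {0}"
  using acl_superset[of "{0 :: expo => 'a}" "exponents n d"] vec.subspace_0[OF subspace_coord_space] by blast
 ultimately show ?case by (simp only: lessThan_0 sum.empty)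
next
 case (Suc m)
 have "(\<Sum>j<m. u j) + u m \<in> acl (exponents n d) {a + b |a b. a \<in> range (secant_param n d k m) & b \<in> range (secant_param n d k 1)}"
  by (rule acl_add) (use Suc in auto)
 hence "(\<Sum>j<m. u j) + u m \<in> acl (exponents n d) (range (secant_param n d k (Suc m) :: 'a params => _))"
  using acl_mono[OF range_secant_param_Suc] by (rule subsetD[rotated])
 thus ?case by (simp only: sum.lessThan_Suc)
qed

lemma span_union_ppoints:
 fixes w :: "nat => 'i => 'a::field"
 assumes "x \<in> vec.span (\<Union>j<s. ppoint_of (w j))"
 shows "EX c. x = (\<Sum>j<s. vscale (c j) (w j))"
proof -
 have "x \<in> {x. EX c. x = (\<Sum>j<s. vscale (c j) (w j))}"
 proof (rule vec.span_minimal[THEN subsetD, OF _ _ assms])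
  show "(\<Union>j<s. ppoint_of (w j)) \<subseteq> {x. EX c. x = (\<Sum>j<s. vscale (c j) (w j))}"
  proof
   fix y assume "y \<in> (\<Union>j<s. ppoint_of (w j))"
   then obtain j where j: "j < s" "y \<in> ppoint_of (w j)" by blast
   obtain b where b: "y = vscale b (w j)" using j(2) unfolding ppoint_of_def by blast
   have "(\<Sum>l<s. vscale (if l = j then b else 0) (w l)) = (\<Sum>l<s. if l = j then vscale b (w j) else 0)"
    by (intro sum.cong) auto
   also have "\<dots> = y" using j b by simp
   finally show "y \<in> {x. EX c. x = (\<Sum>j<s. vscale (c j) (w j))}"
    by (intro CollectI exI[of _ "%l. if l = j then b else 0"]) simp
  qed
  show "vec.subspace {x. EX c. x = (\<Sum>j<s. vscale (c j) (w j))}"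
  proof (rule vec.subspaceI)
   show "0 \<in> {x. EX c. x = (\<Sum>j<s. vscale (c j) (w j))}"
    by (intro CollectI exI[of _ "%_. 0"]) simp
   fix x y assume "x \<in> {x. EX c. x = (\<Sum>j<s. vscale (c j) (w j))}" "y \<in> {x. EX c. x = (\<Sum>j<s. vscale (c j) (w j))}"
   then obtain c b where "x = (\<Sum>j<s. vscale (c j) (w j))" "y = (\<Sum>j<s. vscale (b j) (w j))" by blast
   hence "x + y = (\<Sum>j<s. vscale (c j + b j) (w j))" by (simp add: vec.scale_left_distrib sum.distrib)
   thus "x + y \<in> {x. EX c. x = (\<Sum>j<s. vscale (c j) (w j))}"
    by (intro CollectI exI[of _ "%j. c j + b j"])
  next
   fix a x assume "x \<in> {x. EX c. x = (\<Sum>j<s. vscale (c j) (w j))}"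
   then obtain c where "x = (\<Sum>j<s. vscale (c j) (w j))" by blast
   hence "vscale a x = (\<Sum>j<s. vscale (a * c j) (w j))" by (simp add: vec.scale_sum_right vec.scale_scale)
   thus "vscale a x \<in> {x. EX c. x = (\<Sum>j<s. vscale (c j) (w j))}"
    by (intro CollectI exI[of _ "%j. a * c j"])
  qed
 qed
 thus ?thesis by blast
qed

lemma zariski_closure_mono: "A \<subseteq> B ==> zariski_closure I A \<subseteq> zariski_closure I B"
 unfolding zariski_closure_def by blast

lemma secant_variety_veronese:
 assumes kd: "k < d"
 shows "secant_variety (exponents n d) s (veronese_osculating_variety k n d :: (nat \<Rightarrow>\<^sub>0 nat, 'a::field_char_0) ppoint set) =
  projectivization (acl (exponents n d) (range (secant_param n d k s)))"
proof -
 let ?E = "exponents n d" and ?A = "range (secant_param n d k 1 :: 'a params => _)"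
 let ?W = "projectivization (acl ?E ?A)" and ?R = "range (secant_param n d k s :: 'a params => _)"
 let ?S = "\<Union>Q \<in> {..<s} \<rightarrow>\<^sub>E ?W. projectivization (vec.span (\<Union>j<s. Q j))"
 have con: "conical (acl ?E ?A)" by (rule conical_acl[OF conical_secant_param])
 have A0: "0 \<in> acl ?E ?A"
 proof -
  obtain t where "secant_param n d k 1 t = vscale 0 (secant_param n d k 1 (0 :: 'a params))" using secant_param_cone by blast
  hence "(0 :: expo => 'a) \<in> ?A" by (metis rangeI vec.scale_zero_left)
  thus ?thesis using acl_superset[of ?A ?E] secant_param_coord_space by blast
 qed
 have sub1: "?S \<subseteq> projectivization (acl ?E ?R)"
 proof
  fix P assume "P \<in> ?S"
  then obtain Q where Q: "Q \<in> {..<s} \<rightarrow>\<^sub>E ?W" "P \<in> projectivization (vec.span (\<Union>j<s. Q j))" by blast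
  have "\<forall>j\<in>{..<s}. EX w. w \<in> acl ?E ?A & Q j = ppoint_of w"
  proof
   fix j assume "j \<in> {..<s}"
   hence "Q j \<in> ?W" using Q(1) by auto
   then obtain w where "w \<in> acl ?E ?A" "Q j = ppoint_of w" by (rule projectivizationE)
   thus "EX w. w \<in> acl ?E ?A & Q j = ppoint_of w" by blast
  qed
  from bchoice[OF this] obtain w where w: "!!j. j < s ==> w j \<in> acl ?E ?A" "!!j. j < s ==> Q j = ppoint_of (w j)" by auto
  obtain x where x: "x \<in> vec.span (\<Union>j<s. Q j)" "x ~= 0" "P = ppoint_of x" using Q(2) by (rule projectivizationE)
  have un: "(\<Union>j<s. Q j) = (\<Union>j<s. ppoint_of (w j))" by (intro SUP_cong) (use w(2) in auto)
  obtain c where c: "x = (\<Sum>j<s. vscale (c j) (w j))"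
   using span_union_ppoints[OF x(1)[unfolded un]] by blast
  have "vscale (c j) (w j) \<in> acl ?E ?A" if "j < s" for j
   using conicalD[OF con w(1)[OF that], of "c j"] A0 by (cases "c j = 0") auto
  hence "x \<in> acl ?E ?R" unfolding c by (rule acl_sum_secant_param)
  thus "P \<in> projectivization (acl ?E ?R)" using x by (auto intro: projectivization_mem)
 qed
 have sub2: "projectivization ?R \<subseteq> ?S"
 proof
  fix P assume "P \<in> projectivization ?R"
  then obtain x where x: "x \<in> ?R" "x ~= 0" "P = ppoint_of x" by (rule projectivizationE)
  then obtain v G where vG: "x = (\<Sum>j<s. osc n d k (v j) (G j))" unfolding range_secant_param by blast
  let ?o = "%j. osc n d k (v j) (G j)"
  have oA: "?o j \<in> acl ?E ?A" for j
  proof -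
   have "?o j \<in> ?A" unfolding range_secant_param_1 by blast
   thus ?thesis using acl_superset[of ?A ?E] secant_param_coord_space by blast
  qed
  obtain j0 where j0: "j0 < s" "?o j0 ~= 0"
  proof -
   have "\<exists>j<s. ?o j ~= 0"
   proof (rule ccontr)
    assume "\<not> (\<exists>j<s. ?o j ~= 0)"
    hence "x = 0" unfolding vG by (intro sum.neutral) auto
    thus False using x(2) by simp
   qed
   thus thesis using that by blast
  qed
  \<comment> \<open>A zero summand represents no point of the osculating variety; a non-zero summand
    is repeated in its place, so that s points are available.\<close>
  define w where "w = (%j. if ?o j = 0 then ?o j0 else ?o j)"
  have w0: "w j ~= 0" "w j \<in> acl ?E ?A" for j using j0 oA by (auto simp: w_def)
  define Q where "Q = (\<lambda>j\<in>{..<s}. ppoint_of (w j))"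
  have QW: "Q \<in> {..<s} \<rightarrow>\<^sub>E ?W" unfolding Q_def using w0 by (auto intro: projectivization_mem)
  have "?o j \<in> vec.span (\<Union>j<s. Q j)" if j: "j < s" for j
  proof (cases "?o j = 0")
   case True
   thus ?thesis by (simp only: vec.span_zero)
  next
   case False
   hence "?o j \<in> Q j" using j ppoint_of_self by (simp add: Q_def w_def)
   thus ?thesis using j by (intro vec.span_base) blast
  qed
  hence "x \<in> vec.span (\<Union>j<s. Q j)" unfolding vG by (intro vec.span_sum) auto
  hence "P \<in> projectivization (vec.span (\<Union>j<s. Q j))" using x by (auto intro: projectivization_mem)
  thus "P \<in> ?S" using QW by blast
 qed
 have cl: "zariski_closure ?E (projectivization ?R) = projectivization (acl ?E ?R)"
  by (rule zariski_closure_projectivization[OF conical_secant_param]) (use secant_param_coord_space in blast)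
 have closed: "zariski_closed ?E (projectivization (acl ?E ?R))"
  by (rule zariski_closed_projectivization_acl[OF conical_secant_param])
 have "zariski_closure ?E ?S = projectivization (acl ?E ?R)"
 proof (rule subset_antisym)
  show "zariski_closure ?E ?S \<subseteq> projectivization (acl ?E ?R)"
   unfolding zariski_closure_def using sub1 closed by blast
  have "zariski_closure ?E (projectivization ?R) \<subseteq> zariski_closure ?E ?S"
   by (rule zariski_closure_mono[OF sub2])
  thus "projectivization (acl ?E ?R) \<subseteq> zariski_closure ?E ?S" by (simp only: cl)
 qed
 thus ?thesis by (simp only: secant_variety_def osculating_variety_veronese[OF kd])
qed

lemma zariski_dim_secant_variety:
 fixes t0 :: "'a::field_char_0 params"
 assumes kd: "k < d"
  and r: "!!t :: 'a params. vec.dim (range (dmap (secant_param n d k s) t)) <= r"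
   "vec.dim (range (dmap (secant_param n d k s) t0)) = r" "r >= 1"
 shows "zariski_dim (exponents n d)
  (secant_variety (exponents n d) s (veronese_osculating_variety k n d :: (nat \<Rightarrow>\<^sub>0 nat, 'a) ppoint set)) = enat (r - 1)"
 unfolding secant_variety_veronese[OF kd]
 by (rule zariski_dim_param[where J = "param_index n k s" and ?a0.0 = t0])
  (use r in \<open>simp_all add: finite_param_index secant_param_cone secant_param_euler polyfun_secant_param secant_param_coord_space\<close>)

section \<open>The tangent space of an osculating variety of the Veronese surface\<close>

lemma dim_insert_notin:
 assumes "x \<notin> vec.span V" "V \<subseteq> coord_space I" "finite I"
 shows "vec.dim (insert x V) >= vec.dim V + 1"
proof -
 from coord_space_basis[OF assms(2,3)] obtain B
  where B: "B \<subseteq> V" "vec.independent B" "V \<subseteq> vec.span B" "card B = vec.dim V" "finite B" .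
 have xB: "x \<notin> vec.span B" using assms(1) vec.span_mono[OF B(1)] by blast
 have "x \<notin> B" using xB vec.span_base by blast
 have ind: "vec.independent (insert x B)" by (rule vec.independent_insertI[OF xB B(2)])
 have "vec.dim (insert x V) = card (insert x B)"
 proof (rule vec.dim_unique[OF _ _ ind refl])
  show "insert x B \<subseteq> insert x V" using B(1) by blast
  have "V \<subseteq> vec.span (insert x B)" using B(3) vec.span_mono[of B "insert x B"] by blast
  thus "insert x V \<subseteq> vec.span (insert x B)" using vec.span_base[of x "insert x B"] by blast
 qed
 thus ?thesis using B \<open>x \<notin> B\<close> by simp
qed

lemma dim_insert_diminishing:
 assumes "V \<subseteq> W" "W \<subseteq> coord_space I" "finite I"
 shows "vec.dim (insert x W) + vec.dim V <= vec.dim (insert x V) + vec.dim W"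
proof (cases "x \<in> vec.span V")
 case True
 hence "x \<in> vec.span W" using vec.span_mono[OF assms(1)] by blast
 hence "vec.span (insert x W) = vec.span W" by (rule vec.span_redundant)
 hence "vec.dim (insert x W) = vec.dim W" by (rule vec.span_eq_dim)
 moreover have "vec.span (insert x V) = vec.span V" using True by (rule vec.span_redundant)
 hence "vec.dim (insert x V) = vec.dim V" by (rule vec.span_eq_dim)
 ultimately show ?thesis by simp
next
 case False
 thus ?thesis using dim_insert_notin[of x V I] dim_insert_le[of W I x] subset_trans[OF assms(1,2)] assms by auto
qed

text \<open>Submodularity: adding \<open>S\<close> gains over the larger set no more than over the
  smaller one. It makes gains at different points additive.\<close>

lemma dim_Un_diminishing:
 assumes "finite S" "S \<subseteq> coord_space I" "V \<subseteq> W" "W \<subseteq> coord_space I" "finite I"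
 shows "vec.dim (W \<union> S) + vec.dim V <= vec.dim (V \<union> S) + vec.dim W"
 using assms
proof (induction S rule: finite_induct)
 case (insert x S)
 have "vec.dim (insert x (W \<union> S)) + vec.dim (V \<union> S) <= vec.dim (insert x (V \<union> S)) + vec.dim (W \<union> S)"
  by (rule dim_insert_diminishing[of _ _ I]) (use insert.prems in auto)
 thus ?case using insert by simp
qed simp

text \<open>Choose x and y in \<open>W\<close> independent modulo \<open>V\<close> and take the dual
  functionals that annihilate \<open>V\<close>. The gain of two is thereby expressed by functionals
  that a determinant can test on other vectors.\<close>

lemma dim_Un_ge_dual:
 fixes V :: "('i => 'a::field) set"
 assumes V: "V \<subseteq> coord_space I" "W \<subseteq> coord_space I" "finite I" and dim: "vec.dim (V \<union> W) >= vec.dim V + 2"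
 obtains x y g h where "x \<in> W" "y \<in> W" "g \<in> ann I V" "h \<in> ann I V"
  "dotp I g x = 1" "dotp I g y = 0" "dotp I h x = 0" "dotp I h y = 1"
proof -
 have "\<exists>x\<in>W. x \<notin> vec.span V"
 proof (rule ccontr)
  assume "\<not> ?thesis"
  hence "W \<subseteq> vec.span V" by blast
  hence "V \<union> W \<subseteq> vec.span V" using vec.span_superset by blast
  hence "vec.dim (V \<union> W) <= vec.dim V" by (rule dim_mono_span) (use V in auto)
  thus False using dim by simp
 qed
 then obtain x where x: "x \<in> W" "x \<notin> vec.span V" by blast
 have xI: "x \<in> coord_space I" using x V by blast
 have "\<exists>y\<in>W. y \<notin> vec.span (insert x V)"
 proof (rule ccontr)
  assume "\<not> ?thesis"
  hence "W \<subseteq> vec.span (insert x V)" by blast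
  hence "V \<union> W \<subseteq> vec.span (insert x V)" using vec.span_superset by blast
  hence "vec.dim (V \<union> W) <= vec.dim (insert x V)" by (rule dim_mono_span) (use V xI in auto)
  thus False using dim dim_insert_le[OF V(1,3), of x] by simp
 qed
 then obtain y where y: "y \<in> W" "y \<notin> vec.span (insert x V)" by blast
 from coord_space_basis[OF V(1,3)] obtain B
  where B: "B \<subseteq> V" "vec.independent B" "V \<subseteq> vec.span B" "card B = vec.dim V" "finite B" .
 have xB: "x \<notin> vec.span B" using x(2) vec.span_mono[OF B(1)] by blast
 have yB: "y \<notin> vec.span (insert x B)" using y(2) vec.span_mono[of "insert x B" "insert x V"] B(1) by blast
 have ind: "vec.independent (insert y (insert x B))" by (intro vec.independent_insertI xB yB B(2))
 have sub: "insert y (insert x B) \<subseteq> coord_space I" using x(1) y(1) B(1) V by blast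
 have ne: "x \<notin> B" "y \<notin> B" "x ~= y" using xB yB vec.span_base by blast+
 have *: "\<exists>g\<in>ann I V. dotp I g x = a & dotp I g y = b" for a b
 proof -
  obtain g where g: "g \<in> coord_space I"
   "\<forall>z\<in>insert y (insert x B). dotp I g z = (if z = x then a else if z = y then b else 0)"
   using dual_extend[OF ind sub V(3), of "%z. if z = x then a else if z = y then b else 0"] by blast
  have gB: "dotp I g z = 0" if z: "z \<in> B" for z
  proof -
   have "z ~= x" "z ~= y" using ne z by auto
   thus ?thesis using g(2) z by auto
  qed
  have "dotp I g z = 0" if "z \<in> V" for z
   by (rule dotp_span_eq_0[OF subsetD[OF B(3) \<open>z \<in> V\<close>]]) (rule gB)
  hence "g \<in> ann I V" using g(1) by (auto simp: ann_def)
  thus ?thesis using g(2) ne by auto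
 qed
 obtain g h where "g \<in> ann I V" "dotp I g x = 1" "dotp I g y = 0" "h \<in> ann I V" "dotp I h x = 0" "dotp I h y = 1"
  using *[of 1 0] *[of 0 1] by blast
 thus thesis using that x(1) y(1) by blast
qed

text \<open>The converse certificate: a relation between x and y modulo \<open>V\<close> would be
  inherited by all functionals that annihilate \<open>V\<close> and make the determinant zero.
  Applied to tangent directions, the determinant is quadratic in the form.\<close>

lemma dim_insert_insert_ge:
 assumes V: "V \<subseteq> coord_space I" "finite I" and xy: "x \<in> coord_space I"
  and g: "g \<in> ann I V" "h \<in> ann I V" and det: "dotp I g x * dotp I h y ~= dotp I g y * dotp I h x"
 shows "vec.dim (insert y (insert x V)) >= vec.dim V + 2"
proof -
 have van: "dotp I f z = 0" if "f \<in> ann I V" "z \<in> vec.span V" for f z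
  using dotp_span_eq_0[OF \<open>z \<in> vec.span V\<close>, of I f] \<open>f \<in> ann I V\<close> by (auto simp: ann_def)
 have "x \<notin> vec.span V" using van[OF g(1)] van[OF g(2)] det by auto
 hence 1: "vec.dim (insert x V) >= vec.dim V + 1" by (rule dim_insert_notin[OF _ V])
 have "y \<notin> vec.span (insert x V)"
 proof
  assume "y \<in> vec.span (insert x V)"
  then obtain c where c: "y - vscale c x \<in> vec.span V" by (auto simp: vec.span_insert)
  have eq: "dotp I f y = c * dotp I f x" if f: "f \<in> ann I V" for f
  proof -
   have "dotp I f y = dotp I f (vscale c x + (y - vscale c x))" by (intro arg_cong[where f = "dotp I f"]) (simp add: fun_eq_iff)
   also have "\<dots> = c * dotp I f x" by (simp only: dotp_add_right dotp_scale_right van[OF f c] add_0_right)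
   finally show ?thesis .
  qed
  show False using det eq[OF g(1)] eq[OF g(2)] by simp
 qed
 hence "vec.dim (insert y (insert x V)) >= vec.dim (insert x V) + 1"
  by (rule dim_insert_notin) (use V xy in auto)
 thus ?thesis using 1 by simp
qed

text \<open>A product of two linear forms in G is zero only if a factor is; sums of two unit vectors
  already show this.\<close>

lemma dotp_mult_eq_0:
 fixes f g :: "'i => 'a::field"
 assumes "finite I" "!!G. dotp I G f * dotp I G g = 0"
 shows "(\<forall>a\<in>I. f a = 0) \<or> (\<forall>a\<in>I. g a = 0)"
proof (rule ccontr)
 assume "\<not> ?thesis"
 then obtain a b where ab: "a \<in> I" "b \<in> I" "f a ~= 0" "g b ~= 0" by blast
 have u: "dotp I (unit_vec c) h = h c" if "c \<in> I" for c and h :: "'i => 'a"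
  using dotp_unit_vec[OF assms(1) that, of h] by (simp add: dotp_commute)
 have "g a = 0" using assms(2)[of "unit_vec a"] ab by (simp add: u)
 moreover have "f b = 0" using assms(2)[of "unit_vec b"] ab by (simp add: u)
 ultimately show False using assms(2)[of "unit_vec a + unit_vec b"] ab
  by (simp add: dotp_add_left u del: plus_fun_apply)
qed

text \<open>Unique factorization for products of two linear forms in G: on the hyperplane where f
  vanishes the product of p and q vanishes, hence so does one of them, which is then a multiple of
  f.\<close>

lemma dotp_mult_eq_mult:
 fixes f g p q :: "'i => 'a::field"
 assumes I: "finite I" and eq: "!!G. dotp I G f * dotp I G g = dotp I G p * dotp I G q" and f: "a0 \<in> I" "f a0 ~= 0"
 shows "EX c. (\<forall>a\<in>I. p a = c * f a & g a = c * q a) \<or> (\<forall>a\<in>I. q a = c * f a & g a = c * p a)"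
proof -
 have step: "EX c. \<forall>a\<in>I. p a = c * f a & g a = c * q a"
  if eq: "!!G. dotp I G f * dotp I G g = dotp I G p * dotp I G q"
   and 0: "\<forall>a\<in>I. f a0 * p a - p a0 * f a = 0" for p q :: "'i => 'a"
 proof (intro exI[of _ "p a0 / f a0"] ballI conjI)
  have p: "p a = p a0 / f a0 * f a" if "a \<in> I" for a using 0 that f(2) by (simp add: field_simps)
  have pf: "dotp I G p = p a0 / f a0 * dotp I G f" for G
   unfolding dotp_def sum_distrib_left by (intro sum.cong refl) (simp add: p)
  have "dotp I G f * dotp I G (%a. g a - p a0 / f a0 * q a) = 0" for G
  proof -
   have e: "dotp I G (%a. g a - p a0 / f a0 * q a) = dotp I G g - p a0 / f a0 * dotp I G q"
    unfolding dotp_def sum_distrib_left by (simp only: right_diff_distrib sum_subtractf mult.left_commute)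
   show ?thesis by (simp only: e right_diff_distrib eq pf) (simp add: mult_ac)
  qed
  from dotp_mult_eq_0[OF I this] f have "\<forall>a\<in>I. g a - p a0 / f a0 * q a = 0" by blast
  thus "g a = p a0 / f a0 * q a" if "a \<in> I" for a using that by simp
 qed (use 0 f(2) in \<open>simp add: field_simps\<close>)
 \<comment> \<open>The vector paired with h on the right lies in the hyperplane where f vanishes: it
   is a multiple of the projection of G along \<open>unit_vec a0\<close>. The left side is the
   corresponding functional on all G.\<close>
 have red: "dotp I G (%a. f a0 * h a - h a0 * f a) = dotp I (vscale (f a0) G - vscale (dotp I G f) (unit_vec a0)) h"
  for G h :: "'i => 'a"
 proof -
  have "dotp I (vscale (f a0) G - vscale (dotp I G f) (unit_vec a0)) h =
   dotp I (vscale (f a0) G) h - dotp I (vscale (dotp I G f) (unit_vec a0)) h"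
   by (simp add: dotp_def left_diff_distrib sum_subtractf)
  also have "\<dots> = f a0 * dotp I G h - dotp I G f * h a0"
   using dotp_unit_vec[OF I f(1), of h] by (simp add: dotp_scale_left dotp_commute[of I "unit_vec a0"])
  also have "\<dots> = dotp I G (%a. f a0 * h a - h a0 * f a)"
   by (simp add: dotp_def right_diff_distrib sum_subtractf sum_distrib_left sum_distrib_right mult_ac)
  finally show ?thesis by (rule sym)
 qed
 have "dotp I G (%a. f a0 * p a - p a0 * f a) * dotp I G (%a. f a0 * q a - q a0 * f a) = 0" for G
 proof -
  let ?G = "vscale (f a0) G - vscale (dotp I G f) (unit_vec a0)"
  have "dotp I ?G f = 0" unfolding red[of G f, symmetric] by (simp add: dotp_def)
  hence "dotp I ?G p * dotp I ?G q = 0" unfolding eq[symmetric] by (simp only: mult_zero_left)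
  thus ?thesis unfolding red[of G p] red[of G q] .
 qed
 from dotp_mult_eq_0[OF I this] show ?thesis
 proof
  assume 0: "\<forall>a\<in>I. f a0 * p a - p a0 * f a = 0"
  show ?thesis using step[OF eq 0] by blast
 next
  assume 0: "\<forall>a\<in>I. f a0 * q a - q a0 * f a = 0"
  have eq': "dotp I G f * dotp I G g = dotp I G q * dotp I G p" for G using eq[of G] by (simp add: mult.commute)
  show ?thesis using step[OF eq' 0] by blast
 qed
qed


text \<open>The tangent direction obtained by moving the i-th coordinate of the point v while the
  form G is fixed.\<close>

definition tang_gen :: "nat => nat => nat => (nat => 'a::field_char_0) => (expo => 'a) => nat => expo => 'a" where
 "tang_gen n d k v G i = osc n d (Suc k) v (lin_mult n (unit_vec i) G)"

lemma tang_gen_coord_space: "tang_gen n d k v G i \<in> coord_space (exponents n d)"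
 by (simp add: tang_gen_def osc_coord_space)

lemma tang_gen_eq:
 assumes "i <= n"
 shows "tang_gen n d k v G i = (\<Sum>a\<in>exponents n k. vscale (G a * of_nat (lookup a i + 1)) (hrow n d v (a + single i 1)))"
proof
 fix e
 have "(\<Sum>l\<le>n. unit_vec i l * (of_nat (lookup a l + 1) * hcoef n v e (a + single l 1)))
  = of_nat (lookup a i + 1) * hcoef n v e (a + single i 1)" for a
 proof -
  have "(\<Sum>l\<le>n. unit_vec i l * (of_nat (lookup a l + 1) * hcoef n v e (a + single l 1)))
   = (\<Sum>l\<le>n. if l = i then of_nat (lookup a i + 1) * hcoef n v e (a + single i 1) else 0)"
   by (intro sum.cong refl) (simp add: unit_vec_def)
  thus ?thesis using assms by (simp only: sum.delta finite_atMost atMost_iff if_True)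
 qed
 thus "tang_gen n d k v G i e = (\<Sum>a\<in>exponents n k. vscale (G a * of_nat (lookup a i + 1)) (hrow n d v (a + single i 1))) e"
  unfolding tang_gen_def osc_lin_mult fun_arith by (simp only: hrow_def) (simp add: mult.assoc)
qed

lemma dotp_tang_gen:
 "i <= n ==> dotp I g (tang_gen n d k v G i) =
  dotp (exponents n k) G (%a. of_nat (lookup a i + 1) * dotp I g (hrow n d v (a + single i 1)))"
 unfolding tang_gen_eq dotp_sum_right dotp_scale_right dotp_def[of "exponents n k"] by (simp only: mult.assoc)

lemma hrow_euler:
 assumes "a \<in> exponents n k"
 shows "(\<Sum>i\<le>n. vscale (v i * of_nat (lookup a i + 1)) (hrow n d v (a + single i 1)))
  = vscale (of_nat d - of_nat k) (hrow n d v a)"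
proof
 fix e
 show "(\<Sum>i\<le>n. vscale (v i * of_nat (lookup a i + 1)) (hrow n d v (a + single i 1))) e
  = vscale (of_nat d - of_nat k) (hrow n d v a) e"
 proof (cases "e \<in> exponents n d")
  case True
  show ?thesis
   using hcoef_euler[OF exponentsD(1)[OF True] exponentsD(1)[OF assms], of v] True exponentsD(2)[OF True] exponentsD(2)[OF assms]
   unfolding fun_arith by (simp only: hrow_def if_True mult.assoc)
 qed (simp add: fun_arith hrow_def)
qed

text \<open>Forms that are single monomials yield, up to non-zero factors, the rows for
  \<open>a + single i 1\<close> with i other than i0. Those with i = i0 follow from Euler's
  relation, because \<open>v i0\<close> is non-zero. Every exponent of degree k + 1 is of one of
  these kinds.\<close>

lemma osc_space_Suc_subset_span:
 fixes v :: "nat => 'a::field_char_0"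
 assumes R: "vec.subspace R" "osc_space n d k v \<subseteq> R" and i0: "i0 <= n" "v i0 ~= 0"
  and gen: "!!G i. i <= n ==> i ~= i0 ==> tang_gen n d k v G i \<in> R"
 shows "osc_space n d (Suc k) v \<subseteq> R"
proof -
 have h: "hrow n d v (a + single i 1) \<in> R" if a: "a \<in> exponents n k" and i: "i <= n" "i ~= i0" for a i
 proof -
  have "tang_gen n d k v (unit_vec a) i = vscale (of_nat (lookup a i + 1)) (hrow n d v (a + single i 1))"
  proof -
   have "tang_gen n d k v (unit_vec a) i = (\<Sum>b\<in>exponents n k. if b = a then
     vscale (of_nat (lookup a i + 1)) (hrow n d v (a + single i 1)) else 0)"
    unfolding tang_gen_eq[OF i(1)] by (intro sum.cong refl) (auto simp: unit_vec_def)
   thus ?thesis using a by (simp only: sum.delta finite_exponents if_True)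
  qed
  hence "vscale (of_nat (lookup a i + 1)) (hrow n d v (a + single i 1)) \<in> R"
   using gen[OF i, of "unit_vec a"] by simp
  hence "vscale (inverse (of_nat (lookup a i + 1))) (vscale (of_nat (lookup a i + 1)) (hrow n d v (a + single i 1))) \<in> R"
   by (rule vec.subspace_scale[OF R(1)])
  moreover have "(of_nat (lookup a i + 1) :: 'a) ~= 0" by (simp only: of_nat_eq_0_iff)
  ultimately show ?thesis by (simp only: vec.scale_scale left_inverse vec.scale_one simp_thms)
 qed
 have h0: "hrow n d v (a + single i0 1) \<in> R" if a: "a \<in> exponents n k" for a
 proof -
  let ?s = "%i. vscale (v i * of_nat (lookup a i + 1)) (hrow n d v (a + single i 1))"
  have "(\<Sum>i\<le>n. ?s i) = ?s i0 + (\<Sum>i\<in>{..n}-{i0}. ?s i)" using i0 by (subst sum.remove[of _ i0]) auto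
  hence "?s i0 = vscale (of_nat d - of_nat k) (hrow n d v a) - (\<Sum>i\<in>{..n}-{i0}. ?s i)"
   unfolding hrow_euler[OF a] by (simp only: eq_diff_eq)
  also have "\<dots> \<in> R"
  proof (intro vec.subspace_diff R(1) vec.subspace_scale vec.subspace_sum)
   have "hrow n d v a \<in> osc_space n d k v" using osc_unit_vec[OF a] by (metis osc_space_def rangeI)
   thus "hrow n d v a \<in> R" using R(2) by blast
  qed (use h a in auto)
  finally have "vscale (inverse (v i0 * of_nat (lookup a i0 + 1))) (?s i0) \<in> R" by (rule vec.subspace_scale[OF R(1)])
  moreover have "v i0 * of_nat (lookup a i0 + 1) ~= 0" using i0 by (simp only: mult_eq_0_iff of_nat_eq_0_iff) simp
  ultimately show ?thesis by (simp only: vec.scale_scale left_inverse vec.scale_one simp_thms)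
 qed
 have "hrow n d v c \<in> R" if c: "c \<in> exponents n (Suc k)" for c
 proof -
  have "\<exists>i\<le>n. lookup c i > 0"
  proof (rule ccontr)
   assume "\<not> ?thesis"
   hence "(\<Sum>i\<le>n. lookup c i) = 0" by auto
   thus False using c by (simp add: exponents_iff)
  qed
  then obtain i where i: "i <= n" "lookup c i > 0" by blast
  note m = exponents_minus_single[OF c i(2)]
  show ?thesis using h[OF m(1) i(1)] h0[OF m(1)] m(2) by (cases "i = i0") (simp_all only: simp_thms)
 qed
 thus ?thesis unfolding osc_space_span by (intro vec.span_minimal R(1)) blast
qed

text \<open>If two functionals annihilate \<open>osc_space k v\<close> and the \<open>2 \<times> 2\<close> determinant below vanishes for
  all \<open>G\<close>, then it factors as an identity between products of linear forms, and either the rows or the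
  columns are proportional. Proportional columns make both functionals geometric progressions along the
  exponents of degree \<open>k + 1\<close>, so they are dependent in either case.\<close>

lemma exists_tang_gen_det:
 fixes v :: "nat => 'a::field_char_0"
 assumes v0: "v 0 ~= 0"
  and g: "!!z. z \<in> osc_space 2 d k v ==> dotp I g z = 0" and h: "!!z. z \<in> osc_space 2 d k v ==> dotp I h z = 0"
  and x: "x \<in> osc_space 2 d (Suc k) v" "y \<in> osc_space 2 d (Suc k) v"
  and gx: "dotp I g x = 1" "dotp I g y = 0" "dotp I h x = 0" "dotp I h y = 1"
 shows "EX G. dotp I g (tang_gen 2 d k v G 1) * dotp I h (tang_gen 2 d k v G 2)
  ~= dotp I g (tang_gen 2 d k v G 2) * dotp I h (tang_gen 2 d k v G 1)"
proof (rule ccontr)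
 assume "\<not> ?thesis"
 hence det: "dotp I g (tang_gen 2 d k v G 1) * dotp I h (tang_gen 2 d k v G 2)
  = dotp I g (tang_gen 2 d k v G 2) * dotp I h (tang_gen 2 d k v G 1)" for G by blast
 let ?E = "exponents 2 k" and ?s = "%i. single i (1::nat)"
 define A where "A = (%f i a. of_nat (lookup a i + 1) * dotp I f (hrow 2 d v (a + ?s i)))"
 have det': "dotp ?E G (A g 1) * dotp ?E G (A h 2) = dotp ?E G (A g 2) * dotp ?E G (A h 1)" for G
  using det[of G] dotp_tang_gen[of 1 2 I g d k v G] dotp_tang_gen[of 2 2 I g d k v G]
   dotp_tang_gen[of 1 2 I h d k v G] dotp_tang_gen[of 2 2 I h d k v G] unfolding A_def by simp
 have sum3: "(\<Sum>i\<le>(2::nat). F i) = F 0 + F 1 + F 2" for F :: "nat => 'a"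
  by (simp add: numeral_2_eq_2 )
 have euler: "v 0 * A f 0 a + v 1 * A f 1 a + v 2 * A f 2 a = 0"
  if f: "!!z. z \<in> osc_space 2 d k v ==> dotp I f z = 0" and a: "a \<in> ?E" for f a
 proof -
  have "hrow 2 d v a \<in> osc_space 2 d k v" using osc_unit_vec[OF a] by (metis osc_space_def rangeI)
  hence "dotp I f (vscale (of_nat d - of_nat k) (hrow 2 d v a)) = 0" by (simp only: dotp_scale_right f mult_zero_right)
  hence "(\<Sum>i\<le>2. v i * A f i a) = 0"
   unfolding hrow_euler[OF a, symmetric] dotp_sum_right dotp_scale_right A_def by (simp only: mult.assoc)
  thus ?thesis by (simp only: sum3)
 qed
 have A0: "A f 0 a = - (v 1 * A f 1 a + v 2 * A f 2 a) / v 0"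
  if f: "!!z. z \<in> osc_space 2 d k v ==> dotp I f z = 0" and a: "a \<in> ?E" for f a
  using euler[OF f a] v0 by (simp add: field_simps eq_neg_iff_add_eq_0)
 \<comment> \<open>A non-trivial relation between g and h on the rows extends to the osculating
   space of order k + 1 and contradicts their dual values at x and y.\<close>
 have kill: False
  if f: "!!c. c \<in> exponents 2 (Suc k) ==> dotp I g (hrow 2 d v c) * p = dotp I h (hrow 2 d v c) * q" and pq: "p ~= 0 \<or> q ~= 0" for p q
 proof -
  have "dotp I (vscale p g) z = dotp I (vscale q h) z" if z: "z \<in> osc_space 2 d (Suc k) v" for z
  proof -
   have "dotp I (vscale p g - vscale q h) z = 0"
   proof (rule dotp_span_eq_0[OF z[unfolded osc_space_span]])
    fix w assume "w \<in> hrow 2 d v ` exponents 2 (Suc k)"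
    then obtain c where c: "c \<in> exponents 2 (Suc k)" "w = hrow 2 d v c" by blast
    show "dotp I (vscale p g - vscale q h) w = 0"
     using f[OF c(1)] unfolding c(2) by (simp add: dotp_def algebra_simps sum_subtractf vscale_apply sum_distrib_left)
   qed
   thus ?thesis by (simp add: dotp_def algebra_simps sum_subtractf)
  qed
  from this[OF x(1)] this[OF x(2)] show False using gx pq by (simp add: dotp_scale_left)
 qed
 have split: "EX a i. a \<in> ?E & i <= 2 & c = a + ?s i" if c: "c \<in> exponents 2 (Suc k)" for c
 proof -
  have "\<exists>i\<le>2. lookup c i > 0"
  proof (rule ccontr)
   assume "\<not> ?thesis"
   hence "(\<Sum>i\<le>2. lookup c i) = 0" by auto
   thus False using c by (simp add: exponents_iff)
  qed
  then obtain i where i: "i <= 2" "lookup c i > 0" by blast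
  show ?thesis using exponents_minus_single[OF c i(2)] i(1) by metis
 qed
 have A_pos: "(of_nat (lookup a i + 1) :: 'a) ~= 0" for a :: "nat \<Rightarrow>\<^sub>0 nat" and i by (simp only: of_nat_eq_0_iff)
 have le2: "i = 0 \<or> i = 1 \<or> i = 2" if "i <= 2" for i :: nat using that by auto
 \<comment> \<open>Proportional rows: a relation between g and h in the directions 1 and 2 extends
   to the direction 0 by Euler's relation.\<close>
 have rows: False if r: "!!a. a \<in> ?E ==> A g 1 a * p = A h 1 a * q" "!!a. a \<in> ?E ==> A g 2 a * p = A h 2 a * q"
  and pq: "p ~= 0 \<or> q ~= 0" for p q
 proof (rule kill[OF _ pq])
  fix c assume "c \<in> exponents 2 (Suc k)"
  then obtain a i where ai: "a \<in> ?E" "i <= 2" "c = a + ?s i" using split by blast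
  have "A g 0 a * p = - (v 1 * (A g 1 a * p) + v 2 * (A g 2 a * p)) / v 0" by (simp add: A0[OF g ai(1)] algebra_simps)
  also have "\<dots> = A h 0 a * q" unfolding r(1)[OF ai(1)] r(2)[OF ai(1)] by (simp add: A0[OF h ai(1)] algebra_simps)
  finally have "A g i a * p = A h i a * q" using le2[OF ai(2)] r ai(1) by blast
  hence "of_nat (lookup a i + 1) * (dotp I g (hrow 2 d v c) * p) = of_nat (lookup a i + 1) * (dotp I h (hrow 2 d v c) * q)"
   unfolding A_def ai(3) by (simp only: mult.assoc)
  thus "dotp I g (hrow 2 d v c) * p = dotp I h (hrow 2 d v c) * q" using A_pos by (metis mult_left_cancel)
 qed
 \<comment> \<open>Proportional columns: moving one unit of an exponent from i to m changes the
   values of g and h by the same factor. A relation between their values at the pure power of the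
   variable m therefore holds at all exponents, and one number each always admits a
   relation.\<close>
 have cols: False if m: "m <= 2" and r: "!!f i a. f = g \<or> f = h ==> i <= 2 ==> a \<in> ?E ==> A f i a = r i * A f m a" for m r
 proof -
  let ?C = "single m (Suc k)"
  let ?u = "%f c. dotp I f (hrow 2 d v c)"
  have main: "?u g ?C * p = ?u h ?C * q ==> c \<in> exponents 2 (Suc k) ==> ?u g c * p = ?u h c * q" for c p q
  proof (induction "Suc k - lookup c m" arbitrary: c rule: less_induct)
   case less
   show ?case
   proof (cases "\<exists>i\<le>2. i ~= m & lookup c i > 0")
    case True
    then obtain i where i: "i <= 2" "i ~= m" "lookup c i > 0" by blast
    define a where "a = c - ?s i"
    have a: "a \<in> ?E" "c = a + ?s i" using exponents_minus_single[OF less.prems(2) i(3)] by (simp_all only: a_def)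
    have e: "a + ?s m \<in> exponents 2 (Suc k)" using exponents_add_single[OF a(1) m, of 1] by simp
    have l: "lookup (a + ?s m) m = lookup c m + 1"
     using i(2) by (simp add: a(2) lookup_add lookup_single when_def)
    have "lookup (a + ?s m) m <= Suc k"
     using e m member_le_sum[of m "{..2}" "lookup (a + ?s m)"] by (simp add: exponents_iff)
    hence "Suc k - lookup (a + ?s m) m < Suc k - lookup c m" using l by simp
    hence IH: "?u g (a + ?s m) * p = ?u h (a + ?s m) * q" using less.hyps less.prems(1) e by blast
    have c: "of_nat (lookup a i + 1) * ?u f c = r i * (of_nat (lookup a m + 1) * ?u f (a + ?s m))"
     if "f = g \<or> f = h" for f using r[OF that i(1) a(1)] unfolding A_def a(2) .
    have "of_nat (lookup a i + 1) * (?u g c * p) = of_nat (lookup a i + 1) * ?u g c * p"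
     by (simp only: mult.assoc)
    also have "\<dots> = r i * of_nat (lookup a m + 1) * (?u g (a + ?s m) * p)"
     by (subst c) (simp_all only: mult.assoc simp_thms)
    also have "\<dots> = r i * of_nat (lookup a m + 1) * (?u h (a + ?s m) * q)" by (simp only: IH)
    also have "\<dots> = of_nat (lookup a i + 1) * ?u h c * q"
     unfolding c[OF disjI2[OF refl]] by (simp only: mult.assoc)
    finally show ?thesis using A_pos[of a i] by (simp only: mult.assoc mult_left_cancel simp_thms)
   next
    case False
    hence z: "lookup c i = 0" if "i <= 2" "i ~= m" for i using that by auto
    have "(\<Sum>i\<le>2. lookup c i) = lookup c m + (\<Sum>i\<in>{..2}-{m}. lookup c i)"
     using m by (subst sum.remove[of _ m]) auto
    hence "lookup c m = Suc k" using z less.prems(2) by (simp add: exponents_iff)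
    hence "c = ?C" using z less.prems(2) m
     by (intro exponent_eqI[of _ 2]) (auto simp: lookup_single when_def exponents_iff)
    thus ?thesis using less.prems(1) by (simp only: )
   qed
  qed
  show False
  proof (cases "?u h ?C ~= 0 \<or> ?u g ?C ~= 0")
   case True
   show False by (rule kill[OF main[OF mult.commute] True])
  next
   case False
   show False by (rule kill[OF main[of 1 0]]) (use False in simp_all)
  qed
 qed
 show False
 proof (cases "\<exists>a0\<in>?E. A g 1 a0 ~= 0")
  case True
  then obtain a0 where a0: "a0 \<in> ?E" "A g 1 a0 ~= 0" by blast
  have cr: "A f 0 a = - ((v 1 + v 2 * c) / v 0) * A f 1 a"
   if "f = g \<or> f = h" "a \<in> ?E" "A f 2 a = c * A f 1 a" for f a c
  proof -
   have "!!z. z \<in> osc_space 2 d k v ==> dotp I f z = 0" using that(1) g h by blast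
   from A0[OF this that(2)] show ?thesis by (simp only: that(3)) (use v0 in \<open>simp add: field_simps\<close>)
  qed
  from dotp_mult_eq_mult[OF finite_exponents det' a0] obtain c where
   "(\<forall>a\<in>?E. A g 2 a = c * A g 1 a & A h 2 a = c * A h 1 a) \<or> (\<forall>a\<in>?E. A h 1 a = c * A g 1 a & A h 2 a = c * A g 2 a)" by blast
  thus False
  proof
   assume c: "\<forall>a\<in>?E. A g 2 a = c * A g 1 a & A h 2 a = c * A h 1 a"
   show False
   proof (rule cols[of 1 "%i. if i = 0 then - ((v 1 + v 2 * c) / v 0) else if i = 1 then 1 else c"])
    fix f i a assume fia: "f = g \<or> f = h" "i <= (2::nat)" "a \<in> ?E"
    have 2: "A f 2 a = c * A f 1 a" using c fia by blast
    show "A f i a = (if i = 0 then - ((v 1 + v 2 * c) / v 0) else if i = 1 then 1 else c) * A f 1 a"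
     using le2[OF fia(2)] 2 cr[OF fia(1,3) 2] by auto
   qed simp
  next
   assume c: "\<forall>a\<in>?E. A h 1 a = c * A g 1 a & A h 2 a = c * A g 2 a"
   show False by (rule rows[of c 1]) (use c in \<open>auto simp: mult.commute\<close>)
  qed
 next
  case False
  hence g1: "A g 1 a = 0" if "a \<in> ?E" for a using that by blast
  have "dotp ?E G (A g 1) = 0" for G unfolding dotp_def by (intro sum.neutral ballI) (simp only: g1 mult_zero_right)
  \<comment> \<open>The remaining degenerate case, with first factor zero: either g vanishes in both
    directions, which is a relation between rows, or the whole column of the direction 1
    vanishes.\<close>
  hence "dotp ?E G (A g 2) * dotp ?E G (A h 1) = 0" for G using det'[of G] by simp
  from dotp_mult_eq_0[OF finite_exponents this] show False
  proof
   assume "\<forall>a\<in>?E. A g 2 a = 0"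
   thus False using g1 by (intro rows[of 1 0]) auto
  next
   assume h1: "\<forall>a\<in>?E. A h 1 a = 0"
   show False
   proof (rule cols[of 2 "%i. if i = 0 then - (v 2 / v 0) else if i = 1 then 0 else 1"])
    fix f i a assume fia: "f = g \<or> f = h" "i <= (2::nat)" "a \<in> ?E"
    have f: "!!z. z \<in> osc_space 2 d k v ==> dotp I f z = 0" using fia(1) g h by blast
    have 1: "A f 1 a = 0" using fia g1 h1 by blast
    show "A f i a = (if i = 0 then - (v 2 / v 0) else if i = 1 then 0 else 1) * A f 2 a"
     using le2[OF fia(2)] 1 A0[OF f fia(3)] by auto
   qed simp
  qed
 qed
qed

lemma lin_mult_sum: "lin_mult n b G = (\<Sum>i\<le>n. vscale (b i) (lin_mult n (unit_vec i) G))"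
proof
 fix c
 let ?X = "%i. if lookup c i > 0 then of_nat (lookup c i) * G (c - single i 1) else 0"
 have "(\<Sum>l\<le>n. unit_vec i l * ?X l) = ?X i" if "i <= n" for i
 proof -
  have "(\<Sum>l\<le>n. unit_vec i l * ?X l) = (\<Sum>l\<le>n. if l = i then ?X i else 0)"
   by (intro sum.cong refl) (simp add: unit_vec_def)
  thus ?thesis using that by (simp only: sum.delta finite_atMost atMost_iff if_True)
 qed
 thus "lin_mult n b G c = (\<Sum>i\<le>n. vscale (b i) (lin_mult n (unit_vec i) G)) c"
  unfolding fun_arith lin_mult_def by (intro sum.cong refl) (simp only: atMost_iff)
qed

lemma osc_lin_mult_sum: "osc n d (Suc k) v (lin_mult n b G) = (\<Sum>i\<le>n. vscale (b i) (tang_gen n d k v G i))"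
proof -
 interpret Vector_Spaces.linear vscale vscale "osc n d (Suc k) v" by (rule linear_osc)
 show ?thesis by (subst lin_mult_sum) (simp only: sum scale tang_gen_def)
qed

lemma tang_gen_in_osc_space: "tang_gen n d k v G i \<in> osc_space n d (Suc k) v"
 by (simp add: tang_gen_def osc_space_def)

text \<open>Euler's relation eliminates the direction 0 because \<open>v 0\<close> is non-zero. This
  is why a point contributes two directions although it has three coordinates.\<close>

lemma tang_gen_0_in_span:
 assumes "v 0 ~= 0"
 shows "tang_gen 2 d k v G 0 \<in> vec.span (osc_space 2 d k v \<union> tang_gen 2 d k v G ` {1,2})" (is "_ \<in> vec.span ?S")
proof -
 have sum3: "(\<Sum>i\<le>(2::nat). F i) = F 0 + F 1 + F 2" for F :: "nat => expo => 'a"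
  by (simp add: numeral_2_eq_2)
 have "vscale (v 0) (tang_gen 2 d k v G 0) = vscale (of_nat d - of_nat k) (osc 2 d k v G)
   - vscale (v 1) (tang_gen 2 d k v G 1) - vscale (v 2) (tang_gen 2 d k v G 2)"
  using osc_euler[of 2 d k v G] unfolding osc_lin_mult_sum sum3
  by (simp only: diff_diff_eq eq_diff_eq add.assoc)
 moreover have "\<dots> \<in> vec.span ?S"
  by (intro vec.span_diff vec.span_scale vec.span_base) (auto simp: osc_space_def)
 ultimately have "vscale (inverse (v 0)) (vscale (v 0) (tang_gen 2 d k v G 0)) \<in> vec.span ?S"
  by (simp only: vec.span_scale)
 thus ?thesis using assms by (simp only: vec.scale_scale left_inverse vec.scale_one simp_thms)
qed

lemma range_dmap_secant_param:
 "range (dmap (secant_param n d k s) t) =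
  vec.span (\<Union>j<s. osc_space n d k (pt t j) \<union> tang_gen n d k (pt t j) (form t j) ` {..n})" (is "?L = vec.span ?S")
proof (rule subset_antisym)
 show "?L \<subseteq> vec.span ?S"
 proof (rule subsetI, elim rangeE)
  fix x u assume x: "x = dmap (secant_param n d k s) t u"
  show "x \<in> vec.span ?S" unfolding x dmap_secant_param osc_lin_mult_sum
  proof (intro vec.span_sum vec.span_add)
   fix j assume "j \<in> {..<s}"
   thus "osc n d k (pt t j) (form u j) \<in> vec.span ?S" by (intro vec.span_base) (auto simp: osc_space_def)
  next
   fix j i assume "j \<in> {..<s}" "i \<in> {..n}"
   thus "vscale (pt u j i) (tang_gen n d k (pt t j) (form t j) i) \<in> vec.span ?S"
    by (intro vec.span_scale vec.span_base) auto
  qed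
 qed
 interpret Vector_Spaces.linear vscale vscale "dmap (secant_param n d k s) t"
  by (rule linear_dmap[where J = "param_index n k s"]) (rule polyfun_secant_param)
 have sub: "vec.subspace ?L" by (rule subspace_image) simp
 show "vec.span ?S \<subseteq> ?L"
 proof (rule vec.span_minimal[OF _ sub], rule subsetI)
  fix x assume "x \<in> ?S"
  then obtain j where j: "j < s" "x \<in> osc_space n d k (pt t j) \<or> x \<in> tang_gen n d k (pt t j) (form t j) ` {..n}" by blast
  have "EX b H. x = osc n d k (pt t j) H + osc n d (Suc k) (pt t j) (lin_mult n b (form t j))"
   using j(2)
  proof
   assume "x \<in> osc_space n d k (pt t j)"
   then obtain H where "x = osc n d k (pt t j) H" by (auto simp: osc_space_def)
   moreover have "osc n d (Suc k) (pt t j) (lin_mult n (%_. 0) (form t j)) = 0"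
    unfolding osc_lin_mult_sum by (simp only: vec.scale_zero_left sum.neutral_const)
   ultimately show ?thesis by (metis add_0_right)
  next
   assume "x \<in> tang_gen n d k (pt t j) (form t j) ` {..n}"
   then obtain i where i: "x = osc n d (Suc k) (pt t j) (lin_mult n (unit_vec i) (form t j))" by (auto simp: tang_gen_def)
   have "osc n d k (pt t j) (%_. 0) = 0" by (rule ext) (simp add: osc_def)
   thus ?thesis using i by (metis add_0_left)
  qed
  then obtain b H where x: "x = osc n d k (pt t j) H + osc n d (Suc k) (pt t j) (lin_mult n b (form t j))" by blast
  define u where "u = (%(l, z). if l = j then (case z of Inl i => b i | Inr a => H a) else 0)"
  have "(\<Sum>l<s. osc n d k (pt t l) (form u l) + osc n d (Suc k) (pt t l) (lin_mult n (pt u l) (form t l)))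
   = (\<Sum>l<s. if l = j then x else 0)"
  proof (intro sum.cong refl)
   fix l
   show "osc n d k (pt t l) (form u l) + osc n d (Suc k) (pt t l) (lin_mult n (pt u l) (form t l)) = (if l = j then x else 0)"
   proof (cases "l = j")
    case True
    thus ?thesis by (simp add: x u_def pt_def form_def)
   next
    case False
    hence e: "form u l = (%_. 0)" "pt u l = (%_. 0)" by (auto simp: u_def pt_def form_def)
    have "osc n d k (pt t l) (%_. 0) = 0" by (rule ext) (simp add: osc_def)
    moreover have "osc n d (Suc k) (pt t l) (lin_mult n (%_. 0) (form t l)) = 0"
     unfolding osc_lin_mult_sum by (simp only: vec.scale_zero_left sum.neutral_const)
    ultimately show ?thesis using False by (simp only: e if_False add_0_left)
   qed
  qed
  also have "\<dots> = x" using j(1) by (simp only: sum.delta finite_lessThan lessThan_iff if_True)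
  finally have "dmap (secant_param n d k s) t u = x" by (simp only: dmap_secant_param)
  thus "x \<in> ?L" by blast
 qed
qed

text \<open>A suitable form gains over \<open>R\<close> as much as the osculating space of order k +
  1 does, up to two. A gain of two comes from a non-vanishing determinant in the dual functionals, a
  gain of one from \<open>osc_space_Suc_subset_span\<close>.\<close>

lemma exists_tang_gen_dim:
 fixes v :: "nat => 'a::field_char_0"
 assumes v0: "v 0 ~= 0" and R: "R \<subseteq> coord_space (exponents 2 d)" "osc_space 2 d k v \<subseteq> vec.span R"
 shows "EX G. min (vec.dim (R \<union> osc_space 2 d (Suc k) v)) (vec.dim R + 2)
  <= vec.dim (R \<union> tang_gen 2 d k v G ` {1,2})"
proof -
 let ?E = "exponents 2 d" and ?O = "osc_space 2 d (Suc k) v"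
 have O: "?O \<subseteq> coord_space ?E" by (rule osc_space_coord_space)
 have gen: "R \<union> tang_gen 2 d k v G ` A \<subseteq> coord_space ?E" for G A using R(1) tang_gen_coord_space by blast
 consider "vec.dim (R \<union> ?O) >= vec.dim R + 2" | "vec.dim (R \<union> ?O) = vec.dim R + 1" | "vec.dim (R \<union> ?O) <= vec.dim R" by linarith
 thus ?thesis
 proof cases
  case 1
  from dim_Un_ge_dual[OF R(1) O finite_exponents 1] obtain x y g h where
   x: "x \<in> ?O" "y \<in> ?O" and g: "g \<in> ann ?E R" "h \<in> ann ?E R" and
   gx: "dotp ?E g x = 1" "dotp ?E g y = 0" "dotp ?E h x = 0" "dotp ?E h y = 1" .
  have van: "dotp ?E f z = 0" if f: "f \<in> ann ?E R" and z: "z \<in> osc_space 2 d k v" for f z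
  proof (rule dotp_span_eq_0[OF subsetD[OF R(2) z]])
   fix w assume "w \<in> R"
   thus "dotp ?E f w = 0" using f by (auto simp: ann_def)
  qed
  obtain G where G: "dotp ?E g (tang_gen 2 d k v G 1) * dotp ?E h (tang_gen 2 d k v G 2)
   ~= dotp ?E g (tang_gen 2 d k v G 2) * dotp ?E h (tang_gen 2 d k v G 1)"
   using exists_tang_gen_det[OF v0 van[OF g(1)] van[OF g(2)] x gx] by blast
  have "vec.dim (insert (tang_gen 2 d k v G 2) (insert (tang_gen 2 d k v G 1) R)) >= vec.dim R + 2"
   by (rule dim_insert_insert_ge[OF R(1) finite_exponents tang_gen_coord_space g G])
  moreover have "insert (tang_gen 2 d k v G 2) (insert (tang_gen 2 d k v G 1) R) = R \<union> tang_gen 2 d k v G ` {1,2}" by blast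
  ultimately show ?thesis by (intro exI[of _ G] min.coboundedI2) (simp only: )
 next
  case 2
  have "EX G i. i <= 2 & i ~= 0 & tang_gen 2 d k v G i \<notin> vec.span R"
  proof (rule ccontr)
   assume n: "\<not> ?thesis"
   have "?O \<subseteq> vec.span R"
    by (rule osc_space_Suc_subset_span[OF vec.subspace_span R(2) _ v0]) (use n in auto)
   hence "R \<union> ?O \<subseteq> vec.span R" using vec.span_superset by blast
   hence "vec.dim (R \<union> ?O) <= vec.dim R" by (rule dim_mono_span[OF _ R(1) finite_exponents])
   thus False using 2 by simp
  qed
  then obtain G i where Gi: "i <= 2" "i ~= 0" "tang_gen 2 d k v G i \<notin> vec.span R" by blast
  have "i \<in> {1,2}" using Gi by auto
  hence "insert (tang_gen 2 d k v G i) R \<subseteq> R \<union> tang_gen 2 d k v G ` {1,2}" by blast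
  hence "vec.dim (insert (tang_gen 2 d k v G i) R) <= vec.dim (R \<union> tang_gen 2 d k v G ` {1,2})"
   by (rule dim_mono[OF _ gen finite_exponents])
  moreover have "vec.dim R + 1 <= vec.dim (insert (tang_gen 2 d k v G i) R)"
   by (rule dim_insert_notin[OF Gi(3) R(1) finite_exponents])
  ultimately show ?thesis using 2 by (intro exI[of _ G] min.coboundedI1) linarith
 next
  case 3
  have "vec.dim R <= vec.dim (R \<union> tang_gen 2 d k v 0 ` {1,2})"
   by (rule dim_mono[OF _ gen finite_exponents]) blast
  thus ?thesis using 3 by (intro exI[of _ 0] min.coboundedI1) linarith
 qed
qed

text \<open>A bounded lower semicontinuous function with values in the natural numbers attains its
  maximum on a non-empty open set, and finitely many such sets meet.\<close>

lemma simultaneous_max: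
 fixes \<Phi> :: "(('j => 'a::field_char_0) => nat) set"
 assumes fin: "finite \<Phi>" "finite H" and C: "!!\<phi> t. \<phi> \<in> \<Phi> ==> \<phi> t <= C"
  and lsc: "!!\<phi> a. \<phi> \<in> \<Phi> ==> EX g. polyfun J g & g a ~= 0 & (ALL t. g t ~= 0 --> \<phi> a <= \<phi> t)"
  and H: "!!h. h \<in> H ==> polyfun J h" "!!h. h \<in> H ==> EX a. h a ~= 0"
 obtains t0 where "!!\<phi> t. \<phi> \<in> \<Phi> ==> \<phi> t <= \<phi> t0" "!!h. h \<in> H ==> h t0 ~= 0"
proof -
 have "EX g. polyfun J g & (EX a. g a ~= 0) & (ALL t. g t ~= 0 --> (ALL u. \<phi> u <= \<phi> t))" if \<phi>: "\<phi> \<in> \<Phi>" for \<phi>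
 proof -
  have "EX a. ALL u. \<phi> u <= \<phi> a" using ex_has_greatest_nat[of "%_. True" _ \<phi> "Suc C"] C[OF \<phi>] by (auto simp: less_Suc_eq_le)
  then obtain a where a: "!!u. \<phi> u <= \<phi> a" by blast
  obtain g where "polyfun J g" "g a ~= 0" "ALL t. g t ~= 0 --> \<phi> a <= \<phi> t" using lsc[OF \<phi>] by blast
  thus ?thesis using a le_trans by blast
 qed
 then obtain g where g: "!!\<phi>. \<phi> \<in> \<Phi> ==> polyfun J (g \<phi>) & (EX a. g \<phi> a ~= 0) & (ALL t. g \<phi> t ~= 0 --> (ALL u. \<phi> u <= \<phi> t))"
  by metis
 have "EX x. \<forall>f\<in>g ` \<Phi> \<union> H. f x ~= 0"
  by (rule polyfun_prod_neq_0[where J = J and f = "%f. f"]) (use fin g H in auto)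
 then obtain t0 where t0: "!!f. f \<in> g ` \<Phi> \<union> H ==> f t0 ~= 0" by blast
 show thesis
 proof
  fix \<phi> t assume "\<phi> \<in> \<Phi>"
  thus "\<phi> t <= \<phi> t0" using g t0 by blast
 qed (use t0 in blast)
qed


section \<open>Joins of osculating spaces and the generic rank\<close>

definition osc_join :: "nat => nat => nat => nat => (nat => nat => 'a::field_char_0) => (expo => 'a) set" where
 "osc_join n d k s v = (\<Union>j<s. osc_space n d k (v j))"

lemma osc_join_coord_space: "osc_join n d k s v \<subseteq> coord_space (exponents n d)"
 unfolding osc_join_def using osc_space_coord_space by blast

lemma dim_osc_join_open:
 fixes a :: "'j => 'a::field_char_0"
 assumes "!!j e b. j < s ==> e \<in> exponents n d ==> polyfun J (%t. hcoef n (v t j) e b)"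
 shows "EX g. polyfun J g & g a ~= 0 &
  (ALL t. g t ~= 0 --> vec.dim (osc_join n d k s (v a)) <= vec.dim (osc_join n d k s (v t)))"
proof -
 let ?K = "{..<s} \<times> exponents n k" and ?w = "%x t. hrow n d (v t (fst x)) (snd x)"
 have "vec.dim (osc_join n d k s (v t)) = vec.dim ((%x. ?w x t) ` ?K)" for t
 proof (rule vec.span_eq_dim, rule subset_antisym; rule vec.span_minimal[OF _ vec.subspace_span]; rule subsetI)
  fix x assume "x \<in> osc_join n d k s (v t)"
  then obtain j where j: "j < s" "x \<in> vec.span (hrow n d (v t j) ` exponents n k)"
   by (auto simp: osc_join_def osc_space_span)
  have "hrow n d (v t j) ` exponents n k \<subseteq> (%x. ?w x t) ` ?K" using j(1) by force
  thus "x \<in> vec.span ((%x. ?w x t) ` ?K)" using vec.span_mono j(2) by blast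
 next
  fix x assume "x \<in> (%x. ?w x t) ` ?K"
  then obtain j b where j: "j < s" "b \<in> exponents n k" "x = hrow n d (v t j) b" by auto
  hence "x \<in> osc_space n d k (v t j)" unfolding osc_space_span by (intro vec.span_base) blast
  thus "x \<in> vec.span (osc_join n d k s (v t))" using j(1) by (intro vec.span_base) (auto simp: osc_join_def)
 qed
 moreover have "polyfun J (%t. ?w x t e)" if "x \<in> ?K" for x e
  unfolding hrow_def using \<open>x \<in> ?K\<close> by (intro polyfun_if polyfun_const assms) auto
 ultimately show ?thesis
  by (simp only:, intro dim_family_open[where I = "exponents n d" and w = ?w])
   (auto intro: hrow_coord_space)
qed

lemma dim_tangent_join_open:
 fixes a :: "'a::field_char_0 params"
 assumes i: "i < s"
 shows "EX g. polyfun (param_index n k s) g & g a ~= 0 & (ALL t. g t ~= 0 -->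
  vec.dim (range (dmap (secant_param n d k s) a) \<union> osc_space n d l (pt a i))
  <= vec.dim (range (dmap (secant_param n d k s) t) \<union> osc_space n d l (pt t i)))"
proof -
 let ?J = "param_index n k s" and ?\<Phi> = "secant_param n d k s :: 'a params => _"
 let ?w = "%x t. case x of Inl j => dmap ?\<Phi> t (unit_vec j) | Inr b => hrow n d (pt t i) b"
 have eq: "vec.dim (range (dmap ?\<Phi> t) \<union> osc_space n d l (pt t i)) = vec.dim ((%x. ?w x t) ` (?J <+> exponents n l))" for t
 proof -
  have "(%x. ?w x t) ` (?J <+> exponents n l) = (%j. dmap ?\<Phi> t (unit_vec j)) ` ?J \<union> hrow n d (pt t i) ` exponents n l"
   by (auto simp: image_iff Plus_def split: sum.splits) force+
  moreover have "range (dmap ?\<Phi> t) = vec.span ((%j. dmap ?\<Phi> t (unit_vec j)) ` ?J)"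
   by (rule range_dmap[OF finite_param_index polyfun_secant_param])
  ultimately show ?thesis unfolding osc_space_span
   by (intro vec.span_eq_dim) (simp add: vec.span_Un vec.span_span)
 qed
 have "polyfun ?J (%t. ?w x t e)" if "x \<in> ?J <+> exponents n l" for x e
 proof (cases x)
  case (Inl j)
  thus ?thesis unfolding Inl sum.case dmap_def by (intro polyfun_dd[OF polyfun_secant_param])
 next
  case (Inr b)
  thus ?thesis unfolding Inr sum.case hrow_def by (intro polyfun_if polyfun_const polyfun_hcoef_pt i) auto
 qed
 moreover have "?w x t \<in> coord_space (exponents n d)" for x t
  by (cases x) (auto intro!: dmap_coord_space secant_param_coord_space hrow_coord_space)
 ultimately show ?thesis unfolding eq
  by (intro dim_family_open[where I = "exponents n d" and w = ?w]) (auto simp: finite_param_index)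
qed


lemma dim_coord_subset_le: "V \<subseteq> coord_space I ==> finite I ==> vec.dim (V :: ('i => 'a::field) set) <= card I"
 using dim_mono[of V "coord_space I" I] dim_coord_space[of I] by (metis order_refl)

definition tang_set :: "nat => nat => 'a::field_char_0 params => nat => (expo => 'a) set" where
 "tang_set d k t j = osc_space 2 d k (pt t j) \<union> tang_gen 2 d k (pt t j) (form t j) ` {1,2}"

lemma tang_set_coord_space: "tang_set d k t j \<subseteq> coord_space (exponents 2 d)"
 unfolding tang_set_def using osc_space_coord_space tang_gen_coord_space by blast

lemma range_dmap_tang_set:
 assumes "!!j. j < s ==> pt t j 0 ~= 0"
 shows "range (dmap (secant_param 2 d k s) t) = vec.span (\<Union>j<s. tang_set d k t j)"
 unfolding range_dmap_secant_param
proof (rule subset_antisym; rule vec.span_minimal[OF _ vec.subspace_span]; rule subsetI)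
 fix x assume "x \<in> (\<Union>j<s. osc_space 2 d k (pt t j) \<union> tang_gen 2 d k (pt t j) (form t j) ` {..2})"
 then obtain j where j: "j < s" "x \<in> osc_space 2 d k (pt t j) \<or> x \<in> tang_gen 2 d k (pt t j) (form t j) ` {..2}" by blast
 have "{..2::nat} = {0,1,2}" by auto
 hence "x \<in> tang_set d k t j \<or> x = tang_gen 2 d k (pt t j) (form t j) 0" using j(2) by (auto simp: tang_set_def)
 hence "x \<in> vec.span (tang_set d k t j)"
 proof
  assume "x = tang_gen 2 d k (pt t j) (form t j) 0"
  thus ?thesis unfolding tang_set_def using tang_gen_0_in_span[where v = "pt t j", OF assms[OF j(1)]] by (simp only: )
 qed (rule vec.span_base)
 thus "x \<in> vec.span (\<Union>j<s. tang_set d k t j)" using vec.span_mono[of "tang_set d k t j" "\<Union>j<s. tang_set d k t j"] j(1) by blast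
next
 fix x assume "x \<in> (\<Union>j<s. tang_set d k t j)"
 thus "x \<in> vec.span (\<Union>j<s. osc_space 2 d k (pt t j) \<union> tang_gen 2 d k (pt t j) (form t j) ` {..2})"
 proof (intro vec.span_base)
  from \<open>x \<in> _\<close> obtain j where j: "j < s" "x \<in> tang_set d k t j" by blast
  have "{1,2} \<subseteq> {..2::nat}" by auto
  hence "x \<in> osc_space 2 d k (pt t j) \<union> tang_gen 2 d k (pt t j) (form t j) ` {..2}" using j(2) unfolding tang_set_def by blast
  thus "x \<in> (\<Union>j<s. osc_space 2 d k (pt t j) \<union> tang_gen 2 d k (pt t j) (form t j) ` {..2})" using j(1) by blast
 qed
qed

text \<open>The tangent space depends only on the unordered collection of points with their forms.
  The symmetry carries what holds at one point to every other.\<close>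

lemma range_dmap_permute:
 assumes i: "i < s" "l < s"
 shows "range (dmap (secant_param n d k s) (%(j, z). t ((id(i := l, l := i)) j, z))) = range (dmap (secant_param n d k s) t)"
proof -
 have "(id(i := l, l := i)) j < s" if "j < s" for j using that i by auto
 moreover have "(id(i := l, l := i)) ((id(i := l, l := i)) j) = j" for j by auto
 ultimately have im: "(id(i := l, l := i)) ` {..<s} = {..<s}" by (metis (no_types, lifting) image_eqI image_subsetI lessThan_iff subsetI subset_antisym)
 let ?F = "%j. osc_space n d k (pt t j) \<union> tang_gen n d k (pt t j) (form t j) ` {..n}"
 have "(\<Union>j<s. ?F ((id(i := l, l := i)) j)) = (\<Union>j\<in>(id(i := l, l := i)) ` {..<s}. ?F j)" by (simp only: image_image)
 thus ?thesis unfolding range_dmap_secant_param im by (simp add: pt_def form_def im del: fun_upd_apply)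
qed

text \<open>Choose parameters at which all the dimensions below are maximal. Either adding the osculating
  spaces of order \<open>k + 1\<close> does not enlarge the tangent space, which then is their join; or, by
  symmetry, it is enlarged at every point, so that each point contributes two dimensions that are
  independent of everything else.\<close>

theorem dim_tangent_max:
 assumes kd: "k < d"
 shows "\<exists>t0 :: 'a::field_char_0 params.
  (\<forall>t :: 'a params. vec.dim (range (dmap (secant_param 2 d k s) t)) <= vec.dim (range (dmap (secant_param 2 d k s) t0))) &
  vec.dim (range (dmap (secant_param 2 d k s) t0)) =
   min (vec.dim (osc_join 2 d (Suc k) s (pt t0))) (vec.dim (osc_join 2 d k s (pt t0)) + 2 * s) &
  (\<forall>t :: 'a params. vec.dim (osc_join 2 d k s (pt t)) <= vec.dim (osc_join 2 d k s (pt t0))) &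
  (\<forall>t :: 'a params. vec.dim (osc_join 2 d (Suc k) s (pt t)) <= vec.dim (osc_join 2 d (Suc k) s (pt t0))) &
  (\<forall>j<s. \<forall>i\<le>2. pt t0 j i ~= 0)"
proof -
 let ?E = "exponents 2 d" and ?J = "param_index 2 k s"
 define Y where "Y = (%t :: 'a params. range (dmap (secant_param 2 d k s) t))"
 define x where "x = (%l (t :: 'a params). vec.dim (osc_join 2 d l s (pt t)))"
 define y where "y = (%t. vec.dim (Y t))"
 define z where "z = (%i t. vec.dim (Y t \<union> osc_space 2 d (Suc k) (pt t i)))"
 have YE: "Y t \<subseteq> coord_space ?E" for t unfolding Y_def
  by (rule image_subsetI) (rule dmap_coord_space[OF secant_param_coord_space])
 have YOE: "Y t \<union> osc_space 2 d l v \<subseteq> coord_space ?E" for t l v using YE osc_space_coord_space by blast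
 have xlsc: "EX g. polyfun ?J g & g a ~= 0 & (ALL t. g t ~= 0 --> x l a <= x l t)" for l a unfolding x_def
  by (rule dim_osc_join_open) (rule polyfun_hcoef_pt)
 have ylsc: "EX g. polyfun ?J g & g a ~= 0 & (ALL t. g t ~= 0 --> y a <= y t)" for a unfolding y_def Y_def
  by (rule dim_dmap_open[OF finite_param_index polyfun_secant_param finite_exponents secant_param_coord_space])
 have zlsc: "EX g. polyfun ?J g & g a ~= 0 & (ALL t. g t ~= 0 --> z i a <= z i t)" if "i < s" for i a
  unfolding z_def Y_def by (rule dim_tangent_join_open[OF \<open>i < s\<close>])
 let ?\<Phi> = "{x k, x (Suc k), y} \<union> z ` {..<s}" and ?H = "(%(j,i) (t :: 'a params). pt t j i) ` ({..<s} \<times> {..2::nat})"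
 obtain t0 where t0: "!!\<phi> t. \<phi> \<in> ?\<Phi> ==> \<phi> t <= \<phi> t0" "!!h. h \<in> ?H ==> h t0 ~= 0"
 proof (rule simultaneous_max[of ?\<Phi> ?H "card ?E" ?J])
  show "finite ?\<Phi>" "finite ?H" by auto
  show "\<phi> t <= card ?E" if "\<phi> \<in> ?\<Phi>" for \<phi> t
  proof -
   have "x l t <= card ?E" "y t <= card ?E" "z i t <= card ?E" for l i
    unfolding x_def y_def z_def
    by (rule dim_coord_subset_le[OF _ finite_exponents], rule osc_join_coord_space YE YOE)+
   thus ?thesis using \<open>\<phi> \<in> ?\<Phi>\<close> by auto
  qed
  show "EX g. polyfun ?J g & g a ~= 0 & (ALL t. g t ~= 0 --> \<phi> a <= \<phi> t)" if "\<phi> \<in> ?\<Phi>" for \<phi> a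
   using \<open>\<phi> \<in> ?\<Phi>\<close> xlsc ylsc zlsc by auto
  show "polyfun ?J h" if "h \<in> ?H" for h using \<open>h \<in> ?H\<close> polyfun_pt by auto
  show "EX a. h a ~= 0" if "h \<in> ?H" for h
  proof -
   have "h (%_. 1) ~= 0" using \<open>h \<in> ?H\<close> by (auto simp: pt_def)
   thus ?thesis by blast
  qed
 qed blast
 have p0: "pt t0 j i ~= 0" if "j < s" "i <= 2" for j i
 proof -
  have "(j, i) \<in> {..<s} \<times> {..2::nat}" using that by simp
  hence "(%t. pt t j i) \<in> ?H" by (rule rev_image_eqI) simp
  thus ?thesis by (rule t0(2))
 qed
 have Yspan: "Y t0 = vec.span (\<Union>j<s. tang_set d k t0 j)" unfolding Y_def by (rule range_dmap_tang_set) (use p0 in auto)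
 have tang_sub: "tang_set d k t j \<subseteq> osc_space 2 d (Suc k) (pt t j)" for t :: "'a params" and j
  unfolding tang_set_def using osc_space_Suc[OF kd] tang_gen_in_osc_space by blast
 have le1: "y t0 <= x (Suc k) t0" unfolding y_def x_def Yspan vec.dim_span
  by (rule dim_mono[OF _ osc_join_coord_space finite_exponents]) (use tang_sub in \<open>auto simp: osc_join_def\<close>)
 let ?gen = "%j. tang_gen 2 d k (pt t0 j) (form t0 j) ` {1,2}"
 have gen_card: "card (?gen j) <= 2" for j using card_image_le[of "{1,2::nat}" "tang_gen 2 d k (pt t0 j) (form t0 j)"] by simp
 have Yeq: "(\<Union>j<s. tang_set d k t0 j) = osc_join 2 d k s (pt t0) \<union> (\<Union>j<s. ?gen j)"
  unfolding tang_set_def osc_join_def by blast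
 have "card (\<Union>j<s. ?gen j) <= (\<Sum>j<s. card (?gen j))" by (rule card_UN_le) simp
 also have "\<dots> <= (\<Sum>j<s. 2)" by (intro sum_mono gen_card)
 finally have c2: "card (\<Union>j<s. ?gen j) <= 2 * s" by simp
 have "y t0 <= x k t0 + card (\<Union>j<s. ?gen j)" unfolding y_def x_def Yspan vec.dim_span Yeq
  by (rule dim_Un_card_le[OF _ osc_join_coord_space finite_exponents]) auto
 hence le2: "y t0 <= x k t0 + 2 * s" using c2 by simp
 have ge: "x k t0 + 2 * s <= y t0" if lt: "y t0 < x (Suc k) t0"
 proof -
  have "\<exists>i<s. \<not> osc_space 2 d (Suc k) (pt t0 i) \<subseteq> Y t0"
  proof (rule ccontr)
   assume "\<not> ?thesis"
   hence "osc_join 2 d (Suc k) s (pt t0) \<subseteq> Y t0" by (auto simp: osc_join_def)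
   hence "x (Suc k) t0 <= y t0" unfolding x_def y_def by (rule dim_mono[OF _ YE finite_exponents])
   thus False using lt by simp
  qed
  then obtain i w where i: "i < s" "w \<in> osc_space 2 d (Suc k) (pt t0 i)" "w \<notin> Y t0" by blast
  have "w \<notin> vec.span (Y t0)" using i(3) by (simp only: Yspan vec.span_span simp_thms)
  hence "y t0 + 1 <= vec.dim (insert w (Y t0))" unfolding y_def by (rule dim_insert_notin[OF _ YE finite_exponents])
  also have "\<dots> <= z i t0" unfolding z_def by (rule dim_mono[OF _ YOE finite_exponents]) (use i(2) in blast)
  finally have zi: "y t0 < z i t0" by simp
  \<comment> \<open>Exchanging the points i and l keeps the tangent space and moves the enlargement
    from i to l, though at another parameter value; maximality of \<open>z l\<close> at
    \<open>t0\<close> brings it back.\<close>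
  have zl: "y t0 < z l t0" if l: "l < s" for l
  proof -
   let ?t = "%(j, u). t0 ((id(i := l, l := i)) j, u)"
   have "Y ?t = Y t0" unfolding Y_def by (rule range_dmap_permute[OF i(1) l])
   moreover have "pt ?t l = pt t0 i" by (auto simp: pt_def)
   ultimately have "z l ?t = z i t0" by (simp only: z_def)
   thus ?thesis using zi t0(1)[of "z l" ?t] l by auto
  qed
  \<comment> \<open>All contributions except the two directions at l that depend on the form there.
    Replacing this form leaves \<open>R l\<close> unchanged.\<close>
  define R where "R = (%l. (\<Union>j\<in>{..<s}-{l}. tang_set d k t0 j) \<union> osc_space 2 d k (pt t0 l))"
  have RE: "R l \<subseteq> coord_space ?E" for l unfolding R_def using tang_set_coord_space osc_space_coord_space by blast
  have R2: "vec.dim (R l) + 2 <= y t0" if l: "l < s" for l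
  proof -
   let ?v = "pt t0 l"
   have v0: "?v 0 ~= 0" using p0[OF l, of 0] by simp
   have "osc_space 2 d k ?v \<subseteq> vec.span (R l)" unfolding R_def by (rule subset_trans[OF _ vec.span_superset]) blast
   then obtain G where G: "min (vec.dim (R l \<union> osc_space 2 d (Suc k) ?v)) (vec.dim (R l) + 2)
     <= vec.dim (R l \<union> tang_gen 2 d k ?v G ` {1,2})" using exists_tang_gen_dim[of ?v "R l" d k, OF v0 RE] by blast
   define t1 where "t1 = (%(j, u). if j = l then (case u of Inl i => t0 (j, u) | Inr a => G a) else t0 (j, u))"
   have pt1: "pt t1 j = pt t0 j" for j by (rule ext) (simp add: pt_def t1_def)
   have form1: "form t1 l = G" "j ~= l ==> form t1 j = form t0 j" for j by (auto simp: form_def t1_def fun_eq_iff)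
   have ts: "tang_set d k t1 j = tang_set d k t0 j" if "j ~= l" for j by (simp only: tang_set_def pt1 form1(2)[OF \<open>j ~= l\<close>])
   have "Y t1 = vec.span (\<Union>j<s. tang_set d k t1 j)" unfolding Y_def by (rule range_dmap_tang_set) (use p0 pt1 in auto)
   moreover have "{..<s} = insert l ({..<s} - {l})" using l by auto
   hence "(\<Union>j<s. tang_set d k t1 j) = tang_set d k t1 l \<union> (\<Union>j\<in>{..<s}-{l}. tang_set d k t1 j)" by (metis UN_insert)
   moreover have "(\<Union>j\<in>{..<s}-{l}. tang_set d k t1 j) = (\<Union>j\<in>{..<s}-{l}. tang_set d k t0 j)" by (intro SUP_cong refl) (use ts in blast)
   moreover have "tang_set d k t1 l = osc_space 2 d k ?v \<union> tang_gen 2 d k ?v G ` {1,2}" by (simp only: tang_set_def pt1 form1)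
   ultimately have "y t1 = vec.dim (R l \<union> tang_gen 2 d k ?v G ` {1,2})"
    unfolding y_def R_def by (simp only: vec.dim_span Un_ac)
   hence "min (vec.dim (R l \<union> osc_space 2 d (Suc k) ?v)) (vec.dim (R l) + 2) <= y t0"
    using G t0(1)[of y t1] by auto
   \<comment> \<open>As \<open>z l t0\<close> exceeds \<open>y t0\<close>, the first entry of the
     minimum does too, so the minimum is \<open>vec.dim (R l) + 2\<close>.\<close>
   moreover have "z l t0 <= vec.dim (R l \<union> osc_space 2 d (Suc k) ?v)"
    unfolding z_def
   proof (rule dim_mono_span[OF _ _ finite_exponents])
    show "R l \<union> osc_space 2 d (Suc k) ?v \<subseteq> coord_space ?E" using RE osc_space_coord_space by blast
    have "tang_set d k t0 j \<subseteq> R l \<union> osc_space 2 d (Suc k) ?v" if "j < s" for j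
    proof (cases "j = l")
     case True
     show ?thesis unfolding True using tang_sub[of t0 l] by blast
    next
     case False
     thus ?thesis unfolding R_def using \<open>j < s\<close> by blast
    qed
    hence "(\<Union>j<s. tang_set d k t0 j) \<subseteq> R l \<union> osc_space 2 d (Suc k) ?v" by blast
    hence "Y t0 \<subseteq> vec.span (R l \<union> osc_space 2 d (Suc k) ?v)" unfolding Yspan by (rule vec.span_mono)
    moreover have "osc_space 2 d (Suc k) ?v \<subseteq> vec.span (R l \<union> osc_space 2 d (Suc k) ?v)"
     by (rule subset_trans[OF _ vec.span_superset]) blast
    ultimately show "Y t0 \<union> osc_space 2 d (Suc k) ?v \<subseteq> vec.span (R l \<union> osc_space 2 d (Suc k) ?v)" by blast
   qed
   ultimately show ?thesis using zl[OF l] by linarith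
  qed
  \<comment> \<open>The pairs of generators are added point by point. The gain at m is at least the
    gain over the larger set \<open>R m\<close>, by submodularity, and that is at least two.\<close>
  define W where "W = (%m. osc_join 2 d k s (pt t0) \<union> (\<Union>j<m. ?gen j))"
  have "m <= s ==> x k t0 + 2 * m <= vec.dim (W m)" for m
  proof (induction m)
   case 0
   show ?case by (simp add: W_def x_def)
  next
   case (Suc m)
   hence m: "m < s" by simp
   have sub: "W m \<subseteq> R m"
   proof -
    have "osc_space 2 d k (pt t0 j) \<subseteq> R m" if "j < s" for j unfolding R_def tang_set_def using \<open>j < s\<close> by blast
    moreover have "?gen j \<subseteq> R m" if "j < m" for j unfolding R_def tang_set_def using \<open>j < m\<close> m by auto
    ultimately show ?thesis unfolding W_def osc_join_def by blast
   qed
   have "vec.dim (R m \<union> ?gen m) + vec.dim (W m) <= vec.dim (W m \<union> ?gen m) + vec.dim (R m)"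
    by (rule dim_Un_diminishing[OF _ _ sub RE finite_exponents]) (use tang_gen_coord_space in auto)
   moreover have "y t0 <= vec.dim (R m \<union> ?gen m)" unfolding y_def Yspan vec.dim_span
   proof (rule dim_mono[OF _ _ finite_exponents])
    show "R m \<union> ?gen m \<subseteq> coord_space ?E" using RE tang_gen_coord_space by blast
    have "tang_set d k t0 j \<subseteq> R m \<union> ?gen m" if "j < s" for j
    proof (cases "j = m")
     case True
     show ?thesis unfolding True R_def tang_set_def by blast
    next
     case False
     thus ?thesis unfolding R_def using \<open>j < s\<close> by blast
    qed
    thus "(\<Union>j<s. tang_set d k t0 j) \<subseteq> R m \<union> ?gen m" by blast
   qed
   moreover have "W m \<union> ?gen m = W (Suc m)" by (auto simp: W_def lessThan_Suc)
   ultimately show ?case using R2[OF m] Suc by simp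
  qed
  from this[of s] show ?thesis unfolding y_def Yspan vec.dim_span Yeq W_def by simp
 qed
 have "y t0 = min (x (Suc k) t0) (x k t0 + 2 * s)" using le1 le2 ge by linarith
 moreover have "y t <= y t0" "x k t <= x k t0" "x (Suc k) t <= x (Suc k) t0" for t using t0(1) by blast+
 ultimately show ?thesis
  using p0 unfolding y_def x_def Y_def by (intro exI[of _ t0] conjI allI impI)
qed

section \<open>Jets of Laurent polynomials\<close>

text \<open>Away from the coordinate hyperplanes the Hasse derivatives of order less than \<open>m\<close>, rescaled by
  powers of the variables, make sense for Laurent polynomials.\<close>

definition lterm :: "nat => (nat => 'a::field_char_0) => (nat \<Rightarrow>\<^sub>0 int) => expo => 'a" where
 "lterm n v e a = (\<Prod>i\<le>n. (of_int (lookup e i) gchoose lookup a i) * v i powi lookup e i)"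

definition ljet :: "nat => (nat => 'a::field_char_0) => expo => 'a laurent => 'a" where
 "ljet n v a b = (\<Sum>e\<in>keys b. lookup b e * lterm n v e a)"

definition lvanishes :: "nat => nat => (nat => 'a::field_char_0) => 'a laurent => bool" where
 "lvanishes n m v b \<longleftrightarrow> (ALL a. keys a \<subseteq> {..n} --> mdeg a < m --> ljet n v a b = 0)"

lemma ljet_superset:
 "finite A ==> keys b \<subseteq> A ==> ljet n v a b = (\<Sum>e\<in>A. lookup b e * lterm n v e a)"
 unfolding ljet_def by (rule sum.mono_neutral_left) (auto simp: in_keys_iff)

lemma ljet_add: "ljet n v a (f + g) = ljet n v a f + ljet n v a g"
proof -
 let ?A = "keys f \<union> keys g"
 show ?thesis
  by (subst (1 2 3) ljet_superset[of ?A])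
   (use keys_add[of f g] in \<open>auto simp: lookup_add sum.distrib algebra_simps\<close>)
qed

lemma ljet_zero [simp]: "ljet n v a 0 = 0"
 by (simp add: ljet_def)

lemma ljet_single: "ljet n v a (single e c) = c * lterm n v e a"
 by (cases "c = 0") (auto simp: ljet_def)

lemma ljet_sum: "ljet n v a (\<Sum>i\<in>A. f i) = (\<Sum>i\<in>A. ljet n v a (f i))"
 by (induction A rule: infinite_finite_induct) (auto simp: ljet_add)

lemma laurent_single_mult:
 "single m c * (g :: 'a::field laurent) = (\<Sum>e\<in>keys g. single (m + e) (c * lookup g e))"
 by (subst (1) poly_mapping_sum_single[of g]) (simp add: sum_distrib_left mult_single)

lemma ljet_cmult: "ljet n v a (single 0 c * g) = c * ljet n v a g"
 by (simp add: laurent_single_mult ljet_sum ljet_single ljet_def[of n v a g] sum_distrib_left mult.assoc)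

lemma ljet_uminus: "ljet n v a (- g) = - ljet n v a g"
 using ljet_add[of n v a g "- g"] by (simp add: eq_neg_iff_add_eq_0 add.commute)

lemma ljet_diff: "ljet n v a (f - g) = ljet n v a f - ljet n v a g"
 using ljet_add[of n v a f "- g"] by (simp add: ljet_uminus)

lemma lterm_shift:
 fixes v :: "nat => 'a::field_char_0"
 assumes j: "j <= n" "v j ~= 0"
 shows "lterm n v (e + single j 1) a = v j * (lterm n v e a +
  (if lookup a j > 0 then lterm n v e (a - single j 1) else 0))"
proof -
 let ?F = "%e a i. (of_int (lookup e i) gchoose lookup a i) * v i powi lookup e i"
 let ?R = "%e a. \<Prod>i\<in>{..n}-{j}. ?F e a i"
 have s: "lterm n v e a = ?F e a j * ?R e a" for e a
  unfolding lterm_def using j(1) by (subst prod.remove[of _ j]) auto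
 have "?R (e + single j 1) a = ?R e a"
  by (intro prod.cong refl) (simp add: lookup_add lookup_single when_def)
 moreover have "?R e (a - single j 1) = ?R e a"
  by (intro prod.cong refl) (simp add: lookup_minus lookup_single when_def)
 moreover have "?F (e + single j 1) a j = v j * (?F e a j + (if lookup a j > 0 then ?F e (a - single j 1) j else 0))"
 proof (cases "lookup a j")
  case 0
  thus ?thesis using j(2) by (simp add: lookup_add power_int_add_1 mult.commute)
 next
  case (Suc m)
  have "(of_int (lookup e j + 1) gchoose Suc m :: 'a) = (of_int (lookup e j) gchoose m) + (of_int (lookup e j) gchoose Suc m)"
   by (simp only: of_int_add of_int_1 gbinomial_Suc_Suc)
  moreover have "v j powi (lookup e j + 1) = v j powi lookup e j * v j" using j(2) by (intro power_int_add_1) simp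
  moreover have "lookup (e + single j 1) j = lookup e j + 1"
   "lookup (a - single j 1) j = m" using Suc by (simp_all add: lookup_add lookup_minus)
  ultimately show ?thesis using Suc by (simp only:) (simp add: algebra_simps)
 qed
 ultimately show ?thesis by (simp add: s distrib_right mult.assoc)
qed

lemma ljet_shift:
 assumes j: "j <= n" "v j ~= 0"
 shows "ljet n v a (single (single j 1) 1 * b) = v j * (ljet n v a b +
  (if lookup a j > 0 then ljet n v (a - single j 1) b else 0))"
proof -
 have "ljet n v a (single (single j 1) 1 * b) =
   (\<Sum>e\<in>keys b. lookup b e * lterm n v (e + single j 1) a)"
  by (simp add: laurent_single_mult ljet_sum ljet_single add.commute)
 thus ?thesis by (simp add: lterm_shift[where v = v, OF j] ljet_def distrib_left sum.distrib sum_distrib_left mult_ac)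
qed

text \<open>The jets of b multiplied by x_j are \<open>v j\<close> times those of b plus jets of
  lower order: a triangular system with non-zero diagonal.\<close>

lemma lvanishes_shift:
 assumes j: "j <= n" "v j ~= 0"
 shows "lvanishes n m v (single (single j 1) 1 * b) \<longleftrightarrow> lvanishes n m v b"
proof
 assume v: "lvanishes n m v b"
 show "lvanishes n m v (single (single j 1) 1 * b)" unfolding lvanishes_def
 proof (intro allI impI)
  fix a :: "nat \<Rightarrow>\<^sub>0 nat" assume a: "keys a \<subseteq> {..n}" "mdeg a < m"
  have "keys (a - single j 1) \<subseteq> {..n}" using a(1) by (auto simp: in_keys_iff lookup_minus subset_iff)
  moreover have "mdeg (a - single j 1) < m" if "lookup a j > 0"
  proof -
   have "a - single j 1 + single j 1 = a"
    by (rule poly_mapping_eqI) (use \<open>lookup a j > 0\<close> in \<open>auto simp: lookup_add lookup_minus lookup_single when_def\<close>)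
   hence "mdeg a = mdeg (a - single j 1) + 1" by (metis mdeg_add mdeg_single)
   thus ?thesis using a(2) by simp
  qed
  ultimately show "ljet n v a (single (single j 1) 1 * b) = 0"
   using v a unfolding ljet_shift[where v = v, OF j] lvanishes_def by auto
 qed
next
 assume v: "lvanishes n m v (single (single j 1) 1 * b)"
 have "keys a \<subseteq> {..n} ==> mdeg a < m ==> ljet n v a b = 0" for a
 proof (induction "lookup a j" arbitrary: a)
  case 0
  thus ?case using v j(2) ljet_shift[where v = v, OF j, of a b] by (simp add: lvanishes_def)
 next
  case (Suc l)
  let ?a = "a - single j 1"
  have "?a + single j 1 = a"
   by (rule poly_mapping_eqI) (use Suc(2) in \<open>auto simp: lookup_add lookup_minus lookup_single when_def\<close>)
  hence "mdeg a = mdeg ?a + 1" by (metis mdeg_add mdeg_single)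
  moreover have "keys ?a \<subseteq> {..n}" using Suc(3) by (auto simp: in_keys_iff lookup_minus subset_iff)
  moreover have "l = lookup ?a j" using Suc(2) by (simp add: lookup_minus)
  ultimately have "ljet n v ?a b = 0" using Suc(1)[of ?a] Suc(4) by simp
  moreover have "ljet n v a (single (single j 1) 1 * b) = 0" using v Suc by (simp add: lvanishes_def)
  ultimately show ?case using ljet_shift[where v = v, OF j, of a b] j(2) by (simp split: if_splits)
 qed
 thus "lvanishes n m v b" by (simp add: lvanishes_def)
qed

lemma lvanishes_shift_int:
 assumes j: "j <= n" "v j ~= 0"
 shows "lvanishes n m v (single (single j l) 1 * b) \<longleftrightarrow> lvanishes n m v b"
proof (induction l rule: int_induct[where k = 0])
 case (step1 i)
 have e: "single (single j (i + 1)) 1 * b =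
  single (single j 1) 1 * (single (single j i) 1 * b)"
  by (simp only: mult.assoc[symmetric] mult_single single_add[symmetric] mult_1_left add.commute)
 show ?case unfolding e lvanishes_shift[where v = v, OF j] by (rule step1)
next
 case (step2 i)
 have e: "single (single j i) 1 * b =
  single (single j 1) 1 * (single (single j (i - 1)) 1 * b)"
  by (simp only: mult.assoc[symmetric] mult_single single_add[symmetric] mult_1_left add_diff_cancel_left' diff_add_cancel add.commute[of 1])
 show ?case using step2(2) unfolding e lvanishes_shift[where v = v, OF j] .
qed (simp add: single_one)

lemma lvanishes_inv_vars_power:
 assumes "!!j. j \<in> \<sigma> ==> j <= n" "!!j. j \<in> \<sigma> ==> v j ~= 0" "finite \<sigma>"
 shows "lvanishes n m v (b * inv_vars_power \<sigma> l) \<longleftrightarrow> lvanishes n m v b"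
proof -
 have "lvanishes n m v (single (\<Sum>i\<in>\<sigma>. single i (- int l)) 1 * b) \<longleftrightarrow> lvanishes n m v b"
  using assms(3,1,2)
 proof (induction \<sigma> arbitrary: b rule: finite_induct)
  case (insert i \<sigma>)
  have eq: "single (\<Sum>i\<in>insert i \<sigma>. single i (- int l)) 1 * b =
   single (single i (- int l)) 1 * (single (\<Sum>i\<in>\<sigma>. single i (- int l)) 1 * b)"
   using insert(1,2) by (simp only: sum.insert mult.assoc[symmetric] mult_single mult_1_left simp_thms)
  have i: "i <= n" "v i ~= 0" using insert.prems by auto
  show ?case unfolding eq lvanishes_shift_int[where v = v, OF i] by (rule insert.IH) (use insert.prems in auto)
 qed (simp add: single_one)
 thus ?thesis by (simp only: inv_vars_power_def mult.commute)
qed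

lemma lookup_map_int: "lookup (Poly_Mapping.map int e) i = int (lookup e i)"
 by (transfer, simp add: when_def)

lemma map_int_inject: "Poly_Mapping.map int e = Poly_Mapping.map int f \<longleftrightarrow> e = f"
proof
 assume "Poly_Mapping.map int e = Poly_Mapping.map int f"
 hence "int (lookup e i) = int (lookup f i)" for i by (metis lookup_map_int)
 thus "e = f" by (intro poly_mapping_eqI) simp
qed simp

lemma lookup_laurent_of: "lookup (laurent_of f) (Poly_Mapping.map int m) = lookup f m"
 by (auto simp: laurent_of_def lookup_sum lookup_single map_int_inject when_def in_keys_iff)

lemma keys_laurent_of: "keys (laurent_of f) = Poly_Mapping.map int ` keys f"
proof (intro subset_antisym subsetI)
 fix e assume "e \<in> keys (laurent_of f)"
 moreover have "lookup (laurent_of f) e = 0" if "e \<notin> Poly_Mapping.map int ` keys f"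
  unfolding laurent_of_def lookup_sum using that by (intro sum.neutral) (auto simp: lookup_single when_def)
 ultimately show "e \<in> Poly_Mapping.map int ` keys f" by (auto simp: in_keys_iff[of e "laurent_of f"])
qed (auto simp: in_keys_iff lookup_laurent_of)

lemma laurent_of_eq_0_iff: "laurent_of f = 0 \<longleftrightarrow> f = 0"
 using keys_laurent_of[of f] by (metis image_is_empty keys_eq_empty)

lemma ljet_laurent_of:
 assumes "f \<in> polys {..n}" and v: "!!i. i <= n ==> v i ~= 0"
 shows "ljet n v a (laurent_of f) = (\<Prod>i\<le>n. v i ^ lookup a i) * hasse n v a f"
proof -
 have t: "lterm n v (Poly_Mapping.map int e) a = (\<Prod>i\<le>n. v i ^ lookup a i) * hcoef n v e a"
  if e: "keys e \<subseteq> {..n}" for e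
  unfolding lterm_def hcoef_prod[OF e] prod.distrib[symmetric] lookup_map_int
 proof (intro prod.cong refl)
  fix i
  show "(of_int (int (lookup e i)) gchoose lookup a i) * v i powi int (lookup e i)
   = v i ^ lookup a i * (of_nat (lookup e i choose lookup a i) * v i ^ (lookup e i - lookup a i))"
  proof (cases "lookup a i <= lookup e i")
   case True
   hence "v i ^ lookup e i = v i ^ lookup a i * v i ^ (lookup e i - lookup a i)"
    by (simp flip: power_add)
   thus ?thesis by (simp add: binomial_gbinomial)
  next
   case False
   hence "lookup e i choose lookup a i = 0" by (simp add: binomial_eq_0)
   moreover from this have "(of_nat (lookup e i) gchoose lookup a i :: 'a) = 0"
    by (simp only: binomial_gbinomial[symmetric] of_nat_0)
   ultimately show ?thesis by simp
  qed
 qed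
 have "inj_on (Poly_Mapping.map int) (keys f)" by (auto intro: inj_onI simp: map_int_inject)
 hence "ljet n v a (laurent_of f) = (\<Sum>e\<in>keys f. lookup f e * lterm n v (Poly_Mapping.map int e) a)"
  unfolding ljet_def keys_laurent_of by (subst sum.reindex) (simp_all add: lookup_laurent_of)
 also have "\<dots> = (\<Sum>e\<in>keys f. lookup f e * ((\<Prod>i\<le>n. v i ^ lookup a i) * hcoef n v e a))"
  using assms(1) by (intro sum.cong refl) (subst t, auto simp: polys_def)
 finally show ?thesis by (simp add: hasse_def sum_distrib_left mult_ac)
qed

lemma lvanishes_laurent_of:
 "f \<in> polys {..n} ==> (!!i. i <= n ==> v i ~= 0) ==> lvanishes n m v (laurent_of f) \<longleftrightarrow> vanishes n m v f"
 unfolding lvanishes_def vanishes_def by (auto simp: ljet_laurent_of)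

lemma lterm_euler:
 fixes v :: "nat => 'a::field_char_0"
 shows
 "(\<Sum>i\<le>n. of_nat (lookup a i + 1) * lterm n v e (a + single i 1)) =
  (of_int (\<Sum>i\<le>n. lookup e i) - of_nat (\<Sum>i\<le>n. lookup a i)) * lterm n v e a"
proof -
 let ?F = "%a i. (of_int (lookup e i) gchoose lookup a i) * v i powi lookup e i"
 have "of_nat (lookup a i + 1) * lterm n v e (a + single i 1) =
  (of_int (lookup e i) - of_nat (lookup a i)) * lterm n v e a" if i: "i <= n" for i
 proof -
  have s: "lterm n v e a = ?F a i * (\<Prod>l\<in>{..n}-{i}. ?F a l)" for a
   unfolding lterm_def using i by (subst prod.remove[of _ i]) auto
  have r: "(\<Prod>l\<in>{..n}-{i}. ?F (a + single i 1) l) = (\<Prod>l\<in>{..n}-{i}. ?F a l)"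
   by (intro prod.cong refl) (simp add: lookup_add lookup_single when_def)
  have f: "of_nat (lookup a i + 1) * ?F (a + single i 1) i =
   (of_int (lookup e i) - of_nat (lookup a i)) * ?F a i"
   using gbinomial_mult_1[of "of_int (lookup e i) :: 'a" "lookup a i"]
   by (simp add: lookup_add algebra_simps)
  have "x * (y * z) = u * (w * z)" if "x * y = u * w" for x y z u w :: 'a
   using that by (simp only: mult.assoc[symmetric])
  from this[OF f] show ?thesis unfolding s r .
 qed
 hence "(\<Sum>i\<le>n. of_nat (lookup a i + 1) * lterm n v e (a + single i 1)) =
  (\<Sum>i\<le>n. (of_int (lookup e i) - of_nat (lookup a i)) * lterm n v e a)" by (intro sum.cong refl) simp
 thus ?thesis by (simp only: sum_distrib_right[symmetric] sum_subtractf of_int_sum of_nat_sum)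
qed

lemma lvanishes_iff_top:
 assumes deg: "!!e. e \<in> keys b ==> (\<Sum>i\<le>n. lookup e i) = int d" and k: "k <= d"
 shows "lvanishes n (Suc k) v b \<longleftrightarrow> (\<forall>a\<in>exponents n k. ljet n v a b = 0)"
proof
 assume "lvanishes n (Suc k) v b"
 thus "\<forall>a\<in>exponents n k. ljet n v a b = 0" by (auto simp: lvanishes_def exponents_def)
next
 assume top: "\<forall>a\<in>exponents n k. ljet n v a b = 0"
 have euler: "(\<Sum>i\<le>n. of_nat (lookup a i + 1) * ljet n v (a + single i 1) b) =
  (of_nat d - of_nat (mdeg a)) * ljet n v a b" if a: "keys a \<subseteq> {..n}" for a
 proof -
  have "(\<Sum>i\<le>n. of_nat (lookup a i + 1) * ljet n v (a + single i 1) b) =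
   (\<Sum>e\<in>keys b. lookup b e * (\<Sum>i\<le>n. of_nat (lookup a i + 1) * lterm n v e (a + single i 1)))"
   unfolding ljet_def sum_distrib_left by (subst sum.swap) (intro sum.cong refl, simp only: mult_ac)
  also have "\<dots> = (\<Sum>e\<in>keys b. lookup b e * ((of_nat d - of_nat (mdeg a)) * lterm n v e a))"
   using mdeg_superset[of "{..n}" a] a by (intro sum.cong refl) (simp only: lterm_euler deg of_int_of_nat_eq finite_atMost)
  finally show ?thesis by (simp only: ljet_def sum_distrib_left mult.left_commute)
 qed
 have "keys a \<subseteq> {..n} ==> mdeg a + l = k ==> ljet n v a b = 0" for a l
 proof (induction l arbitrary: a)
  case 0
  thus ?case using top by (auto simp: exponents_def)
 next
  case (Suc l)
  have "ljet n v (a + single i 1) b = 0" if i: "i <= n" for i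
  proof (rule Suc.IH)
   show "keys (a + single i 1) \<subseteq> {..n}"
    using keys_add[of a "single i (1::nat)"] Suc.prems(1) i by (auto split: if_splits)
   show "mdeg (a + single i 1) + l = k" using Suc.prems(2) by (simp only: mdeg_add mdeg_single)
  qed
  hence "(\<Sum>i\<le>n. of_nat (lookup a i + 1) * ljet n v (a + single i 1) b) = 0"
   by (intro sum.neutral ballI) (simp only: atMost_iff mult_zero_right)
  hence "(of_nat d - of_nat (mdeg a)) * ljet n v a b = 0" using euler[OF Suc.prems(1)] by (simp only:)
  moreover have "(of_nat d - of_nat (mdeg a) :: 'a) ~= 0" using Suc.prems(2) k by simp
  ultimately show ?case by simp
 qed
 moreover have "EX l. mdeg a + l = k" if "mdeg a < Suc k" for a :: "nat \<Rightarrow>\<^sub>0 nat" using \<open>mdeg a < Suc k\<close> by presburger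
 ultimately show "lvanishes n (Suc k) v b" unfolding lvanishes_def by blast
qed

section \<open>Sections of the ideal sheaf of fat points\<close>

lemma ideal_power_polys:
 assumes "J \<subseteq> polys I" "g \<in> ideal_power I J m"
 shows "g \<in> polys I"
proof -
 obtain A r where A: "g = (\<Sum>h\<in>A. r h * h)" "A \<subseteq> {(\<Prod>j<m. f j) | f. \<forall>j<m. f j \<in> J}" "\<forall>h\<in>A. r h \<in> polys I"
  using assms(2) unfolding ideal_power_def gen_ideal_def by blast
 have "h \<in> polys I" if "h \<in> A" for h
 proof -
  obtain f where "h = (\<Prod>j<m. f j)" "\<forall>j<m. f j \<in> J" using \<open>h \<in> A\<close> A(2) by blast
  thus ?thesis using assms(1) by (auto intro!: polys_prod)
 qed
 thus ?thesis unfolding A(1) using A(3) by (intro polys_sum polys_mult) auto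
qed

lemma fat_points_ideal_iff:
 fixes v :: "nat => nat => 'a::field_char_0"
 assumes s: "0 < s" and v: "!!j. j < s ==> v j \<in> coord_space {..n}" "!!j. j < s ==> v j ~= 0"
  and P: "!!j. j < s ==> P j = ppoint_of (v j)" and g: "homogeneous D g"
 shows "g \<in> fat_points_ideal n (Suc k) s P \<longleftrightarrow> g \<in> polys {..n} & (\<forall>j<s. vanishes n (Suc k) (v j) g)"
proof -
 have polys: "g \<in> polys {..n}" if "g \<in> fat_points_ideal n (Suc k) s P"
 proof (rule ideal_power_polys)
  show "g \<in> ideal_power {..n} (vanishing_ideal {..n} {P 0}) (Suc k)" using that s by (auto simp: fat_points_ideal_def)
 qed (auto simp: vanishing_ideal_def)
 have "g \<in> fat_points_ideal n (Suc k) s P \<longleftrightarrow> (\<forall>j<s. vanishes n (Suc k) (v j) g)" if "g \<in> polys {..n}"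
  unfolding fat_points_ideal_def using ideal_power_iff_vanishes[OF v \<open>g \<in> polys {..n}\<close> g] P by auto
 thus ?thesis using polys by blast
qed

text \<open>Sections of O(d) over the intersection of the charts in \<sigma>: poles are allowed only
  along x_i with i in \<sigma>.\<close>

definition lspace :: "nat => nat set => 'a::field laurent set" where
 "lspace d \<sigma> = {b. ALL e. lookup b e ~= 0 --> keys e \<subseteq> {..2} &
   (\<Sum>i\<le>2. lookup e i) = int d & (\<forall>i\<le>2. i \<notin> \<sigma> --> 0 <= lookup e i)}"

definition lsections :: "nat => nat => nat => (nat => nat => 'a::field_char_0) => nat set => 'a laurent set" where
 "lsections d k s v \<sigma> = {b \<in> lspace d \<sigma>. \<forall>j<s. lvanishes 2 (Suc k) (v j) b}"

lemma lspaceD: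
 assumes "b \<in> lspace d \<sigma>" "lookup b e ~= 0"
 shows "keys e \<subseteq> {..2}" "(\<Sum>i\<le>2. lookup e i) = int d"
  "i <= 2 ==> i \<notin> \<sigma> ==> 0 <= lookup e i"
 using assms by (auto simp: lspace_def)

lemma lspaceI:
 assumes "!!e. lookup b e ~= 0 ==> keys e \<subseteq> {..2} & (\<Sum>i\<le>2. lookup e i) = int d"
  "!!e i. lookup b e ~= 0 ==> i <= 2 ==> i \<notin> \<sigma> ==> 0 <= lookup e i"
 shows "b \<in> lspace d \<sigma>"
 using assms by (auto simp: lspace_def)

lemma lspace_0 [simp]: "0 \<in> lspace d \<sigma>" and lspace_add: "f \<in> lspace d \<sigma> ==> g \<in> lspace d \<sigma> ==> f + g \<in> lspace d \<sigma>"
 unfolding lspace_def mem_Collect_eq lookup_zero lookup_add by (simp, metis add_0_left)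

lemma lspace_uminus: "f \<in> lspace d \<sigma> ==> - f \<in> lspace d \<sigma>"
 by (simp add: lspace_def)

lemma lspace_diff: "f \<in> lspace d \<sigma> ==> g \<in> lspace d \<sigma> ==> f - g \<in> lspace d \<sigma>"
 using lspace_add[of f d \<sigma> "- g"] lspace_uminus[of g] by simp

lemma lspace_mono: "\<sigma> \<subseteq> \<tau> ==> lspace d \<sigma> \<subseteq> lspace d \<tau>"
 by (auto simp: lspace_def)

lemma lookup_cmult: "lookup (single 0 c * (b :: 'a::field laurent)) e = c * lookup b e"
 by (auto simp: laurent_single_mult lookup_sum lookup_single when_def in_keys_iff)

lemma lspace_cmult: "f \<in> lspace d \<sigma> ==> single 0 c * f \<in> lspace d \<sigma>"
 by (auto simp: lspace_def lookup_cmult)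

lemma lvanishes_add: "lvanishes n m v f ==> lvanishes n m v g ==> lvanishes n m v (f + g)"
 and lvanishes_diff: "lvanishes n m v f ==> lvanishes n m v g ==> lvanishes n m v (f - g)"
 and lvanishes_cmult: "lvanishes n m v f ==> lvanishes n m v (single 0 c * f)"
 and lvanishes_0: "lvanishes n m v 0"
 by (auto simp: lvanishes_def ljet_add ljet_diff ljet_cmult)

lemma laurent_of_superset:
 "finite A ==> keys f \<subseteq> A ==> laurent_of f = (\<Sum>m\<in>A. single (Poly_Mapping.map int m) (lookup f m))"
 unfolding laurent_of_def by (rule sum.mono_neutral_left) (auto simp: in_keys_iff)

lemma laurent_of_add: "laurent_of (f + g) = laurent_of f + laurent_of g"
proof -
 let ?A = "keys f \<union> keys g"
 show ?thesis
  by (subst (1 2 3) laurent_of_superset[of ?A])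
   (use keys_add[of f g] in \<open>auto simp: lookup_add single_add sum.distrib\<close>)
qed

lemma laurent_of_0 [simp]: "laurent_of 0 = 0"
 by (simp add: laurent_of_def)

lemma laurent_of_single: "laurent_of (single m c) = single (Poly_Mapping.map int m) c"
 by (cases "c = 0") (auto simp: laurent_of_def)

lemma laurent_of_sum: "laurent_of (\<Sum>i\<in>A. f i) = (\<Sum>i\<in>A. laurent_of (f i))"
 by (induction A rule: infinite_finite_induct) (auto simp: laurent_of_add)

lemma laurent_of_lspace:
 assumes "f \<in> polys {..2}" "homogeneous d f"
 shows "laurent_of f \<in> lspace d {}"
proof (rule lspaceI)
 fix e assume "lookup (laurent_of f) e ~= 0"
 hence "e \<in> keys (laurent_of f)" by (simp add: in_keys_iff)
 then obtain m where m: "m \<in> keys f" "e = Poly_Mapping.map int m" by (auto simp: keys_laurent_of)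
 hence k: "keys m \<subseteq> {..2}" "mdeg m = d" using assms by (auto simp: polys_def homogeneous_def)
 have "(\<Sum>i\<le>2. int (lookup m i)) = int d" using mdeg_superset[OF _ k(1)] k(2) by simp
 moreover have "keys e \<subseteq> {..2}" using k(1) by (auto simp: in_keys_iff m(2) lookup_map_int subset_iff)
 ultimately show "keys e \<subseteq> {..2} & (\<Sum>i\<le>2. lookup e i) = int d" by (simp add: m(2) lookup_map_int)
 show "0 <= lookup e i" for i by (simp add: m(2) lookup_map_int)
qed

lemma lspace_laurent_of:
 assumes b: "b \<in> lspace d {}"
 obtains f where "f \<in> polys {..2}" "homogeneous d f" "b = laurent_of f"
proof -
 let ?n = "%e. exp_of 2 (%i. nat (lookup e i))"
 define f where "f = (\<Sum>e\<in>keys b. single (?n e) (lookup b e))"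
 have n: "Poly_Mapping.map int (?n e) = e" if e: "e \<in> keys b" for e
 proof (rule poly_mapping_eqI)
  fix i
  have "lookup b e ~= 0" using e by (simp add: in_keys_iff)
  note D = lspaceD[OF b this]
  show "lookup (Poly_Mapping.map int (?n e)) i = lookup e i"
   using D(1) D(3)[of i] by (cases "i <= 2") (auto simp: lookup_map_int lookup_exp_of in_keys_iff subset_iff)
 qed
 have bf: "b = laurent_of f"
 proof -
  have "laurent_of f = (\<Sum>e\<in>keys b. single e (lookup b e))"
   unfolding f_def laurent_of_sum laurent_of_single by (intro sum.cong refl) (simp only: n)
  thus ?thesis using poly_mapping_sum_single[of b] by simp
 qed
 have "keys m \<subseteq> {..2} & mdeg m = d" if m: "m \<in> keys f" for m
 proof -
  have "lookup b (Poly_Mapping.map int m) ~= 0" using m unfolding bf lookup_laurent_of by (simp add: in_keys_iff)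
  note D = lspaceD[OF b this]
  have k: "keys m \<subseteq> {..2}" using D(1) by (auto simp: in_keys_iff lookup_map_int subset_iff)
  moreover have "int (mdeg m) = int d" using D(2) mdeg_superset[OF _ k] by (simp add: lookup_map_int)
  ultimately show ?thesis by simp
 qed
 hence "f \<in> polys {..2}" "homogeneous d f" by (auto simp: polys_def homogeneous_def)
 thus thesis using bf that by blast
qed

lemma lookup_sum_single: "finite \<sigma> ==> lookup (\<Sum>i\<in>\<sigma>. single i (c :: int)) l = (if l \<in> \<sigma> then c else 0)"
 by (auto simp: lookup_sum lookup_single when_def)

lemma lookup_single_1_mult: "lookup (single M 1 * (b :: 'a::field laurent)) (M + e) = lookup b e"
 by (auto simp: laurent_single_mult lookup_sum lookup_single when_def in_keys_iff)

lemma lspace_shift: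
 assumes b: "b \<in> lspace d \<sigma>" and \<sigma>: "\<sigma> \<subseteq> {..2}" "\<tau> \<subseteq> {..2}" and d': "int d' = int d + c * int (card \<tau>)"
  and ge: "!!e i. lookup b e ~= 0 ==> i <= 2 ==> i \<notin> \<sigma>' ==> 0 <= lookup e i + (if i \<in> \<tau> then c else 0)"
 shows "single (\<Sum>i\<in>\<tau>. single i c) 1 * b \<in> lspace d' \<sigma>'"
proof -
 let ?M = "\<Sum>i\<in>\<tau>. single i c"
 have fin: "finite \<tau>" using \<sigma>(2) by (rule finite_subset) simp
 have M: "lookup ?M i = (if i \<in> \<tau> then c else 0)" for i using fin by (simp add: lookup_sum_single)
 have eq: "lookup (single ?M 1 * b) e = lookup b (e - ?M)" for e
  using lookup_single_1_mult[of ?M b "e - ?M"] by simp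
 show ?thesis
 proof (rule lspaceI)
  fix e assume "lookup (single ?M 1 * b) e ~= 0"
  hence ne: "lookup b (e - ?M) ~= 0" by (simp only: eq simp_thms)
  note D = lspaceD[OF b ne]
  have e: "lookup e i = lookup (e - ?M) i + (if i \<in> \<tau> then c else 0)" for i
   by (simp only: lookup_minus M diff_add_cancel)
  have "keys e \<subseteq> {..2}"
  proof
   fix i assume "i \<in> keys e"
   hence "lookup (e - ?M) i ~= 0 \<or> i \<in> \<tau>" using e[of i] by (cases "i \<in> \<tau>") (auto simp: in_keys_iff)
   thus "i \<in> {..2}" using D(1) \<sigma>(2) by (auto simp: in_keys_iff subset_iff)
  qed
  moreover have "(\<Sum>i\<le>2. if i \<in> \<tau> then c else 0) = c * int (card \<tau>)"
   using \<sigma>(2) by (subst sum.inter_restrict[symmetric]) (auto simp: Int_absorb1)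
  hence "(\<Sum>i\<le>2. lookup e i) = int d'" unfolding e sum.distrib D(2) d' by simp
  ultimately show "keys e \<subseteq> {..2} & (\<Sum>i\<le>2. lookup e i) = int d'" by blast
  show "0 <= lookup e i" if "i <= 2" "i \<notin> \<sigma>'" for i using ge[OF ne that] unfolding e[of i] .
 qed
qed

text \<open>Points without zero coordinates lie in every chart, where the variables are invertible.
  Clearing denominators therefore preserves the order of vanishing at the points.\<close>

lemma sheaf_sections_eq:
 fixes v :: "nat => nat => 'a::field_char_0"
 assumes s: "0 < s" and v: "!!j. j < s ==> v j \<in> coord_space {..2}" "!!j i. j < s ==> i <= 2 ==> v j i ~= 0"
  and P: "!!j. j < s ==> P j = ppoint_of (v j)" and \<sigma>: "\<sigma> \<subseteq> {..2}"
 shows "sheaf_sections (fat_points_ideal 2 (Suc k) s P) d \<sigma> = lsections d k s v \<sigma>"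
proof -
 have v0: "v j ~= 0" if "j < s" for j using v(2)[OF that, of 0] by auto
 have iff: "g \<in> fat_points_ideal 2 (Suc k) s P \<longleftrightarrow> g \<in> polys {..2} & (\<forall>j<s. vanishes 2 (Suc k) (v j) g)"
  if "homogeneous D g" for D g by (rule fat_points_ideal_iff[OF s v(1) v0 P that])
 have fin: "finite \<sigma>" using \<sigma> by (rule finite_subset) simp
 have inv: "lvanishes 2 (Suc k) (v j) (b * inv_vars_power \<sigma> m) \<longleftrightarrow> lvanishes 2 (Suc k) (v j) b" if "j < s" for j b m
  by (rule lvanishes_inv_vars_power) (use \<sigma> v(2)[OF that] fin in auto)
 show ?thesis
 proof (intro subset_antisym subsetI)
  fix b assume "b \<in> sheaf_sections (fat_points_ideal 2 (Suc k) s P) d \<sigma>"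
  then obtain f m where f: "b = laurent_of f * inv_vars_power \<sigma> m" "f \<in> fat_points_ideal 2 (Suc k) s P" "homogeneous (d + m * card \<sigma>) f"
   unfolding sheaf_sections_def by blast
  have fp: "f \<in> polys {..2}" "\<forall>j<s. vanishes 2 (Suc k) (v j) f" using f(2) iff[OF f(3)] by auto
  have "single (\<Sum>i\<in>\<sigma>. single i (- int m)) 1 * laurent_of f \<in> lspace d \<sigma>"
  proof (rule lspace_shift[OF laurent_of_lspace[OF fp(1) f(3)] _ \<sigma>])
   fix e i assume a: "lookup (laurent_of f) e ~= 0" "i <= (2::nat)" "i \<notin> \<sigma>"
   show "0 <= lookup e i + (if i \<in> \<sigma> then - int m else 0)"
    using lspaceD(3)[OF laurent_of_lspace[OF fp(1) f(3)] a(1,2)] a(3) by simp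
  qed simp_all
  hence "b \<in> lspace d \<sigma>" by (simp only: f(1) inv_vars_power_def mult.commute)
  moreover have "lvanishes 2 (Suc k) (v j) b" if "j < s" for j
   unfolding f(1) inv[OF that] using fp v(2)[OF that] that by (subst lvanishes_laurent_of) auto
  ultimately show "b \<in> lsections d k s v \<sigma>" by (simp add: lsections_def)
 next
  fix b assume b: "b \<in> lsections d k s v \<sigma>"
  hence bl: "b \<in> lspace d \<sigma>" and bv: "!!j. j < s ==> lvanishes 2 (Suc k) (v j) b" by (auto simp: lsections_def)
  \<comment> \<open>A crude bound for all exponents in b, so that the m-th power of the variables in
    \<sigma> clears every pole.\<close>
  define m where "m = nat (\<Sum>e\<in>keys b. \<Sum>i\<le>2. \<bar>lookup e i\<bar>)"
  have m: "0 <= lookup e i + int m" if e: "lookup b e ~= 0" and i: "i <= 2" for e i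
  proof -
   have "\<bar>lookup e i\<bar> <= (\<Sum>i\<le>2. \<bar>lookup e i\<bar>)"
    by (rule member_le_sum[of i "{..2}" "%i. \<bar>lookup e i\<bar>"]) (use i in auto)
   also have "\<dots> <= (\<Sum>e\<in>keys b. \<Sum>i\<le>2. \<bar>lookup e i\<bar>)"
    by (rule member_le_sum[of e "keys b" "%e. \<Sum>i\<le>2. \<bar>lookup e i\<bar>"])
     (use e in \<open>auto simp: in_keys_iff intro: sum_nonneg\<close>)
   also have "\<dots> <= int m" by (simp add: m_def)
   finally show ?thesis by linarith
  qed
  have "single (\<Sum>i\<in>\<sigma>. single i (int m)) 1 * b \<in> lspace (d + m * card \<sigma>) {}"
  proof (rule lspace_shift[OF bl \<sigma> \<sigma>])
   fix e i assume a: "lookup b e ~= 0" "i <= (2::nat)"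
   show "0 <= lookup e i + (if i \<in> \<sigma> then int m else 0)"
    using m[OF a] lspaceD(3)[OF bl a] by auto
  qed simp
  then obtain f where f: "f \<in> polys {..2}" "homogeneous (d + m * card \<sigma>) f"
   "single (\<Sum>i\<in>\<sigma>. single i (int m)) 1 * b = laurent_of f" by (rule lspace_laurent_of)
  have "(\<Sum>i\<in>\<sigma>. single i (int m)) + (\<Sum>i\<in>\<sigma>. single i (- int m)) = 0"
   by (simp add: sum.distrib[symmetric] single_add[symmetric])
  hence "laurent_of f * inv_vars_power \<sigma> m = b"
   unfolding f(3)[symmetric] inv_vars_power_def by (simp only: mult.commute mult.left_commute mult_single mult.assoc[symmetric] mult_1_left single_one)
  moreover have "lvanishes 2 (Suc k) (v j) (laurent_of f)" if "j < s" for j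
   using bv[OF that] inv[OF that, of "laurent_of f" m] calculation by simp
  hence "f \<in> fat_points_ideal 2 (Suc k) s P"
   using iff[OF f(2)] f(1) v(2) lvanishes_laurent_of[OF f(1)] by auto
  ultimately show "b \<in> sheaf_sections (fat_points_ideal 2 (Suc k) s P) d \<sigma>"
   unfolding sheaf_sections_def using f(2) by blast
 qed
qed

section \<open>Dimension of the cohomology groups\<close>

text \<open>\<tau> identifies cocycles modulo coboundaries with \<open>Q\<close> modulo
  \<open>N\<close>. Cocycles that lift a basis of \<open>Q\<close> modulo \<open>N\<close> generate;
  no smaller number can, as the images of generators together with \<open>N\<close> must span
  \<open>Q\<close>. Lifting up to \<open>N\<close> is enough, so \<tau> itself may miss part of
  \<open>Q\<close>.\<close>

lemma cohomology_dim_eqI: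
 fixes \<tau> :: "'a::field_char_0 cochain => 'i => 'a"
 assumes lin: "!!x y. \<tau> (x + y) = \<tau> x + \<tau> y" "!!c x. \<tau> (cochain_scale c x) = vscale c (\<tau> x)"
  and Q: "vec.subspace Q" "Q \<subseteq> coord_space I" "finite I" and N: "vec.subspace N" "N \<subseteq> Q"
  and Z: "cochain.subspace (cech_cocycles n J d p)" "!!c. c \<in> cech_cocycles n J d p ==> \<tau> c \<in> Q"
  and B: "cech_coboundaries n J d p \<subseteq> cech_cocycles n J d p"
   "!!c. c \<in> cech_cocycles n J d p ==> \<tau> c \<in> N \<longleftrightarrow> c \<in> cech_coboundaries n J d p"
  and onto: "!!q. q \<in> Q ==> \<exists>c\<in>cech_cocycles n J d p. q - \<tau> c \<in> N"
 shows "cohomology_dim n J d p = vec.dim Q - vec.dim N"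
proof -
 let ?Z = "cech_cocycles n J d p" and ?B = "cech_coboundaries n J d p"
 have linear: "Vector_Spaces.linear cochain_scale vscale \<tau>"
  unfolding Vector_Spaces.linear_iff using lin cochain.vector_space_axioms vec.vector_space_axioms by blast
 interpret t: Vector_Spaces.linear cochain_scale vscale \<tau> by (rule linear)
 have NI: "N \<subseteq> coord_space I" using N(2) Q(2) by (rule subset_trans)
 from coord_space_basis[OF NI Q(3)] obtain C
  where C: "C \<subseteq> N" "vec.independent C" "N \<subseteq> vec.span C" "card C = vec.dim N" "finite C" .
 obtain D where D: "C \<subseteq> D" "D \<subseteq> Q" "vec.independent D" "Q \<subseteq> vec.span D"
  using vec.maximal_independent_subset_extend[of C Q] C(1,2) N(2) by blast
 have cardD: "card D = vec.dim Q" by (rule vec.dim_unique[OF D(2,4,3) refl, symmetric])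
 have finD: "finite D" using independent_card_le[OF D(3) _ Q(2,3)] D(2) vec.span_superset by blast
 have "\<forall>q\<in>D. EX c. c \<in> ?Z & q - \<tau> c \<in> N" using onto D(2) by blast
 from bchoice[OF this] obtain z where z: "!!q. q \<in> D ==> z q \<in> ?Z" "!!q. q \<in> D ==> q - \<tau> (z q) \<in> N" by blast
 define S where "S = z ` (D - C)"
 have S: "finite S" "S \<subseteq> ?Z" "card S <= vec.dim Q - vec.dim N"
  unfolding S_def using finD z(1) card_image_le[of "D - C" z] card_Diff_subset[OF C(5) D(1)] cardD C(4) by auto
 have lower: "vec.dim Q - vec.dim N <= card A" if A: "A \<subseteq> ?Z" "finite A" "?Z \<subseteq> cochain.span (A \<union> ?B)" for A
 proof -
  have tA: "N \<union> \<tau> ` A \<subseteq> coord_space I" using NI Z(2) A(1) Q(2) by blast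
  have sp: "\<tau> c \<in> vec.span (N \<union> \<tau> ` A)" if c: "c \<in> ?Z" for c
  proof -
   have "\<tau> c \<in> vec.span (\<tau> ` (A \<union> ?B))" unfolding t.span_image using c A(3) by blast
   moreover have "\<tau> ` (A \<union> ?B) \<subseteq> N \<union> \<tau> ` A" using B by blast
   ultimately show ?thesis using vec.span_mono by blast
  qed
  have "Q \<subseteq> vec.span (N \<union> \<tau> ` A)"
  proof
   fix q assume "q \<in> Q"
   then obtain c where c: "c \<in> ?Z" "q - \<tau> c \<in> N" using onto by blast
   have "q - \<tau> c \<in> vec.span (N \<union> \<tau> ` A)" using c(2) by (intro vec.span_base) blast
   from vec.span_add[OF this sp[OF c(1)]] show "q \<in> vec.span (N \<union> \<tau> ` A)" by (simp only: diff_add_cancel)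
  qed
  hence "vec.dim Q <= vec.dim (N \<union> \<tau> ` A)" by (rule dim_mono_span[OF _ tA Q(3)])
  also have "\<dots> <= vec.dim N + card (\<tau> ` A)" by (rule dim_Un_card_le[OF _ NI Q(3)]) (use A(2) in simp)
  finally show ?thesis using card_image_le[OF A(2), of \<tau>] by linarith
 qed
 have gen: "?Z \<subseteq> cochain.span (S \<union> ?B)"
 proof
  fix c assume c: "c \<in> ?Z"
  have "\<tau> c \<in> vec.span D" using Z(2)[OF c] D(4) by blast
  then obtain u where u: "\<tau> c = (\<Sum>q\<in>D. vscale (u q) q)" using vec.span_finite[OF finD] by auto
  have "\<tau> (\<Sum>q\<in>D - C. cochain_scale (u q) (z q)) = (\<Sum>q\<in>D - C. vscale (u q) (\<tau> (z q)))"
   by (simp only: t.sum lin(2))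
  hence "\<tau> (c - (\<Sum>q\<in>D - C. cochain_scale (u q) (z q))) = (\<Sum>q\<in>C. vscale (u q) q) + (\<Sum>q\<in>D - C. vscale (u q) (q - \<tau> (z q)))"
   by (simp only: t.diff u sum.subset_diff[OF D(1) finD] vec.scale_right_diff_distrib sum_subtractf) (simp only: add_diff_eq add.commute)
  also have "\<dots> \<in> N"
  proof (intro vec.subspace_add[OF N(1)] vec.subspace_sum[OF N(1)] vec.subspace_scale[OF N(1)])
   show "q - \<tau> (z q) \<in> N" if "q \<in> D - C" for q using z(2) that by blast
  qed (use C(1) in blast)
  finally have tN: "\<tau> (c - (\<Sum>q\<in>D - C. cochain_scale (u q) (z q))) \<in> N" .
  have "c - (\<Sum>q\<in>D - C. cochain_scale (u q) (z q)) \<in> ?Z"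
   by (intro cochain.subspace_diff[OF Z(1)] c cochain.subspace_sum[OF Z(1)] cochain.subspace_scale[OF Z(1)] z(1)) blast
  hence "c - (\<Sum>q\<in>D - C. cochain_scale (u q) (z q)) \<in> ?B" using B(2) tN by blast
  hence "c - (\<Sum>q\<in>D - C. cochain_scale (u q) (z q)) \<in> cochain.span (S \<union> ?B)" by (intro cochain.span_base) blast
  moreover have "(\<Sum>q\<in>D - C. cochain_scale (u q) (z q)) \<in> cochain.span (S \<union> ?B)"
   by (intro cochain.span_sum cochain.span_scale cochain.span_base) (auto simp: S_def)
  ultimately have "(c - (\<Sum>q\<in>D - C. cochain_scale (u q) (z q))) + (\<Sum>q\<in>D - C. cochain_scale (u q) (z q)) \<in> cochain.span (S \<union> ?B)"
   by (rule cochain.span_add)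
  thus "c \<in> cochain.span (S \<union> ?B)" by (simp only: diff_add_cancel)
 qed
 have "card S = vec.dim Q - vec.dim N" using S(3) lower[OF S(2,1) gen] by linarith
 thus ?thesis unfolding cohomology_dim_def
  by (intro Least_equality) (use S gen lower in blast)+
qed

lemma vanishes_iff_ann_osc_join:
 fixes v :: "nat => nat => 'a::field_char_0"
 assumes "w \<in> coord_space (exponents n d)" "k <= d"
 shows "(\<forall>j<s. vanishes n (Suc k) (v j) (poly_of n d w)) \<longleftrightarrow> w \<in> ann (exponents n d) (osc_join n d k s v)"
 using vanishes_iff_ann[OF assms] assms(1) by (auto simp: ann_def osc_join_def)

text \<open>The equation of a line through u and (0 : 0 : 1). It vanishes at w iff the first two
  coordinates of u and w are proportional.\<close>

definition line_form :: "(nat => 'a::field) => (nat, 'a) mpoly" where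
 "line_form u = single (single 0 1) (u 1) - single (single 1 1) (u 0)"

lemma line_form: "line_form u \<in> polys {..2}" "homogeneous 1 (line_form u)" "mpoly_eval (line_form u) w = u 1 * w 0 - u 0 * w 1"
 unfolding line_form_def
 by (auto intro!: polys_diff polys_single homogeneous_diff homogeneous_single simp: mpoly_eval_diff)

lemma vanishes_power: "f \<in> polys {..n} ==> mpoly_eval f v = 0 ==> vanishes n m v (f ^ m)"
proof (induction m)
 case 0
 show ?case by (simp add: vanishes_def)
next
 case (Suc m)
 thus ?case using vanishes_mult_Suc[of f n "f ^ m" m v] polys_power[of f "{..n}" m] by simp
qed

lemma homogeneous_power: "homogeneous a f ==> homogeneous (m * a) (f ^ m)"
proof (induction m)
 case 0
 show ?case by (simp add: homogeneous_def)
next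
 case (Suc m)
 thus ?case using homogeneous_mult[of a f "m * a" "f ^ m"] by simp
qed

text \<open>Multiplying by a form that vanishes to order \<open>k + 1\<close> at the other points, but not at the last one,
  shows that the last point imposes independent conditions.\<close>

lemma dim_osc_join_large:
 fixes v :: "nat => nat => 'a::field_char_0"
 assumes "!!j. j < s ==> v j 0 ~= 0" "!!j l. j < s ==> l < s ==> j ~= l ==> v l 1 * v j 0 ~= v l 0 * v j 1"
 shows "EX D0. \<forall>D\<ge>D0. s * card (exponents 2 k) <= vec.dim (osc_join 2 D k s v)"
 using assms
proof (induction s)
 case (Suc s)
 then obtain D0 where D0: "!!D. D >= D0 ==> s * card (exponents 2 k) <= vec.dim (osc_join 2 D k s v)" by (metis less_SucI)
 define g where "g = (\<Prod>l<s. line_form (v l) ^ Suc k)"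
 define \<gamma> where "\<gamma> = s * Suc k"
 have gp: "g \<in> polys {..2}" unfolding g_def by (intro polys_prod polys_power line_form)
 have gh: "homogeneous \<gamma> g" unfolding g_def \<gamma>_def
 proof (induction s)
  case (Suc m)
  show ?case using homogeneous_mult[OF Suc homogeneous_power[OF line_form(2), of "Suc k" "v m"]] by (simp add: ac_simps)
 qed (simp add: homogeneous_def)
 have gv: "vanishes 2 (Suc k) (v l) g" if l: "l < s" for l
 proof -
  have "vanishes 2 (Suc k) (v l) (line_form (v l) ^ Suc k)"
   by (rule vanishes_power[OF line_form(1)]) (simp only: line_form(3) mult.commute right_minus_eq)
  hence "vanishes 2 (Suc k) (v l) ((\<Prod>j\<in>{..<s}-{l}. line_form (v j) ^ Suc k) * line_form (v l) ^ Suc k)"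
   by (intro vanishes_mult polys_prod polys_power line_form)
  moreover have "g = (\<Prod>j\<in>{..<s}-{l}. line_form (v j) ^ Suc k) * line_form (v l) ^ Suc k"
   unfolding g_def using l by (subst prod.remove[of _ l]) (auto simp: mult.commute)
  ultimately show ?thesis by simp
 qed
 have "line_form (v l) \<in> polys {..2} & mpoly_eval (line_form (v l)) (v s) ~= 0" if "l < s" for l
  using Suc.prems(2)[of s l] that by (auto simp: line_form)
 hence gs: "mpoly_eval g (v s) ~= 0" unfolding g_def mpoly_eval_prod mpoly_eval_power by (auto simp: prod_zero_iff)
 show ?case
 proof (intro exI allI impI)
  fix D assume D: "D >= max D0 (\<gamma> + k)"
  let ?D = "D - \<gamma>" and ?u = "v s"
  have kD: "k <= ?D" "k <= D" "\<gamma> + ?D = D" using D by auto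
  \<comment> \<open>\<open>M\<close> multiplies a form of degree \<open>?D\<close> by g, and
    \<open>T\<close> takes the derivatives of order k at the new point. Since g is non-zero there, T
    after M has the same kernel as the vanishing condition in degree \<open>?D\<close>, hence full
    rank, and the forms in the image of M satisfy the conditions at the other points.\<close>
  define M where "M = (%w. lookup (g * poly_of 2 ?D w))"
  define T where "T = (%x a. if a \<in> exponents 2 k then dotp (exponents 2 D) x (hrow 2 D ?u a) else 0)"
  have Mpoly: "poly_of 2 D (M w) = g * poly_of 2 ?D w" "M w \<in> coord_space (exponents 2 D)" for w
  proof -
   have p: "g * poly_of 2 ?D w \<in> polys {..2}" "homogeneous D (g * poly_of 2 ?D w)"
    using polys_mult[OF gp poly_of_polys] homogeneous_mult[OF gh poly_of_homogeneous, of ?D 2 w] kD(3) by simp_all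
   show "poly_of 2 D (M w) = g * poly_of 2 ?D w" unfolding M_def by (rule poly_of_lookup[OF p])
   show "M w \<in> coord_space (exponents 2 D)" unfolding M_def
    using keys_homogeneous[OF p] by (auto simp: coord_space_def in_keys_iff)
  qed
  have poly_of_add: "poly_of 2 ?D (x + y) = poly_of 2 ?D x + poly_of 2 ?D y" for x y :: "_ => 'a"
   by (rule poly_mapping_eqI) (simp add: lookup_poly_of lookup_add)
  have poly_of_scale: "poly_of 2 ?D (vscale c x) = single 0 c * poly_of 2 ?D x" for c and x :: "_ => 'a"
   by (simp add: poly_of_def sum_distrib_left mult_single vscale_apply)
  have lookup_scale: "lookup (single 0 c * h) e = c * lookup h e" for c and h :: "(nat, 'a) mpoly" and e
   by (auto simp: single_mult_eq lookup_sum lookup_single when_def in_keys_iff)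
  have Tlin: "Vector_Spaces.linear vscale vscale T" unfolding Vector_Spaces.linear_iff
   using vec.vector_space_axioms by (auto simp: T_def fun_eq_iff dotp_add_left dotp_scale_left vscale_apply)
  have Madd: "M (x + y) = M x + M y" for x y unfolding M_def
   by (rule ext) (simp add: poly_of_add distrib_left lookup_add del: plus_fun_apply, simp)
  have Mscale: "M (vscale c x) = vscale c (M x)" for c x unfolding M_def
   by (rule ext) (simp only: poly_of_scale mult.left_commute[of g] lookup_scale vscale_apply)
  interpret T: Vector_Spaces.linear vscale vscale T by (rule Tlin)
  have TMlin: "Vector_Spaces.linear vscale vscale (%w. T (M w))" unfolding Vector_Spaces.linear_iff
   by (simp only: vec.vector_space_axioms Madd Mscale T.add T.scale simp_thms)
  have T0: "T x = 0 \<longleftrightarrow> x \<in> ann (exponents 2 D) (osc_space 2 D k ?u)" if x: "x \<in> coord_space (exponents 2 D)" for x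
   unfolding osc_space_span ann_span using x by (auto simp: T_def ann_def fun_eq_iff)
  define V where "V = ann (exponents 2 D) (osc_join 2 D k s v)"
  have V: "vec.subspace V" "V \<subseteq> coord_space (exponents 2 D)" unfolding V_def using subspace_ann by (auto simp: ann_def)
  have "{x\<in>V. T x = 0} = ann (exponents 2 D) (osc_join 2 D k (Suc s) v)"
   using T0 V(2) by (auto simp: V_def ann_def osc_join_def lessThan_Suc)
  hence 1: "vec.dim V = vec.dim (T ` V) + vec.dim (ann (exponents 2 D) (osc_join 2 D k (Suc s) v))"
   using rank_nullity[OF Tlin V] by simp
  have "{w \<in> coord_space (exponents 2 ?D). T (M w) = 0} = ann (exponents 2 ?D) (osc_space 2 ?D k ?u)"
  proof -
   have "T (M w) = 0 \<longleftrightarrow> w \<in> ann (exponents 2 ?D) (osc_space 2 ?D k ?u)" if w: "w \<in> coord_space (exponents 2 ?D)" for w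
   proof -
    have "T (M w) = 0 \<longleftrightarrow> vanishes 2 (Suc k) ?u (g * poly_of 2 ?D w)"
     unfolding T0[OF Mpoly(2)] vanishes_iff_ann[OF Mpoly(2) kD(2), symmetric] Mpoly(1) ..
    also have "\<dots> \<longleftrightarrow> vanishes 2 (Suc k) ?u (poly_of 2 ?D w)"
     using vanishes_cancel[OF gp poly_of_polys gs] vanishes_mult[OF gp poly_of_polys] by blast
    finally show ?thesis using vanishes_iff_ann[OF w kD(1)] by simp
   qed
   thus ?thesis by (auto simp: ann_def)
  qed
  hence "card (exponents 2 ?D) = vec.dim ((%w. T (M w)) ` coord_space (exponents 2 ?D)) + vec.dim (ann (exponents 2 ?D) (osc_space 2 ?D k ?u))"
   using rank_nullity[OF TMlin subspace_coord_space order_refl, of "exponents 2 ?D"] dim_coord_space[of "exponents 2 ?D", where ?'a = 'a] by simp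
  moreover have "vec.dim (osc_space 2 ?D k ?u) = card (exponents 2 k)"
   by (rule dim_osc_space[of 0]) (use Suc.prems(1) kD in auto)
  ultimately have "card (exponents 2 k) = vec.dim ((%w. T (M w)) ` coord_space (exponents 2 ?D))"
   using dim_ann[OF osc_space_coord_space finite_exponents, of 2 ?D k ?u] by linarith
  also have "\<dots> <= vec.dim (T ` V)"
  proof (rule dim_mono[OF _ _ finite_exponents])
   show "T ` V \<subseteq> coord_space (exponents 2 k)" by (auto simp: T_def coord_space_def)
   have "M w \<in> V" for w unfolding V_def vanishes_iff_ann_osc_join[OF Mpoly(2) kD(2), symmetric] Mpoly(1)
    using gv vanishes_mult[OF poly_of_polys gp] by (simp only: mult.commute[of g]) blast
   thus "(%w. T (M w)) ` coord_space (exponents 2 ?D) \<subseteq> T ` V" by blast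
  qed
  finally have "card (exponents 2 k) <= vec.dim (T ` V)" .
  thus "Suc s * card (exponents 2 k) <= vec.dim (osc_join 2 D k (Suc s) v)"
   using 1 D0[of D] D dim_ann[OF osc_join_coord_space finite_exponents, of 2 D k s v]
    dim_ann[OF osc_join_coord_space finite_exponents, of 2 D k "Suc s" v] by (simp add: V_def)
 qed
qed simp

section \<open>Jets at all points jointly\<close>

definition jets :: "nat => nat => (nat => nat => 'a::field_char_0) => 'a laurent => nat \<times> expo => 'a" where
 "jets k s v b = (%(j, a). if j < s & a \<in> exponents 2 k then ljet 2 (v j) a b else 0)"

lemma jets_add: "jets k s v (f + g) = jets k s v f + jets k s v g"
 and jets_diff: "jets k s v (f - g) = jets k s v f - jets k s v g"
 and jets_cmult: "jets k s v (single 0 c * f) = vscale c (jets k s v f)"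
 by (auto simp: jets_def fun_eq_iff ljet_add ljet_diff ljet_cmult vscale_apply)

lemma jets_coord_space: "jets k s v b \<in> coord_space ({..<s} \<times> exponents 2 k)"
 by (auto simp: jets_def coord_space_def)

lemma jets_eq_0_iff:
 assumes "b \<in> lspace d \<sigma>" "k <= d"
 shows "jets k s v b = 0 \<longleftrightarrow> (\<forall>j<s. lvanishes 2 (Suc k) (v j) b)"
proof -
 have "lvanishes 2 (Suc k) (v j) b \<longleftrightarrow> (\<forall>a\<in>exponents 2 k. ljet 2 (v j) a b = 0)" for j
  by (rule lvanishes_iff_top[OF _ assms(2)]) (use lspaceD(2)[OF assms(1)] in \<open>simp add: in_keys_iff\<close>)
 thus ?thesis by (auto simp: jets_def fun_eq_iff)
qed

lemma laurent_of_poly_of: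
 "laurent_of (poly_of n d w) = (\<Sum>e\<in>exponents n d. single (Poly_Mapping.map int e) (w e))"
 by (simp add: poly_of_def laurent_of_sum laurent_of_single)

text \<open>The jets of x_i^(-m) times a form of degree d + m, that is, of the sections over the
  chart i with poles of order at most m.\<close>

definition form_jets :: "nat => nat => nat => nat => nat => (nat => nat => 'a::field_char_0) => (expo => 'a) => nat \<times> expo => 'a" where
 "form_jets d k m i s v w = jets k s v (single (single i (- int m)) 1 * laurent_of (poly_of 2 (d + m) w))"

lemma linear_form_jets: "Vector_Spaces.linear vscale vscale (form_jets d k m i s v)"
proof -
 have "laurent_of (poly_of n D (x + y)) = laurent_of (poly_of n D x) + laurent_of (poly_of n D y)" for n D and x y :: "_ => 'a"
  by (simp add: laurent_of_poly_of single_add sum.distrib)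
 moreover have "laurent_of (poly_of n D (vscale c x)) = single 0 c * laurent_of (poly_of n D x)" for n D c and x :: "_ => 'a"
  by (simp add: laurent_of_poly_of sum_distrib_left mult_single vscale_apply)
 ultimately show ?thesis unfolding Vector_Spaces.linear_iff form_jets_def
  by (simp only: vec.vector_space_axioms distrib_left jets_add mult.left_commute[of _ "single 0 _"] jets_cmult simp_thms)
qed

lemma lspace_form:
 assumes "i <= 2"
 shows "single (single i (- int m)) 1 * laurent_of (poly_of 2 (d + m) w) \<in> lspace d {i}"
proof -
 have l: "laurent_of (poly_of 2 (d + m) w) \<in> lspace (d + m) {}" by (rule laurent_of_lspace[OF poly_of_polys poly_of_homogeneous])
 have "single (\<Sum>i\<in>{i}. single i (- int m)) 1 * laurent_of (poly_of 2 (d + m) w) \<in> lspace d {i}"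
  by (rule lspace_shift[OF l]) (use assms lspaceD(3)[OF l] in auto)
 thus ?thesis by simp
qed

lemma dim_form_jets:
 fixes v :: "nat => nat => 'a::field_char_0"
 assumes v: "!!j i. j < s ==> i <= 2 ==> v j i ~= 0" and k: "k <= d" and i: "i <= 2"
 shows "vec.dim (form_jets d k m i s v ` coord_space (exponents 2 (d + m))) = vec.dim (osc_join 2 (d + m) k s v)"
proof -
 let ?E = "exponents 2 (d + m)"
 have "form_jets d k m i s v w = 0 \<longleftrightarrow> w \<in> ann ?E (osc_join 2 (d + m) k s v)" if w: "w \<in> coord_space ?E" for w
 proof -
  have "lvanishes 2 (Suc k) (v j) (single (single i (- int m)) 1 * laurent_of (poly_of 2 (d + m) w))
   \<longleftrightarrow> vanishes 2 (Suc k) (v j) (poly_of 2 (d + m) w)" if j: "j < s" for j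
   unfolding lvanishes_shift_int[where v = "v j", OF i v[OF j i]] by (rule lvanishes_laurent_of[OF poly_of_polys v[OF j]])
  hence "form_jets d k m i s v w = 0 \<longleftrightarrow> (\<forall>j<s. vanishes 2 (Suc k) (v j) (poly_of 2 (d + m) w))"
   unfolding form_jets_def jets_eq_0_iff[OF lspace_form[OF i] k] by blast
  thus ?thesis using vanishes_iff_ann_osc_join[OF w, of k s v] k by simp
 qed
 hence "{w \<in> coord_space ?E. form_jets d k m i s v w = 0} = ann ?E (osc_join 2 (d + m) k s v)" by (auto simp: ann_def)
 thus ?thesis
  using rank_nullity[OF linear_form_jets subspace_coord_space order_refl, of ?E d k m i s v] dim_coord_space[of ?E, where ?'a = 'a]
   dim_ann[OF osc_join_coord_space finite_exponents, of 2 "d + m" k s v] by simp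
qed

text \<open>Poles of any order are allowed over one chart, which amounts to forms of degree d + m.
  For large m the points impose independent conditions by \<open>dim_osc_join_large\<close>, so
  every jet is attained.\<close>

lemma form_jets_onto:
 fixes v :: "nat => nat => 'a::field_char_0"
 assumes v: "!!j i. j < s ==> i <= 2 ==> v j i ~= 0" and k: "k <= d" and i: "i <= 2"
  and ne: "!!j l. j < s ==> l < s ==> j ~= l ==> v l 1 * v j 0 ~= v l 0 * v j 1"
  and q: "q \<in> coord_space ({..<s} \<times> exponents 2 k)"
 shows "\<exists>b\<in>lspace d {i}. jets k s v b = q"
proof -
 let ?I = "{..<s} \<times> exponents 2 k"
 obtain m where m: "s * card (exponents 2 k) <= vec.dim (osc_join 2 (d + m) k s v)"
  using dim_osc_join_large[of s v k] v ne by (metis le_add2 le0)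
 let ?W = "form_jets d k m i s v ` coord_space (exponents 2 (d + m))"
 have sub: "?W \<subseteq> coord_space ?I" unfolding form_jets_def using jets_coord_space by blast
 interpret Vector_Spaces.linear vscale vscale "form_jets d k m i s v" by (rule linear_form_jets)
 have "vec.span ?W = vec.span (coord_space ?I)"
 proof (rule span_eq_of_dim_le)
  show "vec.dim (coord_space ?I :: (_ => 'a) set) <= vec.dim ?W"
   using m dim_form_jets[of s v k d i m, OF v k i] dim_coord_space[of ?I, where ?'a = 'a] by (simp add: card_cartesian_product)
 qed (use sub in \<open>auto intro: vec.span_base\<close>)
 moreover have "vec.span ?W = ?W" by (rule vec.span_eq_iff[THEN iffD2]) (rule subspace_image[OF subspace_coord_space])
 ultimately have "q \<in> ?W" using q vec.span_base by blast
 thus ?thesis using lspace_form[OF i] unfolding form_jets_def by blast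
qed

lemma subset_atMost_2_cases: "\<sigma> \<subseteq> {..2::nat} ==> \<sigma> \<in> {{},{0},{1},{2},{0,1},{0,2},{1,2},{0,1,2}}"
proof -
 assume "\<sigma> \<subseteq> {..2::nat}"
 moreover have "{..2::nat} = {0,1,2}" by auto
 ultimately have "\<sigma> \<in> Pow {0,1,2}" by blast
 thus ?thesis by (auto simp: Pow_insert)
qed

section \<open>The Cech complex of the three standard charts\<close>

lemma cech_differential_pair:
 fixes c :: "'a::field cochain"
 assumes "a < b" "b <= n"
 shows "cech_differential n 0 c {a,b} = c {b} - c {a}"
proof -
 have e: "{j\<in>{a,b}. j < a} = {}" "{j\<in>{a,b}. j < b} = {a}" "{a,b} - {a} = {b}" "{a,b} - {b} = {a}" using assms by auto
 have "(\<Sum>i\<in>{a,b}. (-1) ^ card {j\<in>{a,b}. j < i} * c ({a,b} - {i})) =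
  (-1) ^ card {j\<in>{a,b}. j < a} * c ({a,b} - {a}) + (-1) ^ card {j\<in>{a,b}. j < b} * c ({a,b} - {b})"
  using assms by (subst sum.insert) auto
 also have "\<dots> = c {b} - c {a}" unfolding e by simp
 finally show ?thesis using assms by (simp add: cech_differential_def)
qed

lemma cech_differential_triple:
 fixes c :: "'a::field cochain"
 shows "cech_differential 2 1 c {0,1,2} = c {1,2} - c {0,2} + c {0,1}"
proof -
 have e: "{j\<in>{0,1,2::nat}. j < 0} = {}" "{j\<in>{0,1,2::nat}. j < 1} = {0}" "{j\<in>{0,1,2::nat}. j < 2} = {0,1}"
  "{0,1,2} - {0} = {1,2::nat}" "{0,1,2} - {1} = {0,2::nat}" "{0,1,2} - {2} = {0,1::nat}" by auto
 let ?F = "%i. (-1) ^ card {j\<in>{0,1,2}. j < i} * c ({0,1,2} - {i})"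
 have "(\<Sum>i\<in>{0,1,2}. ?F i) = ?F 0 + ?F 1 + ?F 2" by (simp add: add.assoc)
 also have "\<dots> = c {1,2} - c {0,2} + c {0,1}" unfolding e by simp
 finally show ?thesis by (simp add: cech_differential_def)
qed

lemma cech_differential_eq_0:
 "\<not> (\<sigma> \<subseteq> {..n} & card \<sigma> = p + 2) ==> cech_differential n p c \<sigma> = 0"
 unfolding cech_differential_def by (rule if_not_P)

lemma cech_differential_0_eq_iff:
 assumes "!!\<sigma>. \<not> (\<sigma> \<subseteq> {..2} & card \<sigma> = 2) ==> c' \<sigma> = 0"
 shows "cech_differential 2 0 c = c' \<longleftrightarrow> c {1} - c {0} = c' {0,1} & c {2} - c {0} = c' {0,2} & c {2} - c {1} = c' {1,2}"
proof
 assume "cech_differential 2 0 c = c'"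
 thus "c {1} - c {0} = c' {0,1} & c {2} - c {0} = c' {0,2} & c {2} - c {1} = c' {1,2}"
  using cech_differential_pair[of 0 1 2 c] cech_differential_pair[of 0 2 2 c] cech_differential_pair[of 1 2 2 c] by auto
next
 assume a: "c {1} - c {0} = c' {0,1} & c {2} - c {0} = c' {0,2} & c {2} - c {1} = c' {1,2}"
 show "cech_differential 2 0 c = c'"
 proof
  fix \<sigma>
  show "cech_differential 2 0 c \<sigma> = c' \<sigma>"
  proof (cases "\<sigma> \<subseteq> {..2} & card \<sigma> = 2")
   case True
   hence "\<sigma> = {0,1} \<or> \<sigma> = {0,2} \<or> \<sigma> = {1,2}" using subset_atMost_2_cases[of \<sigma>] by auto
   thus ?thesis using a cech_differential_pair[of 0 1 2 c] cech_differential_pair[of 0 2 2 c] cech_differential_pair[of 1 2 2 c] by auto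
  next
   case False
   hence "\<not> (\<sigma> \<subseteq> {..2} & card \<sigma> = 0 + 2)" by (simp only: add_0_left simp_thms)
   thus ?thesis using assms[OF False] cech_differential_eq_0[of \<sigma> 2 0 c] by (simp only: simp_thms)
  qed
 qed
qed

lemma cech_differential_1_eq_0_iff: "cech_differential 2 1 c = 0 \<longleftrightarrow> c {1,2} - c {0,2} + c {0,1} = 0"
proof
 assume "cech_differential 2 1 c = 0"
 thus "c {1,2} - c {0,2} + c {0,1} = 0" using cech_differential_triple[of c] by simp
next
 assume a: "c {1,2} - c {0,2} + c {0,1} = 0"
 show "cech_differential 2 1 c = 0"
 proof
  fix \<sigma>
  show "cech_differential 2 1 c \<sigma> = 0 \<sigma>"
  proof (cases "\<sigma> \<subseteq> {..2} & card \<sigma> = 1 + 2")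
   case True
   hence "\<sigma> = {0,1,2}" using subset_atMost_2_cases[of \<sigma>] by auto
   thus ?thesis using a cech_differential_triple[of c] by simp
  next
   case False
   show ?thesis using cech_differential_eq_0[OF False, of c] by simp
  qed
 qed
qed

lemma lsections_0: "0 \<in> lsections d k s v \<sigma>"
 and lsections_add: "f \<in> lsections d k s v \<sigma> ==> g \<in> lsections d k s v \<sigma> ==> f + g \<in> lsections d k s v \<sigma>"
 and lsections_diff: "f \<in> lsections d k s v \<sigma> ==> g \<in> lsections d k s v \<sigma> ==> f - g \<in> lsections d k s v \<sigma>"
 and lsections_cmult: "f \<in> lsections d k s v \<sigma> ==> single 0 c * f \<in> lsections d k s v \<sigma>"
 by (auto simp: lsections_def lspace_add lspace_diff lspace_cmult lvanishes_add lvanishes_diff lvanishes_cmult lvanishes_0)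

lemma lsections_mono: "\<sigma> \<subseteq> \<tau> ==> lsections d k s v \<sigma> \<subseteq> lsections d k s v \<tau>"
 using lspace_mono[of \<sigma> \<tau> d] by (auto simp: lsections_def)

lemma cech_cochains_iff:
 assumes sec: "!!\<sigma>. \<sigma> \<subseteq> {..2} ==> sheaf_sections J d \<sigma> = lsections d k s v \<sigma>"
 shows "c \<in> cech_cochains 2 J d p \<longleftrightarrow> (\<forall>\<sigma>. \<sigma> \<subseteq> {..2} & card \<sigma> = p + 1 --> c \<sigma> \<in> lsections d k s v \<sigma>) &
  (\<forall>\<sigma>. \<not> (\<sigma> \<subseteq> {..2} & card \<sigma> = p + 1) --> c \<sigma> = 0)"
 unfolding cech_cochains_def mem_Collect_eq if_bool_eq_conj all_conj_distrib
 by (intro arg_cong2[where f = "(&)"] all_cong1 imp_cong refl) (auto simp: sec)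

lemma subspace_cech_cocycles:
 assumes sec: "!!\<sigma>. \<sigma> \<subseteq> {..2} ==> sheaf_sections J d \<sigma> = lsections d k s v \<sigma>"
 shows "cochain.subspace (cech_cocycles 2 J d p)"
proof -
 have add: "cech_differential 2 p (x + y) = cech_differential 2 p x + cech_differential 2 p y" for x y :: "'a cochain"
  by (rule ext) (simp add: cech_differential_def distrib_left sum.distrib)
 have scale: "cech_differential 2 p (cochain_scale c x) = cochain_scale c (cech_differential 2 p x)" for c and x :: "'a cochain"
  by (rule ext) (simp add: cech_differential_def cochain_scale_def sum_distrib_left mult.left_commute)
 have iff: "!!c. c \<in> cech_cochains 2 J d p \<longleftrightarrow> (\<forall>\<sigma>. \<sigma> \<subseteq> {..2} & card \<sigma> = p + 1 --> c \<sigma> \<in> lsections d k s v \<sigma>) &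
  (\<forall>\<sigma>. \<not> (\<sigma> \<subseteq> {..2} & card \<sigma> = p + 1) --> c \<sigma> = 0)"
  by (rule cech_cochains_iff) (rule sec)
 show ?thesis
 proof (rule cochain.subspaceI)
  show "0 \<in> cech_cocycles 2 J d p"
   unfolding cech_cocycles_def mem_Collect_eq iff by (auto simp: lsections_0 cech_differential_def)
  fix x y assume "x \<in> cech_cocycles 2 J d p" "y \<in> cech_cocycles 2 J d p"
  thus "x + y \<in> cech_cocycles 2 J d p"
   unfolding cech_cocycles_def mem_Collect_eq iff add by (auto simp: lsections_add fun_eq_iff)
 next
  fix c x assume "x \<in> cech_cocycles 2 J d p"
  thus "cochain_scale c x \<in> cech_cocycles 2 J d p"
   unfolding cech_cocycles_def mem_Collect_eq iff scale by (auto simp: cochain_scale_def lsections_cmult fun_eq_iff)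
 qed
qed

text \<open>A cocycle is a single Laurent polynomial whose poles lie only along x_0 and, read in
  another chart, only along x_1. It has no poles and is a form of degree d satisfying the vanishing
  conditions. There are no non-zero coboundaries, so \<open>cohomology_dim_eqI\<close> is used with
  \<open>N = {0}\<close>.\<close>

theorem cohomology_dim_0:
 fixes v :: "nat => nat => 'a::field_char_0"
 assumes sec: "!!\<sigma>. \<sigma> \<subseteq> {..2} ==> sheaf_sections J d \<sigma> = lsections d k s v \<sigma>"
  and v: "!!j i. j < s ==> i <= 2 ==> v j i ~= 0" and k: "k <= d"
 shows "cohomology_dim 2 J d 0 = card (exponents 2 d) - vec.dim (osc_join 2 d k s v)"
proof -
 let ?E = "exponents 2 d"
 let ?Q = "ann ?E (osc_join 2 d k s v)"
 define \<tau> :: "'a cochain => expo => 'a" where "\<tau> = (%c e. if e \<in> ?E then lookup (c {0}) (Poly_Mapping.map int e) else 0)"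
 have iff: "!!c. c \<in> cech_cochains 2 J d 0 \<longleftrightarrow> (\<forall>\<sigma>. \<sigma> \<subseteq> {..2} & card \<sigma> = 0 + 1 --> c \<sigma> \<in> lsections d k s v \<sigma>) &
  (\<forall>\<sigma>. \<not> (\<sigma> \<subseteq> {..2} & card \<sigma> = 0 + 1) --> c \<sigma> = 0)"
  by (rule cech_cochains_iff) (rule sec)
 have Z: "EX f. f \<in> polys {..2} & homogeneous d f & c {0} = laurent_of f & c {1} = laurent_of f & c {2} = laurent_of f &
   (\<forall>j<s. vanishes 2 (Suc k) (v j) f) & (\<forall>\<sigma>. \<sigma> ~= {0} --> \<sigma> ~= {1} --> \<sigma> ~= {2} --> c \<sigma> = 0)"
  if c: "c \<in> cech_cocycles 2 J d 0" for c
 proof -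
  have cc: "c \<in> cech_cochains 2 J d 0" "cech_differential 2 0 c = 0" using c by (auto simp: cech_cocycles_def)
  have eq: "c {1} = c {0}" "c {2} = c {0}" using cc(2) cech_differential_0_eq_iff[of 0 c] by auto
  have s: "c {i} \<in> lsections d k s v {i}" if "i <= 2" for i using cc(1) \<open>i <= 2\<close> unfolding iff by auto
  have l0: "c {0} \<in> lspace d {0}" "c {0} \<in> lspace d {1}" using s[of 0] s[of 1] eq by (auto simp: lsections_def)
  have "c {0} \<in> lspace d {}"
  proof (rule lspaceI)
   fix e i assume a: "lookup (c {0}) e ~= 0" "i <= (2::nat)"
   show "0 <= lookup e i"
    using lspaceD(3)[OF l0(1) a] lspaceD(3)[OF l0(2) a] by (cases "i = 0") auto
  qed (use lspaceD[OF l0(1)] in auto)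
  then obtain f where f: "f \<in> polys {..2}" "homogeneous d f" "c {0} = laurent_of f" by (rule lspace_laurent_of)
  have "vanishes 2 (Suc k) (v j) f" if "j < s" for j
   using s[of 0] lvanishes_laurent_of[OF f(1) v[OF that]] that by (auto simp: lsections_def f(3))
  moreover have "c \<sigma> = 0" if "\<sigma> ~= {0}" "\<sigma> ~= {1}" "\<sigma> ~= {2}" for \<sigma>
  proof -
   have "\<not> (\<sigma> \<subseteq> {..2} & card \<sigma> = 0 + 1)" using subset_atMost_2_cases[of \<sigma>] that by auto
   thus ?thesis using cc(1) unfolding iff by blast
  qed
  ultimately show ?thesis using f eq by metis
 qed
 have \<tau>: "\<tau> c = lookup f" if "f \<in> polys {..2}" "homogeneous d f" "c {0} = laurent_of f" for c f
  using keys_homogeneous[OF that(1,2)] by (auto simp: \<tau>_def that(3) lookup_laurent_of fun_eq_iff in_keys_iff)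
 have look: "lookup f \<in> ?Q" if "f \<in> polys {..2}" "homogeneous d f" "\<forall>j<s. vanishes 2 (Suc k) (v j) f" for f
 proof -
  have "lookup f \<in> coord_space ?E" using keys_homogeneous[OF that(1,2)] by (auto simp: coord_space_def in_keys_iff)
  from vanishes_iff_ann_osc_join[OF this k, of s v] show ?thesis using that by (simp add: poly_of_lookup)
 qed
 have "cohomology_dim 2 J d 0 = vec.dim ?Q - vec.dim ({0} :: (expo => 'a) set)"
 proof (rule cohomology_dim_eqI[where \<tau> = \<tau> and I = ?E])
  show "\<tau> (x + y) = \<tau> x + \<tau> y" for x y by (auto simp: \<tau>_def fun_eq_iff lookup_add)
  show "\<tau> (cochain_scale c x) = vscale c (\<tau> x)" for c x by (auto simp: \<tau>_def fun_eq_iff cochain_scale_def lookup_cmult vscale_apply)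
  show "vec.subspace ?Q" by (rule subspace_ann)
  show "?Q \<subseteq> coord_space ?E" by (auto simp: ann_def)
  show "vec.subspace ({0} :: (expo => 'a) set)" by (rule vec.subspace_single_0)
  show "{0} \<subseteq> ?Q" using vec.subspace_0[OF subspace_ann] by blast
  show sub: "cochain.subspace (cech_cocycles 2 J d 0)" by (rule subspace_cech_cocycles) (rule sec)
  show "\<tau> c \<in> ?Q" if "c \<in> cech_cocycles 2 J d 0" for c
  proof -
   from Z[OF that] obtain f where f: "f \<in> polys {..2}" "homogeneous d f" "c {0} = laurent_of f" "\<forall>j<s. vanishes 2 (Suc k) (v j) f" by blast
   show ?thesis unfolding \<tau>[where c = c, OF f(1-3)] by (rule look[OF f(1,2,4)])
  qed
  show "cech_coboundaries 2 J d 0 \<subseteq> cech_cocycles 2 J d 0"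
   using cochain.subspace_0[OF sub] by (simp add: cech_coboundaries_def)
  show "\<tau> c \<in> {0} \<longleftrightarrow> c \<in> cech_coboundaries 2 J d 0" if "c \<in> cech_cocycles 2 J d 0" for c
  proof -
   from Z[OF that] obtain f where f: "f \<in> polys {..2}" "homogeneous d f" "c {0} = laurent_of f" "c {1} = laurent_of f" "c {2} = laurent_of f"
    "!!\<sigma>. \<sigma> ~= {0} ==> \<sigma> ~= {1} ==> \<sigma> ~= {2} ==> c \<sigma> = 0" by blast
   have "\<tau> c = 0 \<longleftrightarrow> f = 0" unfolding \<tau>[where c = c, OF f(1-3)] by (auto simp: poly_mapping_eq_iff fun_eq_iff)
   moreover have "c = 0 \<longleftrightarrow> f = 0"
   proof
    assume "f = 0"
    hence "c \<sigma> = 0" for \<sigma> using f(3-6) by (cases "\<sigma> = {0} \<or> \<sigma> = {1} \<or> \<sigma> = {2}") auto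
    thus "c = 0" by (auto simp: fun_eq_iff)
   qed (use f(3) laurent_of_eq_0_iff[of f] in auto)
   ultimately show ?thesis by (simp add: cech_coboundaries_def)
  qed
  show "\<exists>c\<in>cech_cocycles 2 J d 0. q - \<tau> c \<in> {0}" if q: "q \<in> ?Q" for q
  proof
   let ?f = "poly_of 2 d q"
   define c where "c = (%\<sigma>::nat set. if \<sigma> \<subseteq> {..2} & card \<sigma> = 1 then laurent_of ?f else 0)"
   have qE: "q \<in> coord_space ?E" using q by (simp add: ann_def)
   have "\<forall>j<s. vanishes 2 (Suc k) (v j) ?f" using vanishes_iff_ann_osc_join[OF qE k] q by blast
   hence "laurent_of ?f \<in> lsections d k s v {}"
    using laurent_of_lspace[OF poly_of_polys poly_of_homogeneous] lvanishes_laurent_of[OF poly_of_polys v] by (auto simp: lsections_def)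
   hence "laurent_of ?f \<in> lsections d k s v \<sigma>" for \<sigma> using lsections_mono[of "{}" \<sigma> d k s v] by auto
   hence "c \<in> cech_cochains 2 J d 0" unfolding iff by (auto simp: c_def)
   moreover have "cech_differential 2 0 c = 0" by (subst cech_differential_0_eq_iff) (auto simp: c_def)
   ultimately show "c \<in> cech_cocycles 2 J d 0" by (simp add: cech_cocycles_def)
   have "\<tau> c = lookup ?f" by (rule \<tau>[where c = c, OF poly_of_polys poly_of_homogeneous]) (simp add: c_def)
   also have "\<dots> = q" using qE by (auto simp: fun_eq_iff lookup_poly_of coord_space_def)
   finally show "q - \<tau> c \<in> {0}" by (auto simp: fun_eq_iff)
  qed
 qed simp
 also have "vec.dim ({0} :: (expo => 'a) set) = 0" by (rule vec.dim_unique[of "{}"]) (auto simp: vec.independent_empty)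
 finally show ?thesis using dim_ann[OF osc_join_coord_space finite_exponents, of 2 d k s v] by simp
qed

text \<open>Cutting off the negative powers of x_0 is linear and creates no new poles, so it can
  split a section over the charts 0 and 1.\<close>

definition nonneg_part :: "'a::field laurent => 'a laurent" where
 "nonneg_part b = (\<Sum>e\<in>{e \<in> keys b. 0 <= lookup e 0}. single e (lookup b e))"

lemma lookup_nonneg_part: "lookup (nonneg_part b) e = (if 0 <= lookup e 0 then lookup b e else 0)"
 by (auto simp: nonneg_part_def lookup_sum lookup_single when_def in_keys_iff)

lemma nonneg_part_add: "nonneg_part (f + g) = nonneg_part f + nonneg_part g"
 and nonneg_part_diff: "nonneg_part (f - g) = nonneg_part f - nonneg_part g"
 and nonneg_part_cmult: "nonneg_part (single 0 c * f) = single 0 c * nonneg_part f"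
 by (auto intro!: poly_mapping_eqI simp: lookup_nonneg_part lookup_add lookup_minus lookup_cmult)

lemma nonneg_part_lspace: "b \<in> lspace d \<sigma> ==> nonneg_part b \<in> lspace d (\<sigma> - {0})"
 unfolding lspace_def by (auto simp: lookup_nonneg_part split: if_splits)

lemma nonneg_part_eq: "b \<in> lspace d \<sigma> ==> 0 \<notin> \<sigma> ==> nonneg_part b = b"
 by (rule poly_mapping_eqI) (auto simp: lookup_nonneg_part lspace_def)

text \<open>A cocycle is the coboundary of the cochain \<open>b\<^sub>0 = - c\<^sub>0\<^sub>1\<close> in negative powers of \<open>x\<^sub>0\<close> and \<open>b\<^sub>1 = c\<^sub>0\<^sub>1\<close>
  in nonnegative ones with values in the structure sheaf. All \<open>b\<^sub>i\<close> have the same jets, and the cocycle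
  is a coboundary of the ideal sheaf iff these are the jets of a form of degree \<open>d\<close>.\<close>

theorem cohomology_dim_1:
 fixes v :: "nat => nat => 'a::field_char_0"
 assumes sec: "!!\<sigma>. \<sigma> \<subseteq> {..2} ==> sheaf_sections J d \<sigma> = lsections d k s v \<sigma>"
  and v: "!!j i. j < s ==> i <= 2 ==> v j i ~= 0" and k: "k <= d"
  and ne: "!!j l. j < s ==> l < s ==> j ~= l ==> v l 1 * v j 0 ~= v l 0 * v j 1"
 shows "cohomology_dim 2 J d 1 = s * card (exponents 2 k) - vec.dim (osc_join 2 d k s v)"
proof -
 let ?I = "{..<s} \<times> exponents 2 k" and ?J = "jets k s v" and ?S = "lsections d k s v" and ?F = nonneg_part
 define \<tau> where "\<tau> = (%c :: 'a cochain. ?J (?F (c {0,1})))"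
 define N where "N = form_jets d k 0 0 s v ` coord_space (exponents 2 d)"
 have iff0: "c \<in> cech_cochains 2 J d 0 \<longleftrightarrow> (\<forall>\<sigma>. \<sigma> \<subseteq> {..2} & card \<sigma> = 0 + 1 --> c \<sigma> \<in> ?S \<sigma>) &
  (\<forall>\<sigma>. \<not> (\<sigma> \<subseteq> {..2} & card \<sigma> = 0 + 1) --> c \<sigma> = 0)" for c by (rule cech_cochains_iff) (rule sec)
 have iff1: "c \<in> cech_cochains 2 J d 1 \<longleftrightarrow> (\<forall>\<sigma>. \<sigma> \<subseteq> {..2} & card \<sigma> = 1 + 1 --> c \<sigma> \<in> ?S \<sigma>) &
  (\<forall>\<sigma>. \<not> (\<sigma> \<subseteq> {..2} & card \<sigma> = 1 + 1) --> c \<sigma> = 0)" for c by (rule cech_cochains_iff) (rule sec)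
 have N: "x \<in> N \<longleftrightarrow> (\<exists>p\<in>lspace d {}. x = ?J p)" for x
 proof
  assume "x \<in> N"
  then obtain w where "x = ?J (laurent_of (poly_of 2 d w))" by (auto simp: N_def form_jets_def single_one)
  thus "\<exists>p\<in>lspace d {}. x = ?J p" using laurent_of_lspace[OF poly_of_polys poly_of_homogeneous] by blast
 next
  assume "\<exists>p\<in>lspace d {}. x = ?J p"
  then obtain p where p: "p \<in> lspace d {}" "x = ?J p" by blast
  from p(1) obtain f where f: "f \<in> polys {..2}" "homogeneous d f" "p = laurent_of f" by (rule lspace_laurent_of)
  have "lookup f \<in> coord_space (exponents 2 d)"
   using keys_homogeneous[OF f(1,2)] by (auto simp: coord_space_def in_keys_iff)
  moreover have "x = form_jets d k 0 0 s v (lookup f)"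
   using poly_of_lookup[OF f(1,2)] by (simp add: p(2) f(3) form_jets_def single_one)
  ultimately show "x \<in> N" by (simp add: N_def)
 qed
 have cob: "cech_coboundaries 2 J d 1 = cech_differential 2 0 ` cech_cochains 2 J d 0" by (simp add: cech_coboundaries_def)
 have inS: "b \<in> ?S \<sigma>" if "b \<in> lspace d \<sigma>" "?J b = 0" for b \<sigma>
  using that jets_eq_0_iff[OF that(1) k, of s v] by (simp add: lsections_def)
 have Sin: "b \<in> lspace d \<sigma> & ?J b = 0" if "b \<in> ?S \<sigma>" for b \<sigma>
  using that jets_eq_0_iff[of b d \<sigma>, OF _ k, of s v] by (auto simp: lsections_def)
 have Z: "c {0,1} \<in> ?S {0,1}" "c {0,2} \<in> ?S {0,2}" "c {1,2} \<in> ?S {1,2}" "c {1,2} - c {0,2} + c {0,1} = 0"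
  "!!\<sigma>. \<not> (\<sigma> \<subseteq> {..2} & card \<sigma> = 2) ==> c \<sigma> = 0" if c: "c \<in> cech_cocycles 2 J d 1" for c
 proof -
  have cc: "c \<in> cech_cochains 2 J d 1" "cech_differential 2 1 c = 0" using c by (auto simp: cech_cocycles_def)
  have m: "c \<sigma> \<in> ?S \<sigma>" if "\<sigma> \<subseteq> {..2}" "card \<sigma> = 1 + 1" for \<sigma> using cc(1) that unfolding iff1 by blast
  show "c {0,1} \<in> ?S {0,1}" "c {0,2} \<in> ?S {0,2}" "c {1,2} \<in> ?S {1,2}" by (rule m; simp)+
  show "c {1,2} - c {0,2} + c {0,1} = 0" using cc(2) unfolding cech_differential_1_eq_0_iff .
  fix \<sigma> :: "nat set" assume "\<not> (\<sigma> \<subseteq> {..2} & card \<sigma> = 2)"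
  hence "\<not> (\<sigma> \<subseteq> {..2} & card \<sigma> = 1 + 1)" by (simp only: one_add_one simp_thms)
  thus "c \<sigma> = 0" using cc(1) unfolding iff1 by blast
 qed
 have ZI: "c \<in> cech_cocycles 2 J d 1" if c: "c {0,1} \<in> ?S {0,1}" "c {0,2} \<in> ?S {0,2}" "c {1,2} \<in> ?S {1,2}" "c {1,2} - c {0,2} + c {0,1} = 0"
  "!!\<sigma>. \<not> (\<sigma> \<subseteq> {..2} & card \<sigma> = 2) ==> c \<sigma> = 0" for c
 proof -
  have "c \<sigma> \<in> ?S \<sigma>" if "\<sigma> \<subseteq> {..2}" "card \<sigma> = 1 + 1" for \<sigma>
  proof -
   have "\<sigma> = {0,1} \<or> \<sigma> = {0,2} \<or> \<sigma> = {1,2}" using subset_atMost_2_cases[OF that(1)] that(2) by auto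
   thus ?thesis using c(1-3) by blast
  qed
  moreover have "c \<sigma> = 0" if "\<not> (\<sigma> \<subseteq> {..2} & card \<sigma> = 1 + 1)" for \<sigma>
   using that by (intro c(5)) (simp only: one_add_one simp_thms)
  ultimately have "c \<in> cech_cochains 2 J d 1" unfolding iff1 by blast
  thus ?thesis using c(4) unfolding cech_differential_1_eq_0_iff[symmetric] by (simp add: cech_cocycles_def)
 qed
 have BI: "c \<in> cech_coboundaries 2 J d 1" if b: "b0 \<in> ?S {0}" "b1 \<in> ?S {1}" "b2 \<in> ?S {2}"
  and c: "b1 - b0 = c {0,1}" "b2 - b0 = c {0,2}" "b2 - b1 = c {1,2}" "!!\<sigma>. \<not> (\<sigma> \<subseteq> {..2} & card \<sigma> = 2) ==> c \<sigma> = 0" for b0 b1 b2 c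
 proof -
  define b where "b = (%\<sigma>::nat set. if \<sigma> = {0} then b0 else if \<sigma> = {1} then b1 else if \<sigma> = {2} then b2 else 0)"
  have bv: "b {0} = b0" "b {1} = b1" "b {2} = b2" by (simp_all add: b_def)
  have "b \<sigma> \<in> ?S \<sigma>" if "\<sigma> \<subseteq> {..2}" "card \<sigma> = 0 + 1" for \<sigma>
  proof -
   have "\<sigma> = {0} \<or> \<sigma> = {1} \<or> \<sigma> = {2}" using subset_atMost_2_cases[OF that(1)] that(2) by auto
   thus ?thesis using bv b by metis
  qed
  moreover have "b \<sigma> = 0" if "\<not> (\<sigma> \<subseteq> {..2} & card \<sigma> = 0 + 1)" for \<sigma> using that by (auto simp: b_def)
  ultimately have "b \<in> cech_cochains 2 J d 0" unfolding iff0 by blast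
  moreover have "cech_differential 2 0 b = c"
   by (subst cech_differential_0_eq_iff[OF c(4)]) (simp_all only: bv c simp_thms)
  ultimately show ?thesis unfolding cob by blast
 qed
 have "cohomology_dim 2 J d 1 = vec.dim (coord_space ?I :: (_ => 'a) set) - vec.dim N"
 proof (rule cohomology_dim_eqI[where \<tau> = \<tau> and I = ?I])
  show "\<tau> (x + y) = \<tau> x + \<tau> y" for x y by (simp only: \<tau>_def plus_fun_apply nonneg_part_add jets_add)
  show "\<tau> (cochain_scale c x) = vscale c (\<tau> x)" for c x by (simp only: \<tau>_def cochain_scale_def nonneg_part_cmult jets_cmult)
  interpret Vector_Spaces.linear vscale vscale "form_jets d k 0 0 s v" by (rule linear_form_jets)
  show "vec.subspace N" unfolding N_def by (rule subspace_image[OF subspace_coord_space])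
  show "N \<subseteq> coord_space ?I" unfolding N_def form_jets_def using jets_coord_space by blast
  show "cochain.subspace (cech_cocycles 2 J d 1)" by (rule subspace_cech_cocycles) (rule sec)
  show "\<tau> c \<in> coord_space ?I" for c unfolding \<tau>_def by (rule jets_coord_space)
  show sub: "cech_coboundaries 2 J d 1 \<subseteq> cech_cocycles 2 J d 1"
  proof
   fix c assume "c \<in> cech_coboundaries 2 J d 1"
   then obtain b where b: "b \<in> cech_cochains 2 J d 0" "c = cech_differential 2 0 b" unfolding cob by blast
   have m: "b \<sigma> \<in> ?S \<sigma>" if "\<sigma> \<subseteq> {..2}" "card \<sigma> = 0 + 1" for \<sigma> using b(1) that unfolding iff0 by blast
   have bs: "b {0} \<in> ?S {0}" "b {1} \<in> ?S {1}" "b {2} \<in> ?S {2}" by (rule m; simp)+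
   have ci: "c {0,1} = b {1} - b {0}" "c {0,2} = b {2} - b {0}" "c {1,2} = b {2} - b {1}"
    unfolding b(2) by (rule cech_differential_pair; simp)+
   show "c \<in> cech_cocycles 2 J d 1"
   proof (rule ZI)
    show "c {0,1} \<in> ?S {0,1}" "c {0,2} \<in> ?S {0,2}" "c {1,2} \<in> ?S {1,2}"
     unfolding ci by (intro lsections_diff subsetD[OF lsections_mono bs(1)] subsetD[OF lsections_mono bs(2)] subsetD[OF lsections_mono bs(3)]; blast)+
    show "c {1,2} - c {0,2} + c {0,1} = 0" unfolding ci by simp
    fix \<sigma> :: "nat set" assume "\<not> (\<sigma> \<subseteq> {..2} & card \<sigma> = 2)"
    hence "\<not> (\<sigma> \<subseteq> {..2} & card \<sigma> = 0 + 2)" by (simp only: add_0_left simp_thms)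
    thus "c \<sigma> = 0" unfolding b(2) by (rule cech_differential_eq_0)
   qed
  qed
  show "\<tau> c \<in> N \<longleftrightarrow> c \<in> cech_coboundaries 2 J d 1" if c: "c \<in> cech_cocycles 2 J d 1" for c
  proof
   note Zc = Z[OF c]
   assume "\<tau> c \<in> N"
   then obtain p where p: "p \<in> lspace d {}" "?J (?F (c {0,1})) = ?J p" unfolding N \<tau>_def by blast
   \<comment> \<open>The form p has the jets of the splitting. Subtracting it from all three
     sections kills their jets without adding poles.\<close>
   define b1 where "b1 = ?F (c {0,1}) - p"
   define b0 where "b0 = b1 - c {0,1}"
   define b2 where "b2 = b0 + c {0,2}"
   note l = Sin[OF Zc(1), THEN conjunct1] Sin[OF Zc(2), THEN conjunct1] Sin[OF Zc(3), THEN conjunct1]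
   note j = Sin[OF Zc(1), THEN conjunct2] Sin[OF Zc(2), THEN conjunct2] Sin[OF Zc(3), THEN conjunct2]
   have eq: "c {0,2} = c {1,2} + c {0,1}" using Zc(4) by (simp add: algebra_simps)
   have ple: "p \<in> lspace d \<sigma>" for \<sigma> using p(1) lspace_mono[of "{}" \<sigma> d] by blast
   have "?F (c {0,1}) \<in> lspace d {1}"
   proof -
    have "{0,1} - {0} = {1::nat}" by auto
    thus ?thesis using nonneg_part_lspace[OF l(1)] by simp
   qed
   hence b1: "b1 \<in> lspace d {1}" unfolding b1_def by (rule lspace_diff[OF _ ple])
   have jb: "?J b1 = 0" "?J b0 = 0" "?J b2 = 0"
    using p(2) j by (simp_all only: b1_def b0_def b2_def jets_diff jets_add diff_self add_0_left)
   have big: "lspace d \<sigma> \<subseteq> lspace d {0,1,2}" if "\<sigma> \<subseteq> {0,1,2}" for \<sigma> by (rule lspace_mono[OF that])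
   have b0l: "b0 \<in> lspace d {0,1,2}" unfolding b0_def using big[of "{1}"] b1 big[of "{0,1}"] l(1) by (intro lspace_diff) auto
   have b2l: "b2 \<in> lspace d {0,1,2}" unfolding b2_def using b0l big[of "{0,2}"] l(2) by (intro lspace_add) auto
   have le2: "i = 0 \<or> i = 1 \<or> i = 2" if "i <= 2" for i :: nat using that by auto
   have look0: "lookup b0 e = (if 0 <= lookup e 0 then 0 else - lookup (c {0,1}) e) - lookup p e" for e
    by (simp add: b0_def b1_def lookup_minus lookup_nonneg_part)
   \<comment> \<open>Outside the monomials of p, those of \<open>b0\<close> come from
     \<open>c {0,1}\<close> and have negative exponent of x_0. They do not occur in
     \<open>c {1,2}\<close>, hence occur in \<open>c {0,2}\<close>, which has no pole along x_1; and
     \<open>c {0,1}\<close> has none along x_2.\<close>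
   have b0: "b0 \<in> lspace d {0}"
   proof (rule lspaceI)
    fix e i assume a: "lookup b0 e ~= 0" "i <= (2::nat)" "i \<notin> {0}"
    show "0 <= lookup e i"
    proof (cases "lookup p e = 0")
     case True
     hence n: "lookup e 0 < 0" "lookup (c {0,1}) e ~= 0" using a(1) look0[of e] by (auto split: if_splits)
     have "lookup (c {1,2}) e = 0" using lspaceD(3)[OF l(3), of e 0] n(1) by force
     hence "lookup (c {0,2}) e ~= 0" using n(2) by (simp add: eq lookup_add)
     thus ?thesis using le2[OF a(2)] a(3) lspaceD(3)[OF l(2), of e 1] lspaceD(3)[OF l(1) n(2), of 2] by auto
    next
     case False
     thus ?thesis using lspaceD(3)[OF p(1) _ a(2)] by blast
    qed
   qed (use lspaceD[OF b0l] in auto)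
   have look2: "lookup b2 e = (if 0 <= lookup e 0 then lookup (c {0,2}) e else lookup (c {1,2}) e) - lookup p e" for e
    by (simp add: b2_def lookup_add look0 eq)
   \<comment> \<open>Up to p, a monomial with negative exponent of x_0 would come from
     \<open>c {1,2}\<close>, which has none; all others come from \<open>c {0,2}\<close>, which has
     no pole along x_1.\<close>
   have b2: "b2 \<in> lspace d {2}"
   proof (rule lspaceI)
    fix e i assume a: "lookup b2 e ~= 0" "i <= (2::nat)" "i \<notin> {2}"
    show "0 <= lookup e i"
    proof (cases "lookup p e = 0")
     case True
     have n: "0 <= lookup e 0"
      using a(1) look2[of e] True lspaceD(3)[OF l(3), of e 0] by (force split: if_splits)
     hence "lookup (c {0,2}) e ~= 0" using a(1) look2[of e] True by auto
     from lspaceD(3)[OF l(2) this, of 1] show ?thesis using n le2[OF a(2)] a(3) by auto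
    next
     case False
     thus ?thesis using lspaceD(3)[OF p(1) _ a(2)] by blast
    qed
   qed (use lspaceD[OF b2l] in auto)
   show "c \<in> cech_coboundaries 2 J d 1"
    by (rule BI[OF inS[OF b0 jb(2)] inS[OF b1 jb(1)] inS[OF b2 jb(3)] _ _ _ Zc(5)])
     (simp_all add: b2_def b0_def eq)
  next
   assume "c \<in> cech_coboundaries 2 J d 1"
   then obtain b where b: "b \<in> cech_cochains 2 J d 0" "c = cech_differential 2 0 b" unfolding cob by blast
   have m: "b \<sigma> \<in> ?S \<sigma>" if "\<sigma> \<subseteq> {..2}" "card \<sigma> = 0 + 1" for \<sigma> using b(1) that unfolding iff0 by blast
   have bs: "b {0} \<in> ?S {0}" "b {1} \<in> ?S {1}" by (rule m; simp)+
   have ci: "c {0,1} = b {1} - b {0}" unfolding b(2) by (rule cech_differential_pair; simp)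
   note s0 = Sin[OF bs(1)] and s1 = Sin[OF bs(2)]
   have F1: "?F (b {1}) = b {1}" by (rule nonneg_part_eq[OF conjunct1[OF s1]]) simp
   have F0: "?F (b {0}) \<in> lspace d {}" using nonneg_part_lspace[OF conjunct1[OF s0]] by simp
   have "\<tau> c = ?J (b {1}) - ?J (?F (b {0}))" unfolding \<tau>_def ci nonneg_part_diff F1 jets_diff ..
   also have "\<dots> = ?J (0 - ?F (b {0}))" using s1 jets_diff[of k s v "b {1}" "b {1}"] by (simp only: jets_diff diff_self)
   finally show "\<tau> c \<in> N" unfolding N using lspace_diff[OF lspace_0 F0] by blast
  qed
  show "\<exists>c\<in>cech_cocycles 2 J d 1. q - \<tau> c \<in> N" if q: "q \<in> coord_space ?I" for q
  proof -
   have onto: "\<exists>b\<in>lspace d {i}. ?J b = q" if "i <= 2" for i by (rule form_jets_onto[OF v k that ne q])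
   obtain b0 where b0: "b0 \<in> lspace d {0}" "?J b0 = q" using onto[of 0] by auto
   obtain b1 where b1: "b1 \<in> lspace d {1}" "?J b1 = q" using onto[of 1] by auto
   obtain b2 where b2: "b2 \<in> lspace d {2}" "?J b2 = q" using onto[of 2] by auto
   \<comment> \<open>The connecting homomorphism: sections of O(d) over the three charts with the
     same jets q have differences in the ideal sheaf.\<close>
   define c where "c = (%\<sigma>::nat set. if \<sigma> = {0,1} then b1 - b0 else if \<sigma> = {0,2} then b2 - b0 else if \<sigma> = {1,2} then b2 - b1 else 0)"
   have cv: "c {0,1} = b1 - b0" "c {0,2} = b2 - b0" "c {1,2} = b2 - b1" by (simp_all add: c_def doubleton_eq_iff)
   have "c \<in> cech_cocycles 2 J d 1"
   proof (rule ZI)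
    have mono: "x - y \<in> ?S {i,j}" if "x \<in> lspace d {j}" "y \<in> lspace d {i}" "?J x = q" "?J y = q" for x y i j
    proof (rule inS)
     show "x - y \<in> lspace d {i,j}" using that(1,2) lspace_mono[of "{i}" "{i,j}" d] lspace_mono[of "{j}" "{i,j}" d] by (intro lspace_diff) auto
     show "?J (x - y) = 0" by (simp only: jets_diff that diff_self)
    qed
    show "c {0,1} \<in> ?S {0,1}" "c {0,2} \<in> ?S {0,2}" "c {1,2} \<in> ?S {1,2}"
     unfolding cv by (rule mono[OF b1(1) b0(1) b1(2) b0(2)], rule mono[OF b2(1) b0(1) b2(2) b0(2)], rule mono[OF b2(1) b1(1) b2(2) b1(2)])
    show "c {1,2} - c {0,2} + c {0,1} = 0" unfolding cv by simp
    show "c \<sigma> = 0" if "\<not> (\<sigma> \<subseteq> {..2} & card \<sigma> = 2)" for \<sigma>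
    proof -
     have "card {0,1::nat} = 2" "card {0,2::nat} = 2" "card {1,2::nat} = 2" "{0,1} \<subseteq> {..2::nat}" "{0,2} \<subseteq> {..2::nat}" "{1,2} \<subseteq> {..2::nat}" by simp_all
     hence "\<sigma> ~= {0,1}" "\<sigma> ~= {0,2}" "\<sigma> ~= {1,2}" using that by metis+
     thus ?thesis by (simp only: c_def simp_thms if_False)
    qed
   qed
   moreover have "q - \<tau> c \<in> N"
   proof -
    have F1: "?F b1 = b1" by (rule nonneg_part_eq[OF b1(1)]) simp
    have F0: "?F b0 \<in> lspace d {}" using nonneg_part_lspace[OF b0(1)] by simp
    have "q - \<tau> c = ?J (?F b0)" unfolding \<tau>_def cv nonneg_part_diff F1 jets_diff b1(2) by simp
    thus ?thesis unfolding N using F0 by blast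
   qed
   ultimately show ?thesis by blast
  qed
 qed simp_all
 also have "vec.dim (coord_space ?I :: (_ => 'a) set) = s * card (exponents 2 k)"
  using dim_coord_space[of ?I, where ?'a = 'a] by (simp add: card_cartesian_product)
 also have "vec.dim N = vec.dim (osc_join 2 d k s v)"
  using dim_form_jets[of s v k d 0 0, OF v k] by (simp add: N_def)
 finally show ?thesis .
qed

section \<open>Generic points\<close>

lemma digits_unique:
 fixes f g :: "nat => nat"
 assumes "!!j. j < s ==> f j < B" "!!j. j < s ==> g j < B" "(\<Sum>j<s. B ^ j * f j) = (\<Sum>j<s. B ^ j * g j)" "j < s"
 shows "f j = g j"
 using assms
proof (induction s arbitrary: f g j)
 case (Suc s)
 have sum: "(\<Sum>j<Suc s. B ^ j * h j) = h 0 + B * (\<Sum>j<s. B ^ j * h (Suc j))" for h :: "nat => nat"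
  by (simp add: sum.lessThan_Suc_shift sum_distrib_left mult.assoc del: sum.lessThan_Suc)
 have eq: "f 0 + B * (\<Sum>j<s. B ^ j * f (Suc j)) = g 0 + B * (\<Sum>j<s. B ^ j * g (Suc j))"
  using Suc.prems(3) unfolding sum .
 have B: "f 0 < B" "g 0 < B" using Suc.prems(1,2) by auto
 have 0: "f 0 = g 0" using arg_cong[OF eq, of "%x. x mod B"] B by simp
 hence "(\<Sum>j<s. B ^ j * f (Suc j)) = (\<Sum>j<s. B ^ j * g (Suc j))" using eq B by simp
 hence "f (Suc l) = g (Suc l)" if "l < s" for l using Suc.IH[of "%j. f (Suc j)" "%j. g (Suc j)" l] Suc.prems(1,2) that by auto
 thus ?case using 0 Suc.prems(4) by (cases j) auto
qed simp

text \<open>A multihomogeneous component of the product of the given polynomials defines the closed set. Where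
  it does not vanish, the product does not vanish at suitable representatives of the points; they are
  found along the curve \<open>c \<mapsto> (c ^ B ^ j * v j)\<^sub>j\<close>, on which different components have different degrees.\<close>

lemma for_generic_pointsI:
 fixes H :: "((nat \<times> nat => 'a::field_char_0) => 'a) set"
 assumes H: "finite H" "!!h. h \<in> H ==> polyfun ({..<s} \<times> {..n}) h" "!!h. h \<in> H ==> EX a. h a ~= 0"
  and Q: "!!v P. (!!j. j < s ==> v j \<in> coord_space {..n} & v j ~= 0 & P j = ppoint_of (v j)) ==>
   (!!h. h \<in> H ==> h (%(j, i). v j i) ~= 0) ==> Q P"
 shows "for_generic_points n s Q"
proof -
 let ?J = "{..<s} \<times> {..n}"
 have "polyfun ?J (%u. \<Prod>h\<in>H. h u)" by (rule polyfun_prod) (rule H(2))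
 then obtain p where p: "p \<in> polys ?J" "(%u. \<Prod>h\<in>H. h u) = mpoly_eval p" using polyfun_imp_mpoly by blast
 have "EX a. \<forall>h\<in>H. h a ~= 0" by (rule polyfun_prod_neq_0[where f = "%h. h" and J = ?J]) (use H in auto)
 then obtain a where a: "mpoly_eval p a ~= 0" using H(1) unfolding p(2)[symmetric] by (auto simp: prod_zero_iff)
 define dg where "dg = (%j (m :: nat \<times> nat \<Rightarrow>\<^sub>0 nat). \<Sum>i\<le>n. lookup m (j, i))"
 \<comment> \<open>Larger than every degree that occurs in the coordinates of one point, so that
   \<open>w\<close> below encodes the multidegree in base \<open>B\<close> and its graded parts are
   multihomogeneous.\<close>
 define B where "B = Suc (\<Sum>m\<in>keys p. \<Sum>j<s. dg j m)"
 have B: "dg j m < B" if "m \<in> keys p" "j < s" for j m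
 proof -
  have "dg j m <= (\<Sum>j<s. dg j m)" by (rule member_le_sum) (use that(2) in auto)
  also have "\<dots> <= (\<Sum>m\<in>keys p. \<Sum>j<s. dg j m)" by (rule member_le_sum) (use that(1) in auto)
  finally show ?thesis by (simp add: B_def)
 qed
 define w where "w = (%m. \<Sum>j<s. B ^ j * dg j m)"
 have "EX e. mpoly_eval (graded_part w e p) a ~= 0"
 proof (rule ccontr)
  assume n: "\<not> ?thesis"
  have "mpoly_eval p a = (\<Sum>e\<in>w ` keys p. mpoly_eval (graded_part w e p) a)"
   by (subst sum_graded_part[of p w]) (rule mpoly_eval_sum)
  thus False using n a by simp
 qed
 then obtain e where e: "mpoly_eval (graded_part w e p) a ~= 0" by blast
 define q where "q = graded_part w e p"
 have qp: "q \<in> polys ?J" unfolding q_def by (rule graded_part_polys[OF p(1)])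
 have qm: "multihomogeneous n s q" unfolding multihomogeneous_def
 proof (intro allI impI)
  fix j assume j: "j < s"
  have eq: "dg j m = dg j m'" if "m \<in> keys q" "m' \<in> keys q" for m m'
   by (rule digits_unique[where B = B and s = s]) (use that B j in \<open>auto simp: q_def keys_graded_part w_def\<close>)
  have "\<forall>m\<in>keys q. dg j m = dg j (SOME m. m \<in> keys q)"
   by (intro ballI eq) (auto intro: someI)
  thus "EX e. \<forall>m\<in>keys q. (\<Sum>i\<le>n. lookup m (j, i)) = e"
   unfolding dg_def by (rule exI)
 qed
 define Z where "Z = {P \<in> point_tuples n s. \<forall>f\<in>{q}. ALL v. (\<forall>j<s. v j \<in> P j) --> mpoly_eval f (%(j, i). v j i) = 0}"
 have "multi_zariski_closed n s Z" unfolding multi_zariski_closed_def Z_def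
  by (intro exI[of _ "{q}"]) (use qp qm in auto)
 moreover have "Z ~= point_tuples n s"
 proof -
  let ?K = "insert (mpoly_eval q) ((%j u. u (j, 0)) ` {..<s})"
  have "EX x. \<forall>h\<in>?K. h x ~= 0"
  proof (rule polyfun_prod_neq_0[where f = "%h. h" and J = ?J])
   show "polyfun ?J h" if "h \<in> ?K" for h using that polyfun_mpoly_eval[OF qp] by (auto intro: polyfun_var)
   show "EX a. h a ~= 0" if "h \<in> ?K" for h
    using that e by (auto simp: q_def intro: exI[of _ "%_. 1"])
  qed simp
  then obtain x where x: "mpoly_eval q x ~= 0" "!!j. j < s ==> x (j, 0) ~= 0" by auto
  define v where "v = (%j i. if i <= n then x (j, i) else 0)"
  have v: "v j \<in> coord_space {..n}" "j < s ==> v j ~= 0" for j using x(2)[of j] by (auto simp: v_def coord_space_def fun_eq_iff)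
  define P where "P = (\<lambda>j\<in>{..<s}. ppoint_of (v j))"
  have "P \<in> point_tuples n s" unfolding P_def point_tuples_def proj_space_def
   using v by (auto intro: projectivization_mem)
  moreover have "mpoly_eval q (%(j, i). v j i) = mpoly_eval q x"
   by (rule polyfun_cong[OF polyfun_mpoly_eval[OF qp]]) (auto simp: v_def)
  moreover have "\<forall>j<s. v j \<in> P j" by (simp add: P_def ppoint_of_self)
  ultimately have "P \<notin> Z" unfolding Z_def using x(1) by auto
  thus ?thesis using \<open>P \<in> point_tuples n s\<close> by blast
 qed
 moreover have "Q P" if P: "P \<in> point_tuples n s - Z" for P
 proof -
  obtain v where v: "!!j. j < s ==> v j \<in> P j" "mpoly_eval q (%(j, i). v j i) ~= 0" using P unfolding Z_def by blast
  have Pj: "v j \<in> coord_space {..n} & v j ~= 0 & P j = ppoint_of (v j)" if "j < s" for j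
   by (rule proj_space_rep[OF _ v(1)[OF that]]) (use P that in \<open>auto simp: point_tuples_def\<close>)
  define u where "u = (%c j. vscale (c ^ (B ^ j)) (v j))"
  have "EX c. c ~= 0 & mpoly_eval p (%(j, i). u c j i) ~= 0"
  proof (rule ccontr)
   assume n: "\<not> ?thesis"
   have "mpoly_eval (graded_part w e p) (%(j, i). v j i) = 0"
   proof (rule graded_part_eval_eq_0[where \<phi> = "%c (j, i). u c j i"])
    fix m c assume m: "m \<in> keys p"
    hence k: "keys m \<subseteq> ?J" using p(1) by (auto simp: polys_def)
    have "monom_eval m (%(j, i). u c j i) = (\<Prod>(j,i)\<in>?J. (c ^ (B ^ j) * v j i) ^ lookup m (j, i))"
     using k by (subst monom_eval_superset[of ?J]) (auto simp: u_def vscale_apply intro!: prod.cong)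
    also have "\<dots> = (\<Prod>(j,i)\<in>?J. c ^ (B ^ j * lookup m (j, i))) * (\<Prod>(j,i)\<in>?J. v j i ^ lookup m (j, i))"
     by (simp add: case_prod_unfold power_mult_distrib prod.distrib power_mult)
    also have "(\<Prod>(j,i)\<in>?J. c ^ (B ^ j * lookup m (j, i))) = c ^ w m"
     unfolding w_def dg_def power_sum sum_distrib_left by (simp add: prod.cartesian_product)
    also have "(\<Prod>(j,i)\<in>?J. v j i ^ lookup m (j, i)) = monom_eval m (%(j, i). v j i)"
     using k by (subst monom_eval_superset[of ?J]) (auto intro!: prod.cong)
    finally show "monom_eval m (%(j, i). u c j i) = c ^ w m * monom_eval m (%(j, i). v j i)" .
   qed (use n in blast)
   thus False using v(2) by (simp add: q_def)
  qed
  then obtain c where c: "c ~= 0" "mpoly_eval p (%(j, i). u c j i) ~= 0" by blast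
  show "Q P"
  proof (rule Q[of "u c"])
   fix j assume "j < s"
   thus "u c j \<in> coord_space {..n} & u c j ~= 0 & P j = ppoint_of (u c j)"
    using Pj[of j] c(1) ppoint_of_vscale[of "c ^ (B ^ j)" "v j"] vec.subspace_scale[OF subspace_coord_space]
    by (auto simp: u_def)
  next
   fix h assume "h \<in> H"
   thus "h (%(j, i). u c j i) ~= 0" using c(2) H(1) unfolding p(2)[symmetric] by (auto simp: prod_zero_iff)
  qed
 qed
 ultimately show ?thesis unfolding for_generic_points_def by blast
qed

theorem theorem3p5:
  fixes k d s :: nat
  assumes "d \<ge> k + 2" and "s \<ge> 1"
  shows "for_generic_points 2 s
    (\<lambda>P :: nat \<Rightarrow> (nat, 'a::{alg_closed_field, field_char_0}) ppoint.
       let X = fat_points_ideal 2 (k + 1) s P;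
           T = fat_points_ideal 2 (k + 2) s P;
           degY = s * (((k + 2) choose 2) + 2)
       in secant_defective TYPE('a) s k 2 d \<longleftrightarrow>
            int (cohomology_dim 2 X d 1) > max 0 (int degY - int ((d + 2) choose 2)) \<or>
            int (cohomology_dim 2 T d 0) > max 0 (int ((d + 2) choose 2) - int degY))"
    (is "for_generic_points 2 s ?Q")
proof -
 have kd: "k < d" "k <= d" "Suc k <= d" and s: "0 < s" using assms by auto
 obtain t0 :: "'a params" where
  ymax: "!!t :: 'a params. vec.dim (range (dmap (secant_param 2 d k s) t)) <= vec.dim (range (dmap (secant_param 2 d k s) t0))"
  and y: "vec.dim (range (dmap (secant_param 2 d k s) t0)) = min (vec.dim (osc_join 2 d (Suc k) s (pt t0))) (vec.dim (osc_join 2 d k s (pt t0)) + 2 * s)"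
  and xmax: "!!t :: 'a params. vec.dim (osc_join 2 d k s (pt t)) <= vec.dim (osc_join 2 d k s (pt t0))"
  and tmax: "!!t :: 'a params. vec.dim (osc_join 2 d (Suc k) s (pt t)) <= vec.dim (osc_join 2 d (Suc k) s (pt t0))"
  and ne: "!!j i. j < s ==> i <= 2 ==> pt t0 j i ~= 0"
  using dim_tangent_max[OF kd(1), where s = s and ?'a = 'a] by blast
 define x where "x = vec.dim (osc_join 2 d k s (pt t0))"
 define t where "t = vec.dim (osc_join 2 d (Suc k) s (pt t0))"
 define A where "A = (k + 2) choose 2"
 define C where "C = (d + 2) choose 2"
 have ch: "1 <= (l + 2) choose 2" for l :: nat using zero_less_binomial[of 2 "l + 2"] by linarith
 have A: "card (exponents 2 k) = A" "A >= 1" and C: "card (exponents 2 d) = C" "C >= 1"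
  using card_exponents[of 2 k] card_exponents[of 2 d] ch[of k] ch[of d] unfolding A_def C_def by (simp_all only: add.commute[of 2])
 \<comment> \<open>Positive dimensions keep the subtraction of 1, which passes from cones to
   projective dimensions, from truncating.\<close>
 have pos: "1 <= vec.dim (osc_join 2 d l s (pt t0))" if l: "l <= d" for l
 proof -
  have "vec.dim (osc_space 2 d l (pt t0 0)) <= vec.dim (osc_join 2 d l s (pt t0))"
   by (rule dim_mono[OF _ osc_join_coord_space finite_exponents]) (use s in \<open>auto simp: osc_join_def\<close>)
  moreover have "vec.dim (osc_space 2 d l (pt t0 0)) = card (exponents 2 l)" by (rule dim_osc_space[of 0]) (use ne[OF s, of 0] l in auto)
  moreover have "card (exponents 2 l) >= 1" using card_exponents[of 2 l] ch[of l] by (simp only: add.commute[of 2])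
  ultimately show ?thesis by linarith
 qed
 have y1: "min t (x + 2 * s) >= 1" using pos[of "Suc k"] pos[of k] kd by (simp add: t_def x_def)
 have "zariski_dim (exponents 2 d) (secant_variety (exponents 2 d) s (veronese_osculating_variety k 2 d :: (nat \<Rightarrow>\<^sub>0 nat, 'a) ppoint set))
  = enat (min t (x + 2 * s) - 1)"
  by (rule zariski_dim_secant_variety[OF kd(1), where ?t0.0 = t0]) (use ymax y y1 in \<open>simp_all add: t_def x_def\<close>)
 hence defective: "secant_defective TYPE('a) s k 2 d \<longleftrightarrow> min t (x + 2 * s) - 1 < min (C - 1) (s * (2 + A - 1) + s - 1)"
  by (simp add: secant_defective_def A_def C_def add.commute)
 have xle: "x <= s * A"
 proof -
  have "osc_join 2 d k s (pt t0) \<subseteq> vec.span (\<Union>j<s. hrow 2 d (pt t0 j) ` exponents 2 k)"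
   unfolding osc_join_def osc_space_span by (intro UN_least vec.span_mono) blast
  hence "x <= card (\<Union>j<s. hrow 2 d (pt t0 j) ` exponents 2 k)" unfolding x_def by (rule vec.dim_le_card) simp
  also have "\<dots> <= (\<Sum>j<s. card (hrow 2 d (pt t0 j) ` exponents 2 k))" by (rule card_UN_le) simp
  also have "\<dots> <= (\<Sum>j<s. A)" unfolding A(1)[symmetric] by (intro sum_mono card_image_le) simp
  finally show ?thesis by simp
 qed
 have tle: "t <= C" unfolding t_def C(1)[symmetric] by (rule dim_coord_subset_le[OF osc_join_coord_space finite_exponents])
 \<comment> \<open>\<open>t0\<close> carries forms as well as points, whereas genericity concerns
   the points alone. The two maximal dimensions of joins are therefore expressed as open conditions
   on the coordinates of the points.\<close>
 let ?J = "{..<s} \<times> {..2::nat}" and ?v = "%(u :: nat \<times> nat => 'a) j i. u (j, i)"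
 let ?a = "%(j, i). pt t0 j i"
 have open_join: "EX g. polyfun ?J g & g ?a ~= 0 & (ALL u. g u ~= 0 --> vec.dim (osc_join 2 d l s (?v ?a)) <= vec.dim (osc_join 2 d l s (?v u)))" for l
 proof (rule dim_osc_join_open)
  fix j e b assume "j < s" "e \<in> exponents 2 d"
  thus "polyfun ?J (%u. hcoef 2 (?v u j) e b)"
   by (intro polyfun_compose[OF polyfun_hcoef, where \<phi> = "%u. ?v u j"]) (auto intro: polyfun_var dest: exponentsD)
 qed
 obtain g where g: "polyfun ?J g" "g ?a ~= 0" "!!u. g u ~= 0 ==> x <= vec.dim (osc_join 2 d k s (?v u))"
  using open_join[of k] unfolding x_def by auto
 obtain h where h: "polyfun ?J h" "h ?a ~= 0" "!!u. h u ~= 0 ==> t <= vec.dim (osc_join 2 d (Suc k) s (?v u))"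
  using open_join[of "Suc k"] unfolding t_def by auto
 \<comment> \<open>The points have to avoid the coordinate lines for the Laurent jets, and
   \<open>dets\<close> makes their projections from (0 : 0 : 1) distinct, so that the forms
   \<open>line_form\<close> separate them.\<close>
 define crd where "crd = (%(j, i) (u :: nat \<times> nat => 'a). u (j, i)) ` ?J"
 define dets where "dets = (%(j, l) (u :: nat \<times> nat => 'a). u (l, 1) * u (j, 0) - u (l, 0) * u (j, 1)) ` {(j, l) \<in> {..<s} \<times> {..<s}. j ~= l}"
 show ?thesis
 proof (rule for_generic_pointsI[where H = "{g, h} \<union> crd \<union> dets"])
  have "finite {(j, l) \<in> {..<s} \<times> {..<s}. j ~= l}" by (rule finite_subset[of _ "{..<s} \<times> {..<s}"]) auto
  thus "finite ({g, h} \<union> crd \<union> dets)" by (simp add: crd_def dets_def)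
  show "polyfun ?J f" if "f \<in> {g, h} \<union> crd \<union> dets" for f
   using that g(1) h(1) by (auto simp: crd_def dets_def intro!: polyfun_var polyfun_minus polyfun_mult)
  show "EX a. f a ~= 0" if "f \<in> {g, h} \<union> crd \<union> dets" for f
  proof -
   have "EX a. f a ~= 0" if "f \<in> crd"
   proof -
    have "f (%_. 1) ~= 0" using that by (auto simp: crd_def)
    thus ?thesis by blast
   qed
   moreover have "EX a. f a ~= 0" if "f \<in> dets"
   proof -
    obtain x where x: "f = (%(j, l) (u :: nat \<times> nat => 'a). u (l, 1) * u (j, 0) - u (l, 0) * u (j, 1)) x"
     "x \<in> {(j, l) \<in> {..<s} \<times> {..<s}. j ~= l}" using \<open>f \<in> dets\<close> unfolding dets_def by (rule imageE)
    obtain j l where jl': "x = (j, l)" by (cases x)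
    have jl: "j ~= l" "f = (%u. u (l, 1) * u (j, 0) - u (l, 0) * u (j, 1))" using x by (simp_all add: jl')
    have "f (%x. if x = (l, 1) \<or> x = (j, 0) then 1 else 0) ~= 0" using jl(1) by (simp add: jl(2))
    thus ?thesis by blast
   qed
   ultimately show ?thesis using that exI[of "%a. g a ~= 0", OF g(2)] exI[of "%a. h a ~= 0", OF h(2)] by (elim UnE insertE emptyE) simp_all
  qed
 next
  fix v :: "nat => nat => 'a" and P
  assume vP: "!!j. j < s ==> v j \<in> coord_space {..2} & v j ~= 0 & P j = ppoint_of (v j)"
   and gen: "!!f. f \<in> {g, h} \<union> crd \<union> dets ==> f (%(j, i). v j i) ~= 0"
  have v0: "v j i ~= 0" if "j < s" "i <= 2" for j i
  proof -
   have "(j, i) \<in> ?J" using that by simp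
   hence "(%u. u (j, i)) \<in> crd" unfolding crd_def by (rule rev_image_eqI) simp
   thus ?thesis using gen[of "%u. u (j, i)"] by auto
  qed
  have det: "v l 1 * v j 0 ~= v l 0 * v j 1" if "j < s" "l < s" "j ~= l" for j l
  proof -
   have "(j, l) \<in> {(j, l) \<in> {..<s} \<times> {..<s}. j ~= l}" using that by simp
   hence "(%u. u (l, 1) * u (j, 0) - u (l, 0) * u (j, 1)) \<in> dets" unfolding dets_def by (rule rev_image_eqI) simp
   thus ?thesis using gen[of "%u. u (l, 1) * u (j, 0) - u (l, 0) * u (j, 1)"] by auto
  qed
  \<comment> \<open>The joins depend on the points only, so zero forms complete v to a parameter
    value to which the maximality of \<open>t0\<close> applies.\<close>
  define t' :: "'a params" where "t' = (%(j, z). case z of Inl i => v j i | Inr _ => 0)"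
  have pt': "pt t' = v" by (auto simp: pt_def t'_def fun_eq_iff)
  have "g (%(j, i). v j i) ~= 0" "h (%(j, i). v j i) ~= 0" using gen by blast+
  from g(3)[OF this(1)] h(3)[OF this(2)]
  have "x <= vec.dim (osc_join 2 d k s v)" "t <= vec.dim (osc_join 2 d (Suc k) s v)" by simp_all
  hence dims: "vec.dim (osc_join 2 d k s v) = x" "vec.dim (osc_join 2 d (Suc k) s v) = t"
   using xmax[of t'] tmax[of t'] by (simp_all add: pt' x_def t_def)
  have sec: "sheaf_sections (fat_points_ideal 2 (Suc l) s P) d \<sigma> = lsections d l s v \<sigma>" if "\<sigma> \<subseteq> {..2}" for \<sigma> l
   by (rule sheaf_sections_eq[OF s _ v0 _ that]) (use vP in auto)
  have h1: "cohomology_dim 2 (fat_points_ideal 2 (k + 1) s P) d 1 = s * A - x"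
   using cohomology_dim_1[of "fat_points_ideal 2 (Suc k) s P" d k s v, OF sec v0 kd(2) det] by (simp add: dims A)
  have h0: "cohomology_dim 2 (fat_points_ideal 2 (k + 2) s P) d 0 = C - t"
   using cohomology_dim_0[of "fat_points_ideal 2 (Suc (Suc k)) s P" d "Suc k" s v, OF sec v0 kd(3)] by (simp add: dims C)
  define R where "R = s * A"
  have R: "s * (2 + A - 1) + s - 1 = R + 2 * s - 1" "s * (A + 2) = R + 2 * s"
   using A(2) s by (auto simp: R_def algebra_simps)
  \<comment> \<open>\<open>min t (x + 2 * s) < min C (R + 2 * s)\<close> holds iff one of the two
    entries on the left is below both on the right. For t this says that C - t exceeds 0 and C - (R
    + 2 s), which is (ii); for x + 2 s it says that R - x exceeds 0 and R + 2 s - C, which is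
    (i).\<close>
  show "?Q P"
   unfolding Let_def defective h1 h0 A_def[symmetric] C_def[symmetric] R R_def[symmetric]
   using y1 xle tle C(2) s unfolding R_def[symmetric] by (auto simp: of_nat_diff min_def max_def split: if_splits)
 qed
qed

end
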